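(* Let $\beta>1/2$, $\kappa=4/\beta\in(0,8)$, and let $F(r)=\sum_{n\in\mathbb N_0^3}A_nr^n$ be the rainbow series defined in the context. Let $\alpha=\{\{a_1,b_1\},\{a_2,b_2\},\{a_3,b_3\}\}\in\mathrm{LP}_3$ be a rainbow pattern. Put $H(r_1,r_2,r_3)=(r_1r_2r_3)^{2/\kappa}F(r_1,r_2,r_3)$ and, for $x\in\mathfrak X_6$, $$\mathcal Z_\alpha(x)=c_\alpha\prod_{j=1}^3|x_{a_j}-x_{b_j}|^{-2h}\,H\Big(C_{\{x_{a_1},x_{b_1}\},\{x_{a_2},x_{b_2}\}},C_{\{x_{a_2},x_{b_2}\},\{x_{a_3},x_{b_3}\}},C_{\{x_{a_3},x_{b_3}\},\{x_{a_1},x_{b_1}\}}\Big),$$ with $$c_\alpha:=\frac{\Gamma(2\beta)\Gamma(4\beta-1)}{\Gamma(3\beta)\Gamma(3\beta-1)}\left(\frac{\Gamma(\beta)\Gamma(3\beta-1)}{\Gamma(2\beta)\Gamma(2\beta-1)}\right)^2.$$ Then $\mathcal Z_\alpha$ is positive on $\mathfrak X_6$ and satisfies (PDE), (COV) and (ASY) with $N=3$. In particular, $\mathcal Z_\alpha$ has the defining properties of the pure partition function associated with $\alpha$ for $\kappa=4/\beta$.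
   Context: Notation. $[n]=\{1,\dots,n\}$, $\mathbb N_0=\{0,1,2,\dots\}$, $r^n=r_1^{n_1}r_2^{n_2}r_3^{n_3}$, $e_j$ is the $j$-th unit vector of $\mathbb Z^3$, $h=\frac{6-\kappa}{2\kappa}$. $\mathfrak X_{2N}=\{(x_1,\dots,x_{2N})\in\mathbb R^{2N}:x_j<x_k\text{ if }j<k\}$. $\mathbb H$ is the open upper half-plane. The rainbow arrays: $A,B:\mathbb N_0^3\to\mathbb R$, extended by $0$ to $\mathbb Z^3$, are the unique pair with $A_{(0,0,0)}=1$ such that for all $n\in\mathbb Z^3$ and all $\{j,k,\ell\}=\{1,2,3\}$, $$(n_\ell+1)(n_\ell+2\beta)A_{n+e_\ell}-(n_\ell+\beta)(n_\ell+1-\beta)A_n=B_n-B_{n-e_j}-B_{n-e_k}+B_{n-e_j-e_k},$$ $$(2n_jn_k+\beta n_j+\beta n_k-\beta n_\ell)A_n=B_{n-e_\ell}+B_{n-e_\ell-e_j-e_k}-B_{n-e_j}-B_{n-e_k}.$$ The series $F(r)=\sum_nA_nr^n$ converges absolutely on $[-1,1]^3$ when $\beta>1/2$. (PDE): for every $i\in[2N]$, $\Big[\tfrac\kappa2\partial_i^2+\sum_{j\in[2N]\setminus\{i\}}\big(\frac{2}{x_j-x_i}\partial_j-\frac{2h}{(x_j-x_i)^2}\big)\Big]\mathcal Z=0$ on $\mathfrak X_{2N}$ ($\mathcal Z$ smooth). (COV): for all Möbius maps $\varphi$ of $\mathbb H$ with $\varphi(x_1)<\cdots<\varphi(x_{2N})$,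 $\mathcal Z(x_1,\dots,x_{2N})=\prod_{i=1}^{2N}\varphi'(x_i)^h\cdot\mathcal Z(\varphi(x_1),\dots,\varphi(x_{2N}))$. Link patterns: $\mathrm{LP}_N$ is the set of partitions $\{\{a_1,b_1\},\dots,\{a_N,b_N\}\}$ of $[2N]$ into pairs with $(a_j-a_k)(a_j-b_k)(b_j-a_k)(b_j-b_k)>0$ for $j\ne k$. The rainbow patterns in $\mathrm{LP}_3$ are $\{\{1,6\},\{2,5\},\{3,4\}\}$, $\{\{1,4\},\{2,3\},\{5,6\}\}$, $\{\{1,2\},\{3,6\},\{4,5\}\}$. Unoriented cross-ratio: $C_{\{p_1,q_1\},\{p_2,q_2\}}:=\min\Big\{\frac{|p_1-p_2||q_1-q_2|}{|p_1-q_2||q_1-p_2|},\frac{|p_1-q_2||q_1-p_2|}{|p_1-p_2||q_1-q_2|}\Big\}$. $N=2$ pure partition functions: for $\alpha'=\{\{a_1,b_1\},\{a_2,b_2\}\}\in\mathrm{LP}_2$, $x\in\mathfrak X_4$, $C=C_{\{x_{a_1},x_{b_1}\},\{x_{a_2},x_{b_2}\}}$: $\mathcal Z_{\alpha'}(x)=\prod_{j=1}^2|x_{a_j}-x_{b_j}|^{-2h}\cdot\frac{C^{2/\kappa}\,{}_2F_1(1-\beta,\beta;2\beta;C)}{{}_2F_1(1-\beta,\beta;2\beta;1)}$. (ASY) for $N=3$: for all $j\in[5]$, $\xi\in\mathbb R$, with $x_1<\cdots<x_{j-1}<\xi<x_{j+2}<\cdots<x_6$ fixed and $x\in\mathfrak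 X_6$, $\lim_{x_j,x_{j+1}\to\xi}\mathcal Z_\alpha(x)/(x_{j+1}-x_j)^{-2h}$ equals $0$ if $\{j,j+1\}\notin\alpha$, and equals $\mathcal Z_{\alpha/\{j,j+1\}}(x/\{j,j+1\})$ if $\{j,j+1\}\in\alpha$, where $\alpha/\{j,j+1\}\in\mathrm{LP}_2$ is obtained by removing $\{j,j+1\}$ and relabeling in increasing order, and $x/\{j,j+1\}$ by removing $x_j,x_{j+1}$. Defining properties of the pure partition function of $\alpha$: positive solution of (PDE) and (COV) satisfying (ASY). *)

theory Defs
  imports "HOL-Analysis.Analysis" "HOL-Library.Disjoint_Sets"
begin

text \<open>A point of \<open>\<real>\<^sup>n\<close> is encoded as a function \<open>x :: nat \<Rightarrow> real\<close>, of which only the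
  coordinates \<open>x 1, \<dots>, x n\<close> matter. The topology on \<open>nat \<Rightarrow> real\<close> is the product topology, so for a
  function of finitely many coordinates continuity has its usual meaning.\<close>

definition h_exp :: "real \<Rightarrow> real" where
  "h_exp \<kappa> = (6 - \<kappa>) / (2 * \<kappa>)"

definition chamber :: "nat \<Rightarrow> (nat \<Rightarrow> real) set" where
  "chamber N = {x. \<forall>j\<in>{1..2*N}. \<forall>k\<in>{1..2*N}. j < k \<longrightarrow> x j < x k}"

definition ext0 :: "(nat^3 \<Rightarrow> real) \<Rightarrow> int^3 \<Rightarrow> real" where
  "ext0 A n = (if \<forall>i. 0 \<le> n $ i then A (\<chi> i. nat (n $ i)) else 0)"

abbreviation unit3 :: "3 \<Rightarrow> int^3" where
  "unit3 j \<equiv> axis j 1"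

definition rainbow_arrays :: "real \<Rightarrow> (nat^3 \<Rightarrow> real) \<Rightarrow> (nat^3 \<Rightarrow> real) \<Rightarrow> bool" where
  "rainbow_arrays \<beta> A B \<longleftrightarrow>
     A 0 = 1 \<and>
     (\<forall>n j k l. {j, k, l} = {1, 2, 3} \<longrightarrow>
        (of_int (n $ l) + 1) * (of_int (n $ l) + 2 * \<beta>) * ext0 A (n + unit3 l)
          - (of_int (n $ l) + \<beta>) * (of_int (n $ l) + 1 - \<beta>) * ext0 A n
        = ext0 B n - ext0 B (n - unit3 j) - ext0 B (n - unit3 k) + ext0 B (n - unit3 j - unit3 k)
      \<and> (2 * of_int (n $ j) * of_int (n $ k)
           + \<beta> * of_int (n $ j) + \<beta> * of_int (n $ k) - \<beta> * of_int (n $ l)) * ext0 A n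
        = ext0 B (n - unit3 l) + ext0 B (n - unit3 l - unit3 j - unit3 k)
          - ext0 B (n - unit3 j) - ext0 B (n - unit3 k))"

definition rainbow_F :: "(nat^3 \<Rightarrow> real) \<Rightarrow> real^3 \<Rightarrow> real" where
  "rainbow_F A r = (\<Sum>\<^sub>\<infinity>n\<in>UNIV. A n * (\<Prod>i\<in>UNIV. (r $ i) ^ (n $ i)))"

definition rainbow_H :: "real \<Rightarrow> (nat^3 \<Rightarrow> real) \<Rightarrow> real^3 \<Rightarrow> real" where
  "rainbow_H \<kappa> A r = (r $ 1 * r $ 2 * r $ 3) powr (2 / \<kappa>) * rainbow_F A r"

definition link_patterns :: "nat \<Rightarrow> nat set set set" where
  "link_patterns N = {\<alpha>. partition_on {1..2*N} \<alpha> \<and> (\<forall>p\<in>\<alpha>. card p = 2) \<and>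
     (\<forall>a b c d. {a, b} \<in> \<alpha> \<longrightarrow> {c, d} \<in> \<alpha> \<longrightarrow> {a, b} \<noteq> {c, d} \<longrightarrow>
        (int a - int c) * (int a - int d) * (int b - int c) * (int b - int d) > 0)}"

definition rainbow_patterns :: "nat set set set" where
  "rainbow_patterns =
     {{{1, 6}, {2, 5}, {3, 4}}, {{1, 4}, {2, 3}, {5, 6}}, {{1, 2}, {3, 6}, {4, 5}}}"

definition remove_link :: "nat \<Rightarrow> nat set set \<Rightarrow> nat set set" where
  "remove_link j \<alpha> = (\<lambda>p. (\<lambda>i. if i < j then i else i - 2) ` p) ` (\<alpha> - {{j, j + 1}})"

definition remove_points :: "nat \<Rightarrow> (nat \<Rightarrow> real) \<Rightarrow> nat \<Rightarrow> real" where
  "remove_points j x = (\<lambda>i. if i < j then x i else x (i + 2))"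

definition cross_ratio :: "real \<Rightarrow> real \<Rightarrow> real \<Rightarrow> real \<Rightarrow> real" where
  "cross_ratio p1 q1 p2 q2 =
     min ((\<bar>p1 - p2\<bar> * \<bar>q1 - q2\<bar>) / (\<bar>p1 - q2\<bar> * \<bar>q1 - p2\<bar>))
         ((\<bar>p1 - q2\<bar> * \<bar>q1 - p2\<bar>) / (\<bar>p1 - p2\<bar> * \<bar>q1 - q2\<bar>))"

definition hyp2F1 :: "real \<Rightarrow> real \<Rightarrow> real \<Rightarrow> real \<Rightarrow> real" where
  "hyp2F1 a b c z = eval_fps (fps_hypergeo [a, b] [c] 1) z"

text \<open>The pattern is given by a labelling of its links as \<open>{a j, b j}\<close>, \<open>j = 1, 2\<close>. The value
  does not depend on the choice of the labelling.\<close>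

definition pure_Z2 :: "real \<Rightarrow> (nat \<Rightarrow> nat) \<Rightarrow> (nat \<Rightarrow> nat) \<Rightarrow> (nat \<Rightarrow> real) \<Rightarrow> real" where
  "pure_Z2 \<kappa> a b x =
     (let \<beta> = 4 / \<kappa>; C = cross_ratio (x (a 1)) (x (b 1)) (x (a 2)) (x (b 2))
      in (\<Prod>j=1..2. \<bar>x (a j) - x (b j)\<bar> powr (- 2 * h_exp \<kappa>)) *
         (C powr (2 / \<kappa>) * hyp2F1 (1 - \<beta>) \<beta> (2 * \<beta>) C / hyp2F1 (1 - \<beta>) \<beta> (2 * \<beta>) 1))"

definition rainbow_const :: "real \<Rightarrow> real" where
  "rainbow_const \<beta> =
     (Gamma (2 * \<beta>) * Gamma (4 * \<beta> - 1)) / (Gamma (3 * \<beta>) * Gamma (3 * \<beta> - 1)) *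
     ((Gamma \<beta> * Gamma (3 * \<beta> - 1)) / (Gamma (2 * \<beta>) * Gamma (2 * \<beta> - 1)))\<^sup>2"

definition rainbow_Z ::
  "real \<Rightarrow> (nat^3 \<Rightarrow> real) \<Rightarrow> (nat \<Rightarrow> nat) \<Rightarrow> (nat \<Rightarrow> nat) \<Rightarrow> (nat \<Rightarrow> real) \<Rightarrow> real" where
  "rainbow_Z \<kappa> A a b x =
     (let C = (\<lambda>i j. cross_ratio (x (a i)) (x (b i)) (x (a j)) (x (b j)))
      in rainbow_const (4 / \<kappa>) * (\<Prod>j=1..3. \<bar>x (a j) - x (b j)\<bar> powr (- 2 * h_exp \<kappa>)) *
         rainbow_H \<kappa> A (vector [C 1 2, C 2 3, C 3 1]))"

definition partial :: "nat \<Rightarrow> ((nat \<Rightarrow> real) \<Rightarrow> real) \<Rightarrow> (nat \<Rightarrow> real) \<Rightarrow> real" where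
  "partial i f x = deriv (\<lambda>t. f (x(i := t))) (x i)"

text \<open>\<open>Ck_on k I S f\<close>: all iterated partial derivatives of \<open>f\<close> of order at most \<open>k\<close> in the
  coordinates from \<open>I\<close> exist and are continuous on \<open>S\<close>.\<close>

primrec Ck_on ::
  "nat \<Rightarrow> nat set \<Rightarrow> (nat \<Rightarrow> real) set \<Rightarrow> ((nat \<Rightarrow> real) \<Rightarrow> real) \<Rightarrow> bool" where
  "Ck_on 0 I S f \<longleftrightarrow> continuous_on S f"
| "Ck_on (Suc k) I S f \<longleftrightarrow> continuous_on S f \<and>
     (\<forall>i\<in>I. (\<forall>x\<in>S. (\<lambda>t. f (x(i := t))) field_differentiable at (x i)) \<and>
             Ck_on k I S (partial i f))"

definition PDE :: "real \<Rightarrow> nat \<Rightarrow> ((nat \<Rightarrow> real) \<Rightarrow> real) \<Rightarrow> bool" where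
  "PDE \<kappa> N Z \<longleftrightarrow>
     (\<forall>k. Ck_on k {1..2*N} (chamber N) Z) \<and>
     (\<forall>x\<in>chamber N. \<forall>i\<in>{1..2*N}.
        \<kappa> / 2 * partial i (partial i Z) x
        + (\<Sum>j\<in>{1..2*N} - {i}. 2 / (x j - x i) * partial j Z x
                               - 2 * h_exp \<kappa> / (x j - x i)\<^sup>2 * Z x) = 0)"

text \<open>The Moebius maps of the upper half-plane are \<open>z \<mapsto> (a z + b) / (c z + d)\<close> with real
  coefficients and \<open>a d - b c > 0\<close>. The condition \<open>c x\<^sub>i + d \<noteq> 0\<close> says that \<open>\<phi>(x\<^sub>i)\<close> is
  finite.\<close>

definition COV :: "real \<Rightarrow> nat \<Rightarrow> ((nat \<Rightarrow> real) \<Rightarrow> real) \<Rightarrow> bool" where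
  "COV \<kappa> N Z \<longleftrightarrow>
     (\<forall>x\<in>chamber N. \<forall>a b c d. \<forall>\<phi>.
        a * d - b * c > 0 \<longrightarrow> \<phi> = moebius a b c d \<longrightarrow>
        (\<forall>i\<in>{1..2*N}. c * x i + d \<noteq> 0) \<longrightarrow> \<phi> \<circ> x \<in> chamber N \<longrightarrow>
        Z x = (\<Prod>i=1..2*N. deriv \<phi> (x i) powr h_exp \<kappa>) * Z (\<phi> \<circ> x))"

definition ASY3 :: "real \<Rightarrow> nat set set \<Rightarrow> ((nat \<Rightarrow> real) \<Rightarrow> real) \<Rightarrow> bool" where
  "ASY3 \<kappa> \<alpha> Z \<longleftrightarrow>
     (\<forall>j\<in>{1..5}. \<forall>\<xi> x.
        (\<forall>i\<in>{1..6} - {j, j+1}. \<forall>k\<in>{1..6} - {j, j+1}. i < k \<longrightarrow> x i < x k) \<longrightarrow>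
        (\<forall>i\<in>{1..<j}. x i < \<xi>) \<longrightarrow> (\<forall>i\<in>{j+2..6}. \<xi> < x i) \<longrightarrow>
        (let y = (\<lambda>(s, t). x(j := s, j+1 := t));
             tends = (\<lambda>L. ((\<lambda>(s, t). Z (y (s, t)) / (t - s) powr (- 2 * h_exp \<kappa>)) \<longlongrightarrow> L)
                            (at (\<xi>, \<xi>) within {p. y p \<in> chamber 3}))
         in ({j, j+1} \<notin> \<alpha> \<longrightarrow> tends 0) \<and>
            ({j, j+1} \<in> \<alpha> \<longrightarrow>
              (\<forall>a b. remove_link j \<alpha> = {{a 1, b 1}, {a 2, b 2}} \<longrightarrow>
                 tends (pure_Z2 \<kappa> a b (remove_points j x))))))"

definition pure_partition_function3 ::
  "real \<Rightarrow> nat set set \<Rightarrow> ((nat \<Rightarrow> real) \<Rightarrow> real) \<Rightarrow> bool" where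
  "pure_partition_function3 \<kappa> \<alpha> Z \<longleftrightarrow>
     (\<forall>x\<in>chamber 3. Z x > 0) \<and> PDE \<kappa> 3 Z \<and> COV \<kappa> 3 Z \<and> ASY3 \<kappa> \<alpha> Z"

end

theory Submission imports Defs begin

text \<open>Let \<open>F\<close> and \<open>G\<close> be the generating functions of \<open>A\<close> and \<open>B\<close>. The recursions say
  \<open>D\<^sub>l F = (1 - r\<^sub>j) (1 - r\<^sub>k) G\<close> with the hypergeometric operator \<open>D\<close> of \<open>\<^sub>2F\<^sub>1(\<beta>, 1 - \<beta>; 2 \<beta>)\<close>, and
  \<open>\<theta>\<^sub>l (\<theta>\<^sub>j + \<theta>\<^sub>k + \<beta>) F = (r\<^sub>1 r\<^sub>2 r\<^sub>3 - r\<^sub>l) G\<close> with \<open>\<theta> = r \<partial>\<close>. In the points \<open>x\<close>, the BPZ operator applied to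
  the partition function becomes a combination of these left-hand sides, with coefficients for which
  \<open>G\<close> cancels; this is (PDE).

  An energy identity bounds the coefficients \<open>A\<close> polynomially, so that the equations hold
  in the open cube. Eliminating \<open>G\<close> between two of them gives a first order transport equation that
  determines the coefficient \<open>F\<^sub>k\<^sub>+\<^sub>1(y, z)\<close> of \<open>x\<^sup>k\<^sup>+\<^sup>1\<close> in \<open>F\<close> from \<open>F\<^sub>k\<close>. Its maximum principle bounds \<open>F\<^sub>k\<close> by
  the coefficients of \<open>\<^sub>2F\<^sub>1(\<beta>, 1 - \<beta>; 2 \<beta>)\<close> and shows that \<open>F(x, y, z)\<close> tends to \<open>h(1) g(x) g(z)\<close> as \<open>y \<rightarrow> 1\<close>,
  where \<open>g, h\<close> are \<open>\<^sub>2F\<^sub>1(\<beta>, 1 - \<beta>; c)\<close> with \<open>c = 2 \<beta>, 3 \<beta>\<close>. With Gauss' theorem this is (ASY).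

  For \<open>\<beta> \<le> 1\<close> all terms \<open>F\<^sub>k\<close> are nonnegative. For \<open>\<beta> > 1\<close> positivity is a maximum principle, with
  \<open>((1 - x) (1 - y) (1 - z))\<^sup>\<gamma>\<close>, \<open>\<gamma> = (2 \<beta> - 1) / 4\<close>, as a strict supersolution, applied first on
  edges, then on faces, and then to the BPZ operator itself.\<close>

section \<open>Power series in three variables\<close>

text \<open>The energy bound reaches only the open cube; the behaviour at its boundary comes from
  the transport equation \<open>c * f + q * (y * f_y + z * f_z) = R\<close>, where q is a multiple
  of (1 - y) (1 - z) / (1 - y z). Its field points out of every box with a corner at the origin, so
  a maximum principle holds without boundary data. As q vanishes at y = 1, the recursion in k
  degenerates there to that of the coefficients of g; hence the product limit.

  Merging two unlinked points sends a cross-ratio to 0 and leaves over the power 2 \<beta> - 1 > 0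
  of their distance. Merging the ends of a link sends two cross-ratios to 1, and the prefactor is 1
  / (h(1) g(1)^2).

  For \<beta> > 1 the factor \<beta> (1 - \<beta>) in the recursion of g is negative, so positivity
  is not visible termwise. The same sign helps the maximum principle: subtracting a constant
  \<delta> > 0 from F acts in the same direction as the supersolution. Edges come before faces and
  faces before the interior because each stage supplies the lower bound near the boundary of the
  next.\<close>

text \<open>Integer indices let shifts and recursions be written without boundary cases, the value 0
  off the nonnegative octant being the default. Polynomial growth gives absolute convergence in the
  open cube and survives the index weights that differentiation produces.\<close>

definition regular :: "(int \<Rightarrow> int \<Rightarrow> int \<Rightarrow> real) \<Rightarrow> bool" where
  "regular a \<longleftrightarrow> (\<forall>k m n. k < 0 \<or> m < 0 \<or> n < 0 \<longrightarrow> a k m n = 0) \<and>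
     (\<exists>C d. \<forall>k m n. \<bar>a k m n\<bar> \<le> C * (1 + \<bar>real_of_int k\<bar> + \<bar>real_of_int m\<bar> + \<bar>real_of_int n\<bar>) ^ d)"

definition pterm :: "(int \<Rightarrow> int \<Rightarrow> int \<Rightarrow> real) \<Rightarrow> real \<Rightarrow> real \<Rightarrow> real \<Rightarrow> nat \<times> nat \<times> nat \<Rightarrow> real" where
  "pterm a x y z = (\<lambda>(k, m, n). a (int k) (int m) (int n) * x ^ k * y ^ m * z ^ n)"

definition psum :: "(int \<Rightarrow> int \<Rightarrow> int \<Rightarrow> real) \<Rightarrow> real \<Rightarrow> real \<Rightarrow> real \<Rightarrow> real" where
  "psum a x y z = infsum (pterm a x y z) UNIV"

lemma regularI:
  assumes "\<And>k m n. k < 0 \<or> m < 0 \<or> n < 0 \<Longrightarrow> a k m n = 0"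
    and "\<And>k m n. 0 \<le> k \<Longrightarrow> 0 \<le> m \<Longrightarrow> 0 \<le> n \<Longrightarrow>
      \<bar>a k m n\<bar> \<le> C * (1 + real_of_int k + real_of_int m + real_of_int n) ^ d"
  shows "regular a"
proof -
  have C: "C \<ge> 0" using assms(2)[of 0 0 0] by simp
  show ?thesis unfolding regular_def
  proof (intro conjI exI[of _ C] exI[of _ d] allI)
    fix k m n
    show "\<bar>a k m n\<bar> \<le> C * (1 + \<bar>real_of_int k\<bar> + \<bar>real_of_int m\<bar> + \<bar>real_of_int n\<bar>) ^ d"
      using assms C by (cases "k < 0 \<or> m < 0 \<or> n < 0") auto
  qed (use assms in auto)
qed

lemma regularE:
  assumes "regular a"
  obtains C d where "C \<ge> 0"
    "\<And>k m n. \<bar>a k m n\<bar> \<le> C * (1 + \<bar>real_of_int k\<bar> + \<bar>real_of_int m\<bar> + \<bar>real_of_int n\<bar>) ^ d"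
proof -
  obtain C d where *: "\<And>k m n. \<bar>a k m n\<bar> \<le> C * (1 + \<bar>real_of_int k\<bar> + \<bar>real_of_int m\<bar> + \<bar>real_of_int n\<bar>) ^ d"
    using assms unfolding regular_def by blast
  have "C \<ge> 0" using *[of 0 0 0] by simp
  then show ?thesis using * that by blast
qed

lemma regular_zero: "regular a \<Longrightarrow> k < 0 \<or> m < 0 \<or> n < 0 \<Longrightarrow> a k m n = 0"
  by (auto simp: regular_def)

lemma regular_add:
  assumes "regular a" "regular b"
  shows "regular (\<lambda>k m n. a k m n + b k m n)"
proof -
  obtain C d where 1: "C \<ge> 0"
    "\<And>k m n. \<bar>a k m n\<bar> \<le> C * (1 + \<bar>real_of_int k\<bar> + \<bar>real_of_int m\<bar> + \<bar>real_of_int n\<bar>) ^ d"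
    using regularE[OF assms(1)] by blast
  obtain D e where 2: "D \<ge> 0"
    "\<And>k m n. \<bar>b k m n\<bar> \<le> D * (1 + \<bar>real_of_int k\<bar> + \<bar>real_of_int m\<bar> + \<bar>real_of_int n\<bar>) ^ e"
    using regularE[OF assms(2)] by blast
  show ?thesis
  proof (rule regularI[of _ "C + D" "max d e"])
    fix k m n :: int assume nn: "0 \<le> k" "0 \<le> m" "0 \<le> n"
    let ?s = "1 + real_of_int k + real_of_int m + real_of_int n"
    have "?s ^ d \<le> ?s ^ max d e" "?s ^ e \<le> ?s ^ max d e"
      using nn by (auto intro!: power_increasing)
    then have "C * ?s ^ d \<le> C * ?s ^ max d e" "D * ?s ^ e \<le> D * ?s ^ max d e"
      using 1(1) 2(1) by (auto intro!: mult_left_mono)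
    then show "\<bar>a k m n + b k m n\<bar> \<le> (C + D) * ?s ^ max d e"
      using 1(2)[of k m n] 2(2)[of k m n] nn by (simp add: algebra_simps)
  qed (use assms in \<open>auto simp: regular_zero\<close>)
qed

lemma regular_cmult:
  assumes "regular a" shows "regular (\<lambda>k m n. c * a k m n)"
proof -
  obtain C d where 1: "C \<ge> 0"
    "\<And>k m n. \<bar>a k m n\<bar> \<le> C * (1 + \<bar>real_of_int k\<bar> + \<bar>real_of_int m\<bar> + \<bar>real_of_int n\<bar>) ^ d"
    using regularE[OF assms(1)] by blast
  show ?thesis
  proof (rule regularI[of _ "\<bar>c\<bar> * C" d])
    fix k m n :: int assume nn: "0 \<le> k" "0 \<le> m" "0 \<le> n"
    have "\<bar>c\<bar> * \<bar>a k m n\<bar> \<le> \<bar>c\<bar> * (C * (1 + real_of_int k + real_of_int m + real_of_int n) ^ d)"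
      using 1(2)[of k m n] nn by (intro mult_left_mono) auto
    then show "\<bar>c * a k m n\<bar> \<le> \<bar>c\<bar> * C * (1 + real_of_int k + real_of_int m + real_of_int n) ^ d"
      by (simp add: abs_mult mult.assoc)
  qed (use assms in \<open>auto simp: regular_zero\<close>)
qed

lemma regular_diff:
  assumes "regular a" "regular b"
  shows "regular (\<lambda>k m n. a k m n - b k m n)"
  using regular_add[OF assms(1) regular_cmult[OF assms(2), of "-1"]] by simp

text \<open>Facts about the second and third index are deduced from those about the first through
  this transposition and the next one.\<close>

lemma regular_swap12:
  assumes "regular a" shows "regular (\<lambda>k m n. a m k n)"
proof -
  obtain C d where 1: "C \<ge> 0"
    "\<And>k m n. \<bar>a k m n\<bar> \<le> C * (1 + \<bar>real_of_int k\<bar> + \<bar>real_of_int m\<bar> + \<bar>real_of_int n\<bar>) ^ d"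
    using regularE[OF assms(1)] by blast
  show ?thesis
  proof (rule regularI[of _ C d])
    fix k m n :: int assume nn: "0 \<le> k" "0 \<le> m" "0 \<le> n"
    then show "\<bar>a m k n\<bar> \<le> C * (1 + real_of_int k + real_of_int m + real_of_int n) ^ d"
      using 1(2)[of m k n] by (simp add: add_ac)
  qed (use assms in \<open>auto simp: regular_zero\<close>)
qed

lemma regular_swap23:
  assumes "regular a" shows "regular (\<lambda>k m n. a k n m)"
proof -
  obtain C d where 1: "C \<ge> 0"
    "\<And>k m n. \<bar>a k m n\<bar> \<le> C * (1 + \<bar>real_of_int k\<bar> + \<bar>real_of_int m\<bar> + \<bar>real_of_int n\<bar>) ^ d"
    using regularE[OF assms(1)] by blast
  show ?thesis
  proof (rule regularI[of _ C d])
    fix k m n :: int assume nn: "0 \<le> k" "0 \<le> m" "0 \<le> n"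
    then show "\<bar>a k n m\<bar> \<le> C * (1 + real_of_int k + real_of_int m + real_of_int n) ^ d"
      using 1(2)[of k n m] by (simp add: add_ac)
  qed (use assms in \<open>auto simp: regular_zero\<close>)
qed

lemma regular_shift:
  assumes "regular a" shows "regular (\<lambda>k m n. a (k - 1) m n)"
proof -
  obtain C d where 1: "C \<ge> 0"
    "\<And>k m n. \<bar>a k m n\<bar> \<le> C * (1 + \<bar>real_of_int k\<bar> + \<bar>real_of_int m\<bar> + \<bar>real_of_int n\<bar>) ^ d"
    using regularE[OF assms(1)] by blast
  show ?thesis
  proof (rule regularI[of _ C d])
    fix k m n :: int assume nn: "0 \<le> k" "0 \<le> m" "0 \<le> n"
    show "\<bar>a (k - 1) m n\<bar> \<le> C * (1 + real_of_int k + real_of_int m + real_of_int n) ^ d"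
    proof (cases "k = 0")
      case True
      then show ?thesis using 1(1) nn assms by (simp add: regular_zero)
    next
      case False
      have "C * (1 + \<bar>real_of_int (k - 1)\<bar> + \<bar>real_of_int m\<bar> + \<bar>real_of_int n\<bar>) ^ d
          \<le> C * (1 + real_of_int k + real_of_int m + real_of_int n) ^ d"
        using nn False 1(1) by (intro mult_left_mono power_mono) auto
      then show ?thesis using 1(2)[of "k - 1" m n] by linarith
    qed
  qed (use assms in \<open>auto simp: regular_zero\<close>)
qed

definition pderiv1 :: "(int \<Rightarrow> int \<Rightarrow> int \<Rightarrow> real) \<Rightarrow> int \<Rightarrow> int \<Rightarrow> int \<Rightarrow> real" where
  "pderiv1 a = (\<lambda>k m n. (of_int k + 1) * a (k + 1) m n)"

lemma regular_weight:
  assumes "regular a" shows "regular (\<lambda>k m n. of_int k * a k m n)"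
proof -
  obtain C d where 1: "C \<ge> 0"
    "\<And>k m n. \<bar>a k m n\<bar> \<le> C * (1 + \<bar>real_of_int k\<bar> + \<bar>real_of_int m\<bar> + \<bar>real_of_int n\<bar>) ^ d"
    using regularE[OF assms(1)] by blast
  show ?thesis
  proof (rule regularI[of _ C "Suc d"])
    fix k m n :: int assume nn: "0 \<le> k" "0 \<le> m" "0 \<le> n"
    have "\<bar>of_int k * a k m n\<bar> = of_int k * \<bar>a k m n\<bar>" using nn by (simp add: abs_mult)
    also have "\<dots> \<le> (1 + real_of_int k + real_of_int m + real_of_int n) *
        (C * (1 + \<bar>real_of_int k\<bar> + \<bar>real_of_int m\<bar> + \<bar>real_of_int n\<bar>) ^ d)"
      using nn 1(1) by (intro mult_mono 1(2)) auto
    finally show "\<bar>of_int k * a k m n\<bar> \<le> C * (1 + real_of_int k + real_of_int m + real_of_int n) ^ Suc d"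
      using nn by (simp add: mult_ac)
  qed (use assms in \<open>auto simp: regular_zero\<close>)
qed

lemma regular_pderiv1:
  assumes "regular a" shows "regular (pderiv1 a)"
proof -
  obtain C d where 1: "C \<ge> 0"
    "\<And>k m n. \<bar>of_int k * a k m n\<bar> \<le> C * (1 + \<bar>real_of_int k\<bar> + \<bar>real_of_int m\<bar> + \<bar>real_of_int n\<bar>) ^ d"
    using regularE[OF regular_weight[OF assms]] by blast
  show ?thesis
  proof (rule regularI[of _ "C * 2 ^ d" d])
    fix k m n :: int assume nn: "0 \<le> k" "0 \<le> m" "0 \<le> n"
    have "\<bar>pderiv1 a k m n\<bar> \<le> C * (1 + \<bar>real_of_int (k + 1)\<bar> + \<bar>real_of_int m\<bar> + \<bar>real_of_int n\<bar>) ^ d"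
      using 1(2)[of "k + 1" m n] by (simp add: pderiv1_def)
    also have "\<dots> \<le> C * (2 * (1 + real_of_int k + real_of_int m + real_of_int n)) ^ d"
      using nn 1 by (intro mult_left_mono power_mono) auto
    also have "\<dots> = C * 2 ^ d * (1 + real_of_int k + real_of_int m + real_of_int n) ^ d"
      by (simp only: power_mult_distrib mult.assoc)
    finally show "\<bar>pderiv1 a k m n\<bar> \<le> C * 2 ^ d * (1 + real_of_int k + real_of_int m + real_of_int n) ^ d" .
  next
    fix k m n :: int assume "k < 0 \<or> m < 0 \<or> n < 0"
    \<comment> \<open>For \<open>k = -1\<close> the value of \<open>a\<close> at first index 0 need
      not vanish; the factor \<open>k + 1\<close> does.\<close>
    then show "pderiv1 a k m n = 0" using assms
      by (cases "k = -1") (auto simp: pderiv1_def regular_zero)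
  qed
qed

section \<open>Absolute convergence in the open cube\<close>

text \<open>Induction on \<open>d\<close>: differentiating a power series multiplies its
  coefficients by the index, so convergence for the exponent \<open>d\<close> yields convergence for
  \<open>d + 1\<close>.\<close>

lemma summable_poly_power:
  fixes r :: real assumes "\<bar>r\<bar> < 1" shows "summable (\<lambda>k. (1 + real k) ^ d * r ^ k)"
  using assms
proof (induction d arbitrary: r)
  case 0 then show ?case by (simp add: summable_geometric)
next
  case (Suc d)
  have *: "summable (\<lambda>n. diffs (\<lambda>k. (1 + real k) ^ d) n * \<bar>r\<bar> ^ n)"
    by (rule termdiff_converges[of _ 1]) (use Suc in auto)
  show ?case
  proof (rule summable_comparison_test'[OF *])
    fix n
    have "norm ((1 + real n) ^ Suc d * r ^ n) = (1 + real n) * ((1 + real n) ^ d * \<bar>r\<bar> ^ n)"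
      by (simp add: abs_mult power_abs)
    also have "\<dots> \<le> (1 + real n) * ((1 + real (Suc n)) ^ d * \<bar>r\<bar> ^ n)"
      by (intro mult_left_mono mult_right_mono power_mono) auto
    finally show "norm ((1 + real n) ^ Suc d * r ^ n) \<le> diffs (\<lambda>k. (1 + real k) ^ d) n * \<bar>r\<bar> ^ n"
      by (simp add: diffs_def mult_ac)
  qed
qed

lemma summable_on_triple:
  fixes f g h :: "nat \<Rightarrow> real"
  assumes "summable (\<lambda>k. \<bar>f k\<bar>)" "summable (\<lambda>k. \<bar>g k\<bar>)" "summable (\<lambda>k. \<bar>h k\<bar>)"
  shows "(\<lambda>p. norm (case p of (k, m, n) \<Rightarrow> f k * g m * h n)) summable_on UNIV"
proof -
  have s: "(\<lambda>k. norm (u k)) summable_on UNIV" if "summable (\<lambda>k. \<bar>u k\<bar>)" for u :: "nat \<Rightarrow> real"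
    using that by (intro norm_summable_imp_summable_on) auto
  have pr: "(\<lambda>p. norm (case p of (m, n) \<Rightarrow> u m * v n)) summable_on UNIV"
    if "(\<lambda>k. norm (u k)) summable_on UNIV" "(\<lambda>k. norm (v k)) summable_on UNIV"
    for u :: "nat \<Rightarrow> real" and v :: "'b \<Rightarrow> real"
  proof -
    have "(\<lambda>p. norm (case p of (m, n) \<Rightarrow> u m * v n)) summable_on (SIGMA m:UNIV. UNIV)"
      unfolding Infinite_Sum.abs_summable_on_Sigma_iff
    proof (intro conjI ballI)
      show "(\<lambda>y. norm (case (x, y) of (m, n) \<Rightarrow> u m * v n)) summable_on UNIV" for x
        using summable_on_cmult_right[OF that(2), of "norm (u x)"] by (simp add: abs_mult)
      have "(\<lambda>x. norm (infsum (\<lambda>y. norm (case (x, y) of (m, n) \<Rightarrow> u m * v n)) UNIV)) =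
          (\<lambda>x. norm (u x) * \<bar>infsum (\<lambda>y. norm (v y)) UNIV\<bar>)"
        by (simp add: abs_mult infsum_cmult_right')
      then show "(\<lambda>x. norm (infsum (\<lambda>y. norm (case (x, y) of (m, n) \<Rightarrow> u m * v n)) UNIV)) summable_on UNIV"
        using summable_on_cmult_left[OF that(1)] by simp
    qed
    then show ?thesis by simp
  qed
  have "(\<lambda>q. norm (case q of (k, p) \<Rightarrow> f k * (case p of (m, n) \<Rightarrow> g m * h n))) summable_on UNIV"
    by (rule pr[OF s[OF assms(1)] pr[OF s[OF assms(2)] s[OF assms(3)]]])
  then show ?thesis by (simp add: case_prod_unfold mult.assoc)
qed

lemma pterm_summable:
  assumes "regular a" "\<bar>x\<bar> < 1" "\<bar>y\<bar> < 1" "\<bar>z\<bar> < 1"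
  shows "(\<lambda>p. norm (pterm a x y z p)) summable_on UNIV"
proof -
  obtain C d where 1: "C \<ge> 0"
    "\<And>k m n. \<bar>a k m n\<bar> \<le> C * (1 + \<bar>real_of_int k\<bar> + \<bar>real_of_int m\<bar> + \<bar>real_of_int n\<bar>) ^ d"
    using regularE[OF assms(1)] by blast
  let ?u = "\<lambda>r k. (1 + real k) ^ d * \<bar>r\<bar> ^ k"
  have "summable (\<lambda>k. \<bar>?u r k\<bar>)" if "\<bar>r\<bar> < 1" for r :: real
    using summable_poly_power[of "\<bar>r\<bar>" d] that by (simp add: abs_mult)
  note u = this
  have "(\<lambda>p. norm (case p of (k, m, n) \<Rightarrow> (C * ?u x k) * ?u y m * ?u z n)) summable_on UNIV"
    by (rule summable_on_triple)
      (use u[OF assms(2)] u[OF assms(3)] u[OF assms(4)] summable_mult[OF u[OF assms(2)], of "\<bar>C\<bar>"] in \<open>simp_all add: abs_mult\<close>)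
  then show ?thesis
  proof (rule Infinite_Sum.abs_summable_on_comparison_test)
    fix p :: "nat \<times> nat \<times> nat"
    obtain k m n where p: "p = (k, m, n)" by (cases p)
    \<comment> \<open>This product bound separates the indices, so the triple series is dominated by
      a product of three one-variable series.\<close>
    have "1 + real k + real m + real n \<le> (1 + real k) * (1 + real m) * (1 + real n)"
      by (simp add: algebra_simps)
    then have "(1 + real k + real m + real n) ^ d \<le> ((1 + real k) * (1 + real m) * (1 + real n)) ^ d"
      by (intro power_mono) auto
    then have "C * (1 + real k + real m + real n) ^ d \<le> C * ((1 + real k) * (1 + real m) * (1 + real n)) ^ d"
      using 1(1) by (rule mult_left_mono)
    then have "\<bar>a (int k) (int m) (int n)\<bar> \<le> C * ((1 + real k) * (1 + real m) * (1 + real n)) ^ d"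
      using 1(2)[of "int k" "int m" "int n"] by simp
    then have "\<bar>a (int k) (int m) (int n)\<bar> * (\<bar>x\<bar> ^ k * \<bar>y\<bar> ^ m * \<bar>z\<bar> ^ n)
       \<le> C * ((1 + real k) * (1 + real m) * (1 + real n)) ^ d * (\<bar>x\<bar> ^ k * \<bar>y\<bar> ^ m * \<bar>z\<bar> ^ n)"
      by (rule mult_right_mono) auto
    then show "norm (pterm a x y z p) \<le> norm (case p of (k, m, n) \<Rightarrow> (C * ?u x k) * ?u y m * ?u z n)"
      using 1(1) by (simp add: p pterm_def abs_mult power_abs power_mult_distrib mult_ac)
  qed
qed

lemma pterm_summable_on:
  assumes "regular a" "\<bar>x\<bar> < 1" "\<bar>y\<bar> < 1" "\<bar>z\<bar> < 1"
  shows "pterm a x y z summable_on UNIV"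
  using pterm_summable[OF assms] abs_summable_summable by blast

lemma psum_add:
  assumes "regular a" "regular b" "\<bar>x\<bar> < 1" "\<bar>y\<bar> < 1" "\<bar>z\<bar> < 1"
  shows "psum (\<lambda>k m n. a k m n + b k m n) x y z = psum a x y z + psum b x y z"
  unfolding psum_def
proof -
  have "pterm (\<lambda>k m n. a k m n + b k m n) x y z = (\<lambda>p. pterm a x y z p + pterm b x y z p)"
    by (auto simp add: fun_eq_iff pterm_def algebra_simps)
  then show "infsum (pterm (\<lambda>k m n. a k m n + b k m n) x y z) UNIV = infsum (pterm a x y z) UNIV + infsum (pterm b x y z) UNIV"
    using infsum_add[OF pterm_summable_on[OF assms(1,3-5)] pterm_summable_on[OF assms(2-5)]] by simp
qed

lemma psum_cmult: "psum (\<lambda>k m n. c * a k m n) x y z = c * psum a x y z"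
  unfolding psum_def
proof -
  have "pterm (\<lambda>k m n. c * a k m n) x y z = (\<lambda>p. c * pterm a x y z p)"
    by (auto simp add: fun_eq_iff pterm_def)
  then show "infsum (pterm (\<lambda>k m n. c * a k m n) x y z) UNIV = c * infsum (pterm a x y z) UNIV"
    by (simp add: infsum_cmult_right')
qed

lemma psum_diff:
  assumes "regular a" "regular b" "\<bar>x\<bar> < 1" "\<bar>y\<bar> < 1" "\<bar>z\<bar> < 1"
  shows "psum (\<lambda>k m n. a k m n - b k m n) x y z = psum a x y z - psum b x y z"
  using psum_add[OF assms(1) regular_cmult[OF assms(2), of "-1"] assms(3-5)]
    psum_cmult[of "-1" b] by simp

lemma psum_swap12: "psum (\<lambda>k m n. a m k n) x y z = psum a y x z"
  unfolding psum_def
  by (rule infsum_reindex_bij_witness[of _ "\<lambda>(k, m, n). (m, k, n)" "\<lambda>(k, m, n). (m, k, n)"])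
    (auto simp: pterm_def)

lemma psum_swap23: "psum (\<lambda>k m n. a k n m) x y z = psum a x z y"
  unfolding psum_def
  by (rule infsum_reindex_bij_witness[of _ "\<lambda>(k, m, n). (k, n, m)" "\<lambda>(k, m, n). (k, n, m)"])
    (auto simp: pterm_def)

lemma psum_shift:
  assumes "regular a"
  shows "psum (\<lambda>k m n. a (k - 1) m n) x y z = x * psum a x y z"
proof -
  have "psum (\<lambda>k m n. a (k - 1) m n) x y z = infsum (pterm (\<lambda>k m n. a (k - 1) m n) x y z) (range (\<lambda>(k, m, n). (Suc k, m, n)))"
    unfolding psum_def
  proof (rule infsum_cong_neutral)
    fix p :: "nat \<times> nat \<times> nat"
    assume "p \<in> UNIV - range (\<lambda>(k, m, n). (Suc k, m, n))"
    then have "fst p = 0" by (cases p; cases "fst p") (auto simp: image_iff)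
    then show "pterm (\<lambda>k m n. a (k - 1) m n) x y z p = 0"
      using regular_zero[OF assms] by (cases p) (auto simp: pterm_def)
  qed auto
  also have "\<dots> = infsum (\<lambda>p. x * pterm a x y z p) UNIV"
    by (subst infsum_reindex) (auto simp: inj_on_def pterm_def o_def intro!: infsum_cong)
  finally show ?thesis by (simp add: infsum_cmult_right' psum_def)
qed

lemma infsum_nat_suminf:
  fixes f :: "nat \<Rightarrow> real" assumes "f summable_on UNIV" shows "infsum f UNIV = suminf f"
  using has_sum_imp_sums[OF has_sum_infsum[OF assms]] sums_unique by blast

section \<open>Slices in the first variable and termwise differentiation\<close>

text \<open>Fubini for the absolutely convergent triple series; calculus in the first variable
  thereby reduces to ordinary power series.\<close>

lemma psum_slices:
  assumes "regular a" "\<bar>x\<bar> < 1" "\<bar>y\<bar> < 1" "\<bar>z\<bar> < 1"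
  defines "S \<equiv> \<lambda>k. infsum (\<lambda>(m, n). a (int k) (int m) (int n) * y ^ m * z ^ n) UNIV"
  shows "psum a x y z = (\<Sum>k. S k * x ^ k)" "summable (\<lambda>k. S k * x ^ k)"
proof -
  have "pterm a x y z = (\<lambda>(k, p). x ^ k * (case p of (m, n) \<Rightarrow> a (int k) (int m) (int n) * y ^ m * z ^ n))"
    by (auto simp: pterm_def)
  then have s: "(\<lambda>(k, p). x ^ k * (case p of (m, n) \<Rightarrow> a (int k) (int m) (int n) * y ^ m * z ^ n)) summable_on (SIGMA k:UNIV. UNIV)"
    and e: "psum a x y z = infsum (\<lambda>(k, p). x ^ k * (case p of (m, n) \<Rightarrow> a (int k) (int m) (int n) * y ^ m * z ^ n)) (SIGMA k:UNIV. UNIV)"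
    using pterm_summable_on[OF assms(1-4)] by (auto simp: psum_def)
  have "(\<lambda>k. infsum (\<lambda>p. x ^ k * (case p of (m, n) \<Rightarrow> a (int k) (int m) (int n) * y ^ m * z ^ n)) UNIV) = (\<lambda>k. S k * x ^ k)"
    by (auto simp: S_def infsum_cmult_right' mult.commute)
  then have "psum a x y z = infsum (\<lambda>k. S k * x ^ k) UNIV" and t: "(\<lambda>k. S k * x ^ k) summable_on UNIV"
    using infsum_Sigma'_banach[OF s] summable_on_Sigma_banach[OF s] e by auto
  then show "psum a x y z = (\<Sum>k. S k * x ^ k)" "summable (\<lambda>k. S k * x ^ k)"
    by (auto simp: infsum_nat_suminf summable_on_imp_summable)
qed

text \<open>The \<open>k\<close>-th coefficient in the first variable is stored again as a
  three-variable array, concentrated at first index 0, so that all results on \<open>psum\<close>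
  apply to it. Its sum does not depend on the first argument, for which 0 is used below.\<close>

definition slice1 :: "nat \<Rightarrow> (int \<Rightarrow> int \<Rightarrow> int \<Rightarrow> real) \<Rightarrow> int \<Rightarrow> int \<Rightarrow> int \<Rightarrow> real" where
  "slice1 k a = (\<lambda>i m n. if i = 0 then a (int k) m n else 0)"

lemma regular_slice1: assumes "regular a" shows "regular (slice1 k a)"
proof -
  obtain C d where 1: "C \<ge> 0"
    "\<And>k m n. \<bar>a k m n\<bar> \<le> C * (1 + \<bar>real_of_int k\<bar> + \<bar>real_of_int m\<bar> + \<bar>real_of_int n\<bar>) ^ d"
    using regularE[OF assms(1)] by blast
  show ?thesis
  proof (rule regularI[of _ "C * (1 + real k) ^ d" d])
    fix i m n :: int assume nn: "0 \<le> i" "0 \<le> m" "0 \<le> n"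
    have "\<bar>a (int k) m n\<bar> \<le> C * (1 + real k + real_of_int m + real_of_int n) ^ d"
      using 1(2)[of "int k" m n] nn by simp
    also have "\<dots> \<le> C * ((1 + real k) * (1 + real_of_int i + real_of_int m + real_of_int n)) ^ d"
      using nn 1(1) by (intro mult_left_mono power_mono) (auto simp: algebra_simps)
    finally show "\<bar>slice1 k a i m n\<bar> \<le> C * (1 + real k) ^ d * (1 + real_of_int i + real_of_int m + real_of_int n) ^ d"
      using nn 1(1) unfolding power_mult_distrib by (auto simp: slice1_def mult.assoc)
  qed (use assms in \<open>auto simp: slice1_def regular_zero\<close>)
qed

lemma psum_slice1: "psum (slice1 k a) x y z = infsum (\<lambda>(m, n). a (int k) (int m) (int n) * y ^ m * z ^ n) UNIV"
proof -
  have "psum (slice1 k a) x y z = infsum (pterm (slice1 k a) x y z) (range (\<lambda>(m, n). (0, m, n)))"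
    unfolding psum_def by (rule infsum_cong_neutral) (auto simp: pterm_def slice1_def)
  also have "\<dots> = infsum (\<lambda>(m, n). a (int k) (int m) (int n) * y ^ m * z ^ n) UNIV"
    by (subst infsum_reindex) (auto simp: inj_on_def pterm_def slice1_def o_def intro!: infsum_cong)
  finally show ?thesis .
qed

lemma psum_power_series:
  assumes "regular a" "\<bar>x\<bar> < 1" "\<bar>y\<bar> < 1" "\<bar>z\<bar> < 1"
  shows "(\<lambda>k. psum (slice1 k a) 0 y z * x ^ k) sums psum a x y z"
  using psum_slices[OF assms] by (simp add: psum_slice1 summable_sums)

lemma psum_slice1_pderiv1:
  "psum (slice1 k (pderiv1 a)) 0 y z = (real k + 1) * psum (slice1 (Suc k) a) 0 y z"
proof -
  have "slice1 k (pderiv1 a) = (\<lambda>i m n. (real k + 1) * slice1 (Suc k) a i m n)"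
    by (auto simp: slice1_def pderiv1_def fun_eq_iff add.commute)
  then show ?thesis by (simp add: psum_cmult)
qed

lemma psum_has_derivative1:
  assumes "regular a" "\<bar>x\<bar> < 1" "\<bar>y\<bar> < 1" "\<bar>z\<bar> < 1"
  shows "((\<lambda>t. psum a t y z) has_real_derivative psum (pderiv1 a) x y z) (at x)"
proof -
  let ?S = "\<lambda>k. psum (slice1 k a) 0 y z"
  obtain K where K: "\<bar>x\<bar> < K" "K < 1" using assms(2) dense by blast
  have d: "((\<lambda>t. \<Sum>k. ?S k * t ^ k) has_real_derivative (\<Sum>k. diffs ?S k * x ^ k)) (at x)"
    by (rule termdiffs_strong[of _ K])
      (use K sums_summable[OF psum_power_series[OF assms(1) _ assms(3,4), of K]] in auto)
  have e: "(\<Sum>k. diffs ?S k * x ^ k) = psum (pderiv1 a) x y z"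
    using sums_unique[OF psum_power_series[OF regular_pderiv1[OF assms(1)] assms(2-4)]]
    by (simp add: psum_slice1_pderiv1 diffs_def add.commute)
  have ev: "\<forall>\<^sub>F t in nhds x. (\<Sum>k. ?S k * t ^ k) = psum a t y z"
  proof (rule eventually_mono)
    show "\<forall>\<^sub>F t in nhds x. t \<in> {-1<..<1}"
      using assms(2) by (intro eventually_nhds_in_open) auto
    show "(\<Sum>k. ?S k * t ^ k) = psum a t y z" if "t \<in> {-1<..<1}" for t
      using sums_unique[OF psum_power_series[OF assms(1) _ assms(3,4), of t]] that by auto
  qed
  show ?thesis by (rule DERIV_cong_ev[OF refl ev e, THEN iffD1, OF d])
qed

section \<open>The hypergeometric series\<close>

text \<open>The numerator parameters \<beta> and 1 - \<beta> add up to 1, so the decay of these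
  coefficients is governed by \<gamma> alone.\<close>

definition hcoef :: "real \<Rightarrow> real \<Rightarrow> nat \<Rightarrow> real" where
  "hcoef \<beta> \<gamma> n = pochhammer \<beta> n * pochhammer (1 - \<beta>) n / (pochhammer \<gamma> n * fact n)"

lemma hcoef_0 [simp]: "hcoef \<beta> \<gamma> 0 = 1"
  by (simp add: hcoef_def)

lemma hcoef_Suc:
  "hcoef \<beta> \<gamma> (Suc n) =
     (real n + \<beta>) * (real n + 1 - \<beta>) / ((real n + \<gamma>) * (real n + 1)) * hcoef \<beta> \<gamma> n"
  by (simp add: hcoef_def pochhammer_Suc divide_simps) (simp add: algebra_simps)

lemma rGamma_series_powr:
  fixes z :: real assumes "n > 0"
  shows "pochhammer z (Suc n) = rGamma_series z n * fact n * real n powr z"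
  using assms by (simp add: rGamma_series_def powr_def)

text \<open>By Euler's limit each Pochhammer symbol is an \<open>rGamma_series\<close> times a
  factorial times a power of \<open>n\<close>. The quotient of the \<open>rGamma_series\<close>
  converges, hence is bounded, and the powers combine to at most
  \<open>n powr (- \<gamma>)\<close>.\<close>

lemma hcoef_bound:
  assumes "\<gamma> > 0"
  obtains C where "C > 0" "\<And>n. \<bar>hcoef \<beta> \<gamma> n\<bar> \<le> C * (1 + real n) powr (- \<gamma>)"
proof -
  let ?q = "\<lambda>n. rGamma_series \<beta> n * rGamma_series (1 - \<beta>) n / rGamma_series \<gamma> n"
  have "rGamma \<gamma> \<noteq> 0" using assms by (auto simp: rGamma_eq_zero_iff elim!: nonpos_Ints_cases)
  then have "?q \<longlonglongrightarrow> rGamma \<beta> * rGamma (1 - \<beta>) / rGamma \<gamma>"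
    by (intro tendsto_intros) auto
  then have "convergent ?q" by (rule convergentI)
  then have "Bseq ?q" by (rule convergent_imp_Bseq)
  then obtain K where K: "K > 0" "\<And>n. \<bar>?q n\<bar> \<le> K" by (auto simp: Bseq_def)
  have b: "\<bar>hcoef \<beta> \<gamma> (Suc n)\<bar> \<le> K * 3 powr \<gamma> * (1 + real (Suc n)) powr (- \<gamma>)" if "n > 0" for n
  proof -
    have n: "real n > 0" using that by simp
    have "hcoef \<beta> \<gamma> (Suc n) = ?q n * (real n powr \<beta> * real n powr (1 - \<beta>) / real n powr \<gamma>) / (real n + 1)"
    proof -
      have "(a * F * x) * (b * F * y) / ((c * F * z) * (d * F)) = a * b / c * (x * y / z) / d" if "F \<noteq> 0"
        for a b c d x y z F :: real
      proof -
        have "(a * F * x) * (b * F * y) / ((c * F * z) * (d * F)) = (a * b * (x * y) * (F * F)) / (c * z * d * (F * F))"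
          by (simp only: mult_ac)
        then show ?thesis using that by simp
      qed
      from this[of "fact n"] show ?thesis
        by (simp add: hcoef_def rGamma_series_powr[OF that] add.commute)
    qed
    also have "real n powr \<beta> * real n powr (1 - \<beta>) / real n powr \<gamma> = real n * real n powr (- \<gamma>)"
      using n by (simp add: powr_diff powr_minus divide_simps)
    finally have "\<bar>hcoef \<beta> \<gamma> (Suc n)\<bar> = \<bar>?q n\<bar> * (real n / (real n + 1) * real n powr (- \<gamma>))"
      using n by (simp add: abs_mult)
    also have "\<dots> \<le> K * (1 * real n powr (- \<gamma>))"
      using n K by (intro mult_mono) auto
    \<comment> \<open>For \<open>n \<ge> 1\<close> the shifted argument \<open>n + 2\<close> is at
      most \<open>3 * n\<close>; this costs the constant \<open>3 powr \<gamma>\<close>.\<close>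
    also have "real n powr (- \<gamma>) \<le> ((1 + real (Suc n)) / 3) powr (- \<gamma>)"
      by (rule powr_mono2') (use n assms that in auto)
    also have "((1 + real (Suc n)) / 3) powr (- \<gamma>) = 3 powr \<gamma> * (1 + real (Suc n)) powr (- \<gamma>)"
      by (simp add: powr_divide powr_minus field_simps)
    finally show ?thesis using K(1) by (simp add: mult_ac)
  qed
  \<comment> \<open>The asymptotic estimate starts at index 2; the first and the last entry cover
    the indices 0 and 1.\<close>
  define C where "C = Max {1, K * 3 powr \<gamma>, \<bar>hcoef \<beta> \<gamma> 1\<bar> * 2 powr \<gamma>}"
  have C: "1 \<le> C" "K * 3 powr \<gamma> \<le> C" "\<bar>hcoef \<beta> \<gamma> 1\<bar> * 2 powr \<gamma> \<le> C" by (auto simp: C_def)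
  show ?thesis
  proof (rule that[of C])
    fix n
    consider "n = 0" | "n = 1" | m where "n = Suc m" "m > 0" by (metis One_nat_def gr0_conv_Suc not_gr0)
    then show "\<bar>hcoef \<beta> \<gamma> n\<bar> \<le> C * (1 + real n) powr (- \<gamma>)"
    proof cases
      case 2
      have "\<bar>hcoef \<beta> \<gamma> 1\<bar> * 2 powr \<gamma> * 2 powr (- \<gamma>) \<le> C * 2 powr (- \<gamma>)" using C(3) by (intro mult_right_mono) auto
      moreover have "2 powr \<gamma> * 2 powr (- \<gamma>) = 1" by (simp add: powr_minus)
      ultimately have "\<bar>hcoef \<beta> \<gamma> 1\<bar> \<le> C * 2 powr (- \<gamma>)" by (simp only: mult.assoc mult_1_right)
      then show ?thesis using 2 by simp
    next
      case 3
      have "\<bar>hcoef \<beta> \<gamma> n\<bar> \<le> K * 3 powr \<gamma> * (1 + real n) powr (- \<gamma>)" using b[OF 3(2)] 3(1) by simp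
      also have "\<dots> \<le> C * (1 + real n) powr (- \<gamma>)" by (intro mult_right_mono C(2)) simp
      finally show ?thesis .
    qed (use C in auto)
  qed (use C in auto)
qed

lemma hcoef_summable_weighted:
  assumes "\<gamma> > 0" "\<nu> \<ge> 0" "\<nu> < \<gamma> - 1"
  shows "summable (\<lambda>n. (1 + real n) powr \<nu> * \<bar>hcoef \<beta> \<gamma> n\<bar>)"
proof -
  obtain C where C: "C > 0" "\<And>n. \<bar>hcoef \<beta> \<gamma> n\<bar> \<le> C * (1 + real n) powr (- \<gamma>)"
    using hcoef_bound[OF assms(1)] by blast
  have "summable (\<lambda>n. real n powr (\<nu> - \<gamma>))" using assms by (subst summable_real_powr_iff) auto
  then have "summable (\<lambda>n. real (Suc n) powr (\<nu> - \<gamma>))" by (subst summable_Suc_iff)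
  then have s: "summable (\<lambda>n. C * (1 + real n) powr (\<nu> - \<gamma>))" by (intro summable_mult) (simp add: add.commute)
  show ?thesis
  proof (rule summable_comparison_test'[OF s])
    fix n
    have "(1 + real n) powr \<nu> * \<bar>hcoef \<beta> \<gamma> n\<bar> \<le> (1 + real n) powr \<nu> * (C * (1 + real n) powr (- \<gamma>))"
      by (intro mult_left_mono C) auto
    then show "norm ((1 + real n) powr \<nu> * \<bar>hcoef \<beta> \<gamma> n\<bar>) \<le> C * (1 + real n) powr (\<nu> - \<gamma>)"
      by (simp add: powr_diff powr_minus divide_simps mult_ac)
  qed
qed

lemma hcoef_summable:
  assumes "\<gamma> > 1" shows "summable (\<lambda>n. \<bar>hcoef \<beta> \<gamma> n\<bar>)"
  using hcoef_summable_weighted[of \<gamma> 0 \<beta>] assms by simp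

lemma hcoef_bounded:
  assumes "\<gamma> > 0" obtains C where "C > 0" "\<And>n. \<bar>hcoef \<beta> \<gamma> n\<bar> \<le> C"
proof -
  obtain C where C: "C > 0" "\<And>n. \<bar>hcoef \<beta> \<gamma> n\<bar> \<le> C * (1 + real n) powr (- \<gamma>)"
    using hcoef_bound[OF assms] by blast
  have "(1 + real n) powr (- \<gamma>) \<le> 1" for n
    using assms powr_mono[of "-\<gamma>" 0 "1 + real n"] by auto
  then have "C * (1 + real n) powr (- \<gamma>) \<le> C" for n using C(1) mult_left_mono[of _ 1 C] by force
  then show ?thesis using C that order_trans by metis
qed

definition hfun :: "real \<Rightarrow> real \<Rightarrow> real \<Rightarrow> real" where
  "hfun \<beta> \<gamma> x = (\<Sum>n. hcoef \<beta> \<gamma> n * x ^ n)"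

lemma hyp2F1_hfun: "hyp2F1 (1 - \<beta>) \<beta> \<gamma> x = hfun \<beta> \<gamma> x"
  by (simp add: hyp2F1_def hfun_def eval_fps_def hcoef_def mult.commute)

lemma hfun_0 [simp]: "hfun \<beta> \<gamma> 0 = 1"
  unfolding hfun_def by (subst powser_zero) simp

lemma hfun_summable:
  assumes "\<gamma> > 1" "\<bar>x\<bar> \<le> 1" shows "summable (\<lambda>n. hcoef \<beta> \<gamma> n * x ^ n)"
proof (rule summable_comparison_test'[OF hcoef_summable[OF assms(1)]])
  fix n show "norm (hcoef \<beta> \<gamma> n * x ^ n) \<le> \<bar>hcoef \<beta> \<gamma> n\<bar>"
    using assms(2) by (simp add: abs_mult power_abs mult_left_le power_le_one)
qed

lemma hfun_continuous: assumes "\<gamma> > 1" shows "continuous_on {-1..1} (hfun \<beta> \<gamma>)"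
proof -
  have "uniform_limit {-1..1} (\<lambda>n x. \<Sum>i<n. hcoef \<beta> \<gamma> i * x ^ i) (\<lambda>x. \<Sum>i. hcoef \<beta> \<gamma> i * x ^ i) sequentially"
  proof (rule Weierstrass_m_test)
    show "norm (hcoef \<beta> \<gamma> n * x ^ n) \<le> \<bar>hcoef \<beta> \<gamma> n\<bar>" if "x \<in> {-1..1}" for n x
      using that by (auto simp: abs_mult power_abs mult_left_le power_le_one)
  qed (rule hcoef_summable[OF assms])
  then have "continuous_on {-1..1} (\<lambda>x. \<Sum>i. hcoef \<beta> \<gamma> i * x ^ i)"
    by (rule uniform_limit_theorem[rotated]) (auto intro!: always_eventually continuous_intros)
  then show ?thesis by (simp add: hfun_def[abs_def])
qed

section \<open>Contiguity in the lower parameter and the value at 1\<close>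

lemma hcoef_gamma_shift:
  assumes "\<gamma> > 0"
  shows "hcoef \<beta> (\<gamma> + 1) n = \<gamma> / (\<gamma> + real n) * hcoef \<beta> \<gamma> n"
proof -
  have p: "pochhammer \<gamma> n > 0" "pochhammer (\<gamma> + 1) n > 0" using assms by (auto intro!: pochhammer_pos)
  have "\<gamma> * pochhammer (\<gamma> + 1) n = pochhammer \<gamma> n * (\<gamma> + real n)"
    using pochhammer_rec[of \<gamma> n] pochhammer_Suc[of \<gamma> n] by simp
  then have "pochhammer (\<gamma> + 1) n = pochhammer \<gamma> n * (\<gamma> + real n) / \<gamma>" using assms by (simp add: field_simps)
  then show ?thesis using assms p by (simp add: hcoef_def mult_ac)
qed

text \<open>The difference of the two sides of the contiguity relation telescopes, with
  \<open>\<gamma> n c\<^sub>n\<close> as the telescoping sequence.\<close>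

lemma hfun_contiguous:
  assumes "\<gamma> > 1"
  shows "\<gamma> * (\<gamma> - 1) * hfun \<beta> \<gamma> 1 = (\<gamma> - \<beta>) * (\<gamma> - 1 + \<beta>) * hfun \<beta> (\<gamma> + 1) 1"
proof -
  let ?D = "\<lambda>n. \<gamma> * real n * hcoef \<beta> \<gamma> n"
  have eq: "?D n - ?D (Suc n) = \<gamma> * (\<gamma> - 1) * hcoef \<beta> \<gamma> n - (\<gamma> - \<beta>) * (\<gamma> - 1 + \<beta>) * hcoef \<beta> (\<gamma> + 1) n" for n
  proof -
    have nz: "real n + \<gamma> \<noteq> 0" "real n + 1 \<noteq> 0" using assms by auto
    have "(real n + 1) * hcoef \<beta> \<gamma> (Suc n) = (real n + \<beta>) * (real n + 1 - \<beta>) / (real n + \<gamma>) * hcoef \<beta> \<gamma> n"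
      using nz(2) by (simp add: hcoef_Suc)
    then have "?D (Suc n) = \<gamma> * ((real n + \<beta>) * (real n + 1 - \<beta>) / (real n + \<gamma>)) * hcoef \<beta> \<gamma> n"
      by (simp add: add.commute mult.assoc)
    moreover have "hcoef \<beta> (\<gamma> + 1) n = \<gamma> / (real n + \<gamma>) * hcoef \<beta> \<gamma> n"
      using hcoef_gamma_shift[of \<gamma> \<beta> n] assms by (simp add: add.commute)
    moreover have "\<gamma> * real n - \<gamma> * ((real n + \<beta>) * (real n + 1 - \<beta>) / (real n + \<gamma>))
        = \<gamma> * (\<gamma> - 1) - (\<gamma> - \<beta>) * (\<gamma> - 1 + \<beta>) * (\<gamma> / (real n + \<gamma>))"
      using nz(1) by (simp add: divide_simps) algebra
    ultimately show ?thesis by algebra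
  qed
  obtain C where C: "C > 0" "\<And>n. \<bar>hcoef \<beta> \<gamma> n\<bar> \<le> C * (1 + real n) powr (- \<gamma>)"
    using hcoef_bound[of \<gamma>] assms by auto
  have "?D \<longlonglongrightarrow> 0"
  proof (rule Lim_null_comparison)
    show "\<forall>\<^sub>F n in sequentially. norm (?D n) \<le> \<gamma> * C * (1 + real n) powr (1 - \<gamma>)"
    proof (intro always_eventually allI)
      fix n
      have "norm (?D n) \<le> \<gamma> * (1 + real n) * (C * (1 + real n) powr (- \<gamma>))"
        using assms C by (auto simp: abs_mult intro!: mult_mono)
      also have "\<dots> = \<gamma> * C * (1 + real n) powr (1 - \<gamma>)" by (simp add: powr_diff powr_minus divide_simps)
      finally show "norm (?D n) \<le> \<gamma> * C * (1 + real n) powr (1 - \<gamma>)" .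
    qed
    have "(\<lambda>n. (1 + real n) powr (1 - \<gamma>)) \<longlonglongrightarrow> 0"
      using assms by (intro tendsto_neg_powr filterlim_tendsto_add_at_top[OF tendsto_const]) (auto intro: filterlim_real_sequentially)
    then show "(\<lambda>n. \<gamma> * C * (1 + real n) powr (1 - \<gamma>)) \<longlonglongrightarrow> 0" by (rule tendsto_mult_right_zero)
  qed
  then have "(\<lambda>n. ?D n - ?D (Suc n)) sums (?D 0 - 0)" by (rule telescope_sums')
  moreover have "(\<lambda>n. \<gamma> * (\<gamma> - 1) * hcoef \<beta> \<gamma> n - (\<gamma> - \<beta>) * (\<gamma> - 1 + \<beta>) * hcoef \<beta> (\<gamma> + 1) n) sums
     (\<gamma> * (\<gamma> - 1) * hfun \<beta> \<gamma> 1 - (\<gamma> - \<beta>) * (\<gamma> - 1 + \<beta>) * hfun \<beta> (\<gamma> + 1) 1)"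
    using hfun_summable[of \<gamma> 1 \<beta>] hfun_summable[of "\<gamma> + 1" 1 \<beta>] assms
    unfolding hfun_def by (intro sums_diff sums_mult) (auto simp: summable_sums)
  ultimately show ?thesis unfolding eq using sums_unique2 by fastforce
qed

lemma hfun_iterate:
  assumes "\<gamma> > 1"
  shows "pochhammer \<gamma> N * pochhammer (\<gamma> - 1) N * hfun \<beta> \<gamma> 1 =
    pochhammer (\<gamma> - \<beta>) N * pochhammer (\<gamma> - 1 + \<beta>) N * hfun \<beta> (\<gamma> + real N) 1"
proof (induction N)
  case (Suc N)
  have c: "(\<gamma> + real N) * (\<gamma> - 1 + real N) * hfun \<beta> (\<gamma> + real N) 1
     = (\<gamma> - \<beta> + real N) * (\<gamma> - 1 + \<beta> + real N) * hfun \<beta> (\<gamma> + real (Suc N)) 1"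
    using hfun_contiguous[of "\<gamma> + real N" \<beta>] assms by (simp add: algebra_simps)
  have "pochhammer \<gamma> (Suc N) * pochhammer (\<gamma> - 1) (Suc N) * hfun \<beta> \<gamma> 1
     = (\<gamma> + real N) * (\<gamma> - 1 + real N) * (pochhammer \<gamma> N * pochhammer (\<gamma> - 1) N * hfun \<beta> \<gamma> 1)"
    by (simp add: pochhammer_Suc)
  also have "\<dots> = pochhammer (\<gamma> - \<beta>) N * pochhammer (\<gamma> - 1 + \<beta>) N * ((\<gamma> + real N) * (\<gamma> - 1 + real N) * hfun \<beta> (\<gamma> + real N) 1)"
    by (simp add: Suc.IH)
  finally show ?case unfolding c by (simp add: pochhammer_Suc)
qed simp

text \<open>Raising the lower parameter shrinks every coefficient, so those at \<gamma> are a
  majorant for all \<open>N\<close>, while each coefficient of positive index tends to 0. Tannery's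
  theorem interchanges limit and sum.\<close>

lemma hfun_gamma_limit:
  assumes "\<gamma> > 1"
  shows "(\<lambda>N. hfun \<beta> (\<gamma> + real N) 1) \<longlonglongrightarrow> 1"
proof -
  have le: "\<bar>hcoef \<beta> (\<gamma> + real N) k\<bar> \<le> \<bar>hcoef \<beta> \<gamma> k\<bar>" for N k
  proof (induction N)
    case (Suc N)
    have "\<bar>hcoef \<beta> (\<gamma> + real N + 1) k\<bar> = (\<gamma> + real N) / (\<gamma> + real N + real k) * \<bar>hcoef \<beta> (\<gamma> + real N) k\<bar>"
      using hcoef_gamma_shift[of "\<gamma> + real N" \<beta> k] assms by (simp add: abs_mult)
    also have "\<dots> \<le> 1 * \<bar>hcoef \<beta> (\<gamma> + real N) k\<bar>" using assms by (intro mult_right_mono) auto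
    finally show ?case using Suc by (simp add: add_ac)
  qed simp
  have lim: "(\<lambda>N. hcoef \<beta> (\<gamma> + real N) k) \<longlonglongrightarrow> (if k = 0 then 1 else 0)" for k
  proof (cases k)
    case (Suc j)
    let ?c = "\<bar>pochhammer \<beta> k * pochhammer (1 - \<beta>) k\<bar>"
    have "\<forall>\<^sub>F N in sequentially. norm (hcoef \<beta> (\<gamma> + real N) k) \<le> ?c / (\<gamma> + real N)"
    proof (intro always_eventually allI)
      fix N
      have "1 \<le> pochhammer (\<gamma> + real N + 1) j" for j
        using assms by (induction j) (auto simp: pochhammer_Suc intro!: mult_ge1_I)
      then have "\<gamma> + real N \<le> pochhammer (\<gamma> + real N) k"
        using assms by (simp add: Suc pochhammer_rec mult_le_cancel_left1)
      then have "(\<gamma> + real N) * 1 \<le> pochhammer (\<gamma> + real N) k * fact k"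
        using assms by (intro mult_mono) (auto intro!: fact_ge_1)
      then have "?c / (pochhammer (\<gamma> + real N) k * fact k) \<le> ?c / (\<gamma> + real N)"
        using assms by (intro divide_left_mono mult_pos_pos pochhammer_pos) auto
      moreover have "pochhammer (\<gamma> + real N) k > 0" using assms by (intro pochhammer_pos) auto
      ultimately show "norm (hcoef \<beta> (\<gamma> + real N) k) \<le> ?c / (\<gamma> + real N)"
        by (simp add: hcoef_def abs_mult)
    qed
    moreover have "filterlim (\<lambda>N. \<gamma> + real N) at_top sequentially"
      by (rule filterlim_tendsto_add_at_top[OF tendsto_const filterlim_real_sequentially])
    then have "filterlim (\<lambda>N. \<gamma> + real N) at_infinity sequentially"
      by (rule filterlim_at_top_imp_at_infinity)
    then have "(\<lambda>N. ?c / (\<gamma> + real N)) \<longlonglongrightarrow> 0"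
      by (rule tendsto_divide_0[OF tendsto_const])
    ultimately have "(\<lambda>N. hcoef \<beta> (\<gamma> + real N) k) \<longlonglongrightarrow> 0"
      by (rule Lim_null_comparison)
    then show ?thesis using Suc by simp
  qed simp
  have "(\<lambda>N. \<Sum>k. hcoef \<beta> (\<gamma> + real N) k) \<longlonglongrightarrow> (\<Sum>k. if k = 0 then 1 else 0)"
    by (rule tannerys_theorem[where M = "\<lambda>k. \<bar>hcoef \<beta> \<gamma> k\<bar>", THEN conjunct2, THEN conjunct2])
      (use le lim hcoef_summable[OF assms] in \<open>auto intro!: always_eventually\<close>)
  moreover have "(\<Sum>k::nat. if k = 0 then 1 else 0) = (1::real)"
    using suminf_finite[of "{0::nat}" "\<lambda>k. if k = 0 then 1 else (0::real)"] by auto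
  ultimately show ?thesis by (simp add: hfun_def)
qed

text \<open>Gauss' summation theorem. The contiguity relation is iterated towards large \<gamma>,
  where the series tends to 1, and the remaining Pochhammer quotient converges by Euler's limit. The
  factors \<open>rGamma\<close> keep the formula meaningful where \<open>Gamma\<close> has
  poles.\<close>

theorem hfun_at_1:
  assumes "\<gamma> > 1"
  shows "hfun \<beta> \<gamma> 1 = Gamma \<gamma> * Gamma (\<gamma> - 1) * (rGamma (\<gamma> - \<beta>) * rGamma (\<gamma> - 1 + \<beta>))"
proof -
  have pos: "rGamma_series \<gamma> n > 0" "rGamma_series (\<gamma> - 1) n > 0" for n
    using assms by (auto simp: rGamma_series_def intro!: divide_pos_pos pochhammer_pos)
  let ?R = "\<lambda>n. rGamma_series (\<gamma> - \<beta>) n * rGamma_series (\<gamma> - 1 + \<beta>) n / (rGamma_series \<gamma> n * rGamma_series (\<gamma> - 1) n)"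
  have R: "hfun \<beta> \<gamma> 1 = ?R n * hfun \<beta> (\<gamma> + real (Suc n)) 1" if "n > 0" for n
  proof -
    have n: "real n > 0" using that by simp
    have e: "real n powr (\<gamma> - \<beta>) * real n powr (\<gamma> - 1 + \<beta>) = real n powr \<gamma> * real n powr (\<gamma> - 1)"
      by (simp flip: powr_add)
    have "rGamma_series \<gamma> n * rGamma_series (\<gamma> - 1) n * (fact n)\<^sup>2 * (real n powr \<gamma> * real n powr (\<gamma> - 1)) * hfun \<beta> \<gamma> 1 =
      rGamma_series (\<gamma> - \<beta>) n * rGamma_series (\<gamma> - 1 + \<beta>) n * (fact n)\<^sup>2 * (real n powr (\<gamma> - \<beta>) * real n powr (\<gamma> - 1 + \<beta>)) * hfun \<beta> (\<gamma> + real (Suc n)) 1"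
      using hfun_iterate[OF assms, of "Suc n" \<beta>] unfolding rGamma_series_powr[OF that]
      by (simp only: power2_eq_square mult_ac)
    then have "rGamma_series \<gamma> n * rGamma_series (\<gamma> - 1) n * hfun \<beta> \<gamma> 1 * ((fact n)\<^sup>2 * (real n powr \<gamma> * real n powr (\<gamma> - 1))) =
      rGamma_series (\<gamma> - \<beta>) n * rGamma_series (\<gamma> - 1 + \<beta>) n * hfun \<beta> (\<gamma> + real (Suc n)) 1 * ((fact n)\<^sup>2 * (real n powr \<gamma> * real n powr (\<gamma> - 1)))"
      unfolding e by (simp only: mult_ac)
    then have "rGamma_series \<gamma> n * rGamma_series (\<gamma> - 1) n * hfun \<beta> \<gamma> 1 =
      rGamma_series (\<gamma> - \<beta>) n * rGamma_series (\<gamma> - 1 + \<beta>) n * hfun \<beta> (\<gamma> + real (Suc n)) 1"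
      using n by simp
    then show ?thesis using pos[of n] by (simp add: field_simps)
  qed
  have "\<forall>\<^sub>F n in sequentially. ?R n * hfun \<beta> (\<gamma> + real (Suc n)) 1 = hfun \<beta> \<gamma> 1"
    by (rule eventually_sequentiallyI[of 1], rule R[symmetric]) simp
  then have "(\<lambda>n. ?R n * hfun \<beta> (\<gamma> + real (Suc n)) 1) \<longlonglongrightarrow> hfun \<beta> \<gamma> 1"
    by (rule tendsto_eventually)
  moreover have "rGamma \<gamma> \<noteq> 0" "rGamma (\<gamma> - 1) \<noteq> 0"
    using assms by (auto simp: rGamma_eq_zero_iff elim!: nonpos_Ints_cases)
  then have "(\<lambda>n. ?R n * hfun \<beta> (\<gamma> + real (Suc n)) 1) \<longlonglongrightarrow>
      rGamma (\<gamma> - \<beta>) * rGamma (\<gamma> - 1 + \<beta>) / (rGamma \<gamma> * rGamma (\<gamma> - 1)) * 1"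
    by (intro tendsto_intros LIMSEQ_Suc[OF hfun_gamma_limit[OF assms]]) auto
  ultimately have "hfun \<beta> \<gamma> 1 = rGamma (\<gamma> - \<beta>) * rGamma (\<gamma> - 1 + \<beta>) / (rGamma \<gamma> * rGamma (\<gamma> - 1))"
    using LIMSEQ_unique by fastforce
  then show ?thesis by (simp add: rGamma_inverse_Gamma field_simps)
qed

section \<open>The rainbow arrays\<close>

text \<open>\<open>M1\<close>, \<open>M2\<close>, \<open>M3\<close> are half the sums of two instances of the second defining recursion.\<close>

locale rainbow =
  fixes \<beta> :: real and a b :: "int \<Rightarrow> int \<Rightarrow> int \<Rightarrow> real"
  assumes beta: "\<beta> > 1/2"
    and zero: "k < 0 \<or> m < 0 \<or> n < 0 \<Longrightarrow> a k m n = 0 \<and> b k m n = 0"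
    and a0: "a 0 0 0 = 1"
    and D1: "(of_int k + 1) * (of_int k + 2 * \<beta>) * a (k + 1) m n - (of_int k + \<beta>) * (of_int k + 1 - \<beta>) * a k m n
      = b k m n - b k (m - 1) n - b k m (n - 1) + b k (m - 1) (n - 1)"
    and D2: "(of_int m + 1) * (of_int m + 2 * \<beta>) * a k (m + 1) n - (of_int m + \<beta>) * (of_int m + 1 - \<beta>) * a k m n
      = b k m n - b (k - 1) m n - b k m (n - 1) + b (k - 1) m (n - 1)"
    and D3: "(of_int n + 1) * (of_int n + 2 * \<beta>) * a k m (n + 1) - (of_int n + \<beta>) * (of_int n + 1 - \<beta>) * a k m n
      = b k m n - b (k - 1) m n - b k (m - 1) n + b (k - 1) (m - 1) n"
    and M1: "of_int k * (of_int m + of_int n + \<beta>) * a k m n = b (k - 1) (m - 1) (n - 1) - b (k - 1) m n"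
    and M2: "of_int m * (of_int k + of_int n + \<beta>) * a k m n = b (k - 1) (m - 1) (n - 1) - b k (m - 1) n"
    and M3: "of_int n * (of_int k + of_int m + \<beta>) * a k m n = b (k - 1) (m - 1) (n - 1) - b k m (n - 1)"
begin

lemma swap12: "rainbow \<beta> (\<lambda>k m n. a m k n) (\<lambda>k m n. b m k n)"
proof (unfold_locales, goal_cases)
  case (2 k m n) then show ?case using zero[of m k n] by auto
next
  case (4 k m n) then show ?case using D2[of k m n] by simp
next
  case (5 m k n) then show ?case using D1[of m k n] by simp
next
  case (6 n k m) then show ?case using D3[of n m k] by simp
next
  case (7 k m n) then show ?case using M2[of k m n] by simp
next
  case (8 m k n) then show ?case using M1[of m k n] by simp
next
  case (9 n k m) then show ?case using M3[of n m k] by (simp add: add_ac)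
qed (use beta a0 in auto)

lemma swap23: "rainbow \<beta> (\<lambda>k m n. a k n m) (\<lambda>k m n. b k n m)"
proof (unfold_locales, goal_cases)
  case (2 k m n) then show ?case using zero[of k n m] by auto
next
  case (4 k m n) then show ?case using D1[of k n m] by simp
next
  case (5 m k n) then show ?case using D3[of m k n] by simp
next
  case (6 n k m) then show ?case using D2[of n k m] by simp
next
  case (7 k m n) then show ?case using M1[of k n m] by (simp add: add_ac)
next
  case (8 m k n) then show ?case using M3[of m k n] by (simp add: add_ac)
next
  case (9 n k m) then show ?case using M2[of n k m] by (simp add: add_ac)
qed (use beta a0 in auto)

text \<open>\<open>D1\<close> plus \<open>M1\<close> at \<open>k + 1\<close>, with \<open>M2\<close>
  and \<open>M3\<close> replacing two of the values of \<open>b\<close>. The result is a step in one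
  index whose remaining \<open>b\<close>-terms have total degree below \<open>k + m + n\<close> by
  two or three.\<close>

lemma a_recursion1:
  "(of_int k + 1) * (of_int k + of_int m + of_int n + 3 * \<beta>) * a (k + 1) m n =
   ((of_int k + \<beta>) * (of_int k + of_int m + of_int n + 1 - \<beta>) + 2 * of_int m * of_int n) * a k m n
   + 2 * (b k (m - 1) (n - 1) - b (k - 1) (m - 1) (n - 1))"
  using D1[of k m n] M1[of "k + 1" m n] M2[of m k n] M3[of n k m] by (simp add: algebra_simps)

lemma a_recursion2:
  "(of_int m + 1) * (of_int k + of_int m + of_int n + 3 * \<beta>) * a k (m + 1) n =
   ((of_int m + \<beta>) * (of_int k + of_int m + of_int n + 1 - \<beta>) + 2 * of_int k * of_int n) * a k m n
   + 2 * (b (k - 1) m (n - 1) - b (k - 1) (m - 1) (n - 1))"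
  using rainbow.a_recursion1[OF swap12, of m k n] by (simp add: add_ac)

lemma a_recursion3:
  "(of_int n + 1) * (of_int k + of_int m + of_int n + 3 * \<beta>) * a k m (n + 1) =
   ((of_int n + \<beta>) * (of_int k + of_int m + of_int n + 1 - \<beta>) + 2 * of_int k * of_int m) * a k m n
   + 2 * (b (k - 1) (m - 1) n - b (k - 1) (m - 1) (n - 1))"
  using rainbow.a_recursion2[OF swap23, of n k m] by (simp add: add_ac)

end

section \<open>Uniqueness and symmetry of the arrays\<close>

text \<open>Induction on the total degree of \<open>a\<close>, carrying along \<open>b\<close> at
  the index lowered by one in each place. Uniqueness yields the symmetry of the arrays, because
  permuting the indices produces another solution.\<close>

lemma rainbow_unique:
  assumes "rainbow \<beta> a b" "rainbow \<beta> a' b'"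
  shows "a k m n = a' k m n \<and> b k m n = b' k m n"
proof -
  interpret A: rainbow \<beta> a b by fact
  interpret B: rainbow \<beta> a' b' by fact
  note beta = A.beta
  have *: "k \<ge> 0 \<longrightarrow> m \<ge> 0 \<longrightarrow> n \<ge> 0 \<longrightarrow> nat (k + m + n) = N \<longrightarrow>
     a k m n = a' k m n \<and> b (k - 1) (m - 1) (n - 1) = b' (k - 1) (m - 1) (n - 1)" for N k m n
  proof (induction N arbitrary: k m n rule: less_induct)
    case (less N)
    show ?case
    proof (intro impI)
      assume nn: "k \<ge> 0" "m \<ge> 0" "n \<ge> 0" and N: "nat (k + m + n) = N"
      have IH: "a i j l = a' i j l \<and> b (i - 1) (j - 1) (l - 1) = b' (i - 1) (j - 1) (l - 1)"
        if "i + j + l < k + m + n" for i j l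
      proof (cases "i \<ge> 0 \<and> j \<ge> 0 \<and> l \<ge> 0")
        case True then show ?thesis using less.IH[of "nat (i + j + l)" i j l] that N nn by auto
      next
        case False then show ?thesis using A.zero B.zero by (smt (verit))
      qed
      \<comment> \<open>\<open>M1\<close> with the second and third index lowered ties this value to
        an \<open>a\<close> and a \<open>b\<close> that the induction hypothesis covers in total
        degree smaller by two.\<close>
      have bb: "b (k - 1) (m - 1) (n - 1) = b' (k - 1) (m - 1) (n - 1)"
      proof -
        have "b (k - 1) (m - 2) (n - 2) = b' (k - 1) (m - 2) (n - 2)" "a k (m - 1) (n - 1) = a' k (m - 1) (n - 1)"
          using IH[of k "m - 1" "n - 1"] by simp_all
        then show ?thesis
          using A.M1[of k "m - 1" "n - 1"] B.M1[of k "m - 1" "n - 1"] by simp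
      qed
      have pos: "real_of_int (k + m + n) - 1 + 3 * \<beta> \<noteq> 0" using nn beta by linarith
      have "a k m n = a' k m n"
      proof -
        consider "k > 0" | "m > 0" | "n > 0" | "k = 0" "m = 0" "n = 0" using nn by linarith
        then show ?thesis
        proof cases
          case 1
          have "real_of_int k * (real_of_int (k + m + n) - 1 + 3 * \<beta>) * a k m n
              = real_of_int k * (real_of_int (k + m + n) - 1 + 3 * \<beta>) * a' k m n"
            using A.a_recursion1[of "k - 1" m n] B.a_recursion1[of "k - 1" m n] IH[of "k - 1" m n] bb by (simp add: algebra_simps)
          then show ?thesis using 1 pos by simp
        next
          case 2
          have "real_of_int m * (real_of_int (k + m + n) - 1 + 3 * \<beta>) * a k m n
              = real_of_int m * (real_of_int (k + m + n) - 1 + 3 * \<beta>) * a' k m n"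
            using A.a_recursion2[of "m - 1" k n] B.a_recursion2[of "m - 1" k n] IH[of k "m - 1" n] bb by (simp add: algebra_simps)
          then show ?thesis using 2 pos by simp
        next
          case 3
          have "real_of_int n * (real_of_int (k + m + n) - 1 + 3 * \<beta>) * a k m n
              = real_of_int n * (real_of_int (k + m + n) - 1 + 3 * \<beta>) * a' k m n"
            using A.a_recursion3[of "n - 1" k m] B.a_recursion3[of "n - 1" k m] IH[of k m "n - 1"] bb by (simp add: algebra_simps)
          then show ?thesis using 3 pos by simp
        qed (use A.a0 B.a0 in simp)
      qed
      then show "a k m n = a' k m n \<and> b (k - 1) (m - 1) (n - 1) = b' (k - 1) (m - 1) (n - 1)" using bb by simp
    qed
  qed
  have aa: "a k m n = a' k m n" for k m n
    using *[of k m n] A.zero[of k m n] B.zero[of k m n] by (cases "k \<ge> 0 \<and> m \<ge> 0 \<and> n \<ge> 0") auto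
  have "b k m n = b' k m n"
    using *[of "k + 1" "m + 1" "n + 1"] A.zero[of k m n] B.zero[of k m n]
    by (cases "k \<ge> 0 \<and> m \<ge> 0 \<and> n \<ge> 0") auto
  then show ?thesis using aa by simp
qed

context rainbow
begin

lemma sym12: "a m k n = a k m n" "b m k n = b k m n"
  using rainbow_unique[OF swap12 rainbow_axioms] by auto

lemma sym23: "a k n m = a k m n" "b k n m = b k m n"
  using rainbow_unique[OF swap23 rainbow_axioms] by auto

lemma sym13: "a n m k = a k m n"
  using sym12 sym23 by metis

text \<open>On an axis every \<open>b\<close>-term carries a negative index, which leaves a two-term
  recursion. This is where the lower parameter 3 \<beta> comes from.\<close>

lemma a_axis: "a 0 0 (int n) = hcoef \<beta> (3 * \<beta>) n"
proof (induction n)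
  case (Suc n)
  have "(real n + 1) * (real n + 3 * \<beta>) * a 0 0 (int n + 1) = (real n + \<beta>) * (real n + 1 - \<beta>) * a 0 0 (int n)"
    using a_recursion3[of "int n" 0 0] zero by simp
  moreover have "(real n + 1) * (real n + 3 * \<beta>) \<noteq> 0" using beta by auto
  ultimately have "a 0 0 (int n + 1) = (real n + \<beta>) * (real n + 1 - \<beta>) * a 0 0 (int n) / ((real n + 1) * (real n + 3 * \<beta>))"
    by (metis nonzero_mult_div_cancel_left)
  then show ?case using Suc by (simp add: hcoef_Suc add.commute mult_ac)
qed (simp add: a0)

section \<open>Energy estimate and polynomial growth\<close>

abbreviation "g \<equiv> hcoef \<beta> (2 * \<beta>)"

text \<open>With \<open>u\<close> and \<open>v\<close> the coefficients (in the last two indices) of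
  \<open>(1 - y) (1 - z) G\<^sub>k\<close> and \<open>(y z - 1) G\<^sub>k\<close>, the product \<open>- u v\<close> is a sum of two telescoping
  terms, which makes the quadratic form below nonnegative.\<close>

lemma telescope_box:
  fixes f :: "int \<Rightarrow> real"
  assumes "f (-1) = 0"
  shows "(\<Sum>m\<le>M. f (int m) - f (int m - 1)) = f (int M)"
  by (induction M) (use assms in auto)

lemma box_form_nonneg:
  fixes f :: "int \<Rightarrow> int \<Rightarrow> real"
  assumes "\<And>m n. m < 0 \<or> n < 0 \<Longrightarrow> f m n = 0"
  shows "(\<Sum>m\<le>M. \<Sum>n\<le>N.
    (f (int m) (int n) - f (int m - 1) (int n) - f (int m) (int n - 1) + f (int m - 1) (int n - 1))
    * (f (int m - 1) (int n - 1) - f (int m) (int n))) \<le> 0"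
proof -
  \<comment> \<open>The increment of \<open>X\<close> in \<open>m\<close> and that of
    \<open>Y\<close> in \<open>n\<close> both contain the first factor of the summand; their
    cofactors add up to minus twice the second factor.\<close>
  define X where "X n m = (f m n - f m (n - 1))\<^sup>2" for m n
  define Y where "Y m n = (f m n - f (m - 1) n)\<^sup>2" for m n
  have "(\<Sum>m\<le>M. \<Sum>n\<le>N.
    (f (int m) (int n) - f (int m - 1) (int n) - f (int m) (int n - 1) + f (int m - 1) (int n - 1))
    * (f (int m - 1) (int n - 1) - f (int m) (int n)))
    = (\<Sum>m\<le>M. \<Sum>n\<le>N. - ((X (int n) (int m) - X (int n) (int m - 1)) + (Y (int m) (int n) - Y (int m) (int n - 1))) / 2)"
    by (intro sum.cong refl) (simp add: X_def Y_def, algebra)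
  also have "\<dots> = - ((\<Sum>m\<le>M. \<Sum>n\<le>N. X (int n) (int m) - X (int n) (int m - 1)) + (\<Sum>m\<le>M. \<Sum>n\<le>N. Y (int m) (int n) - Y (int m) (int n - 1))) / 2"
    by (simp only: sum_negf sum.distrib sum_divide_distrib[symmetric])
  also have "(\<Sum>m\<le>M. \<Sum>n\<le>N. X (int n) (int m) - X (int n) (int m - 1)) = (\<Sum>n\<le>N. X (int n) (int M))"
    by (subst sum.swap) (intro sum.cong refl telescope_box, simp add: X_def assms)
  also have "(\<Sum>m\<le>M. \<Sum>n\<le>N. Y (int m) (int n) - Y (int m) (int n - 1)) = (\<Sum>m\<le>M. Y (int m) (int N))"
    by (intro sum.cong refl telescope_box) (simp add: Y_def assms)
  also have "- ((\<Sum>n\<le>N. X (int n) (int M)) + (\<Sum>m\<le>M. Y (int m) (int N))) / 2 \<le> 0"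
  proof -
    have "(\<Sum>n\<le>N. X (int n) (int M)) \<ge> 0" "(\<Sum>m\<le>M. Y (int m) (int N)) \<ge> 0"
      by (auto simp: X_def Y_def intro!: sum_nonneg)
    then show ?thesis by simp
  qed
  finally show ?thesis .
qed

text \<open>The weight \<open>m + n + \<beta>\<close> is the factor of \<open>a\<close> in
  \<open>M1\<close>; with it, pairing \<open>D1\<close> with \<open>M1\<close> produces this
  weighted square norm of a slice.\<close>

definition energy :: "nat \<Rightarrow> nat \<Rightarrow> nat \<Rightarrow> real" where
  "energy k M N = (\<Sum>m\<le>M. \<Sum>n\<le>N. (real m + real n + \<beta>) * (a (int k) (int m) (int n))\<^sup>2)"

text \<open>By \<open>D1\<close> the slice \<open>k + 1\<close> is \<open>t k\<close> times the
  slice \<open>k\<close> up to a multiple of the box difference of \<open>b\<close>, and the pairing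
  of the latter with the right-hand side of \<open>M1\<close> has a sign. So a step costs at most
  the square of the ratio of consecutive \<open>g\<close>, whatever the sign of that ratio.\<close>

lemma energy_Suc:
  defines "t \<equiv> \<lambda>k::nat. (real k + \<beta>) * (real k + 1 - \<beta>) / ((real k + 2 * \<beta>) * (real k + 1))"
  shows "energy (Suc k) M N \<le> (t k)\<^sup>2 * energy k M N"
proof -
  let ?w = "\<lambda>m n. real m + real n + \<beta>"
  let ?A = "\<lambda>m n. a (int (Suc k)) (int m) (int n)" and ?B = "\<lambda>m n. a (int k) (int m) (int n)"
  let ?c = "(real k + 1) * (real k + 2 * \<beta>)"
  have c: "?c > 0" and k: "real k + 1 > 0" using beta by auto
  have u: "b (int k) (int m) (int n) - b (int k) (int m - 1) (int n) - b (int k) (int m) (int n - 1) + b (int k) (int m - 1) (int n - 1)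
      = ?c * (?A m n - t k * ?B m n)" for m n
  proof -
    have "real k + 2 * \<beta> \<noteq> 0" using beta by linarith
    then have "?c * t k = (real k + \<beta>) * (real k + 1 - \<beta>)"
      using k unfolding t_def by (simp add: mult.commute)
    then have "?c * (t k * ?B m n) = (real k + \<beta>) * (real k + 1 - \<beta>) * ?B m n"
      by (simp only: mult.assoc[symmetric])
    moreover have "int (Suc k) = int k + 1" by simp
    ultimately show ?thesis using D1[of "int k" "int m" "int n"] by (simp only: right_diff_distrib of_int_of_nat_eq)
  qed
  have v: "b (int k) (int m - 1) (int n - 1) - b (int k) (int m) (int n) = (real k + 1) * (?w m n * ?A m n)" for m n
    using M1[of "int (Suc k)" "int m" "int n"] by (simp add: algebra_simps)
  have "(\<Sum>m\<le>M. \<Sum>n\<le>N. (?c * (?A m n - t k * ?B m n)) * ((real k + 1) * (?w m n * ?A m n))) \<le> 0"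
    using box_form_nonneg[of "b (int k)" N M] zero unfolding u v by auto
  also have "(\<Sum>m\<le>M. \<Sum>n\<le>N. (?c * (?A m n - t k * ?B m n)) * ((real k + 1) * (?w m n * ?A m n))) =
      (?c * (real k + 1)) * (\<Sum>m\<le>M. \<Sum>n\<le>N. (?A m n - t k * ?B m n) * (?w m n * ?A m n))"
    unfolding sum_distrib_left by (intro sum.cong refl) (simp only: mult_ac)
  finally have le: "(\<Sum>m\<le>M. \<Sum>n\<le>N. (?A m n - t k * ?B m n) * (?w m n * ?A m n)) \<le> 0"
    using c k by (simp add: mult_le_0_iff not_le[symmetric])
  have "energy (Suc k) M N - (t k)\<^sup>2 * energy k M N
     = (\<Sum>m\<le>M. \<Sum>n\<le>N. ?w m n * (?A m n)\<^sup>2 - (t k)\<^sup>2 * (?w m n * (?B m n)\<^sup>2))"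
    by (simp add: energy_def sum_distrib_left sum_subtractf)
  also have "\<dots> \<le> (\<Sum>m\<le>M. \<Sum>n\<le>N. 2 * ((?A m n - t k * ?B m n) * (?w m n * ?A m n)))"
  proof (intro sum_mono)
    fix m n
    have "?w m n * (?A m n - t k * ?B m n)\<^sup>2 \<ge> 0" using beta by (intro mult_nonneg_nonneg) auto
    then show "?w m n * (?A m n)\<^sup>2 - (t k)\<^sup>2 * (?w m n * (?B m n)\<^sup>2) \<le> 2 * ((?A m n - t k * ?B m n) * (?w m n * ?A m n))"
      by (simp add: power2_eq_square algebra_simps)
  qed
  also have "\<dots> = 2 * (\<Sum>m\<le>M. \<Sum>n\<le>N. (?A m n - t k * ?B m n) * (?w m n * ?A m n))"
    by (simp add: sum_distrib_left)
  also have "\<dots> \<le> 0" using le by simp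
  finally show ?thesis by simp
qed

lemma energy_le: "energy k M N \<le> (g k)\<^sup>2 * energy 0 M N"
proof (induction k)
  case (Suc k)
  let ?t = "(real k + \<beta>) * (real k + 1 - \<beta>) / ((real k + 2 * \<beta>) * (real k + 1))"
  have "energy (Suc k) M N \<le> ?t\<^sup>2 * energy k M N" by (rule energy_Suc)
  also have "\<dots> \<le> ?t\<^sup>2 * ((g k)\<^sup>2 * energy 0 M N)" by (intro mult_left_mono Suc) auto
  also have "\<dots> = (?t * g k)\<^sup>2 * energy 0 M N" by (simp only: power_mult_distrib mult.assoc)
  also have "?t * g k = g (Suc k)" by (simp only: hcoef_Suc)
  finally show ?case .
qed simp

lemma energy_ge: "\<beta> * (a (int k) (int m) (int n))\<^sup>2 \<le> energy k m n"
proof -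
  have "\<beta> * (a (int k) (int m) (int n))\<^sup>2 \<le> (real m + real n + \<beta>) * (a (int k) (int m) (int n))\<^sup>2"
    by (intro mult_right_mono) auto
  also have "\<dots> \<le> (\<Sum>n'\<le>n. (real m + real n' + \<beta>) * (a (int k) (int m) (int n'))\<^sup>2)"
    using beta by (intro member_le_sum[of n "{..n}"]) (auto intro!: mult_nonneg_nonneg)
  also have "\<dots> \<le> energy k m n"
    unfolding energy_def using beta
    by (intro member_le_sum[of m "{..m}"]) (auto intro!: mult_nonneg_nonneg sum_nonneg)
  finally show ?thesis .
qed

text \<open>The energy estimate is used in two indices: symmetry moves the second index of
  \<open>a 0 m n\<close> to the front, which reduces it to an axis and the hypergeometric bound;
  then \<open>a k m n\<close> is reduced to \<open>a 0 m n\<close>.\<close>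

lemma regular_a: "regular a"
proof -
  obtain \<Gamma> where \<Gamma>: "\<Gamma> > 0" "\<And>k. \<bar>g k\<bar> \<le> \<Gamma>" using hcoef_bounded[of "2 * \<beta>" \<beta>] beta by auto
  obtain H where H: "H > 0" "\<And>k. \<bar>hcoef \<beta> (3 * \<beta>) k\<bar> \<le> H" using hcoef_bounded[of "3 * \<beta>" \<beta>] beta by auto
  have g2: "(g k)\<^sup>2 \<le> \<Gamma>\<^sup>2" for k using \<Gamma> by (metis abs_ge_zero power2_abs power_mono)
  have h2: "(hcoef \<beta> (3 * \<beta>) k)\<^sup>2 \<le> H\<^sup>2" for k using H by (metis abs_ge_zero power2_abs power_mono)
  have enn: "energy k M N \<ge> 0" for k M N
    unfolding energy_def using beta by (auto intro!: sum_nonneg mult_nonneg_nonneg)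
  have e00: "energy 0 0 N \<le> (real N + 1) * ((real N + \<beta>) * H\<^sup>2)" for N
  proof -
    have "energy 0 0 N \<le> (\<Sum>n\<le>N. (real N + \<beta>) * H\<^sup>2)"
      unfolding energy_def using h2 beta by (simp add: a_axis del: sum_constant, intro sum_mono mult_mono) auto
    then show ?thesis by (simp add: algebra_simps)
  qed
  have a0mn: "(a 0 (int m) (int n))\<^sup>2 \<le> \<Gamma>\<^sup>2 * ((real n + 1) * ((real n + \<beta>) * H\<^sup>2)) / \<beta>" for m n
  proof -
    have "\<beta> * (a (int m) 0 (int n))\<^sup>2 \<le> energy m 0 n" using energy_ge[of m 0 n] by simp
    also have "\<dots> \<le> \<Gamma>\<^sup>2 * ((real n + 1) * ((real n + \<beta>) * H\<^sup>2))"
      using order_trans[OF energy_le mult_mono[OF g2 e00]] enn by auto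
    finally show ?thesis using beta sym12(1)[of 0 "int m" "int n"] by (simp add: field_simps)
  qed
  define K where "K = \<Gamma>\<^sup>2 * (\<Gamma>\<^sup>2 * H\<^sup>2 / \<beta> * (1 + \<beta>)\<^sup>2) / \<beta>"
  have K: "K \<ge> 0" unfolding K_def using beta by simp
  \<comment> \<open>Two sums, one weight and two factors from \<open>a0mn\<close> have degree five;
    raising this to the even exponent 6 makes the square root a polynomial.\<close>
  have fin: "(a (int k) (int m) (int n))\<^sup>2 \<le> K * (1 + real k + real m + real n) ^ 6" for k m n
  proof -
    let ?s = "1 + real k + real m + real n"
    have s1: "real n + \<beta> \<le> (1 + \<beta>) * ?s" "real m + real n + \<beta> \<le> (1 + \<beta>) * ?s"
      using beta by (auto simp: algebra_simps intro!: add_mono)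
    have "energy 0 m n \<le> (\<Sum>m'\<le>m. \<Sum>n'\<le>n. ((1 + \<beta>) * ?s) * (\<Gamma>\<^sup>2 * (?s * (((1 + \<beta>) * ?s) * H\<^sup>2)) / \<beta>))"
      unfolding energy_def
    proof (intro sum_mono mult_mono)
      fix m' n' assume mn: "m' \<in> {..m}" "n' \<in> {..n}"
      show "real m' + real n' + \<beta> \<le> (1 + \<beta>) * ?s" using s1 mn by auto
      have "(a (int 0) (int m') (int n'))\<^sup>2 \<le> \<Gamma>\<^sup>2 * ((real n' + 1) * ((real n' + \<beta>) * H\<^sup>2)) / \<beta>"
        using a0mn[of m' n'] by simp
      also have "\<dots> \<le> \<Gamma>\<^sup>2 * (?s * (((1 + \<beta>) * ?s) * H\<^sup>2)) / \<beta>"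
        using s1 mn beta by (intro divide_right_mono mult_left_mono mult_mono) auto
      finally show "(a (int 0) (int m') (int n'))\<^sup>2 \<le> \<Gamma>\<^sup>2 * (?s * (((1 + \<beta>) * ?s) * H\<^sup>2)) / \<beta>" .
    qed (use beta in auto)
    also have "\<dots> = (real m + 1) * ((real n + 1) * (((1 + \<beta>) * ?s) * (\<Gamma>\<^sup>2 * (?s * (((1 + \<beta>) * ?s) * H\<^sup>2)) / \<beta>)))"
      by (simp add: add.commute)
    also have "\<dots> \<le> ?s * (?s * (((1 + \<beta>) * ?s) * (\<Gamma>\<^sup>2 * (?s * (((1 + \<beta>) * ?s) * H\<^sup>2)) / \<beta>)))"
      using beta by (intro mult_mono) auto
    also have "\<dots> = \<Gamma>\<^sup>2 * H\<^sup>2 / \<beta> * (1 + \<beta>)\<^sup>2 * ?s ^ 5"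
      by (simp add: power2_eq_square power_def)
    also have "\<dots> \<le> \<Gamma>\<^sup>2 * H\<^sup>2 / \<beta> * (1 + \<beta>)\<^sup>2 * ?s ^ 6"
      using beta by (intro mult_left_mono power_increasing) auto
    finally have "energy 0 m n \<le> \<Gamma>\<^sup>2 * H\<^sup>2 / \<beta> * (1 + \<beta>)\<^sup>2 * ?s ^ 6" .
    then have "energy k m n \<le> \<Gamma>\<^sup>2 * (\<Gamma>\<^sup>2 * H\<^sup>2 / \<beta> * (1 + \<beta>)\<^sup>2 * ?s ^ 6)"
      using order_trans[OF energy_le mult_mono[OF g2]] enn zero_le_power2 by blast
    then have "\<beta> * (a (int k) (int m) (int n))\<^sup>2 \<le> \<Gamma>\<^sup>2 * (\<Gamma>\<^sup>2 * H\<^sup>2 / \<beta> * (1 + \<beta>)\<^sup>2 * ?s ^ 6)"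
      using energy_ge order_trans by blast
    then have "(a (int k) (int m) (int n))\<^sup>2 \<le> \<Gamma>\<^sup>2 * (\<Gamma>\<^sup>2 * H\<^sup>2 / \<beta> * (1 + \<beta>)\<^sup>2 * ?s ^ 6) / \<beta>"
      using beta by (simp add: pos_le_divide_eq mult.commute)
    then show ?thesis by (simp add: K_def mult_ac)
  qed
  show ?thesis
  proof (rule regularI[of _ "sqrt K" 3])
    fix k m n :: int assume nn: "0 \<le> k" "0 \<le> m" "0 \<le> n"
    let ?s = "1 + real_of_int k + real_of_int m + real_of_int n"
    have "(a k m n)\<^sup>2 \<le> K * ?s ^ 6" using fin[of "nat k" "nat m" "nat n"] nn by simp
    also have "\<dots> = (sqrt K * ?s ^ 3)\<^sup>2" using K by (simp add: power_mult_distrib flip: power_mult)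
    finally show "\<bar>a k m n\<bar> \<le> sqrt K * ?s ^ 3"
      using K nn abs_le_square_iff[of "a k m n" "sqrt K * ?s ^ 3"] by simp
  qed (use zero in auto)
qed

text \<open>The recursion \<open>M1\<close> expresses \<open>b\<close> as a finite sum of values of \<open>a\<close> along the diagonal.\<close>

lemma regular_b: "regular b"
proof -
  obtain C d where C: "C \<ge> 0"
    "\<And>k m n. \<bar>a k m n\<bar> \<le> C * (1 + \<bar>real_of_int k\<bar> + \<bar>real_of_int m\<bar> + \<bar>real_of_int n\<bar>) ^ d"
    using regularE[OF regular_a] by blast
  define D where "D = C * (1 + \<beta>) * 2 ^ d"
  have D: "D \<ge> 0" using C beta by (simp add: D_def)
  have t: "\<bar>(real k + 1) * (real m + real n + \<beta>) * a (int k + 1) (int m) (int n)\<bar> \<le> D * (1 + real k + real m + real n) ^ (d + 2)" for k m n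
  proof -
    let ?s = "1 + real k + real m + real n"
    have "\<bar>(real k + 1) * (real m + real n + \<beta>) * a (int k + 1) (int m) (int n)\<bar> =
      (real k + 1) * (real m + real n + \<beta>) * \<bar>a (int k + 1) (int m) (int n)\<bar>"
      using beta by (simp add: abs_mult)
    also have "\<dots> \<le> ?s * ((1 + \<beta>) * ?s) * (C * (2 * ?s) ^ d)"
    proof (intro mult_mono)
      have "\<beta> * 1 \<le> \<beta> * ?s" using beta by (intro mult_left_mono) auto
      then show "real m + real n + \<beta> \<le> (1 + \<beta>) * ?s" unfolding distrib_right by simp
      have "\<bar>a (int k + 1) (int m) (int n)\<bar> \<le> C * (1 + (real k + 1) + real m + real n) ^ d"
        using C(2)[of "int k + 1" "int m" "int n"] by simp
      also have "\<dots> \<le> C * (2 * ?s) ^ d" using C(1) by (intro mult_left_mono power_mono) auto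
      finally show "\<bar>a (int k + 1) (int m) (int n)\<bar> \<le> C * (2 * ?s) ^ d" .
    qed (use beta in auto)
    also have "\<dots> = D * ?s ^ (d + 2)" by (simp only: D_def power_mult_distrib power_add power2_eq_square mult_ac)
    finally show ?thesis .
  qed
  have bd: "\<bar>b (int k) (int m) (int n)\<bar> \<le> D * (1 + real m) * (1 + real k + real m + real n) ^ (d + 2)" for k m n
  proof (induction m arbitrary: n)
      case (0 n)
      show ?case using M1[of "int k + 1" 0 "int n"] zero[of "int k" "-1" "int n - 1"] t[of k 0 n] by (simp add: add.commute)
    next
      case (Suc m n)
      let ?s = "1 + real k + real (Suc m) + real n"
      have ih: "\<bar>b (int k) (int m) (int n - 1)\<bar> \<le> D * (1 + real m) * ?s ^ (d + 2)"
      proof (cases n)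
        case 0 then show ?thesis using zero D by simp
      next
        case n: (Suc n')
        have "\<bar>b (int k) (int m) (int n')\<bar> \<le> D * (1 + real m) * (1 + real k + real m + real n') ^ (d + 2)"
          by (rule Suc.IH)
        also have "\<dots> \<le> D * (1 + real m) * ?s ^ (d + 2)" using n D by (intro mult_left_mono power_mono) auto
        finally show ?thesis using n by simp
      qed
      have "b (int k) (int (Suc m)) (int n) = b (int k) (int m) (int n - 1) - (real k + 1) * (real (Suc m) + real n + \<beta>) * a (int k + 1) (int (Suc m)) (int n)"
        using M1[of "int k + 1" "int (Suc m)" "int n"] by simp
      then have "\<bar>b (int k) (int (Suc m)) (int n)\<bar> \<le> D * (1 + real m) * ?s ^ (d + 2) + D * ?s ^ (d + 2)"
        using ih t[of k "Suc m" n] by linarith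
      also have "\<dots> = D * (1 + real (Suc m)) * ?s ^ (d + 2)" by (simp add: algebra_simps del: power_Suc power_add)
      finally show ?case .
  qed
  show ?thesis
  proof (rule regularI[of _ D "d + 3"])
    fix k m n :: int assume nn: "0 \<le> k" "0 \<le> m" "0 \<le> n"
    let ?s = "1 + real_of_int k + real_of_int m + real_of_int n"
    have "\<bar>b k m n\<bar> \<le> D * (1 + real_of_int m) * ?s ^ (d + 2)" using bd[of "nat k" "nat m" "nat n"] nn by simp
    also have "\<dots> \<le> D * ?s * ?s ^ (d + 2)" using nn D by (intro mult_right_mono mult_left_mono) auto
    finally show "\<bar>b k m n\<bar> \<le> D * ?s ^ (d + 3)" by (simp add: numeral_3_eq_3 mult.assoc)
  qed (use zero in auto)
qed

end

section \<open>Differential equations for the rainbow series\<close>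

definition pderiv2 :: "(int \<Rightarrow> int \<Rightarrow> int \<Rightarrow> real) \<Rightarrow> int \<Rightarrow> int \<Rightarrow> int \<Rightarrow> real" where
  "pderiv2 a = (\<lambda>k m n. (of_int m + 1) * a k (m + 1) n)"

definition pderiv3 :: "(int \<Rightarrow> int \<Rightarrow> int \<Rightarrow> real) \<Rightarrow> int \<Rightarrow> int \<Rightarrow> int \<Rightarrow> real" where
  "pderiv3 a = (\<lambda>k m n. (of_int n + 1) * a k m (n + 1))"

lemma regular_pderiv2: assumes "regular a" shows "regular (pderiv2 a)"
proof -
  have "regular (pderiv1 (\<lambda>k m n. a m k n))" by (rule regular_pderiv1[OF regular_swap12[OF assms]])
  from regular_swap12[OF this] show ?thesis by (simp add: pderiv1_def pderiv2_def)
qed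

lemma regular_pderiv3: assumes "regular a" shows "regular (pderiv3 a)"
proof -
  have "regular (pderiv2 (\<lambda>k m n. a k n m))" by (rule regular_pderiv2[OF regular_swap23[OF assms]])
  from regular_swap23[OF this] show ?thesis by (simp add: pderiv2_def pderiv3_def)
qed

lemma psum_shift2:
  assumes "regular a"
  shows "regular (\<lambda>k m n. a k (m - 1) n)" "psum (\<lambda>k m n. a k (m - 1) n) x y z = y * psum a x y z"
proof -
  have r: "regular (\<lambda>k m n. a m k n)" by (rule regular_swap12[OF assms])
  have r2: "regular (\<lambda>k m n. a m (k - 1) n)" using regular_shift[OF r] by simp
  show "regular (\<lambda>k m n. a k (m - 1) n)" using regular_swap12[OF r2] by simp
  have "psum (\<lambda>k m n. a k (m - 1) n) x y z = psum (\<lambda>k m n. a m (k - 1) n) y x z"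
    by (rule psum_swap12[of "\<lambda>k m n. a m (k - 1) n"])
  also have "\<dots> = y * psum (\<lambda>k m n. a m k n) y x z" by (rule psum_shift[OF r])
  finally show "psum (\<lambda>k m n. a k (m - 1) n) x y z = y * psum a x y z" using psum_swap12[of a y x z] by simp
qed

lemma psum_shift3:
  assumes "regular a"
  shows "regular (\<lambda>k m n. a k m (n - 1))" "psum (\<lambda>k m n. a k m (n - 1)) x y z = z * psum a x y z"
proof -
  have r: "regular (\<lambda>k m n. a k n m)" by (rule regular_swap23[OF assms])
  have r2: "regular (\<lambda>k m n. a k n (m - 1))" using psum_shift2(1)[OF r] by simp
  show "regular (\<lambda>k m n. a k m (n - 1))" using regular_swap23[OF r2] by simp
  have "psum (\<lambda>k m n. a k m (n - 1)) x y z = psum (\<lambda>k m n. a k n (m - 1)) x z y"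
    by (rule psum_swap23[of "\<lambda>k m n. a k n (m - 1)"])
  also have "\<dots> = z * psum (\<lambda>k m n. a k n m) x z y" by (rule psum_shift2(2)[OF r])
  finally show "psum (\<lambda>k m n. a k m (n - 1)) x y z = z * psum a x y z" using psum_swap23[of a x z y] by simp
qed

lemma psum_has_derivative2:
  assumes "regular a" "\<bar>x\<bar> < 1" "\<bar>y\<bar> < 1" "\<bar>z\<bar> < 1"
  shows "((\<lambda>t. psum a x t z) has_real_derivative psum (pderiv2 a) x y z) (at y)"
proof -
  have "(\<lambda>t. psum a x t z) = (\<lambda>t. psum (\<lambda>k m n. a m k n) t x z)"
    by (rule ext) (rule psum_swap12[symmetric])
  moreover have "psum (pderiv2 a) x y z = psum (pderiv1 (\<lambda>k m n. a m k n)) y x z"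
    using psum_swap12[of "pderiv1 (\<lambda>k m n. a m k n)" x y z] by (simp add: pderiv2_def pderiv1_def)
  ultimately show ?thesis using psum_has_derivative1[OF regular_swap12[OF assms(1)] assms(3,2,4)] by simp
qed

lemma psum_has_derivative3:
  assumes "regular a" "\<bar>x\<bar> < 1" "\<bar>y\<bar> < 1" "\<bar>z\<bar> < 1"
  shows "((\<lambda>t. psum a x y t) has_real_derivative psum (pderiv3 a) x y z) (at z)"
proof -
  have "(\<lambda>t. psum a x y t) = (\<lambda>t. psum (\<lambda>k m n. a k n m) x t y)"
    by (rule ext) (rule psum_swap23[symmetric])
  moreover have "psum (pderiv3 a) x y z = psum (pderiv2 (\<lambda>k m n. a k n m)) x z y"
    using psum_swap23[of "pderiv2 (\<lambda>k m n. a k n m)" x y z] by (simp add: pderiv2_def pderiv3_def)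
  ultimately show ?thesis using psum_has_derivative2[OF regular_swap23[OF assms(1)] assms(2,4,3)] by simp
qed

section \<open>Joint continuity and the chain rule\<close>

abbreviation cube :: "real \<Rightarrow> (real \<times> real \<times> real) set" where
  "cube r \<equiv> {-r<..<r} \<times> {-r<..<r} \<times> {-r<..<r}"

text \<open>Weierstrass test on each smaller cube, with the terms at its corner
  \<open>(r, r, r)\<close> as majorant.\<close>

lemma psum_continuous_on:
  assumes "regular a"
  shows "continuous_on (cube 1) (\<lambda>(x, y, z). psum a x y z)"
proof -
  have c: "continuous_on (cube r) (\<lambda>(x, y, z). psum a x y z)" if r: "0 < r" "r < 1" for r
  proof -
    have "uniform_limit (cube r) (\<lambda>P q. \<Sum>p\<in>P. case q of (x, y, z) \<Rightarrow> pterm a x y z p)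
       (\<lambda>q. infsum (\<lambda>p. case q of (x, y, z) \<Rightarrow> pterm a x y z p) UNIV) (finite_subsets_at_top UNIV)"
    proof (rule Weierstrass_m_test_general)
      show "(\<lambda>p. norm (pterm a r r r p)) summable_on UNIV"
        using r by (intro pterm_summable assms) auto
      fix p :: "nat \<times> nat \<times> nat" and q assume "q \<in> cube r"
      then obtain x y z where q: "q = (x, y, z)" "\<bar>x\<bar> \<le> r" "\<bar>y\<bar> \<le> r" "\<bar>z\<bar> \<le> r" by auto
      obtain k m n where p: "p = (k, m, n)" by (cases p)
      have "\<bar>x\<bar> ^ k * \<bar>y\<bar> ^ m * \<bar>z\<bar> ^ n \<le> r ^ k * r ^ m * r ^ n"
        using q r by (intro mult_mono power_mono) auto
      then have "\<bar>a (int k) (int m) (int n)\<bar> * (\<bar>x\<bar> ^ k * \<bar>y\<bar> ^ m * \<bar>z\<bar> ^ n) \<le> \<bar>a (int k) (int m) (int n)\<bar> * (r ^ k * r ^ m * r ^ n)"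
        by (intro mult_left_mono) auto
      then show "norm (case q of (x, y, z) \<Rightarrow> pterm a x y z p) \<le> norm (pterm a r r r p)"
        using r by (simp add: q p pterm_def abs_mult power_abs mult.assoc)
    qed
    then have "continuous_on (cube r) (\<lambda>q. infsum (\<lambda>p. case q of (x, y, z) \<Rightarrow> pterm a x y z p) UNIV)"
      by (rule uniform_limit_theorem[rotated])
        (auto intro!: always_eventually continuous_on_sum simp: pterm_def split_beta intro!: continuous_intros)
    then show ?thesis by (simp add: psum_def split_beta)
  qed
  show ?thesis
  proof (rule continuous_at_imp_continuous_on, rule ballI)
    fix q assume "q \<in> cube 1"
    then obtain x y z where q: "q = (x, y, z)" "\<bar>x\<bar> < 1" "\<bar>y\<bar> < 1" "\<bar>z\<bar> < 1" by auto
    then have "max 0 (max \<bar>x\<bar> (max \<bar>y\<bar> \<bar>z\<bar>)) < 1" by auto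
    then obtain r where r: "max 0 (max \<bar>x\<bar> (max \<bar>y\<bar> \<bar>z\<bar>)) < r" "r < 1" using dense by blast
    have "q \<in> cube r" using q r by auto
    moreover have "open (cube r)" by (intro open_Times) auto
    moreover have "continuous_on (cube r) (\<lambda>(x, y, z). psum a x y z)" by (rule c) (use r in auto)
    ultimately show "isCont (\<lambda>(x, y, z). psum a x y z) q"
      using continuous_on_eq_continuous_at by blast
  qed
qed

lemma psum_isCont:
  assumes "regular a" "\<bar>x\<bar> < 1" "\<bar>y\<bar> < 1" "\<bar>z\<bar> < 1"
  shows "isCont (\<lambda>(x, y, z). psum a x y z) (x, y, z)"
proof -
  have "open (cube 1)" by (auto intro!: open_Times)
  then show ?thesis
    using psum_continuous_on[OF assms(1)] continuous_on_eq_continuous_at assms(2-4) by fastforce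
qed

lemma psum_tendsto:
  assumes "regular a" "\<bar>x\<bar> < 1" "\<bar>y\<bar> < 1" "\<bar>z\<bar> < 1"
    and "(X \<longlongrightarrow> x) A" "(Y \<longlongrightarrow> y) A" "(Z \<longlongrightarrow> z) A"
  shows "((\<lambda>s. psum a (X s) (Y s) (Z s)) \<longlongrightarrow> psum a x y z) A"
proof -
  have "((\<lambda>s. (X s, Y s, Z s)) \<longlongrightarrow> (x, y, z)) A" using assms(5-) by (intro tendsto_Pair)
  from isCont_tendsto_compose[OF psum_isCont[OF assms(1-4)] this] show ?thesis by simp
qed

text \<open>The chain rule along curves in the open unit cube serves as the notion of
  differentiability: it is what is needed when the cross-ratios move with the points. The functions
  are arbitrary because comparison functions, which are not power series arrays, must be covered as
  well.\<close>

definition has_partials ::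
  "(real \<Rightarrow> real \<Rightarrow> real \<Rightarrow> real) \<Rightarrow> (real \<Rightarrow> real \<Rightarrow> real \<Rightarrow> real) \<Rightarrow>
   (real \<Rightarrow> real \<Rightarrow> real \<Rightarrow> real) \<Rightarrow> (real \<Rightarrow> real \<Rightarrow> real \<Rightarrow> real) \<Rightarrow> bool" where
  "has_partials E E1 E2 E3 \<longleftrightarrow> (\<forall>X Y Z X' Y' Z' t.
     (X has_real_derivative X') (at t) \<longrightarrow> (Y has_real_derivative Y') (at t) \<longrightarrow>
     (Z has_real_derivative Z') (at t) \<longrightarrow> X t \<in> {0<..<1} \<longrightarrow> Y t \<in> {0<..<1} \<longrightarrow> Z t \<in> {0<..<1} \<longrightarrow>
     ((\<lambda>s. E (X s) (Y s) (Z s)) has_real_derivative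
       E1 (X t) (Y t) (Z t) * X' + E2 (X t) (Y t) (Z t) * Y' + E3 (X t) (Y t) (Z t) * Z') (at t))"

text \<open>Continuous partial derivatives give a total derivative. The triple is nested because the
  criterion adds one variable at a time.\<close>

lemma psum_has_derivative:
  assumes a: "regular a" and q: "\<bar>x\<bar> < 1" "\<bar>y\<bar> < 1" "\<bar>z\<bar> < 1"
  shows "((\<lambda>((x, y), z). psum a x y z) has_derivative
     (\<lambda>((u, v), w). psum (pderiv1 a) x y z * u + psum (pderiv2 a) x y z * v + psum (pderiv3 a) x y z * w)) (at ((x, y), z))"
proof -
  let ?I = "{-1<..<1::real}"
  have o: "open (?I \<times> ?I)" "open ((?I \<times> ?I) \<times> ?I)" by (auto intro!: open_Times)
  have xy: "((\<lambda>(x, y). psum a x y z) has_derivative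
      (\<lambda>(u, v). psum (pderiv1 a) x y z * u + blinfun_apply (blinfun_mult_right (psum (pderiv2 a) x y z)) v)) (at (x, y) within ?I \<times> ?I)"
  proof (rule has_derivative_partialsI[where fy = "\<lambda>x y. blinfun_mult_right (psum (pderiv2 a) x y z)"])
    show "((\<lambda>x. psum a x y z) has_derivative (*) (psum (pderiv1 a) x y z)) (at x within ?I)"
      using psum_has_derivative1[OF a q] by (simp add: has_field_derivative_def has_derivative_at_withinI)
    show "((\<lambda>y. psum a x y z) has_derivative blinfun_apply (blinfun_mult_right (psum (pderiv2 a) x y z))) (at y within ?I)"
      if "x \<in> ?I" "y \<in> ?I" for x y
      using psum_has_derivative2[OF a, of x y z] that q by (auto simp: has_field_derivative_def has_derivative_at_withinI)
    have "isCont (\<lambda>p. psum (pderiv2 a) (fst p) (snd p) z) (x, y)"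
      unfolding isCont_def
      by (rule psum_tendsto[OF regular_pderiv2[OF a]])
        (use q tendsto_fst[OF tendsto_ident_at, of "(x, y)"] tendsto_snd[OF tendsto_ident_at, of "(x, y)"] in auto)
    then show "continuous (at (x, y) within ?I \<times> ?I) (\<lambda>(x, y). blinfun_mult_right (psum (pderiv2 a) x y z))"
      unfolding split_beta continuous_within
      by (intro bounded_linear.tendsto[OF bounded_linear_blinfun_mult_right]) (auto simp: isCont_def intro: tendsto_within_subset)
  qed (use q in auto)
  have "((\<lambda>(p, z). psum a (fst p) (snd p) z) has_derivative
      (\<lambda>(r, w). (\<lambda>(u, v). psum (pderiv1 a) x y z * u + blinfun_apply (blinfun_mult_right (psum (pderiv2 a) x y z)) v) r
        + blinfun_apply (blinfun_mult_right (psum (pderiv3 a) (fst (x, y)) (snd (x, y)) z)) w)) (at ((x, y), z) within (?I \<times> ?I) \<times> ?I)"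
  proof (rule has_derivative_partialsI[where fy = "\<lambda>p z. blinfun_mult_right (psum (pderiv3 a) (fst p) (snd p) z)"])
    show "((\<lambda>p. psum a (fst p) (snd p) z) has_derivative
      (\<lambda>(u, v). psum (pderiv1 a) x y z * u + blinfun_apply (blinfun_mult_right (psum (pderiv2 a) x y z)) v)) (at (x, y) within ?I \<times> ?I)"
      using xy by (simp add: case_prod_unfold)
    show "((\<lambda>y. psum a (fst p) (snd p) y) has_derivative blinfun_apply (blinfun_mult_right (psum (pderiv3 a) (fst p) (snd p) z))) (at z within ?I)"
      if "p \<in> ?I \<times> ?I" "z \<in> ?I" for p z
      using psum_has_derivative3[OF a, of "fst p" "snd p" z] that by (auto simp: has_field_derivative_def has_derivative_at_withinI)
    have "isCont (\<lambda>s. psum (pderiv3 a) (fst (fst s)) (snd (fst s)) (snd s)) ((x, y), z)"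
      unfolding isCont_def
      by (rule psum_tendsto[OF regular_pderiv3[OF a]])
        (use q tendsto_fst[OF tendsto_fst[OF tendsto_ident_at], of "((x, y), z)"]
          tendsto_snd[OF tendsto_fst[OF tendsto_ident_at], of "((x, y), z)"]
          tendsto_snd[OF tendsto_ident_at, of "((x, y), z)"] in auto)
    then show "continuous (at ((x, y), z) within (?I \<times> ?I) \<times> ?I) (\<lambda>(p, z). blinfun_mult_right (psum (pderiv3 a) (fst p) (snd p) z))"
      unfolding split_beta continuous_within
      by (intro bounded_linear.tendsto[OF bounded_linear_blinfun_mult_right]) (auto simp: isCont_def intro: tendsto_within_subset)
  qed (use q in auto)
  then show ?thesis
    using q o(2) by (subst (asm) at_within_open) (auto simp: case_prod_unfold abs_less_iff)
qed

lemma psum_chain: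
  assumes a: "regular a"
    and d: "(X has_real_derivative X') (at t)" "(Y has_real_derivative Y') (at t)" "(Z has_real_derivative Z') (at t)"
    and q: "\<bar>X t\<bar> < 1" "\<bar>Y t\<bar> < 1" "\<bar>Z t\<bar> < 1"
  shows "((\<lambda>s. psum a (X s) (Y s) (Z s)) has_real_derivative
    psum (pderiv1 a) (X t) (Y t) (Z t) * X' + psum (pderiv2 a) (X t) (Y t) (Z t) * Y' + psum (pderiv3 a) (X t) (Y t) (Z t) * Z') (at t)"
proof -
  have "((\<lambda>s. ((X s, Y s), Z s)) has_derivative (\<lambda>h. ((X' * h, Y' * h), Z' * h))) (at t)"
    using d by (intro has_derivative_Pair) (auto simp: has_field_derivative_def)
  from diff_chain_at[OF this] psum_has_derivative[OF a q]
  have "((\<lambda>((x, y), z). psum a x y z) \<circ> (\<lambda>s. ((X s, Y s), Z s)) has_derivative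
     (\<lambda>((u, v), w). psum (pderiv1 a) (X t) (Y t) (Z t) * u + psum (pderiv2 a) (X t) (Y t) (Z t) * v + psum (pderiv3 a) (X t) (Y t) (Z t) * w)
      \<circ> (\<lambda>h. ((X' * h, Y' * h), Z' * h))) (at t)" by blast
  then have "((\<lambda>s. psum a (X s) (Y s) (Z s)) has_derivative
     (\<lambda>h. psum (pderiv1 a) (X t) (Y t) (Z t) * (X' * h) + psum (pderiv2 a) (X t) (Y t) (Z t) * (Y' * h) + psum (pderiv3 a) (X t) (Y t) (Z t) * (Z' * h))) (at t)"
    by (simp add: o_def)
  then show ?thesis
    unfolding has_field_derivative_def by (rule has_derivative_eq_rhs) (auto simp: algebra_simps fun_eq_iff)
qed

lemma psum_has_partials:
  "regular a \<Longrightarrow> has_partials (psum a) (psum (pderiv1 a)) (psum (pderiv2 a)) (psum (pderiv3 a))"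
  unfolding has_partials_def by (intro allI impI psum_chain) auto

section \<open>The generating functions of the two arrays\<close>

context rainbow
begin

abbreviation "F \<equiv> psum a"
abbreviation "G \<equiv> psum b"

lemmas reg = regular_a regular_b regular_pderiv1 regular_pderiv2 regular_pderiv3
  regular_shift psum_shift2(1) psum_shift3(1) regular_add regular_diff regular_cmult

lemma F_sym: "F y x z = F x y z" "F x z y = F x y z"
  using psum_swap12[of a x y z] psum_swap23[of a x y z] sym12(1) sym23(1) by (auto simp: fun_eq_iff)

lemma G_sym: "G y x z = G x y z" "G x z y = G x y z"
  using psum_swap12[of b x y z] psum_swap23[of b x y z] sym12(2) sym23(2) by (auto simp: fun_eq_iff)

lemma F_zero: "F 0 0 0 = 1"
proof -
  have "F 0 0 0 = infsum (pterm a 0 0 0) {(0, 0, 0)}"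
    unfolding psum_def by (rule infsum_cong_neutral) (auto simp: pterm_def power_0_left split: if_splits)
  then show ?thesis using a0 by (simp add: pterm_def)
qed

context
  fixes x y z :: real
  assumes q: "\<bar>x\<bar> < 1" "\<bar>y\<bar> < 1" "\<bar>z\<bar> < 1"
begin

text \<open>Multiplying by a variable shifts the coefficients, so this is the recursion
  \<open>D1\<close> coefficient by coefficient.\<close>

lemma eq_D1:
  "x * (1 - x) * psum (pderiv1 (pderiv1 a)) x y z + (2 * \<beta> - 2 * x) * psum (pderiv1 a) x y z
     - \<beta> * (1 - \<beta>) * F x y z = (1 - y) * (1 - z) * G x y z"
proof -
  define d where "d = pderiv1 a"
  define d1 where "d1 = (\<lambda>k m n. d (k - 1) m n)"
  define e1 where "e1 = (\<lambda>k m n. pderiv1 d (k - 1) m n)"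
  define e2 where "e2 = (\<lambda>k m n. e1 (k - 1) m n)"
  have r1: "regular d" "regular e1"
    by (auto simp: d_def e1_def intro!: reg)
  have r: "regular d" "regular d1" "regular e1" "regular e2"
    using regular_shift[OF r1(1)] regular_shift[OF r1(2)] r1 by (auto simp: d1_def e2_def)
  have s: "psum d1 x y z = x * psum d x y z" "psum e1 x y z = x * psum (pderiv1 d) x y z"
    "psum e2 x y z = x * psum e1 x y z"
    using psum_shift[OF r(1), of x y z] psum_shift[OF regular_pderiv1[OF r(1)], of x y z] psum_shift[OF r(3), of x y z]
    by (simp_all only: d1_def e1_def e2_def)
  define b3 where "b3 = (\<lambda>k m n. b k m (n - 1))"
  define b2 where "b2 = (\<lambda>k m n. b k (m - 1) n)"
  define b23 where "b23 = (\<lambda>k m n. b3 k (m - 1) n)"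
  have rb: "regular b3" "regular b2" "regular b23"
    by (auto simp: b2_def b3_def b23_def intro!: reg)
  have sb: "psum b3 x y z = z * G x y z" "psum b2 x y z = y * G x y z" "psum b23 x y z = y * psum b3 x y z"
    using psum_shift2(2)[OF rb(1), of x y z] by (auto simp: b3_def b2_def b23_def intro!: psum_shift2(2) psum_shift3(2) reg)
  have "psum (\<lambda>k m n. e1 k m n - e2 k m n + (2 * \<beta>) * d k m n - 2 * d1 k m n - (\<beta> * (1 - \<beta>)) * a k m n) x y z
      = psum e1 x y z - psum e2 x y z + (2 * \<beta>) * psum d x y z - 2 * psum d1 x y z - (\<beta> * (1 - \<beta>)) * F x y z"
    by (simp add: psum_add psum_diff psum_cmult r reg q)
  moreover have "psum (\<lambda>k m n. b k m n - b2 k m n - b3 k m n + b23 k m n) x y z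
      = G x y z - psum b2 x y z - psum b3 x y z + psum b23 x y z"
    by (simp add: psum_add psum_diff rb reg q)
  moreover have "e1 k m n - e2 k m n + (2 * \<beta>) * d k m n - 2 * d1 k m n - (\<beta> * (1 - \<beta>)) * a k m n
     = b k m n - b2 k m n - b3 k m n + b23 k m n" for k m n
    using D1[of k m n]
    by (simp add: d_def d1_def e1_def e2_def b2_def b3_def b23_def pderiv1_def algebra_simps)
  ultimately have "psum e1 x y z - psum e2 x y z + (2 * \<beta>) * psum d x y z - 2 * psum d1 x y z - (\<beta> * (1 - \<beta>)) * F x y z
    = G x y z - psum b2 x y z - psum b3 x y z + psum b23 x y z" by simp
  then show ?thesis unfolding s sb d_def by (simp add: algebra_simps)
qed

lemma eq_M1:
  "y * psum (pderiv2 (pderiv1 a)) x y z + z * psum (pderiv3 (pderiv1 a)) x y z + \<beta> * psum (pderiv1 a) x y z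
    = (y * z - 1) * G x y z"
proof -
  define d where "d = pderiv1 a"
  define d2 where "d2 = (\<lambda>k m n. pderiv2 d k (m - 1) n)"
  define d3 where "d3 = (\<lambda>k m n. pderiv3 d k m (n - 1))"
  define b3 where "b3 = (\<lambda>k m n. b k m (n - 1))"
  define b23 where "b23 = (\<lambda>k m n. b3 k (m - 1) n)"
  have r: "regular d" "regular d2" "regular d3" "regular b3" "regular b23"
    by (auto simp: d_def d2_def d3_def b3_def b23_def intro!: reg)
  have s: "psum d2 x y z = y * psum (pderiv2 d) x y z" "psum d3 x y z = z * psum (pderiv3 d) x y z"
     "psum b3 x y z = z * G x y z" "psum b23 x y z = y * psum b3 x y z"
    using psum_shift2(2)[OF r(4), of x y z] by (auto simp: d2_def d3_def b3_def b23_def intro!: psum_shift2(2) psum_shift3(2) r reg)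
  have "psum (\<lambda>k m n. d2 k m n + d3 k m n + \<beta> * d k m n) x y z
      = psum d2 x y z + psum d3 x y z + \<beta> * psum d x y z"
    by (simp add: psum_add psum_cmult r reg q)
  moreover have "psum (\<lambda>k m n. b23 k m n - b k m n) x y z = psum b23 x y z - G x y z"
    by (simp add: psum_diff r reg q)
  moreover have "d2 k m n + d3 k m n + \<beta> * d k m n = b23 k m n - b k m n" for k m n
    using M1[of "k + 1" m n] by (simp add: d_def d2_def d3_def b3_def b23_def pderiv1_def pderiv2_def pderiv3_def algebra_simps)
  ultimately have "psum d2 x y z + psum d3 x y z + \<beta> * psum d x y z = psum b23 x y z - G x y z" by simp
  then show ?thesis unfolding s d_def by (simp add: algebra_simps)
qed

end

lemma swap_pderiv:
  "psum (pderiv1 a) y x z = psum (pderiv2 a) x y z"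
  "psum (pderiv2 a) y x z = psum (pderiv1 a) x y z"
  "psum (pderiv3 a) y x z = psum (pderiv3 a) x y z"
  "psum (pderiv1 (pderiv1 a)) y x z = psum (pderiv2 (pderiv2 a)) x y z"
  "psum (pderiv2 (pderiv1 a)) y x z = psum (pderiv2 (pderiv1 a)) x y z"
  "psum (pderiv3 (pderiv1 a)) y x z = psum (pderiv3 (pderiv2 a)) x y z"
  unfolding psum_swap12[symmetric, of _ x y z]
  using sym12(1) by (simp_all add: pderiv1_def pderiv2_def pderiv3_def mult_ac)

lemma swap_pderiv':
  "psum (pderiv1 a) x z y = psum (pderiv1 a) x y z"
  "psum (pderiv2 a) x z y = psum (pderiv3 a) x y z"
  "psum (pderiv3 a) x z y = psum (pderiv2 a) x y z"
  "psum (pderiv2 (pderiv2 a)) x z y = psum (pderiv3 (pderiv3 a)) x y z"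
  "psum (pderiv3 (pderiv2 a)) x z y = psum (pderiv3 (pderiv2 a)) x y z"
  "psum (pderiv2 (pderiv1 a)) x z y = psum (pderiv3 (pderiv1 a)) x y z"
  unfolding psum_swap23[symmetric, of _ x y z]
  using sym23(1) by (simp_all add: pderiv1_def pderiv2_def pderiv3_def mult_ac)

context
  fixes x y z :: real
  assumes q: "\<bar>x\<bar> < 1" "\<bar>y\<bar> < 1" "\<bar>z\<bar> < 1"
begin

lemma eq_D2:
  "y * (1 - y) * psum (pderiv2 (pderiv2 a)) x y z + (2 * \<beta> - 2 * y) * psum (pderiv2 a) x y z
     - \<beta> * (1 - \<beta>) * F x y z = (1 - x) * (1 - z) * G x y z"
  using eq_D1[OF q(2,1,3)] by (simp add: swap_pderiv[where x = x and y = y and z = z] F_sym(1)[where x = x and y = y and z = z]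
      G_sym(1)[where x = x and y = y and z = z])

lemma eq_D3:
  "z * (1 - z) * psum (pderiv3 (pderiv3 a)) x y z + (2 * \<beta> - 2 * z) * psum (pderiv3 a) x y z
     - \<beta> * (1 - \<beta>) * F x y z = (1 - x) * (1 - y) * G x y z"
  using rainbow.eq_D2[OF rainbow_axioms q(1,3,2)]
  by (simp add: swap_pderiv'[where x = x and y = y and z = z] F_sym(2)[where x = x and y = y and z = z]
      G_sym(2)[where x = x and y = y and z = z])

lemma eq_M2:
  "x * psum (pderiv2 (pderiv1 a)) x y z + z * psum (pderiv3 (pderiv2 a)) x y z + \<beta> * psum (pderiv2 a) x y z
    = (x * z - 1) * G x y z"
  using eq_M1[OF q(2,1,3)] by (simp add: swap_pderiv[where x = x and y = y and z = z] F_sym(1)[where x = x and y = y and z = z]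
      G_sym(1)[where x = x and y = y and z = z])

lemma eq_M3:
  "x * psum (pderiv3 (pderiv1 a)) x y z + y * psum (pderiv3 (pderiv2 a)) x y z + \<beta> * psum (pderiv3 a) x y z
    = (x * y - 1) * G x y z"
  using rainbow.eq_M2[OF rainbow_axioms q(1,3,2)]
  by (simp add: swap_pderiv'[where x = x and y = y and z = z] F_sym(2)[where x = x and y = y and z = z]
      G_sym(2)[where x = x and y = y and z = z])

end

end

section \<open>Boundary values\<close>

text \<open>The factor \<open>y\<close> absorbs the endpoint \<open>y = 0\<close>, where the sign of
  the derivative is unknown; elsewhere only points to the left are compared.\<close>

lemma max_derivative_nonneg:
  fixes f :: "real \<Rightarrow> real"
  assumes "(f has_real_derivative D) (at y)" "y \<ge> 0" "\<And>t. 0 \<le> t \<Longrightarrow> t \<le> y \<Longrightarrow> f t \<le> f y"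
  shows "y * D \<ge> 0"
proof (cases "y = 0")
  case False
  have "D \<ge> 0"
  proof (rule ccontr)
    assume "\<not> D \<ge> 0"
    then obtain d where d: "d > 0" "\<And>h. 0 < h \<Longrightarrow> h < d \<Longrightarrow> f y < f (y - h)"
      using DERIV_neg_dec_left[OF assms(1)] by auto
    define h where "h = min (d / 2) y"
    have "0 < h" "h < d" "h \<le> y" using d False assms(2) by (auto simp: h_def)
    then show False using d(2)[of h] assms(3)[of "y - h"] by auto
  qed
  then show ?thesis using assms(2) by simp
qed simp

text \<open>At a maximum over the box both \<open>y * fy\<close> and \<open>z * fz\<close> are
  nonnegative, on the outer edges too, so the equation there gives
  \<open>c * f \<le> R\<close>.\<close>

lemma transport_le:
  fixes f fy fz c q R :: "real \<Rightarrow> real \<Rightarrow> real"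
  assumes nn: "0 \<le> \<rho>" "0 \<le> \<sigma>"
    and cont: "continuous_on ({0..\<rho>} \<times> {0..\<sigma>}) (\<lambda>(y, z). f y z)"
    and fy: "\<And>y z. y \<in> {0..\<rho>} \<Longrightarrow> z \<in> {0..\<sigma>} \<Longrightarrow> ((\<lambda>t. f t z) has_real_derivative fy y z) (at y)"
    and fz: "\<And>y z. y \<in> {0..\<rho>} \<Longrightarrow> z \<in> {0..\<sigma>} \<Longrightarrow> ((\<lambda>t. f y t) has_real_derivative fz y z) (at z)"
    and q: "\<And>y z. y \<in> {0..\<rho>} \<Longrightarrow> z \<in> {0..\<sigma>} \<Longrightarrow> q y z \<ge> 0"
    and c: "\<And>y z. y \<in> {0..\<rho>} \<Longrightarrow> z \<in> {0..\<sigma>} \<Longrightarrow> c y z \<ge> c0" "c0 > 0"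
    and eq: "\<And>y z. y \<in> {0..\<rho>} \<Longrightarrow> z \<in> {0..\<sigma>} \<Longrightarrow> c y z * f y z + q y z * (y * fy y z + z * fz y z) = R y z"
    and R: "\<And>y z. y \<in> {0..\<rho>} \<Longrightarrow> z \<in> {0..\<sigma>} \<Longrightarrow> R y z \<le> K" "K \<ge> 0"
    and y: "y \<in> {0..\<rho>}" and z: "z \<in> {0..\<sigma>}"
  shows "f y z \<le> K / c0"
proof -
  let ?B = "{0..\<rho>} \<times> {0..\<sigma>}"
  have "\<exists>p\<in>?B. \<forall>p'\<in>?B. (\<lambda>(y, z). f y z) p' \<le> (\<lambda>(y, z). f y z) p"
    by (rule continuous_attains_sup) (use nn cont in \<open>auto intro!: compact_Times\<close>)
  then obtain u v where uv: "u \<in> {0..\<rho>}" "v \<in> {0..\<sigma>}"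
    "\<And>y z. y \<in> {0..\<rho>} \<Longrightarrow> z \<in> {0..\<sigma>} \<Longrightarrow> f y z \<le> f u v" by auto
  have "u * fy u v \<ge> 0" by (rule max_derivative_nonneg[OF fy[OF uv(1,2)]]) (use uv in auto)
  moreover have "v * fz u v \<ge> 0" by (rule max_derivative_nonneg[OF fz[OF uv(1,2)]]) (use uv in auto)
  ultimately have "q u v * (u * fy u v + v * fz u v) \<ge> 0" using q[OF uv(1,2)] by simp
  then have le: "c u v * f u v \<le> K" using eq[OF uv(1,2)] R(1)[OF uv(1,2)] by linarith
  have "f u v \<le> K / c0"
  proof (cases "f u v \<le> 0")
    case True then show ?thesis using R(2) c(2) by (meson divide_nonneg_pos order_trans)
  next
    case False
    then have "c0 * f u v \<le> c u v * f u v" using c(1)[OF uv(1,2)] by (intro mult_right_mono) auto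
    then show ?thesis using le c(2) by (simp add: field_simps)
  qed
  then show ?thesis using uv(3)[OF y z] by simp
qed

lemma transport_bound:
  fixes f fy fz c q R :: "real \<Rightarrow> real \<Rightarrow> real"
  assumes nn: "0 \<le> \<rho>" "0 \<le> \<sigma>"
    and cont: "continuous_on ({0..\<rho>} \<times> {0..\<sigma>}) (\<lambda>(y, z). f y z)"
    and fy: "\<And>y z. y \<in> {0..\<rho>} \<Longrightarrow> z \<in> {0..\<sigma>} \<Longrightarrow> ((\<lambda>t. f t z) has_real_derivative fy y z) (at y)"
    and fz: "\<And>y z. y \<in> {0..\<rho>} \<Longrightarrow> z \<in> {0..\<sigma>} \<Longrightarrow> ((\<lambda>t. f y t) has_real_derivative fz y z) (at z)"
    and q: "\<And>y z. y \<in> {0..\<rho>} \<Longrightarrow> z \<in> {0..\<sigma>} \<Longrightarrow> q y z \<ge> 0"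
    and c: "\<And>y z. y \<in> {0..\<rho>} \<Longrightarrow> z \<in> {0..\<sigma>} \<Longrightarrow> c y z \<ge> c0" "c0 > 0"
    and eq: "\<And>y z. y \<in> {0..\<rho>} \<Longrightarrow> z \<in> {0..\<sigma>} \<Longrightarrow> c y z * f y z + q y z * (y * fy y z + z * fz y z) = R y z"
    and R: "\<And>y z. y \<in> {0..\<rho>} \<Longrightarrow> z \<in> {0..\<sigma>} \<Longrightarrow> \<bar>R y z\<bar> \<le> K"
    and y: "y \<in> {0..\<rho>}" and z: "z \<in> {0..\<sigma>}"
  shows "\<bar>f y z\<bar> \<le> K / c0"
proof -
  have K: "K \<ge> 0" using R[OF y z] by simp
  have "f y z \<le> K / c0"
    by (rule transport_le[OF nn cont fy fz q c eq _ K y z]) (use R in \<open>auto simp: abs_le_iff\<close>)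
  moreover have "- f y z \<le> K / c0"
  proof (rule transport_le[where fy = "\<lambda>y z. - fy y z" and fz = "\<lambda>y z. - fz y z" and R = "\<lambda>y z. - R y z", OF nn _ _ _ q c _ _ K y z])
    show "continuous_on ({0..\<rho>} \<times> {0..\<sigma>}) (\<lambda>(y, z). - f y z)"
      using continuous_on_minus[OF cont] by (simp add: split_beta)
    show "c y z * - f y z + q y z * (y * - fy y z + z * - fz y z) = - R y z" if "y \<in> {0..\<rho>}" "z \<in> {0..\<sigma>}" for y z
      using eq[OF that] by (simp add: algebra_simps)
  qed (use fy fz R in \<open>auto intro!: DERIV_minus simp: abs_le_iff\<close>)
  ultimately show ?thesis by (simp add: abs_le_iff)
qed

text \<open>\<open>G\<close> has the factors \<open>(1 - y) * (1 - z)\<close> and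
  \<open>y * z - 1\<close> in the equations from \<open>D1\<close> and \<open>M1\<close>; this is
  minus their quotient, by which \<open>G\<close> is eliminated.\<close>

definition qfun :: "real \<Rightarrow> real \<Rightarrow> real" where
  "qfun y z = (1 - y) * (1 - z) / (1 - y * z)"

lemma one_minus_mult_pos:
  fixes y z :: real assumes "0 \<le> y" "y < 1" "0 \<le> z" "z < 1" shows "1 - y * z > 0"
  using mult_strict_mono[of y 1 z 1] assms by auto

text \<open>The last bound controls the extra term that a weight
  \<open>(1 - y) powr (- \<nu>)\<close> creates in the transport equation.\<close>

lemma qfun_bounds:
  assumes "0 \<le> y" "y < 1" "0 \<le> z" "z < 1"
  shows "0 \<le> qfun y z" "qfun y z \<le> 1 - y" "qfun y z \<le> 1 - z" "qfun y z * (y / (1 - y)) \<le> 1"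
proof -
  note p = one_minus_mult_pos[OF assms]
  show "0 \<le> qfun y z" using p assms by (simp add: qfun_def)
  have "(1 - y) * (1 - z) \<le> (1 - y) * (1 - y * z)" "(1 - z) * (1 - y) \<le> (1 - z) * (1 - y * z)"
    using assms mult_right_mono[of y 1 z] mult_left_mono[of z 1 y] by (auto intro!: mult_left_mono)
  then show "qfun y z \<le> 1 - y" "qfun y z \<le> 1 - z"
    using p by (auto simp: qfun_def pos_divide_le_eq mult_ac)
  have "qfun y z * (y / (1 - y)) = y * (1 - z) / (1 - y * z)" using assms by (simp add: qfun_def)
  also have "\<dots> \<le> 1" using p assms by (simp add: algebra_simps)
  finally show "qfun y z * (y / (1 - y)) \<le> 1" .
qed

text \<open>Comparison with the geometric sum gives
  \<open>(1 + k) * y ^ k * (1 - y) \<le> 1\<close>. Then the power \<open>1 - \<nu>\<close> is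
  taken, under which \<open>y ^ k \<le> 1\<close> can only grow.\<close>

lemma pow_times_one_minus:
  fixes y \<nu> :: real assumes "0 \<le> y" "y < 1" "0 \<le> \<nu>" "\<nu> \<le> 1"
  shows "(1 - y) powr (1 - \<nu>) * y ^ k \<le> (1 + real k) powr (\<nu> - 1)"
proof -
  have "(\<Sum>i<Suc k. y ^ k) \<le> (\<Sum>i<Suc k. y ^ i)"
    using assms by (intro sum_mono power_decreasing) auto
  then have "(\<Sum>i<Suc k. y ^ k) * (1 - y) \<le> (\<Sum>i<Suc k. y ^ i) * (1 - y)"
    using assms by (intro mult_right_mono) auto
  also have "\<dots> = 1 - y ^ Suc k" by (simp only: one_diff_power_eq mult.commute)
  also have "\<dots> \<le> 1" using assms zero_le_power[of y "Suc k"] by simp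
  finally have "(1 + real k) * y ^ k * (1 - y) \<le> 1" by (simp only: sum_constant card_lessThan of_nat_Suc)
  then have le: "(1 - y) * y ^ k \<le> inverse (1 + real k)" by (simp add: field_simps)
  have "(1 - y) powr (1 - \<nu>) * y ^ k \<le> (1 - y) powr (1 - \<nu>) * (y ^ k) powr (1 - \<nu>)"
  proof (intro mult_left_mono)
    show "y ^ k \<le> (y ^ k) powr (1 - \<nu>)"
    proof (cases "y ^ k = 0")
      case False
      then have "(y ^ k) powr 1 \<le> (y ^ k) powr (1 - \<nu>)"
        using assms by (intro powr_mono') (auto simp: power_le_one zero_le_power)
      then show ?thesis using assms by simp
    next
      case True
      then show ?thesis by (simp only: True powr_ge_zero)
    qed
  qed auto
  also have "\<dots> = ((1 - y) * y ^ k) powr (1 - \<nu>)" using assms by (simp add: powr_mult)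
  also have "\<dots> \<le> (inverse (1 + real k)) powr (1 - \<nu>)" using assms le by (intro powr_mono2) auto
  also have "\<dots> = (1 + real k) powr (\<nu> - 1)" by (simp add: powr_minus[symmetric] inverse_powr)
  finally show ?thesis .
qed

section \<open>Transport equation of the slices and uniform bounds\<close>

context rainbow
begin

definition fs :: "nat \<Rightarrow> real \<Rightarrow> real \<Rightarrow> real" where "fs k y z = psum (slice1 k a) 0 y z"
definition fsy :: "nat \<Rightarrow> real \<Rightarrow> real \<Rightarrow> real" where "fsy k y z = psum (pderiv2 (slice1 k a)) 0 y z"
definition fsz :: "nat \<Rightarrow> real \<Rightarrow> real \<Rightarrow> real" where "fsz k y z = psum (pderiv3 (slice1 k a)) 0 y z"

lemmas reg_slice = regular_slice1[OF regular_a]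

lemma fs_deriv:
  assumes "\<bar>y\<bar> < 1" "\<bar>z\<bar> < 1"
  shows "((\<lambda>t. fs k t z) has_real_derivative fsy k y z) (at y)" "((\<lambda>t. fs k y t) has_real_derivative fsz k y z) (at z)"
  using psum_has_derivative2[OF reg_slice, of 0 y z k] psum_has_derivative3[OF reg_slice, of 0 y z k] assms
  by (simp_all add: fs_def[abs_def] fsy_def fsz_def)

lemma fs_continuous: "continuous_on ({-1<..<1} \<times> {-1<..<1}) (\<lambda>(y, z). fs k y z)"
proof -
  have "continuous_on ({-1<..<1} \<times> {-1<..<1}) ((\<lambda>(x, y, z). psum (slice1 k a) x y z) \<circ> (\<lambda>(y, z). (0, y, z)))"
    by (rule continuous_on_compose[OF _ continuous_on_subset[OF psum_continuous_on[OF reg_slice]]])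
      (auto simp: split_beta intro!: continuous_intros)
  then show ?thesis by (simp add: o_def split_beta fs_def)
qed

lemma fs_continuous_box:
  assumes "\<rho>1 < 1" "\<rho>2 < 1" shows "continuous_on ({0..\<rho>1} \<times> {0..\<rho>2}) (\<lambda>(y, z). fs k y z)"
  by (rule continuous_on_subset[OF fs_continuous]) (use assms in auto)

lemma F_sums: "\<bar>x\<bar> < 1 \<Longrightarrow> \<bar>y\<bar> < 1 \<Longrightarrow> \<bar>z\<bar> < 1 \<Longrightarrow> (\<lambda>k. fs k y z * x ^ k) sums F x y z"
  unfolding fs_def by (rule psum_power_series[OF regular_a])

lemma fs_0: "\<bar>y\<bar> < 1 \<Longrightarrow> \<bar>z\<bar> < 1 \<Longrightarrow> fs 0 y z = F 0 y z"
  using F_sums[of 0 y z] powser_sums_zero[of "\<lambda>k. fs k y z"] sums_unique2 by fastforce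

abbreviation "ec k \<equiv> (real k + \<beta>) * (real k + 1 - \<beta>)"

lemma g_Suc: "(real k + 1) * (real k + 2 * \<beta>) * g (Suc k) = ec k * g k"
proof -
  have "(real k + 2 * \<beta>) * (real k + 1) \<noteq> 0" using beta by auto
  then show ?thesis by (simp add: hcoef_Suc field_simps)
qed

text \<open>\<open>e1\<close> and \<open>e2\<close> are \<open>D1\<close> and \<open>M1\<close> for
  the coefficient of \<open>x ^ k\<close>; adding \<open>qfun y z\<close> times \<open>e2\<close> to
  \<open>e1\<close> removes \<open>G\<close>.\<close>

lemma fs_transport:
  assumes "0 \<le> y" "y < 1" "0 \<le> z" "z < 1"
  shows "(real k + 1) * (real k + 2 * \<beta> + \<beta> * qfun y z) * fs (Suc k) y z
    + (real k + 1) * qfun y z * (y * fsy (Suc k) y z + z * fsz (Suc k) y z) = ec k * fs k y z"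
proof -
  note q = assms
  define A where "A = slice1 (Suc k) a"
  define A0 where "A0 = slice1 k a"
  define b0 where "b0 = slice1 k b"
  define d2 where "d2 = (\<lambda>k m n. pderiv2 A k (m - 1) n)"
  define d3 where "d3 = (\<lambda>k m n. pderiv3 A k m (n - 1))"
  define b3 where "b3 = (\<lambda>k m n. b0 k m (n - 1))"
  define b2 where "b2 = (\<lambda>k m n. b0 k (m - 1) n)"
  define b23 where "b23 = (\<lambda>k m n. b3 k (m - 1) n)"
  have r: "regular A" "regular A0" "regular b0" "regular d2" "regular d3" "regular b3" "regular b2" "regular b23"
    by (auto simp: A_def A0_def b0_def d2_def d3_def b3_def b2_def b23_def intro!: reg regular_slice1)
  let ?p = "\<lambda>c. psum c 0 y z"
  have s: "?p d2 = y * ?p (pderiv2 A)" "?p d3 = z * ?p (pderiv3 A)"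
     "?p b3 = z * ?p b0" "?p b2 = y * ?p b0" "?p b23 = y * ?p b3"
    using psum_shift2(2)[OF r(6), of 0 y z]
    by (auto simp: d2_def d3_def b3_def b2_def b23_def intro!: psum_shift2(2) psum_shift3(2) r reg)
  have "?p (\<lambda>i m n. ((real k + 1) * (real k + 2 * \<beta>)) * A i m n - ec k * A0 i m n)
      = ((real k + 1) * (real k + 2 * \<beta>)) * ?p A - ec k * ?p A0"
    using q by (simp add: psum_diff psum_cmult r reg)
  moreover have "?p (\<lambda>i m n. b0 i m n - b2 i m n - b3 i m n + b23 i m n) = ?p b0 - ?p b2 - ?p b3 + ?p b23"
    using q by (simp add: psum_diff psum_add r reg)
  moreover have "(\<lambda>i m n. ((real k + 1) * (real k + 2 * \<beta>)) * A i m n - ec k * A0 i m n) = (\<lambda>i m n. b0 i m n - b2 i m n - b3 i m n + b23 i m n)"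
    using D1[of "int k"] by (intro ext) (simp add: A_def A0_def b0_def b2_def b3_def b23_def slice1_def add.commute)
  ultimately have "((real k + 1) * (real k + 2 * \<beta>)) * ?p A - ec k * ?p A0 = ?p b0 - ?p b2 - ?p b3 + ?p b23" by simp
  also have "\<dots> = (1 - y) * (1 - z) * ?p b0" unfolding s by algebra
  finally have e1: "((real k + 1) * (real k + 2 * \<beta>)) * ?p A - ec k * ?p A0 = (1 - y) * (1 - z) * ?p b0" .
  have "?p (\<lambda>i m n. (real k + 1) * (d2 i m n + d3 i m n + \<beta> * A i m n)) = (real k + 1) * (?p d2 + ?p d3 + \<beta> * ?p A)"
    using q by (simp add: psum_add psum_cmult r reg)
  moreover have "?p (\<lambda>i m n. b23 i m n - b0 i m n) = ?p b23 - ?p b0" using q by (simp add: psum_diff r)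
  moreover have "(\<lambda>i m n. (real k + 1) * (d2 i m n + d3 i m n + \<beta> * A i m n)) = (\<lambda>i m n. b23 i m n - b0 i m n)"
    using M1[of "int k + 1"]
    by (intro ext) (simp add: A_def b0_def b3_def b23_def d2_def d3_def slice1_def pderiv2_def pderiv3_def algebra_simps)
  ultimately have "(real k + 1) * (?p d2 + ?p d3 + \<beta> * ?p A) = ?p b23 - ?p b0" by simp
  also have "\<dots> = (y * z - 1) * ?p b0" unfolding s by algebra
  finally have e2: "(real k + 1) * (y * ?p (pderiv2 A) + z * ?p (pderiv3 A) + \<beta> * ?p A) = (y * z - 1) * ?p b0"
    unfolding s .
  have nz: "1 - y * z \<noteq> 0" using one_minus_mult_pos[OF q] by simp
  have "qfun y z * ((y * z - 1) * ?p b0) = - ((1 - y) * (1 - z) * ?p b0)"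
  proof -
    have "qfun y z * (1 - y * z) = (1 - y) * (1 - z)" using nz by (simp add: qfun_def)
    then show ?thesis by algebra
  qed
  then have "qfun y z * ((real k + 1) * (y * ?p (pderiv2 A) + z * ?p (pderiv3 A) + \<beta> * ?p A))
     + (((real k + 1) * (real k + 2 * \<beta>)) * ?p A - ec k * ?p A0) = 0" unfolding e1 e2 by simp
  then have "(real k + 1) * (real k + 2 * \<beta> + \<beta> * qfun y z) * ?p A
    + (real k + 1) * qfun y z * (y * ?p (pderiv2 A) + z * ?p (pderiv3 A)) = ec k * ?p A0" by algebra
  then show ?thesis unfolding fs_def fsy_def fsz_def A_def A0_def .
qed

text \<open>The zero order factor of \<open>fs (Suc k)\<close> is at least
  \<open>(k + 1) * (k + 2 * \<beta>)\<close>, so each step multiplies the bound by the absolute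
  ratio of consecutive \<open>g\<close>. Boxes that degenerate to an edge are included on
  purpose.\<close>

lemma fs_bound_box:
  assumes \<rho>: "0 \<le> \<rho>1" "\<rho>1 < 1" "0 \<le> \<rho>2" "\<rho>2 < 1"
    and M: "\<And>y z. y \<in> {0..\<rho>1} \<Longrightarrow> z \<in> {0..\<rho>2} \<Longrightarrow> \<bar>fs 0 y z\<bar> \<le> M"
    and yz: "y \<in> {0..\<rho>1}" "z \<in> {0..\<rho>2}"
  shows "\<bar>fs k y z\<bar> \<le> \<bar>g k\<bar> * M"
  using yz
proof (induction k arbitrary: y z)
  case (Suc k)
  have c0: "(real k + 1) * (real k + 2 * \<beta>) > 0" using beta by auto
  have "\<bar>fs (Suc k) y z\<bar> \<le> (\<bar>ec k\<bar> * (\<bar>g k\<bar> * M)) / ((real k + 1) * (real k + 2 * \<beta>))"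
  proof (rule transport_bound[where fy = "fsy (Suc k)" and fz = "fsz (Suc k)" and R = "\<lambda>y z. ec k * fs k y z"
        and c = "\<lambda>y z. (real k + 1) * (real k + 2 * \<beta> + \<beta> * qfun y z)" and q = "\<lambda>y z. (real k + 1) * qfun y z",
        OF \<rho>(1,3) fs_continuous_box[OF \<rho>(2,4)] _ _ _ _ c0 _ _ Suc.prems])
    fix y z assume yz: "y \<in> {0..\<rho>1}" "z \<in> {0..\<rho>2}"
    then have q: "0 \<le> y" "y < 1" "0 \<le> z" "z < 1" using \<rho> by auto
    then show "((\<lambda>t. fs (Suc k) t z) has_real_derivative fsy (Suc k) y z) (at y)"
      "((\<lambda>t. fs (Suc k) y t) has_real_derivative fsz (Suc k) y z) (at z)" by (auto intro!: fs_deriv)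
    show "0 \<le> (real k + 1) * qfun y z" using qfun_bounds[OF q] by simp
    show "(real k + 1) * (real k + 2 * \<beta>) \<le> (real k + 1) * (real k + 2 * \<beta> + \<beta> * qfun y z)"
      using qfun_bounds(1)[OF q] beta by (intro mult_left_mono) auto
    show "(real k + 1) * (real k + 2 * \<beta> + \<beta> * qfun y z) * fs (Suc k) y z
      + (real k + 1) * qfun y z * (y * fsy (Suc k) y z + z * fsz (Suc k) y z) = ec k * fs k y z"
      by (rule fs_transport[OF q])
    show "\<bar>ec k * fs k y z\<bar> \<le> \<bar>ec k\<bar> * (\<bar>g k\<bar> * M)"
      unfolding abs_mult[of "ec k"] by (intro mult_left_mono Suc.IH yz) auto
  qed
  also have "\<dots> = \<bar>ec k * g k\<bar> * M / ((real k + 1) * (real k + 2 * \<beta>))" by (simp add: abs_mult)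
  also have "ec k * g k = (real k + 1) * (real k + 2 * \<beta>) * g (Suc k)" by (rule g_Suc[symmetric])
  also have "\<bar>(real k + 1) * (real k + 2 * \<beta>) * g (Suc k)\<bar> * M / ((real k + 1) * (real k + 2 * \<beta>)) = \<bar>g (Suc k)\<bar> * M"
    using c0 unfolding abs_mult[of "(real k + 1) * (real k + 2 * \<beta>)"] abs_of_pos[OF c0]
    by (metis less_irrefl mult.assoc nonzero_mult_div_cancel_left)
  finally show ?case .
qed (use M in simp)

text \<open>The bounds climb with the dimension: \<open>Hsum\<close> bounds \<open>F\<close> on an
  axis, \<open>M0\<close> on a face and \<open>gsum * M0\<close> in the cube, each step multiplying
  by the sum of the \<open>g\<close>.\<close>

definition "gsum = (\<Sum>k. \<bar>g k\<bar>)"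
definition "Hsum = (\<Sum>k. \<bar>hcoef \<beta> (3 * \<beta>) k\<bar>)"
definition "M0 = Hsum * gsum"

lemma summable_g: "summable (\<lambda>k. \<bar>g k\<bar>)" using hcoef_summable[of "2 * \<beta>"] beta by simp
lemma summable_h: "summable (\<lambda>k. \<bar>hcoef \<beta> (3 * \<beta>) k\<bar>)" using hcoef_summable[of "3 * \<beta>"] beta by simp

lemma sum_nonneg_consts: "gsum \<ge> 0" "Hsum \<ge> 0" "M0 \<ge> 0"
  using suminf_nonneg[OF summable_g] suminf_nonneg[OF summable_h] by (auto simp: gsum_def Hsum_def M0_def)

lemma F_axis: assumes "\<bar>z\<bar> < 1" shows "F 0 0 z = hfun \<beta> (3 * \<beta>) z" "F z 0 0 = hfun \<beta> (3 * \<beta>) z" "F 0 z 0 = hfun \<beta> (3 * \<beta>) z"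
proof -
  have "fs k 0 0 = hcoef \<beta> (3 * \<beta>) k" for k
  proof -
    have "fs k 0 0 = infsum (pterm (slice1 k a) 0 0 0) {(0, 0, 0)}"
      unfolding fs_def psum_def by (rule infsum_cong_neutral) (auto simp: pterm_def power_0_left split: if_splits)
    then show ?thesis using a_axis[of k] sym13[of "int k" 0 0] by (simp add: pterm_def slice1_def)
  qed
  then show "F z 0 0 = hfun \<beta> (3 * \<beta>) z"
    using F_sums[of z 0 0] assms sums_unique unfolding hfun_def by fastforce
  then show "F 0 0 z = hfun \<beta> (3 * \<beta>) z" "F 0 z 0 = hfun \<beta> (3 * \<beta>) z" by (metis F_sym)+
qed

lemma power_series_bound:
  fixes c d :: "nat \<Rightarrow> real"
  assumes "\<And>k. \<bar>c k\<bar> \<le> \<bar>d k\<bar> * M" "summable (\<lambda>k. \<bar>d k\<bar>)" "\<bar>x\<bar> \<le> 1" "(\<lambda>k. c k * x ^ k) sums S"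
  shows "\<bar>S\<bar> \<le> (\<Sum>k. \<bar>d k\<bar>) * M"
proof -
  have le: "norm (c k * x ^ k) \<le> \<bar>d k\<bar> * M" for k
  proof -
    have "norm (c k * x ^ k) \<le> \<bar>c k\<bar> * 1"
      using assms(3) by (simp add: abs_mult power_abs mult_left_le power_le_one)
    then show ?thesis using assms(1)[of k] by simp
  qed
  have "norm (suminf (\<lambda>k. c k * x ^ k)) \<le> (\<Sum>k. \<bar>d k\<bar> * M)"
    by (rule norm_suminf_le[OF le summable_mult2[OF assms(2)]])
  then show ?thesis using sums_unique[OF assms(4)] suminf_mult2[OF assms(2), of M] by simp
qed

lemma hfun_bound: "\<bar>z\<bar> \<le> 1 \<Longrightarrow> \<bar>hfun \<beta> (3 * \<beta>) z\<bar> \<le> Hsum" "\<bar>z\<bar> \<le> 1 \<Longrightarrow> \<bar>hfun \<beta> (2 * \<beta>) z\<bar> \<le> gsum"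
  using power_series_bound[of "hcoef \<beta> (3 * \<beta>)" "hcoef \<beta> (3 * \<beta>)" 1 z] hfun_summable[of "3 * \<beta>" z \<beta>]
    power_series_bound[of g g 1 z] hfun_summable[of "2 * \<beta>" z \<beta>] summable_g summable_h beta
  by (auto simp: hfun_def Hsum_def gsum_def summable_sums)

lemma fs_edge_bound: assumes "0 \<le> z" "z < 1" shows "\<bar>fs k 0 z\<bar> \<le> \<bar>g k\<bar> * Hsum"
  by (rule fs_bound_box[of 0 z]) (use assms in \<open>auto simp: fs_0 F_axis intro!: hfun_bound\<close>)

lemma F0_bound: assumes "0 \<le> y" "y < 1" "0 \<le> z" "z < 1" shows "\<bar>F 0 y z\<bar> \<le> M0"
proof -
  have "\<bar>F y 0 z\<bar> \<le> gsum * Hsum"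
    unfolding gsum_def
    by (rule power_series_bound[OF fs_edge_bound[OF assms(3,4)] summable_g _ F_sums]) (use assms in auto)
  then show ?thesis by (simp add: M0_def F_sym(1)[of 0 y] mult.commute)
qed

lemma fs_bound: assumes "0 \<le> y" "y < 1" "0 \<le> z" "z < 1" shows "\<bar>fs k y z\<bar> \<le> \<bar>g k\<bar> * M0"
  by (rule fs_bound_box[of y z]) (use assms F0_bound in \<open>auto simp: fs_0\<close>)

lemma F_bound: assumes "0 \<le> x" "x < 1" "0 \<le> y" "y < 1" "0 \<le> z" "z < 1" shows "\<bar>F x y z\<bar> \<le> gsum * M0"
  unfolding gsum_def
  by (rule power_series_bound[OF fs_bound[OF assms(3-6)] summable_g _ F_sums]) (use assms in auto)

text \<open>The terms of positive degree share a factor \<open>x\<close>, and what remains is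
  bounded uniformly in \<open>y\<close> and \<open>z\<close>. A lower bound on the face
  \<open>x = 0\<close> therefore extends to a collar.\<close>

lemma F_near_face:
  assumes "0 \<le> x" "x < 1" "0 \<le> y" "y < 1" "0 \<le> z" "z < 1"
  shows "\<bar>F x y z - F 0 y z\<bar> \<le> gsum * M0 * x"
proof -
  have s: "(\<lambda>k. fs (Suc k) y z * x ^ Suc k) sums (F x y z - F 0 y z)"
    using F_sums[of x y z] assms sums_Suc_iff[of "\<lambda>k. fs k y z * x ^ k"] by (simp add: fs_0)
  have le: "norm (fs (Suc k) y z * x ^ Suc k) \<le> \<bar>g (Suc k)\<bar> * (M0 * x)" for k
  proof -
    have "norm (fs (Suc k) y z * x ^ Suc k) = \<bar>fs (Suc k) y z\<bar> * x * x ^ k" using assms by (simp add: abs_mult)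
    also have "\<dots> \<le> (\<bar>g (Suc k)\<bar> * M0) * x * 1"
      using assms sum_nonneg_consts by (intro mult_mono fs_bound) (auto simp: power_le_one)
    finally show ?thesis by (simp add: mult_ac)
  qed
  have sg: "summable (\<lambda>k. \<bar>g (Suc k)\<bar>)" using summable_g by (subst summable_Suc_iff)
  have "norm (F x y z - F 0 y z) \<le> (\<Sum>k. \<bar>g (Suc k)\<bar> * (M0 * x))"
    unfolding sums_unique[OF s] by (rule norm_suminf_le[OF le summable_mult2[OF sg]])
  also have "\<dots> = (\<Sum>k. \<bar>g (Suc k)\<bar>) * (M0 * x)" by (rule suminf_mult2[OF sg, symmetric])
  also have "\<dots> \<le> gsum * (M0 * x)"
    using suminf_split_head[OF summable_g] assms sum_nonneg_consts by (intro mult_right_mono) (auto simp: gsum_def)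
  finally show ?thesis by (simp add: mult_ac)
qed

section \<open>Limit at the faces through 1\<close>

text \<open>A Hoelder exponent. Below \<open>2 * \<beta> - 1\<close> the weighted series of
  \<open>g\<close> converges, since \<open>g\<close> decays like the power
  \<open>- 2 * \<beta>\<close>; below 1 the factor \<open>1 - y\<close> is dominated by its
  power.\<close>

definition "\<nu> = min (1/2) ((2 * \<beta> - 1) / 2)"
lemma nu: "0 < \<nu>" "\<nu> < 1" "\<nu> < 2 * \<beta> - 1" using beta by (auto simp: \<nu>_def min_def)

definition "K1 = Hsum * (\<Sum>k. (1 + real k) powr \<nu> * \<bar>g k\<bar>)"

lemma summable_g_nu: "summable (\<lambda>k. (1 + real k) powr \<nu> * \<bar>g k\<bar>)"
  using hcoef_summable_weighted[of "2 * \<beta>" \<nu> \<beta>] beta nu by simp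

lemma K1_nonneg: "K1 \<ge> 0"
  using suminf_nonneg[OF summable_g_nu] sum_nonneg_consts by (auto simp: K1_def)

text \<open>Termwise, \<open>pow_times_one_minus\<close> trades the singular factor for the summable
  weight \<open>(1 + k) powr \<nu>\<close>. On a face the derivative thus grows at most like
  \<open>(1 - y) powr (\<nu> - 1)\<close>.\<close>

lemma F0_deriv_bound:
  assumes "0 \<le> y" "y < 1" "0 \<le> z" "z < 1"
  shows "(1 - y) powr (1 - \<nu>) * \<bar>psum (pderiv1 a) y 0 z\<bar> \<le> K1"
proof -
  have s: "(\<lambda>k. (real k + 1) * fs (Suc k) 0 z * y ^ k) sums psum (pderiv1 a) y 0 z"
    using psum_power_series[OF regular_pderiv1[OF regular_a], of y 0 z] assms
    by (simp add: psum_slice1_pderiv1 fs_def)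
  then have s': "(\<lambda>k. (1 - y) powr (1 - \<nu>) * ((real k + 1) * fs (Suc k) 0 z * y ^ k)) sums ((1 - y) powr (1 - \<nu>) * psum (pderiv1 a) y 0 z)"
    by (rule sums_mult)
  have le: "norm ((1 - y) powr (1 - \<nu>) * ((real k + 1) * fs (Suc k) 0 z * y ^ k)) \<le> ((1 + real (Suc k)) powr \<nu> * \<bar>g (Suc k)\<bar>) * Hsum" for k
  proof -
    have "norm ((1 - y) powr (1 - \<nu>) * ((real k + 1) * fs (Suc k) 0 z * y ^ k)) = ((1 - y) powr (1 - \<nu>) * y ^ k) * ((1 + real k) * \<bar>fs (Suc k) 0 z\<bar>)"
      using assms by (simp add: abs_mult mult_ac)
    also have "\<dots> \<le> (1 + real k) powr (\<nu> - 1) * ((1 + real k) * (\<bar>g (Suc k)\<bar> * Hsum))"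
      using assms nu by (intro mult_mono pow_times_one_minus fs_edge_bound mult_left_mono) auto
    also have "\<dots> = (1 + real k) powr \<nu> * \<bar>g (Suc k)\<bar> * Hsum"
      using powr_add[of "1 + real k" "\<nu> - 1" 1] by (simp add: mult_ac)
    also have "\<dots> \<le> (1 + real (Suc k)) powr \<nu> * \<bar>g (Suc k)\<bar> * Hsum"
      using nu sum_nonneg_consts by (intro mult_right_mono powr_mono2) auto
    finally show ?thesis .
  qed
  have sg: "summable (\<lambda>k. (1 + real (Suc k)) powr \<nu> * \<bar>g (Suc k)\<bar>)" using summable_g_nu by (subst summable_Suc_iff)
  have "norm ((1 - y) powr (1 - \<nu>) * psum (pderiv1 a) y 0 z) \<le> (\<Sum>k. (1 + real (Suc k)) powr \<nu> * \<bar>g (Suc k)\<bar> * Hsum)"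
    unfolding sums_unique[OF s'] by (rule norm_suminf_le[OF le summable_mult2[OF sg]])
  also have "\<dots> = (\<Sum>k. (1 + real (Suc k)) powr \<nu> * \<bar>g (Suc k)\<bar>) * Hsum" by (rule suminf_mult2[OF sg, symmetric])
  also have "\<dots> \<le> K1"
    using suminf_split_head[OF summable_g_nu] sum_nonneg_consts unfolding K1_def
    by (subst mult.commute) (intro mult_left_mono, auto)
  finally show ?thesis by (simp add: abs_mult)
qed

lemma fs0_deriv:
  assumes "\<bar>y\<bar> < 1" "\<bar>z\<bar> < 1"
  shows "fsy 0 y z = psum (pderiv1 a) y 0 z" "fsz 0 y z = psum (pderiv1 a) z 0 y"
proof -
  have ev: "\<forall>\<^sub>F t in nhds u. \<bar>t\<bar> < 1" if "\<bar>u\<bar> < 1" for u :: real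
    using eventually_nhds_in_open[of "{-1<..<1}" u] that by (auto simp: abs_less_iff elim!: eventually_mono)
  have "((\<lambda>t. fs 0 t z) has_real_derivative psum (pderiv1 a) y 0 z) (at y)"
    by (rule DERIV_cong_ev[OF refl _ refl, THEN iffD1, OF _ psum_has_derivative1[OF regular_a]])
      (use assms ev[OF assms(1)] in \<open>auto simp: fs_0 F_sym(1)[of 0] elim!: eventually_mono\<close>)
  then show "fsy 0 y z = psum (pderiv1 a) y 0 z" using fs_deriv(1)[OF assms, of 0] DERIV_unique by blast
  have "((\<lambda>t. fs 0 y t) has_real_derivative psum (pderiv1 a) z 0 y) (at z)"
  proof (rule DERIV_cong_ev[OF refl _ refl, THEN iffD1, OF _ psum_has_derivative1[OF regular_a]])
    have "F t 0 y = F 0 y t" for t using F_sym by metis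
    then show "\<forall>\<^sub>F t in nhds z. F t 0 y = fs 0 y t"
      using assms ev[OF assms(2)] by (auto simp: fs_0 elim!: eventually_mono)
  qed (use assms in auto)
  then show "fsz 0 y z = psum (pderiv1 a) z 0 y" using fs_deriv(2)[OF assms, of 0] DERIV_unique by blast
qed

definition "K2 = 2 * K1 + \<beta> * M0"

lemma source_bound:
  assumes "0 \<le> y" "y < 1" "0 \<le> z" "z < 1"
  shows "\<bar>qfun y z * (y * fsy 0 y z + z * fsz 0 y z + \<beta> * fs 0 y z)\<bar> \<le> K2 * (1 - y) powr \<nu>"
proof -
  note qb = qfun_bounds[OF assms]
  have u: "\<bar>psum (pderiv1 a) u 0 v\<bar> \<le> K1 * (1 - u) powr (\<nu> - 1)" if "0 \<le> u" "u < 1" "0 \<le> v" "v < 1" for u v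
  proof -
    have "(1 - u) powr (1 - \<nu>) > 0" using that by simp
    then have "\<bar>psum (pderiv1 a) u 0 v\<bar> \<le> K1 / (1 - u) powr (1 - \<nu>)"
      using F0_deriv_bound[OF that] by (simp add: pos_le_divide_eq mult.commute)
    also have "\<dots> = K1 * (1 - u) powr (\<nu> - 1)" using powr_minus_divide[of "1 - u" "1 - \<nu>"] by simp
    finally show ?thesis .
  qed
  have s: "(1 - u) powr \<nu> = (1 - u) * (1 - u) powr (\<nu> - 1)" if "u < 1" for u
    using that powr_add[of "1 - u" 1 "\<nu> - 1"] by simp
  \<comment> \<open>The derivative in \<open>z\<close> is singular at \<open>z = 1\<close> rather
    than \<open>y = 1\<close>; this is compensated because \<open>qfun\<close> is at most the
    smaller of \<open>1 - y\<close> and \<open>1 - z\<close>.\<close>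
  have k: "qfun y z * (1 - z) powr (\<nu> - 1) \<le> (1 - y) powr \<nu>"
  proof (cases "1 - z \<le> 1 - y")
    case True
    have "qfun y z * (1 - z) powr (\<nu> - 1) \<le> (1 - z) * (1 - z) powr (\<nu> - 1)" using qb by (intro mult_right_mono) auto
    also have "\<dots> = (1 - z) powr \<nu>" using s[of z] assms by simp
    also have "\<dots> \<le> (1 - y) powr \<nu>" using True nu assms by (intro powr_mono2) auto
    finally show ?thesis .
  next
    case False
    have "qfun y z * (1 - z) powr (\<nu> - 1) \<le> (1 - y) * (1 - y) powr (\<nu> - 1)"
      using qb False nu assms by (intro mult_mono powr_mono2') auto
    then show ?thesis using s[of y] assms by simp
  qed
  have k': "qfun y z * (1 - y) powr (\<nu> - 1) \<le> (1 - y) powr \<nu>"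
    unfolding s[OF assms(2)] using qb by (intro mult_right_mono) auto
  have k0: "qfun y z \<le> (1 - y) powr \<nu>"
  proof -
    have "(1 - y) powr 1 \<le> (1 - y) powr \<nu>" using assms nu by (intro powr_mono') auto
    then show ?thesis using qb assms by simp
  qed
  have a1: "\<bar>qfun y z * (y * fsy 0 y z)\<bar> \<le> K1 * (1 - y) powr \<nu>"
  proof -
    have "\<bar>qfun y z * (y * fsy 0 y z)\<bar> = qfun y z * (y * \<bar>fsy 0 y z\<bar>)" using qb assms by (simp add: abs_mult)
    also have "\<dots> \<le> qfun y z * (1 * (K1 * (1 - y) powr (\<nu> - 1)))"
      using qb assms u[OF assms] by (intro mult_left_mono mult_mono) (auto simp: fs0_deriv)
    also have "\<dots> = K1 * (qfun y z * (1 - y) powr (\<nu> - 1))" by simp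
    also have "\<dots> \<le> K1 * (1 - y) powr \<nu>" by (intro mult_left_mono k' K1_nonneg)
    finally show ?thesis .
  qed
  have a2: "\<bar>qfun y z * (z * fsz 0 y z)\<bar> \<le> K1 * (1 - y) powr \<nu>"
  proof -
    have "\<bar>qfun y z * (z * fsz 0 y z)\<bar> = qfun y z * (z * \<bar>fsz 0 y z\<bar>)" using qb assms by (simp add: abs_mult)
    also have "\<dots> \<le> qfun y z * (1 * (K1 * (1 - z) powr (\<nu> - 1)))"
      using qb assms u[OF assms(3,4,1,2)] by (intro mult_left_mono mult_mono) (auto simp: fs0_deriv)
    also have "\<dots> = K1 * (qfun y z * (1 - z) powr (\<nu> - 1))" by simp
    also have "\<dots> \<le> K1 * (1 - y) powr \<nu>" by (intro mult_left_mono k K1_nonneg)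
    finally show ?thesis .
  qed
  have a3: "\<bar>qfun y z * (\<beta> * fs 0 y z)\<bar> \<le> \<beta> * M0 * (1 - y) powr \<nu>"
  proof -
    have "\<bar>qfun y z * (\<beta> * fs 0 y z)\<bar> = \<beta> * (qfun y z * \<bar>fs 0 y z\<bar>)" using qb assms beta by (simp add: abs_mult)
    also have "\<dots> \<le> \<beta> * ((1 - y) powr \<nu> * M0)"
      using qb assms beta k0 F0_bound[OF assms] by (intro mult_left_mono mult_mono) (auto simp: fs_0)
    finally show ?thesis by (simp add: mult_ac)
  qed
  have "\<bar>qfun y z * (y * fsy 0 y z + z * fsz 0 y z + \<beta> * fs 0 y z)\<bar>
      \<le> \<bar>qfun y z * (y * fsy 0 y z)\<bar> + \<bar>qfun y z * (z * fsz 0 y z)\<bar> + \<bar>qfun y z * (\<beta> * fs 0 y z)\<bar>"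
    by (simp add: distrib_left)
  then show ?thesis using a1 a2 a3 by (simp add: K2_def algebra_simps)
qed

text \<open>As \<open>y\<close> tends to 1, \<open>qfun\<close> vanishes and the transport recursion
  becomes that of \<open>g\<close>. The difference solves the same equation with a source of order
  \<open>(1 - y) powr \<nu>\<close>; dividing by this power keeps the maximum principle, because the
  extra term is at most \<nu> < 2 \<beta>. The constant may depend on \<open>k\<close>.\<close>

lemma slice_difference_bound:
  "\<exists>C\<ge>0. \<forall>y z. 0 \<le> y \<longrightarrow> y < 1 \<longrightarrow> 0 \<le> z \<longrightarrow> z < 1 \<longrightarrow> \<bar>fs k y z - g k * fs 0 y z\<bar> \<le> C * (1 - y) powr \<nu>"
proof (induction k)
  case 0
  then show ?case by (intro exI[of _ 0]) auto
next
  case (Suc k)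
  then obtain C where C: "C \<ge> 0" "\<And>y z. 0 \<le> y \<Longrightarrow> y < 1 \<Longrightarrow> 0 \<le> z \<Longrightarrow> z < 1 \<Longrightarrow> \<bar>fs k y z - g k * fs 0 y z\<bar> \<le> C * (1 - y) powr \<nu>" by blast
  define K where "K = \<bar>ec k\<bar> * C + (real k + 1) * \<bar>g (Suc k)\<bar> * K2"
  define c0 where "c0 = (real k + 1) * (real k + 2 * \<beta> - \<nu>)"
  have c0: "c0 > 0" using nu by (simp add: c0_def)
  define W where "W k y z = fs k y z - g k * fs 0 y z" for k y z
  define Wy where "Wy k y z = fsy k y z - g k * fsy 0 y z" for k y z
  define Wz where "Wz k y z = fsz k y z - g k * fsz 0 y z" for k y z
  have main: "\<bar>W (Suc k) y z\<bar> \<le> K / c0 * (1 - y) powr \<nu>" if yz: "0 \<le> y" "y < 1" "0 \<le> z" "z < 1" for y z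
  proof -
    have "\<bar>W (Suc k) y z * (1 - y) powr (- \<nu>)\<bar> \<le> K / c0"
    proof (rule transport_bound[where f = "\<lambda>y z. W (Suc k) y z * (1 - y) powr (- \<nu>)"
          and fy = "\<lambda>y z. (Wy (Suc k) y z + \<nu> / (1 - y) * W (Suc k) y z) * (1 - y) powr (- \<nu>)"
          and fz = "\<lambda>y z. Wz (Suc k) y z * (1 - y) powr (- \<nu>)"
          and R = "\<lambda>y z. (ec k * W k y z - (real k + 1) * g (Suc k) * (qfun y z * (y * fsy 0 y z + z * fsz 0 y z + \<beta> * fs 0 y z))) * (1 - y) powr (- \<nu>)"
          and c = "\<lambda>y z. (real k + 1) * (real k + 2 * \<beta> + \<beta> * qfun y z - \<nu> * (qfun y z * (y / (1 - y))))"
          and q = "\<lambda>y z. (real k + 1) * qfun y z" and \<rho> = y and \<sigma> = z, OF yz(1,3) _ _ _ _ _ c0])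
      have "continuous_on ({0..y} \<times> {0..z}) (\<lambda>p. (1 - fst p) powr (- \<nu>))"
        using yz by (intro continuous_on_powr' continuous_intros) auto
      then show "continuous_on ({0..y} \<times> {0..z}) (\<lambda>(y, z). W (Suc k) y z * (1 - y) powr (- \<nu>))"
        using fs_continuous_box[OF yz(2,4), of "Suc k"] fs_continuous_box[OF yz(2,4), of 0]
        unfolding W_def split_beta by (intro continuous_on_mult continuous_on_diff continuous_on_const)
    next
      fix u v assume uv: "u \<in> {0..y}" "v \<in> {0..z}"
      then have q: "0 \<le> u" "u < 1" "0 \<le> v" "v < 1" using yz by auto
      note qb = qfun_bounds[OF q]
      have dy: "((\<lambda>t. W (Suc k) t v) has_real_derivative Wy (Suc k) u v) (at u)"
        unfolding W_def Wy_def using q by (intro DERIV_diff DERIV_cmult fs_deriv) auto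
      have dz: "((\<lambda>t. W (Suc k) u t) has_real_derivative Wz (Suc k) u v) (at v)"
        unfolding W_def Wz_def using q by (intro DERIV_diff DERIV_cmult fs_deriv) auto
      have "((\<lambda>t. (1 - t) powr (- \<nu>)) has_real_derivative \<nu> / (1 - u) * (1 - u) powr (- \<nu>)) (at u)"
        using q by (auto intro!: derivative_eq_intros simp: powr_diff divide_simps)
      from DERIV_mult[OF dy this]
      show "((\<lambda>t. W (Suc k) t v * (1 - t) powr (- \<nu>)) has_real_derivative
          (Wy (Suc k) u v + \<nu> / (1 - u) * W (Suc k) u v) * (1 - u) powr (- \<nu>)) (at u)"
        by (simp add: algebra_simps)
      show "((\<lambda>t. W (Suc k) u t * (1 - u) powr (- \<nu>)) has_real_derivative Wz (Suc k) u v * (1 - u) powr (- \<nu>)) (at v)"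
        by (rule DERIV_cmult_right[OF dz])
      show "0 \<le> (real k + 1) * qfun u v" using qb by simp
      show "c0 \<le> (real k + 1) * (real k + 2 * \<beta> + \<beta> * qfun u v - \<nu> * (qfun u v * (u / (1 - u))))"
      proof -
        have "\<nu> * (qfun u v * (u / (1 - u))) \<le> \<nu> * 1" by (rule mult_left_mono[OF qb(4)]) (use nu in simp)
        moreover have "\<beta> * qfun u v \<ge> 0" using qb beta by simp
        ultimately show ?thesis unfolding c0_def by (intro mult_left_mono) auto
      qed
      have eq: "(real k + 1) * (real k + 2 * \<beta> + \<beta> * qfun u v) * W (Suc k) u v + (real k + 1) * qfun u v * (u * Wy (Suc k) u v + v * Wz (Suc k) u v)
         = ec k * W k u v - (real k + 1) * g (Suc k) * (qfun u v * (u * fsy 0 u v + v * fsz 0 u v + \<beta> * fs 0 u v))"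
        using fs_transport[OF q, of k] g_Suc[of k] unfolding W_def Wy_def Wz_def by algebra
      let ?\<omega> = "(1 - u) powr (- \<nu>)"
      have "(real k + 1) * (real k + 2 * \<beta> + \<beta> * qfun u v - \<nu> * (qfun u v * (u / (1 - u)))) * (W (Suc k) u v * ?\<omega>)
         + (real k + 1) * qfun u v * (u * ((Wy (Suc k) u v + \<nu> / (1 - u) * W (Suc k) u v) * ?\<omega>) + v * (Wz (Suc k) u v * ?\<omega>))
         = ((real k + 1) * (real k + 2 * \<beta> + \<beta> * qfun u v) * W (Suc k) u v + (real k + 1) * qfun u v * (u * Wy (Suc k) u v + v * Wz (Suc k) u v)) * ?\<omega>"
        by (simp add: algebra_simps)
      then show "(real k + 1) * (real k + 2 * \<beta> + \<beta> * qfun u v - \<nu> * (qfun u v * (u / (1 - u)))) * (W (Suc k) u v * ?\<omega>)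
         + (real k + 1) * qfun u v * (u * ((Wy (Suc k) u v + \<nu> / (1 - u) * W (Suc k) u v) * ?\<omega>) + v * (Wz (Suc k) u v * ?\<omega>))
         = (ec k * W k u v - (real k + 1) * g (Suc k) * (qfun u v * (u * fsy 0 u v + v * fsz 0 u v + \<beta> * fs 0 u v))) * ?\<omega>"
        unfolding eq .
      have "\<bar>ec k * W k u v\<bar> \<le> \<bar>ec k\<bar> * (C * (1 - u) powr \<nu>)"
        unfolding abs_mult[of "ec k"] W_def by (intro mult_left_mono C q) auto
      moreover have "\<bar>(real k + 1) * g (Suc k) * (qfun u v * (u * fsy 0 u v + v * fsz 0 u v + \<beta> * fs 0 u v))\<bar>
          \<le> (real k + 1) * \<bar>g (Suc k)\<bar> * (K2 * (1 - u) powr \<nu>)"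
        unfolding abs_mult[of "(real k + 1) * g (Suc k)"] using source_bound[OF q] by (intro mult_mono) (auto simp: abs_mult)
      ultimately have "\<bar>ec k * W k u v - (real k + 1) * g (Suc k) * (qfun u v * (u * fsy 0 u v + v * fsz 0 u v + \<beta> * fs 0 u v))\<bar> \<le> K * (1 - u) powr \<nu>"
        unfolding K_def by (simp add: algebra_simps)
      then have "\<bar>ec k * W k u v - (real k + 1) * g (Suc k) * (qfun u v * (u * fsy 0 u v + v * fsz 0 u v + \<beta> * fs 0 u v))\<bar> * ?\<omega> \<le> K * (1 - u) powr \<nu> * ?\<omega>"
        by (rule mult_right_mono) simp
      also have "K * (1 - u) powr \<nu> * ?\<omega> = K" using q by (simp add: powr_minus)
      finally show "\<bar>(ec k * W k u v - (real k + 1) * g (Suc k) * (qfun u v * (u * fsy 0 u v + v * fsz 0 u v + \<beta> * fs 0 u v))) * ?\<omega>\<bar> \<le> K"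
        by (simp add: abs_mult)
    qed (use yz in auto)
    then have "\<bar>W (Suc k) y z\<bar> * (1 - y) powr (- \<nu>) * (1 - y) powr \<nu> \<le> K / c0 * (1 - y) powr \<nu>"
      by (intro mult_right_mono) (auto simp: abs_mult)
    moreover have "(1 - y) powr (- \<nu>) * (1 - y) powr \<nu> = 1" using yz by (simp flip: powr_add)
    ultimately show ?thesis by (simp only: mult.assoc mult_1_right)
  qed
  have "K / c0 \<ge> 0" using main[of 0 0] by force
  then show ?case using main unfolding W_def by blast
qed

text \<open>The tail in \<open>k\<close> is small uniformly by the majorant \<open>g\<close>, so
  only the constants of finitely many slices matter; \<delta> is chosen from their sum.\<close>

lemma F_limit:
  assumes "\<epsilon> > 0"
  obtains \<delta> where "\<delta> > 0" "\<And>x y z. 0 \<le> x \<Longrightarrow> x < 1 \<Longrightarrow> 0 \<le> y \<Longrightarrow> y < 1 \<Longrightarrow> 0 \<le> z \<Longrightarrow> z < 1 \<Longrightarrow>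
    1 - y < \<delta> \<Longrightarrow> \<bar>F x y z - hfun \<beta> (2 * \<beta>) x * F 0 y z\<bar> < \<epsilon>"
proof -
  obtain C where C: "\<And>k. C k \<ge> 0" "\<And>k y z. 0 \<le> y \<Longrightarrow> y < 1 \<Longrightarrow> 0 \<le> z \<Longrightarrow> z < 1 \<Longrightarrow>
      \<bar>fs k y z - g k * fs 0 y z\<bar> \<le> C k * (1 - y) powr \<nu>"
    using slice_difference_bound by metis
  have st: "summable (\<lambda>k. 2 * M0 * \<bar>g k\<bar>)" by (intro summable_mult summable_g)
  obtain N where N: "norm (\<Sum>k. 2 * M0 * \<bar>g (k + N)\<bar>) < \<epsilon> / 2"
    using suminf_exist_split[OF _ st, of "\<epsilon> / 2"] assms by auto
  define S where "S = (\<Sum>k<N. C k) + 1"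
  have S: "S > 0" using sum_nonneg[of "{..<N}" C] C(1) by (simp add: S_def add_nonneg_pos)
  define \<delta> where "\<delta> = (\<epsilon> / 2 / S) powr (1 / \<nu>)"
  have d: "\<delta> > 0" using assms S by (simp add: \<delta>_def)
  show ?thesis
  proof (rule that[OF d])
    fix x y z :: real assume q: "0 \<le> x" "x < 1" "0 \<le> y" "y < 1" "0 \<le> z" "z < 1" and yd: "1 - y < \<delta>"
    let ?t = "\<lambda>k. (fs k y z - g k * fs 0 y z) * x ^ k"
    have gs: "(\<lambda>k. g k * x ^ k) sums hfun \<beta> (2 * \<beta>) x"
      using hfun_summable[of "2 * \<beta>" x \<beta>] q beta by (simp add: hfun_def summable_sums)
    have s: "?t sums (F x y z - hfun \<beta> (2 * \<beta>) x * F 0 y z)"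
      using sums_diff[OF F_sums[of x y z] sums_mult2[OF gs, of "fs 0 y z"]] q by (simp add: fs_0 algebra_simps)
    have le: "\<bar>?t k\<bar> \<le> \<bar>fs k y z - g k * fs 0 y z\<bar>" for k
      using q by (simp add: abs_mult mult_left_le power_le_one)
    have le2: "\<bar>?t k\<bar> \<le> 2 * M0 * \<bar>g k\<bar>" for k
    proof -
      have "\<bar>fs k y z - g k * fs 0 y z\<bar> \<le> \<bar>fs k y z\<bar> + \<bar>g k\<bar> * \<bar>fs 0 y z\<bar>"
        using abs_triangle_ineq4[of "fs k y z" "g k * fs 0 y z"] by (simp add: abs_mult)
      also have "\<dots> \<le> \<bar>g k\<bar> * M0 + \<bar>g k\<bar> * M0"
        using fs_bound[of y z k] fs_bound[of y z 0] q by (intro add_mono mult_left_mono) auto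
      also have "\<dots> = 2 * M0 * \<bar>g k\<bar>" by simp
      finally show ?thesis using le[of k] by linarith
    qed
    have sN: "summable (\<lambda>k. 2 * M0 * \<bar>g (k + N)\<bar>)" using st by (subst summable_iff_shift)
    have tail: "\<bar>\<Sum>k. ?t (k + N)\<bar> \<le> (\<Sum>k. 2 * M0 * \<bar>g (k + N)\<bar>)"
      using norm_suminf_le[OF _ sN, of "\<lambda>k. ?t (k + N)"] le2 by simp
    have "\<bar>\<Sum>k<N. ?t k\<bar> \<le> (\<Sum>k<N. C k * (1 - y) powr \<nu>)"
      by (rule order_trans[OF sum_abs sum_mono], rule order_trans[OF le]) (use C(2)[of y z] q in auto)
    also have "\<dots> = (\<Sum>k<N. C k) * (1 - y) powr \<nu>" by (simp add: sum_distrib_right)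
    also have "\<dots> \<le> S * (1 - y) powr \<nu>" by (intro mult_right_mono) (auto simp: S_def)
    also have "(1 - y) powr \<nu> < \<delta> powr \<nu>" using yd q nu by (intro powr_less_mono2) auto
    also have "\<delta> powr \<nu> = \<epsilon> / 2 / S" using nu assms S by (simp add: \<delta>_def powr_powr)
    finally have head: "\<bar>\<Sum>k<N. ?t k\<bar> < \<epsilon> / 2" using S by simp
    have "F x y z - hfun \<beta> (2 * \<beta>) x * F 0 y z = (\<Sum>k. ?t (k + N)) + (\<Sum>k<N. ?t k)"
      using suminf_split_initial_segment[OF sums_summable[OF s], of N] sums_unique[OF s] by simp
    then show "\<bar>F x y z - hfun \<beta> (2 * \<beta>) x * F 0 y z\<bar> < \<epsilon>"
      using head tail N unfolding real_norm_def by linarith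
  qed
qed

abbreviation "gf \<equiv> hfun \<beta> (2 * \<beta>)"
abbreviation "hf \<equiv> hfun \<beta> (3 * \<beta>)"

text \<open>\<open>F_limit\<close> is used at \<open>(x, y, z)\<close> and, by symmetry, at
  \<open>(z, y, 0)\<close>, which turns \<open>F 0 y z\<close> into \<open>gf z * hf y\<close>; then
  \<open>hf\<close> is continuous at 1. The estimate is uniform in \<open>x\<close> and
  \<open>z\<close>, also where they approach 1 themselves.\<close>

lemma F_boundary:
  assumes "\<epsilon> > 0"
  obtains \<delta> where "\<delta> > 0" "\<And>x y z. 0 \<le> x \<Longrightarrow> x < 1 \<Longrightarrow> 0 \<le> y \<Longrightarrow> y < 1 \<Longrightarrow> 0 \<le> z \<Longrightarrow> z < 1 \<Longrightarrow>
    1 - y < \<delta> \<Longrightarrow> \<bar>F x y z - hf 1 * gf x * gf z\<bar> < \<epsilon>"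
proof -
  let ?e = "\<epsilon> / (3 * (gsum + 1))" and ?e' = "\<epsilon> / (3 * (gsum + 1) * (gsum + 1))"
  have g1: "gsum + 1 > 0" using sum_nonneg_consts by simp
  have e: "?e > 0" "?e' > 0" "\<epsilon> / 3 > 0" using assms g1 by auto
  have ee: "(gsum + 1) * ?e = \<epsilon> / 3" "(gsum + 1) * ((gsum + 1) * ?e') = \<epsilon> / 3"
  proof -
    have "c * (\<epsilon> / (3 * c)) = \<epsilon> / 3" "c * (c * (\<epsilon> / (3 * c * c))) = \<epsilon> / 3" if "c > 0" for c :: real
      using that by auto
    from this[OF g1] show "(gsum + 1) * ?e = \<epsilon> / 3" "(gsum + 1) * ((gsum + 1) * ?e') = \<epsilon> / 3" by blast+
  qed
  obtain d1 where d1: "d1 > 0" "\<And>x y z. 0 \<le> x \<Longrightarrow> x < 1 \<Longrightarrow> 0 \<le> y \<Longrightarrow> y < 1 \<Longrightarrow> 0 \<le> z \<Longrightarrow> z < 1 \<Longrightarrow>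
    1 - y < d1 \<Longrightarrow> \<bar>F x y z - gf x * F 0 y z\<bar> < \<epsilon> / 3" using F_limit[OF e(3)] by blast
  obtain d2 where d2: "d2 > 0" "\<And>x y z. 0 \<le> x \<Longrightarrow> x < 1 \<Longrightarrow> 0 \<le> y \<Longrightarrow> y < 1 \<Longrightarrow> 0 \<le> z \<Longrightarrow> z < 1 \<Longrightarrow>
    1 - y < d2 \<Longrightarrow> \<bar>F x y z - gf x * F 0 y z\<bar> < ?e" using F_limit[OF e(1)] by blast
  have "continuous_on {-1..1} hf" using hfun_continuous[of "3 * \<beta>" \<beta>] beta by simp
  from bspec[OF this[unfolded continuous_on_iff], of 1]
  have "\<exists>d3>0. \<forall>t\<in>{-1..1}. dist t 1 < d3 \<longrightarrow> dist (hf t) (hf 1) < ?e'" using e(2) by simp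
  then obtain d3 where d3: "d3 > 0" "\<And>t. t \<in> {-1..1} \<Longrightarrow> dist t 1 < d3 \<Longrightarrow> dist (hf t) (hf 1) < ?e'" by blast
  show ?thesis
  proof (rule that[of "min d1 (min d2 d3)"])
    fix x y z :: real assume q: "0 \<le> x" "x < 1" "0 \<le> y" "y < 1" "0 \<le> z" "z < 1" and yd: "1 - y < min d1 (min d2 d3)"
    have gx: "\<bar>gf x\<bar> \<le> gsum + 1" "\<bar>gf z\<bar> \<le> gsum + 1" using hfun_bound(2)[of x] hfun_bound(2)[of z] q by auto
    have 1: "\<bar>F x y z - gf x * F 0 y z\<bar> < \<epsilon> / 3" using d1(2)[of x y z] q yd by auto
    have "F z y 0 = F 0 y z" by (metis F_sym)
    then have "\<bar>F 0 y z - gf z * hf y\<bar> < ?e" using d2(2)[of z y 0] q yd by (auto simp: F_axis)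
    then have "\<bar>gf x\<bar> * \<bar>F 0 y z - gf z * hf y\<bar> \<le> (gsum + 1) * ?e" using gx by (intro mult_mono) auto
    then have 2: "\<bar>gf x * F 0 y z - gf x * (gf z * hf y)\<bar> \<le> \<epsilon> / 3"
      unfolding ee by (simp only: abs_mult[symmetric] right_diff_distrib)
    have "dist (hf y) (hf 1) < ?e'" using d3(2)[of y] q yd by (auto simp: dist_real_def)
    then have "\<bar>gf x\<bar> * (\<bar>gf z\<bar> * \<bar>hf y - hf 1\<bar>) \<le> (gsum + 1) * ((gsum + 1) * ?e')"
      using gx g1 by (intro mult_mono) (auto simp: dist_real_def)
    also have "\<dots> = \<epsilon> / 3" by (rule ee)
    finally have 3: "\<bar>gf x * (gf z * hf y) - hf 1 * gf x * gf z\<bar> \<le> \<epsilon> / 3"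
      by (simp add: abs_mult[symmetric] algebra_simps)
    show "\<bar>F x y z - hf 1 * gf x * gf z\<bar> < \<epsilon>" using 1 2 3 by linarith
  qed (use d1 d2 d3 in auto)
qed

end

section \<open>Lower bounds near the faces of the cube\<close>

lemma second_derivative_nonneg:
  fixes E E' :: "real \<Rightarrow> real"
  assumes d: "d > 0" "\<And>s. \<bar>s - t\<bar> < d \<Longrightarrow> (E has_real_derivative E' s) (at s)"
    and dd: "(E' has_real_derivative E2) (at t)"
    and min: "\<And>s. \<bar>s - t\<bar> < d \<Longrightarrow> E t \<le> E s"
  shows "E' t = 0" "E2 \<ge> 0"
proof -
  show z: "E' t = 0"
    using DERIV_local_min[of E "E' t" t d] d min by (auto simp: abs_minus_commute)
  show "E2 \<ge> 0"
  proof (rule ccontr)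
    assume "\<not> E2 \<ge> 0"
    then obtain e where e: "e > 0" "\<And>h. 0 < h \<Longrightarrow> h < e \<Longrightarrow> E' (t + h) < E' t"
      using DERIV_neg_dec_right[OF dd] by auto
    define h where "h = min d e / 2"
    have h: "0 < h" "h < d" "h < e" using d(1) e(1) by (auto simp: h_def min_def)
    have "\<exists>u>t. u < t + h \<and> E (t + h) - E t = (t + h - t) * E' u"
      by (rule MVT2) (use h d in auto)
    then obtain u where u: "t < u" "u < t + h" "E (t + h) - E t = h * E' u" by auto
    have "E' u < 0" using e(2)[of "u - t"] u h z by simp
    then have "h * E' u < 0" using h(1) by (rule mult_pos_neg[rotated])
    then have "E (t + h) < E t" using u(3) by linarith
    then show False using min[of "t + h"] h by simp
  qed
qed

lemma powr_one_minus_deriv: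
  fixes x :: real
  assumes "x < 1"
  shows "((\<lambda>t. (1 - t) powr \<gamma>) has_real_derivative - \<gamma> / (1 - x) * (1 - x) powr \<gamma>) (at x)"
  using assms by (auto intro!: derivative_eq_intros simp: powr_diff)

lemma psum_hypergeometric_operator:
  assumes a: "regular a" and q: "\<bar>x\<bar> < 1" "\<bar>y\<bar> < 1" "\<bar>z\<bar> < 1"
  shows "psum (\<lambda>k m n. (of_int k + 1) * (of_int k + c) * a (k + 1) m n - (of_int k + \<beta>) * (of_int k + 1 - \<beta>) * a k m n) x y z
    = x * (1 - x) * psum (pderiv1 (pderiv1 a)) x y z + (c - 2 * x) * psum (pderiv1 a) x y z - \<beta> * (1 - \<beta>) * psum a x y z"
proof -
  define d where "d = pderiv1 a"
  define d1 where "d1 = (\<lambda>k m n. d (k - 1) m n)"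
  define e1 where "e1 = (\<lambda>k m n. pderiv1 d (k - 1) m n)"
  define e2 where "e2 = (\<lambda>k m n. e1 (k - 1) m n)"
  have r1: "regular d" "regular e1"
    by (auto simp: d_def e1_def intro!: a regular_pderiv1 regular_shift)
  have r: "regular d" "regular d1" "regular e1" "regular e2"
    using regular_shift[OF r1(1)] regular_shift[OF r1(2)] r1 by (auto simp: d1_def e2_def)
  have s: "psum d1 x y z = x * psum d x y z" "psum e1 x y z = x * psum (pderiv1 d) x y z"
    "psum e2 x y z = x * psum e1 x y z"
    using psum_shift[OF r(1), of x y z] psum_shift[OF regular_pderiv1[OF r(1)], of x y z] psum_shift[OF r(3), of x y z]
    by (simp_all only: d1_def e1_def e2_def)
  have "(\<lambda>k m n. (of_int k + 1) * (of_int k + c) * a (k + 1) m n - (of_int k + \<beta>) * (of_int k + 1 - \<beta>) * a k m n)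
     = (\<lambda>k m n. e1 k m n - e2 k m n + c * d k m n - 2 * d1 k m n - (\<beta> * (1 - \<beta>)) * a k m n)"
    by (intro ext) (simp add: d_def d1_def e1_def e2_def pderiv1_def algebra_simps)
  moreover have "psum (\<lambda>k m n. e1 k m n - e2 k m n + c * d k m n - 2 * d1 k m n - (\<beta> * (1 - \<beta>)) * a k m n) x y z
      = psum e1 x y z - psum e2 x y z + c * psum d x y z - 2 * psum d1 x y z - (\<beta> * (1 - \<beta>)) * psum a x y z"
    by (simp add: psum_add psum_diff psum_cmult r a q regular_add regular_diff regular_cmult)
  ultimately show ?thesis unfolding s by (simp add: d_def algebra_simps)
qed

text \<open>The coefficients are placed on the first axis of a three-variable array, so that
  differentiability and the operator come from the results on \<open>psum\<close>.\<close>

lemma hfun_ode: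
  assumes "\<gamma> > 1"
  obtains h1 h2 where
    "\<And>x. \<bar>x\<bar> < 1 \<Longrightarrow> (hfun \<beta> \<gamma> has_real_derivative h1 x) (at x)"
    "\<And>x. \<bar>x\<bar> < 1 \<Longrightarrow> (h1 has_real_derivative h2 x) (at x)"
    "\<And>x. \<bar>x\<bar> < 1 \<Longrightarrow> x * (1 - x) * h2 x + (\<gamma> - 2 * x) * h1 x - \<beta> * (1 - \<beta>) * hfun \<beta> \<gamma> x = 0"
proof -
  define c where "c = (\<lambda>(k::int) (m::int) (n::int). if 0 \<le> k \<and> m = 0 \<and> n = 0 then hcoef \<beta> \<gamma> (nat k) else 0)"
  obtain C where C: "C > 0" "\<And>n. \<bar>hcoef \<beta> \<gamma> n\<bar> \<le> C" using hcoef_bounded[of \<gamma> \<beta>] assms by auto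
  have reg: "regular c"
    by (rule regularI[of _ C 0]) (use C in \<open>auto simp: c_def\<close>)
  have sl: "psum (slice1 k c) 0 0 0 = hcoef \<beta> \<gamma> k" for k
  proof -
    have "psum (slice1 k c) 0 0 0 = infsum (pterm (slice1 k c) 0 0 0) {(0, 0, 0)}"
      unfolding psum_def by (rule infsum_cong_neutral) (auto simp: pterm_def power_0_left split: if_splits)
    then show ?thesis by (simp add: pterm_def slice1_def c_def)
  qed
  have eq: "hfun \<beta> \<gamma> x = psum c x 0 0" if "\<bar>x\<bar> < 1" for x
    using sums_unique[OF psum_power_series[OF reg, of x 0 0]] that by (simp add: hfun_def sl)
  show ?thesis
  proof (rule that[of "\<lambda>x. psum (pderiv1 c) x 0 0" "\<lambda>x. psum (pderiv1 (pderiv1 c)) x 0 0"])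
    fix x :: real assume x: "\<bar>x\<bar> < 1"
    have "\<forall>\<^sub>F t in nhds x. t \<in> {-1<..<1}" by (rule eventually_nhds_in_open) (use x in auto)
    then have ev: "\<forall>\<^sub>F t in nhds x. psum c t 0 0 = hfun \<beta> \<gamma> t"
      by (rule eventually_mono) (auto simp: eq abs_less_iff)
    show "(hfun \<beta> \<gamma> has_real_derivative psum (pderiv1 c) x 0 0) (at x)"
      by (rule DERIV_cong_ev[OF refl ev refl, THEN iffD1, OF psum_has_derivative1[OF reg x]]) auto
    show "((\<lambda>x. psum (pderiv1 c) x 0 0) has_real_derivative psum (pderiv1 (pderiv1 c)) x 0 0) (at x)"
      by (rule psum_has_derivative1[OF regular_pderiv1[OF reg] x]) auto
    have "(of_int k + 1) * (of_int k + \<gamma>) * c (k + 1) m n - (of_int k + \<beta>) * (of_int k + 1 - \<beta>) * c k m n = 0" for k m n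
    proof (cases "0 \<le> k \<and> m = 0 \<and> n = 0")
      case True
      then obtain j where j: "k = int j" using nonneg_int_cases by blast
      have "(real j + \<gamma>) * (real j + 1) \<noteq> 0" using assms by auto
      then show ?thesis using True by (simp add: c_def j nat_add_distrib hcoef_Suc field_simps)
    next
      case False then show ?thesis by (cases "k = -1") (auto simp: c_def)
    qed
    then have "(\<lambda>k m n. (of_int k + 1) * (of_int k + \<gamma>) * c (k + 1) m n - (of_int k + \<beta>) * (of_int k + 1 - \<beta>) * c k m n) = (\<lambda>k m n. 0)"
      by (intro ext)
    moreover have "psum (\<lambda>k m n. 0) x 0 0 = 0" using psum_cmult[of 0 c x 0 0] by simp
    ultimately show "x * (1 - x) * psum (pderiv1 (pderiv1 c)) x 0 0 + (\<gamma> - 2 * x) * psum (pderiv1 c) x 0 0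
        - \<beta> * (1 - \<beta>) * hfun \<beta> \<gamma> x = 0"
      using psum_hypergeometric_operator[OF reg x, of 0 0 \<gamma> \<beta>] eq[OF x] by simp
  qed
qed

context rainbow
begin

lemma gf_1: "gf 1 = Gamma (2 * \<beta>) * Gamma (2 * \<beta> - 1) / (Gamma \<beta> * Gamma (3 * \<beta> - 1))"
  using hfun_at_1[of "2 * \<beta>" \<beta>] beta by (simp add: rGamma_inverse_Gamma field_simps)

lemma hf_1: "hf 1 = Gamma (3 * \<beta>) * Gamma (3 * \<beta> - 1) / (Gamma (2 * \<beta>) * Gamma (4 * \<beta> - 1))"
  using hfun_at_1[of "3 * \<beta>" \<beta>] beta by (simp add: rGamma_inverse_Gamma field_simps)

lemma gf_1_pos: "gf 1 > 0" and hf_1_pos: "hf 1 > 0"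
  using beta by (auto simp: gf_1 hf_1 intro!: divide_pos_pos mult_pos_pos)

text \<open>The estimates use \<gamma> > 0, \<gamma> > (\<beta> - 1) / 2 and \<gamma> < \<beta> - 1
  / 2; half of the upper bound satisfies all three.\<close>

definition "\<gamma> = (2 * \<beta> - 1) / 4"

lemma gam: "\<gamma> > 0" "2 * \<gamma> + 1 - 2 * \<beta> < 0" "3 * \<gamma> + 1 - \<beta> > 0" "\<gamma> + 1 - 2 * \<beta> < 0" "2 * \<gamma> + 1 - \<beta> > 0"
  using beta by (auto simp: \<gamma>_def field_simps)

text \<open>Maximum principle for \<open>(g - \<delta>) / (1 - x)\<^sup>\<gamma>\<close>: the power \<open>(1 - x)\<^sup>\<gamma>\<close> is a strict
  supersolution of the hypergeometric equation.\<close>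

lemma gf_lower:
  assumes b1: "\<beta> > 1" obtains \<delta> where "\<delta> > 0" "\<And>x. 0 \<le> x \<Longrightarrow> x \<le> 1 \<Longrightarrow> gf x \<ge> \<delta>"
proof -
  define \<delta> where "\<delta> = min (1/2) (gf 1 / 2)"
  have de: "\<delta> > 0" "\<delta> < 1" "\<delta> < gf 1" using gf_1_pos by (auto simp: \<delta>_def min_def)
  have cont: "continuous_on {-1..1} gf" using hfun_continuous[of "2 * \<beta>" \<beta>] beta by simp
  have "gf x \<ge> \<delta>" if x: "0 \<le> x" "x \<le> 1" for x
  proof (rule ccontr)
    assume neg: "\<not> gf x \<ge> \<delta>"
    from bspec[OF cont[unfolded continuous_on_iff], of 1]
    have "\<exists>d>0. \<forall>t\<in>{-1..1}. dist t 1 < d \<longrightarrow> dist (gf t) (gf 1) < gf 1 - \<delta>" using de by simp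
    then obtain d where d: "d > 0" "\<And>t. t \<in> {-1..1} \<Longrightarrow> dist t 1 < d \<Longrightarrow> dist (gf t) (gf 1) < gf 1 - \<delta>" by blast
    have near: "gf t > \<delta>" if "0 \<le> t" "t \<le> 1" "1 - t < d" for t
    proof -
      have "\<bar>gf t - gf 1\<bar> < gf 1 - \<delta>" using d(2)[of t] that by (auto simp: dist_real_def)
      then show ?thesis by linarith
    qed
    \<comment> \<open>The quotient is minimised on \<open>[0, r]\<close> only, where its denominator
      is bounded away from 0; from \<open>r\<close> on, \<open>gf\<close> exceeds \<delta> by
      continuity at 1.\<close>
    define r where "r = 1 - min d 1 / 2"
    have r: "0 < r" "r < 1" "1 - r < d" using d(1) by (auto simp: r_def min_def)
    have xr: "x < r" using near[OF x] neg r x by (cases "x < r") auto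
    let ?f = "\<lambda>t. (gf t - \<delta>) / (1 - t) powr \<gamma>"
    have "continuous_on {0..r} ?f"
      using r by (intro continuous_intros continuous_on_subset[OF cont]) auto
    then obtain m where m: "m \<in> {0..r}" "\<And>t. t \<in> {0..r} \<Longrightarrow> ?f m \<le> ?f t"
      using continuous_attains_inf[of "{0..r}" ?f] r by auto
    have "?f x < 0" using neg xr r by (simp add: divide_neg_pos)
    then have fm: "?f m < 0" using m(2)[of x] x xr by auto
    have "m \<noteq> 0" using fm de by auto
    moreover have "gf r > \<delta>" using near[of r] r by simp
    then have "?f r > 0" using r by (intro divide_pos_pos) auto
    then have "m \<noteq> r" using fm by auto
    ultimately have mm: "0 < m" "m < r" using m(1) by auto
    obtain h1 h2 where h: "\<And>x. \<bar>x\<bar> < 1 \<Longrightarrow> (gf has_real_derivative h1 x) (at x)"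
      "\<And>x. \<bar>x\<bar> < 1 \<Longrightarrow> (h1 has_real_derivative h2 x) (at x)"
      "\<And>x. \<bar>x\<bar> < 1 \<Longrightarrow> x * (1 - x) * h2 x + (2 * \<beta> - 2 * x) * h1 x - \<beta> * (1 - \<beta>) * gf x = 0"
      using hfun_ode[of "2 * \<beta>" \<beta>] beta by auto
    define \<mu> where "\<mu> = - ?f m"
    have mu: "\<mu> > 0" using fm by (simp add: \<mu>_def)
    let ?E = "\<lambda>t. gf t - \<delta> + \<mu> * (1 - t) powr \<gamma>"
    let ?E1 = "\<lambda>t. h1 t + \<mu> * (- \<gamma> / (1 - t) * (1 - t) powr \<gamma>)"
    let ?w = "(1 - m) powr \<gamma>"
    let ?E2 = "h2 m + \<mu> * (\<gamma> * (\<gamma> - 1) / (1 - m)\<^sup>2 * ?w)"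
    have m1: "0 < 1 - m" using mm r by simp
    have Em: "?E m = 0" using m1 by (simp add: \<mu>_def)
    have Epos: "?E t \<ge> 0" if "t \<in> {0..r}" for t
    proof -
      have "- \<mu> \<le> ?f t" using m(2)[OF that] by (simp add: \<mu>_def)
      moreover have "(1 - t) powr \<gamma> > 0" using that r by auto
      ultimately show ?thesis by (simp add: pos_le_divide_eq)
    qed
    have dd: "((\<lambda>t. - \<gamma> / (1 - t) * (1 - t) powr \<gamma>) has_real_derivative \<gamma> * (\<gamma> - 1) / (1 - m)\<^sup>2 * ?w) (at m)"
    proof -
      have "((\<lambda>t. - \<gamma> / (1 - t)) has_real_derivative - \<gamma> / (1 - m)\<^sup>2) (at m)"
        using m1 by (auto intro!: derivative_eq_intros simp: power2_eq_square)
      from DERIV_mult[OF this powr_one_minus_deriv[of m \<gamma>]] m1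
      have d: "((\<lambda>t. - \<gamma> / (1 - t) * (1 - t) powr \<gamma>) has_real_derivative
        - \<gamma> / (1 - m)\<^sup>2 * ?w + - \<gamma> / (1 - m) * ?w * (- \<gamma> / (1 - m))) (at m)" by simp
      have "- \<gamma> / (1 - m)\<^sup>2 * ?w + - \<gamma> / (1 - m) * ?w * (- \<gamma> / (1 - m)) = \<gamma> * (\<gamma> - 1) / (1 - m)\<^sup>2 * ?w"
        using m1 by (simp add: power2_eq_square divide_simps) (simp add: algebra_simps)
      then show ?thesis using d by simp
    qed
    have e0: "min m (r - m) > 0" using mm by simp
    have e1: "(?E has_real_derivative ?E1 s) (at s)" if "\<bar>s - m\<bar> < min m (r - m)" for s
    proof -
      have "(?E has_real_derivative h1 s - 0 + \<mu> * (- \<gamma> / (1 - s) * (1 - s) powr \<gamma>)) (at s)"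
        by (intro DERIV_add DERIV_diff DERIV_cmult DERIV_const h powr_one_minus_deriv) (use that r in auto)
      then show ?thesis by simp
    qed
    have e2: "(?E1 has_real_derivative ?E2) (at m)"
      by (intro DERIV_add DERIV_cmult h dd) (use mm r in auto)
    have e3: "?E m \<le> ?E s" if "\<bar>s - m\<bar> < min m (r - m)" for s
      unfolding Em using that by (intro Epos) auto
    note z = second_derivative_nonneg[of _ m ?E ?E1 ?E2, OF e0 e1 e2 e3]
    let ?D = "\<gamma> * (\<gamma> - 1) * m - (2 * \<beta> - 2 * m) * \<gamma> - \<beta> * (1 - \<beta>) * (1 - m)"
    have D: "?D < 0"
    proof -
      \<comment> \<open>\<open>?D\<close> is affine in \<open>m\<close>, and its values at 0 and 1
        are both negative by the choice of \<gamma>.\<close>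
      have "?D = - ((1 - m) * (\<beta> * (2 * \<gamma> + 1 - \<beta>))) - m * (\<gamma> * (2 * \<beta> - 1 - \<gamma>))" by algebra
      moreover have "(1 - m) * (\<beta> * (2 * \<gamma> + 1 - \<beta>)) > 0" "m * (\<gamma> * (2 * \<beta> - 1 - \<gamma>)) > 0"
        using gam beta m1 mm by simp_all
      ultimately show ?thesis by linarith
    qed
    have z1: "?E1 m = 0" using z(1) .
    have "0 \<le> m * (1 - m) * ?E2" using mm m1 by (intro mult_nonneg_nonneg z(2)) auto
    also have "\<dots> = m * (1 - m) * ?E2 + (2 * \<beta> - 2 * m) * ?E1 m - \<beta> * (1 - \<beta>) * ?E m"
      unfolding z1 Em by simp
    also have "\<dots> = \<delta> * (\<beta> * (1 - \<beta>)) + \<mu> * (?w / (1 - m)) * ?D"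
    proof -
      have key: "m * (1 - m) * (k2 + \<mu> * e) + (2 * \<beta> - 2 * m) * (k1 + \<mu> * k) - \<beta> * (1 - \<beta>) * (p - \<delta> + \<mu> * w)
        = \<delta> * (\<beta> * (1 - \<beta>)) + \<mu> * t * ?D"
        if "m * (1 - m) * k2 + (2 * \<beta> - 2 * m) * k1 - \<beta> * (1 - \<beta>) * p = 0" "(1 - m) * e = \<gamma> * (\<gamma> - 1) * t"
          "k = - \<gamma> * t" "w = (1 - m) * t" for k2 e k1 k p w t
      proof -
        have "m * (1 - m) * (k2 + \<mu> * e) = m * (1 - m) * k2 + \<mu> * m * ((1 - m) * e)" by (simp add: algebra_simps)
        then show ?thesis unfolding that(2-4) using that(1) by (simp add: algebra_simps)
      qed
      show ?thesis
        by (rule key, rule h(3)) (use m1 mm r in \<open>simp_all add: power2_eq_square\<close>)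
    qed
    also have "\<dots> < 0"
      using D mu m1 de b1 by (intro add_nonpos_neg mult_nonneg_nonpos mult_pos_neg divide_pos_pos mult_pos_pos) auto
    finally show False by simp
  qed
  then show ?thesis using that de by blast
qed

section \<open>Positivity on a face\<close>

lemma psum_ray:
  assumes "regular c" "\<bar>s * u\<bar> < 1" "\<bar>s * v\<bar> < 1"
  shows "((\<lambda>s. psum c 0 (s * u) (s * v)) has_real_derivative
    psum (pderiv2 c) 0 (s * u) (s * v) * u + psum (pderiv3 c) 0 (s * u) (s * v) * v) (at s)"
proof -
  have "((\<lambda>s. psum c 0 (s * u) (s * v)) has_real_derivative
    psum (pderiv1 c) 0 (s * u) (s * v) * 0 + psum (pderiv2 c) 0 (s * u) (s * v) * u + psum (pderiv3 c) 0 (s * u) (s * v) * v) (at s)"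
    by (rule psum_chain[OF assms(1)]) (use assms in \<open>auto intro!: derivative_eq_intros\<close>)
  then show ?thesis by simp
qed

text \<open>Elimination of \<open>G\<close> from the equations on the face \<open>x = 0\<close>, so that the second order part becomes
  the second derivative along the ray through the origin.\<close>

lemma F0_ray_equation:
  assumes q: "0 \<le> u" "u < 1" "0 \<le> v" "v < 1"
  defines "a' \<equiv> u / (1 - u)" and "b' \<equiv> v / (1 - v)"
  shows "u\<^sup>2 * psum (pderiv2 (pderiv2 a)) 0 u v + 2 * (u * v) * psum (pderiv3 (pderiv2 a)) 0 u v + v\<^sup>2 * psum (pderiv3 (pderiv3 a)) 0 u v
    = \<beta> * (1 - \<beta>) * (a' + b') * F 0 u v
      - u * psum (pderiv2 a) 0 u v * (2 * \<beta> * (1 + a') - 2 * a' + \<beta> * (1 + a') - \<beta> * b')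
      - v * psum (pderiv3 a) 0 u v * (2 * \<beta> * (1 + b') - 2 * b' + \<beta> * (1 + b') - \<beta> * a')"
proof -
  have q': "\<bar>0::real\<bar> < 1" "\<bar>u\<bar> < 1" "\<bar>v\<bar> < 1" using q by auto
  have A: "a' * (1 - u) = u" "b' * (1 - v) = v" "(1 + a') * (1 - u) = 1" "(1 + b') * (1 - v) = 1"
    using q by (simp_all add: a'_def b'_def field_simps)
  have 1: "u * (1 - u) * psum (pderiv2 (pderiv2 a)) 0 u v + (2 * \<beta> - 2 * u) * psum (pderiv2 a) 0 u v - \<beta> * (1 - \<beta>) * F 0 u v = (1 - v) * G 0 u v"
    using eq_D2[OF q'] by simp
  have 2: "v * (1 - v) * psum (pderiv3 (pderiv3 a)) 0 u v + (2 * \<beta> - 2 * v) * psum (pderiv3 a) 0 u v - \<beta> * (1 - \<beta>) * F 0 u v = (1 - u) * G 0 u v"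
    using eq_D3[OF q'] by simp
  have 3: "v * psum (pderiv3 (pderiv2 a)) 0 u v + \<beta> * psum (pderiv2 a) 0 u v = - G 0 u v"
    using eq_M2[OF q'] by simp
  have 4: "u * psum (pderiv3 (pderiv2 a)) 0 u v + \<beta> * psum (pderiv3 a) 0 u v = - G 0 u v"
    using eq_M3[OF q'] by simp
  have key: "u\<^sup>2 * p11 + 2 * (u * v) * p12 + v\<^sup>2 * p22 = \<beta> * (1 - \<beta>) * (a' + b') * p
      - u * p1 * (2 * \<beta> * (1 + a') - 2 * a' + \<beta> * (1 + a') - \<beta> * b')
      - v * p2 * (2 * \<beta> * (1 + b') - 2 * b' + \<beta> * (1 + b') - \<beta> * a')"
    if h: "u * (1 - u) * p11 + (2 * \<beta> - 2 * u) * p1 - \<beta> * (1 - \<beta>) * p = (1 - v) * g0"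
      "v * (1 - v) * p22 + (2 * \<beta> - 2 * v) * p2 - \<beta> * (1 - \<beta>) * p = (1 - u) * g0"
      "v * p12 + \<beta> * p1 = - g0" "u * p12 + \<beta> * p2 = - g0" for p11 p12 p22 p1 p2 p g0
  proof -
    have "u\<^sup>2 * p11 = (a' * (1 - u)) * u * p11" unfolding A(1) by algebra
    then have "u\<^sup>2 * p11 = a' * (u * (1 - u) * p11)" by algebra
    then have e1: "u\<^sup>2 * p11 = a' * ((1 - v) * g0 - (2 * \<beta> - 2 * u) * p1 + \<beta> * (1 - \<beta>) * p)" using h(1) by algebra
    have "v\<^sup>2 * p22 = (b' * (1 - v)) * v * p22" unfolding A(2) by algebra
    then have "v\<^sup>2 * p22 = b' * (v * (1 - v) * p22)" by algebra
    then have e2: "v\<^sup>2 * p22 = b' * ((1 - u) * g0 - (2 * \<beta> - 2 * v) * p2 + \<beta> * (1 - \<beta>) * p)" using h(2) by algebra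
    have "a' = (1 + a') * u" using A(1) by (simp add: algebra_simps)
    moreover have "b' = (1 + b') * v" using A(2) by (simp add: algebra_simps)
    ultimately have a1: "a' = (1 + a') * u" "b' = (1 + b') * v" by blast+
    \<comment> \<open>\<open>G\<close> is eliminated with both mixed equations, in proportions for
      which \<open>g1\<close> and \<open>g2\<close> contribute \<open>- (u * v * p12)\<close> each.
      Together they supply the mixed term of the second derivative along the ray.\<close>
    have g1: "a' * (1 - v) * g0 = - (u * v * p12) - \<beta> * (1 + a') * u * p1 + \<beta> * a' * v * p2"
    proof -
      have "a' * g0 = - (1 + a') * (u * v * p12 + \<beta> * u * p1)" using a1(1) h(3) by algebra
      moreover have "v * g0 = - (u * v * p12 + \<beta> * v * p2)" using h(4) by algebra
      ultimately show ?thesis by algebra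
    qed
    have g2: "b' * (1 - u) * g0 = - (u * v * p12) - \<beta> * (1 + b') * v * p2 + \<beta> * b' * u * p1"
    proof -
      have "b' * g0 = - (1 + b') * (u * v * p12 + \<beta> * v * p2)" using a1(2) h(4) by algebra
      moreover have "u * g0 = - (u * v * p12 + \<beta> * u * p1)" using h(3) by algebra
      ultimately show ?thesis by algebra
    qed
    have f1: "a' * (2 * \<beta> - 2 * u) * p1 = u * p1 * (2 * \<beta> * (1 + a') - 2 * a')" using a1(1) by algebra
    have f2: "b' * (2 * \<beta> - 2 * v) * p2 = v * p2 * (2 * \<beta> * (1 + b') - 2 * b')" using a1(2) by algebra
    show ?thesis unfolding e1 e2 using g1 g2 f1 f2 by algebra
  qed
  show ?thesis by (rule key[OF 1 2 3 4])
qed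

text \<open>Up to a positive factor this is the ray equation applied to
  \<open>(1 - u) powr \<gamma> * (1 - v) powr \<gamma>\<close>, with \<open>a' = u / (1 - u)\<close>
  and \<open>b' = v / (1 - v)\<close>. Completing the square in \<open>a' - b'\<close> leaves terms
  whose signs are those in \<open>gam\<close>.\<close>

lemma supersolution_form:
  fixes a' b' :: real
  assumes "a' \<ge> 0" "b' \<ge> 0" "a' + b' > 0"
  shows "\<gamma>\<^sup>2 * (a' + b')\<^sup>2 - \<gamma> * (a'\<^sup>2 + b'\<^sup>2) - \<beta> * (1 - \<beta>) * (a' + b')
    - \<gamma> * (a' * (2 * \<beta> * (1 + a') - 2 * a' + \<beta> * (1 + a') - \<beta> * b') + b' * (2 * \<beta> * (1 + b') - 2 * b' + \<beta> * (1 + b') - \<beta> * a')) < 0"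
  (is "?S < 0")
proof -
  have "?S = \<gamma> * (2 * \<gamma> + 1 - 2 * \<beta>) * (a'\<^sup>2 + b'\<^sup>2) - \<gamma> * (\<gamma> + \<beta>) * (a' - b')\<^sup>2 - \<beta> * (3 * \<gamma> + 1 - \<beta>) * (a' + b')"
    by (simp add: power2_eq_square algebra_simps)
  moreover have "\<gamma> * (2 * \<gamma> + 1 - 2 * \<beta>) * (a'\<^sup>2 + b'\<^sup>2) \<le> 0" using gam by (intro mult_nonpos_nonneg mult_nonneg_nonpos) auto
  moreover have "\<gamma> * (\<gamma> + \<beta>) * (a' - b')\<^sup>2 \<ge> 0" using gam beta by (intro mult_nonneg_nonneg) auto
  moreover have "\<beta> * (3 * \<gamma> + 1 - \<beta>) * (a' + b') > 0" using gam beta assms by (intro mult_pos_pos) auto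
  ultimately show ?thesis by linarith
qed

text \<open>The minimum of \<open>(F - \<delta>) / \<psi>\<close>, with \<psi> the product of
  powers, may lie on an edge. Hence the test curves are \<open>(s * u, v)\<close>,
  \<open>(u, s * v)\<close> and \<open>(s * u, s * v)\<close> near \<open>s = 1\<close>: they fix
  vanishing coordinates and stay in the box for \<open>s\<close> on both sides of 1. Only the origin
  is degenerate, and there \<open>F = 1 > \<delta>\<close>.\<close>

lemma F0_lower:
  assumes b1: "\<beta> > 1"
  obtains \<delta> where "\<delta> > 0" "\<And>y z. 0 \<le> y \<Longrightarrow> y < 1 \<Longrightarrow> 0 \<le> z \<Longrightarrow> z < 1 \<Longrightarrow> F 0 y z \<ge> \<delta>"
proof -
  obtain gm where gm: "gm > 0" "\<And>x. 0 \<le> x \<Longrightarrow> x \<le> 1 \<Longrightarrow> gf x \<ge> gm" using gf_lower[OF b1] by blast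
  define c1 where "c1 = hf 1 * gm / 2"
  have c1: "c1 > 0" using gm hf_1_pos by (simp add: c1_def)
  obtain d where d: "d > 0" "\<And>x y z. 0 \<le> x \<Longrightarrow> x < 1 \<Longrightarrow> 0 \<le> y \<Longrightarrow> y < 1 \<Longrightarrow> 0 \<le> z \<Longrightarrow> z < 1 \<Longrightarrow>
    1 - y < d \<Longrightarrow> \<bar>F x y z - hf 1 * gf x * gf z\<bar> < c1" using F_boundary[OF c1] by blast
  have near: "F 0 y z > c1" if "0 \<le> y" "y < 1" "0 \<le> z" "z < 1" "1 - y < d" for y z
  proof -
    have "hf 1 * gm \<le> hf 1 * gf z" using gm(2)[of z] that hf_1_pos by (intro mult_left_mono) auto
    moreover have "\<bar>F 0 y z - hf 1 * gf z\<bar> < c1" using d(2)[of 0 y z] that by simp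
    ultimately show ?thesis unfolding c1_def by linarith
  qed
  define \<delta> where "\<delta> = min c1 (1/2)"
  have de: "\<delta> > 0" "\<delta> \<le> c1" "\<delta> < 1" using c1 by (auto simp: \<delta>_def)
  define r where "r = 1 - min d 1 / 2"
  have r: "0 < r" "r < 1" "1 - r < d" using d(1) by (auto simp: r_def min_def)
  have near': "F 0 y z > \<delta>" if "0 \<le> y" "y < 1" "0 \<le> z" "z < 1" "r \<le> y \<or> r \<le> z" for y z
    using near[of y z] near[of z y] that r de F_sym(2)[of 0 y z] by fastforce
  have "F 0 y z \<ge> \<delta>" if yz: "0 \<le> y" "y < 1" "0 \<le> z" "z < 1" for y z
  proof (rule ccontr)
    assume neg: "\<not> F 0 y z \<ge> \<delta>"
    then have yz': "y < r" "z < r" using near'[OF yz] by force+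
    let ?B = "{0..r} \<times> {0..r}"
    let ?\<psi> = "\<lambda>y z. (1 - y) powr \<gamma> * (1 - z) powr \<gamma>"
    let ?f = "\<lambda>p. (F 0 (fst p) (snd p) - \<delta>) / ?\<psi> (fst p) (snd p)"
    have psi: "?\<psi> y z > 0" if "y < 1" "z < 1" for y z using that by simp
    have "continuous_on ?B (\<lambda>(y, z). F 0 y z)"
      using fs_continuous_box[of r r 0] r
      by (rule_tac continuous_on_cong[THEN iffD1, OF refl]) (auto simp: fs_0)
    then have "continuous_on ?B ?f"
      using r by (intro continuous_intros) (auto simp: split_beta)
    moreover have "compact ?B" by (intro compact_Times) auto
    moreover have "?B \<noteq> {}" using r by auto
    ultimately obtain m where m: "m \<in> ?B" "\<And>p. p \<in> ?B \<Longrightarrow> ?f m \<le> ?f p"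
      using continuous_attains_inf[of ?B ?f] by blast
    obtain u v where uv: "m = (u, v)" by (cases m)
    have q: "0 \<le> u" "u \<le> r" "0 \<le> v" "v \<le> r" using m(1) uv by auto
    have q1: "u < 1" "v < 1" using q r by auto
    have "?f (y, z) < 0" using neg psi[of y z] yz by (simp add: divide_neg_pos)
    then have fm: "?f m < 0" using m(2)[of "(y, z)"] yz yz' by auto
    then have Flt: "F 0 u v < \<delta>" using psi[OF q1] by (simp add: uv divide_less_0_iff not_less_iff_gr_or_eq)
    then have ur: "u < r" "v < r" using near'[of u v] q q1 by force+
    have nz: "u + v > 0" using Flt de(3) F_zero q by (cases "u = 0 \<and> v = 0") auto
    define \<mu> where "\<mu> = - ?f m"
    have mu: "\<mu> > 0" using fm by (simp add: \<mu>_def)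
    define E where "E y z = F 0 y z - \<delta> + \<mu> * ?\<psi> y z" for y z
    have E0: "E u v = 0"
    proof -
      have "t + - (t / w) * w = 0" if "w > 0" for t w :: real using that by simp
      from this[OF psi[OF q1], of "F 0 u v - \<delta>"] show ?thesis by (simp only: E_def \<mu>_def uv fst_conv snd_conv)
    qed
    have Epos: "E y z \<ge> 0" if "y \<in> {0..r}" "z \<in> {0..r}" for y z
    proof -
      have "- \<mu> \<le> ?f (y, z)" using m(2)[of "(y, z)"] that by (simp add: \<mu>_def)
      moreover have "?\<psi> y z > 0" using psi that r by auto
      ultimately show ?thesis by (simp add: pos_le_divide_eq E_def)
    qed
    define e where "e = min (r - u) (r - v)"
    have e: "e > 0" using ur by (simp add: e_def)
    have box: "s * u \<in> {0..r}" "s * v \<in> {0..r}" if "\<bar>s - 1\<bar> < e" for s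
    proof -
      have s: "s \<ge> 0" "s - 1 \<le> e" using that q r by (auto simp: e_def)
      have "(s - 1) * u \<le> e * 1" by (rule mult_mono) (use s q q1 e in auto)
      moreover have "(s - 1) * v \<le> e * 1" by (rule mult_mono) (use s q q1 e in auto)
      ultimately have "s * u \<le> r" "s * v \<le> r" by (auto simp: e_def algebra_simps)
      then show "s * u \<in> {0..r}" "s * v \<in> {0..r}" using s q by auto
    qed
    define p1 where "p1 = psum (pderiv2 a) 0 u v"
    define p2 where "p2 = psum (pderiv3 a) 0 u v"
    define a' where "a' = u / (1 - u)"
    define b' where "b' = v / (1 - v)"
    let ?w = "?\<psi> u v"
    have dy: "u * p1 = \<mu> * (\<gamma> * a' * ?w)"
    proof -
      have "((\<lambda>s. E (s * u) v) has_real_derivative (p1 * u + \<mu> * (- \<gamma> * a' * ?w))) (at 1)"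
      proof -
        have "((\<lambda>s. psum a 0 (s * u) v) has_real_derivative psum (pderiv2 a) 0 (1 * u) v * u) (at 1)"
          by (rule DERIV_chain2[of "\<lambda>y. psum a 0 y v", OF psum_has_derivative2[OF regular_a]])
            (use q q1 in \<open>auto intro!: derivative_eq_intros\<close>)
        moreover have "((\<lambda>s. (1 - s * u) powr \<gamma>) has_real_derivative - \<gamma> / (1 - 1 * u) * (1 - 1 * u) powr \<gamma> * u) (at 1)"
          by (rule DERIV_chain2[of "\<lambda>y. (1 - y) powr \<gamma>", OF powr_one_minus_deriv])
            (use q1 in \<open>auto intro!: derivative_eq_intros\<close>)
        ultimately have "((\<lambda>s. psum a 0 (s * u) v - \<delta> + \<mu> * ((1 - s * u) powr \<gamma> * (1 - v) powr \<gamma>)) has_real_derivative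
          psum (pderiv2 a) 0 (1 * u) v * u - 0 + \<mu> * ((- \<gamma> / (1 - 1 * u) * (1 - 1 * u) powr \<gamma> * u) * (1 - v) powr \<gamma>)) (at 1)"
          by (intro DERIV_add DERIV_diff DERIV_const DERIV_cmult DERIV_cmult_right)
        then show ?thesis by (simp add: E_def p1_def a'_def mult_ac)
      qed
      from DERIV_local_min[OF this e] have "p1 * u + \<mu> * (- \<gamma> * a' * ?w) = 0"
        using box Epos q E0 by (auto simp: abs_minus_commute)
      then show ?thesis by (simp add: algebra_simps)
    qed
    have dz: "v * p2 = \<mu> * (\<gamma> * b' * ?w)"
    proof -
      have "((\<lambda>s. E u (s * v)) has_real_derivative (p2 * v + \<mu> * (- \<gamma> * b' * ?w))) (at 1)"
      proof -
        have "((\<lambda>s. psum a 0 u (s * v)) has_real_derivative psum (pderiv3 a) 0 u (1 * v) * v) (at 1)"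
          by (rule DERIV_chain2[of "\<lambda>y. psum a 0 u y", OF psum_has_derivative3[OF regular_a]])
            (use q q1 in \<open>auto intro!: derivative_eq_intros\<close>)
        moreover have "((\<lambda>s. (1 - s * v) powr \<gamma>) has_real_derivative - \<gamma> / (1 - 1 * v) * (1 - 1 * v) powr \<gamma> * v) (at 1)"
          by (rule DERIV_chain2[of "\<lambda>y. (1 - y) powr \<gamma>", OF powr_one_minus_deriv])
            (use q1 in \<open>auto intro!: derivative_eq_intros\<close>)
        ultimately have "((\<lambda>s. psum a 0 u (s * v) - \<delta> + \<mu> * ((1 - u) powr \<gamma> * (1 - s * v) powr \<gamma>)) has_real_derivative
          psum (pderiv3 a) 0 u (1 * v) * v - 0 + \<mu> * ((1 - u) powr \<gamma> * (- \<gamma> / (1 - 1 * v) * (1 - 1 * v) powr \<gamma> * v))) (at 1)"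
          by (intro DERIV_add DERIV_diff DERIV_const DERIV_cmult)
        then show ?thesis by (simp add: E_def p2_def b'_def mult_ac)
      qed
      from DERIV_local_min[OF this e] have "p2 * v + \<mu> * (- \<gamma> * b' * ?w) = 0"
        using box Epos q E0 by (auto simp: abs_minus_commute)
      then show ?thesis by (simp add: algebra_simps)
    qed
    let ?p11 = "psum (pderiv2 (pderiv2 a)) 0 u v" and ?p12 = "psum (pderiv3 (pderiv2 a)) 0 u v" and ?p22 = "psum (pderiv3 (pderiv3 a)) 0 u v"
    have "0 \<le> (u\<^sup>2 * ?p11 + 2 * (u * v) * ?p12 + v\<^sup>2 * ?p22) + \<mu> * ((\<gamma>\<^sup>2 * (a' + b')\<^sup>2 - \<gamma> * (a'\<^sup>2 + b'\<^sup>2)) * ?w)"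
    proof -
      let ?W = "\<lambda>s. ?\<psi> (s * u) (s * v)"
      let ?k = "\<lambda>s. u / (1 - s * u) + v / (1 - s * v)"
      let ?R1 = "\<lambda>s. psum (pderiv2 a) 0 (s * u) (s * v) * u + psum (pderiv3 a) 0 (s * u) (s * v) * v"
      have lt: "s * u < 1" "s * v < 1" "\<bar>s * u\<bar> < 1" "\<bar>s * v\<bar> < 1" if "\<bar>s - 1\<bar> < e" for s
        using box[OF that] r by auto
      have W: "(?W has_real_derivative - \<gamma> * ?k s * ?W s) (at s)" if "\<bar>s - 1\<bar> < e" for s
      proof -
        have c: "((\<lambda>s. (1 - s * t) powr \<gamma>) has_real_derivative - \<gamma> / (1 - s * t) * (1 - s * t) powr \<gamma> * t) (at s)" if "s * t < 1" for t
          by (rule DERIV_chain2[where f = "\<lambda>y. (1 - y) powr \<gamma>" and g = "\<lambda>s. s * t", OF powr_one_minus_deriv])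
            (use that in \<open>auto intro!: derivative_eq_intros\<close>)
        from DERIV_mult[OF c[OF lt(1)[OF that]] c[OF lt(2)[OF that]]] show ?thesis
          by (simp add: algebra_simps)
      qed
      have k: "(?k has_real_derivative a'\<^sup>2 + b'\<^sup>2) (at 1)"
        using q1 by (auto intro!: derivative_eq_intros simp: a'_def b'_def power2_eq_square)
      have one: "\<bar>1 - 1\<bar> < e" using e by simp
      have "(?R1 has_real_derivative
         (psum (pderiv2 (pderiv2 a)) 0 (1 * u) (1 * v) * u + psum (pderiv3 (pderiv2 a)) 0 (1 * u) (1 * v) * v) * u
         + (psum (pderiv2 (pderiv3 a)) 0 (1 * u) (1 * v) * u + psum (pderiv3 (pderiv3 a)) 0 (1 * u) (1 * v) * v) * v) (at 1)"
        by (intro DERIV_add DERIV_cmult_right psum_ray regular_pderiv2 regular_pderiv3 regular_a lt one)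
      moreover have "pderiv2 (pderiv3 a) = pderiv3 (pderiv2 a)" by (auto simp: pderiv2_def pderiv3_def fun_eq_iff)
      ultimately have R2: "(?R1 has_real_derivative u\<^sup>2 * ?p11 + 2 * (u * v) * ?p12 + v\<^sup>2 * ?p22) (at 1)"
        by (simp add: power2_eq_square algebra_simps)
      have W2: "((\<lambda>s. - \<gamma> * ?k s * ?W s) has_real_derivative (\<gamma>\<^sup>2 * (a' + b')\<^sup>2 - \<gamma> * (a'\<^sup>2 + b'\<^sup>2)) * ?w) (at 1)"
        by (rule DERIV_cong[OF DERIV_mult[OF DERIV_cmult[OF k, of "- \<gamma>"] W[OF one]]])
          (simp add: a'_def[symmetric] b'_def[symmetric], simp add: power2_eq_square algebra_simps)
      show ?thesis
      proof (rule second_derivative_nonneg(2)[of e 1 "\<lambda>s. E (s * u) (s * v)" "\<lambda>s. ?R1 s + \<mu> * (- \<gamma> * ?k s * ?W s)"])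
        show "((\<lambda>s. E (s * u) (s * v)) has_real_derivative ?R1 s + \<mu> * (- \<gamma> * ?k s * ?W s)) (at s)" if "\<bar>s - 1\<bar> < e" for s
        proof -
          have "((\<lambda>s. psum a 0 (s * u) (s * v) - \<delta> + \<mu> * ?W s) has_real_derivative ?R1 s - 0 + \<mu> * (- \<gamma> * ?k s * ?W s)) (at s)"
            by (intro DERIV_add DERIV_diff DERIV_cmult DERIV_const psum_ray regular_a lt W that)
          then show ?thesis by (simp add: E_def)
        qed
        show "((\<lambda>s. ?R1 s + \<mu> * (- \<gamma> * ?k s * ?W s)) has_real_derivative (u\<^sup>2 * ?p11 + 2 * (u * v) * ?p12 + v\<^sup>2 * ?p22) + \<mu> * ((\<gamma>\<^sup>2 * (a' + b')\<^sup>2 - \<gamma> * (a'\<^sup>2 + b'\<^sup>2)) * ?w)) (at 1)"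
          by (intro DERIV_add DERIV_cmult R2 W2)
        show "E (1 * u) (1 * v) \<le> E (s * u) (s * v)" if "\<bar>s - 1\<bar> < e" for s
          using Epos[OF box[OF that]] E0 by simp
      qed (rule e)
    qed
    also have "\<dots> = \<beta> * (1 - \<beta>) * (a' + b') * \<delta> + \<mu> * ?w * (\<gamma>\<^sup>2 * (a' + b')\<^sup>2 - \<gamma> * (a'\<^sup>2 + b'\<^sup>2) - \<beta> * (1 - \<beta>) * (a' + b')
    - \<gamma> * (a' * (2 * \<beta> * (1 + a') - 2 * a' + \<beta> * (1 + a') - \<beta> * b') + b' * (2 * \<beta> * (1 + b') - 2 * b' + \<beta> * (1 + b') - \<beta> * a')))"
    proof -
      have "F 0 u v = \<delta> - \<mu> * ?w" using E0 by (simp add: E_def)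
      then show ?thesis
        using F0_ray_equation[OF q(1) q1(1) q(3) q1(2)] dy dz unfolding a'_def[symmetric] b'_def[symmetric] p1_def p2_def
        by algebra
    qed
    also have "\<dots> < 0"
    proof -
      have ab: "a' \<ge> 0" "b' \<ge> 0" using q q1 by (auto simp: a'_def b'_def)
      have "a' > 0 \<or> b' > 0" using nz q q1 by (cases "u = 0") (auto simp: a'_def b'_def)
      then have "a' + b' > 0" using ab by linarith
      note mult_pos_neg[OF mult_pos_pos[OF mu psi[OF q1]] supersolution_form[OF ab this]]
      moreover have "\<beta> * (\<beta> - 1) * (a' + b') * \<delta> \<ge> 0" using ab de b1 by (intro mult_nonneg_nonneg) auto
      then have "\<beta> * (1 - \<beta>) * (a' + b') * \<delta> \<le> 0" by (simp add: algebra_simps)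
      ultimately show ?thesis by linarith
    qed
    finally show False by simp
  qed
  then show ?thesis using that de by blast
qed

text \<open>Near the faces through 0 the bound comes from \<open>F0_lower\<close> and
  \<open>F_near_face\<close>, near those through 1 from \<open>F_boundary\<close>; symmetry treats
  all six alike. This collar keeps later minima away from the boundary.\<close>

lemma F_faces:
  assumes b1: "\<beta> > 1"
  obtains \<delta> \<eta> where "\<delta> > 0" "\<eta> > 0" "\<And>x y z. 0 < x \<Longrightarrow> x < 1 \<Longrightarrow> 0 < y \<Longrightarrow> y < 1 \<Longrightarrow> 0 < z \<Longrightarrow> z < 1 \<Longrightarrow>
    min x (min y z) < \<eta> \<or> 1 - \<eta> < max x (max y z) \<Longrightarrow> F x y z > \<delta>"
proof -
  obtain gm where gm: "gm > 0" "\<And>x. 0 \<le> x \<Longrightarrow> x \<le> 1 \<Longrightarrow> gf x \<ge> gm" using gf_lower[OF b1] by blast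
  obtain c0 where c0: "c0 > 0" "\<And>y z. 0 \<le> y \<Longrightarrow> y < 1 \<Longrightarrow> 0 \<le> z \<Longrightarrow> z < 1 \<Longrightarrow> F 0 y z \<ge> c0" using F0_lower[OF b1] by blast
  define c1 where "c1 = hf 1 * gm * gm / 2"
  have c1: "c1 > 0" using gm hf_1_pos by (simp add: c1_def)
  obtain d where d: "d > 0" "\<And>x y z. 0 \<le> x \<Longrightarrow> x < 1 \<Longrightarrow> 0 \<le> y \<Longrightarrow> y < 1 \<Longrightarrow> 0 \<le> z \<Longrightarrow> z < 1 \<Longrightarrow>
    1 - y < d \<Longrightarrow> \<bar>F x y z - hf 1 * gf x * gf z\<bar> < c1" using F_boundary[OF c1] by blast
  have up: "F x y z > c1" if "0 < x" "x < 1" "0 < y" "y < 1" "0 < z" "z < 1" "1 - y < d" for x y z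
  proof -
    have "hf 1 * gm * gm \<le> hf 1 * gf x * gf z"
      using gm(2)[of x] gm(2)[of z] gm(1) that hf_1_pos by (intro mult_mono) auto
    moreover have "\<bar>F x y z - hf 1 * gf x * gf z\<bar> < c1" using d(2)[of x y z] that by simp
    ultimately show ?thesis unfolding c1_def by linarith
  qed
  define C where "C = gsum * M0 + 1"
  have C: "C > 0" using sum_nonneg_consts by (simp add: C_def add_nonneg_pos)
  have lo: "F x y z > c0 / 2" if "0 < x" "x < 1" "0 < y" "y < 1" "0 < z" "z < 1" "x < c0 / 2 / C" for x y z
  proof -
    have "gsum * M0 * x \<le> C * x" using that by (intro mult_right_mono) (auto simp: C_def)
    also have "C * x < c0 / 2" using that C by (simp add: pos_less_divide_eq mult_ac)
    finally show ?thesis using F_near_face[of x y z] c0(2)[of y z] that by (simp add: abs_le_iff)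
  qed
  define \<delta> where "\<delta> = min c1 (c0 / 2)"
  define \<eta> where "\<eta> = min d (c0 / 2 / C)"
  show ?thesis
  proof (rule that[of \<delta> \<eta>])
    fix x y z :: real assume q: "0 < x" "x < 1" "0 < y" "y < 1" "0 < z" "z < 1" and c: "min x (min y z) < \<eta> \<or> 1 - \<eta> < max x (max y z)"
    have s: "F y x z = F x y z" "F x z y = F x y z" "F z x y = F x y z" by (metis F_sym)+
    from c consider "x < \<eta>" | "y < \<eta>" | "z < \<eta>" | "1 - x < \<eta>" | "1 - y < \<eta>" | "1 - z < \<eta>"
      by (auto simp: min_def max_def split: if_splits)
    then show "F x y z > \<delta>"
    proof cases
      case 1 then show ?thesis using lo[of x y z] q by (auto simp: \<eta>_def \<delta>_def)
    next
      case 2 then show ?thesis using lo[of y x z] q s by (auto simp: \<eta>_def \<delta>_def)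
    next
      case 3 then show ?thesis using lo[of z x y] q s by (auto simp: \<eta>_def \<delta>_def)
    next
      case 4 then show ?thesis using up[of y x z] q s by (auto simp: \<eta>_def \<delta>_def)
    next
      case 5 then show ?thesis using up[of x y z] q s by (auto simp: \<eta>_def \<delta>_def)
    next
      case 6 then show ?thesis using up[of x z y] q s by (auto simp: \<eta>_def \<delta>_def)
    qed
  qed (use c0 c1 d C in \<open>auto simp: \<delta>_def \<eta>_def\<close>)
qed

text \<open>For \<beta> \<le> 1 the factors \<open>ec k\<close> are nonnegative, so the transport
  equation propagates nonnegativity from slice to slice. Then \<open>F\<close> is at least its slice
  of degree 0, first on a face over an edge, then in the cube over a face; on the axis it is at
  least 1.\<close>

lemma F_ge_1:
  assumes b1: "\<beta> \<le> 1" and q: "0 \<le> x" "x < 1" "0 \<le> y" "y < 1" "0 \<le> z" "z < 1"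
  shows "F x y z \<ge> 1"
proof -
  have ec: "ec k \<ge> 0" for k using b1 beta by simp
  have hc: "hcoef \<beta> (3 * \<beta>) k \<ge> 0" for k
    using b1 beta by (induction k) (auto simp: hcoef_Suc intro!: mult_nonneg_nonneg divide_nonneg_nonneg)
  have box: "fs k y z \<ge> 0"
    if \<rho>: "0 \<le> \<rho>1" "\<rho>1 < 1" "0 \<le> \<rho>2" "\<rho>2 < 1"
    and M: "\<And>y z. y \<in> {0..\<rho>1} \<Longrightarrow> z \<in> {0..\<rho>2} \<Longrightarrow> fs 0 y z \<ge> 0" and yz: "y \<in> {0..\<rho>1}" "z \<in> {0..\<rho>2}" for k y z \<rho>1 \<rho>2
    using yz
  proof (induction k arbitrary: y z)
    case (Suc k)
    have c0: "(real k + 1) * (real k + 2 * \<beta>) > 0" using beta by auto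
    have "- fs (Suc k) y z \<le> 0 / ((real k + 1) * (real k + 2 * \<beta>))"
    proof (rule transport_le[where fy = "\<lambda>y z. - fsy (Suc k) y z" and fz = "\<lambda>y z. - fsz (Suc k) y z" and R = "\<lambda>y z. - (ec k * fs k y z)"
          and c = "\<lambda>y z. (real k + 1) * (real k + 2 * \<beta> + \<beta> * qfun y z)" and q = "\<lambda>y z. (real k + 1) * qfun y z",
          OF \<rho>(1,3) _ _ _ _ _ c0 _ _ _ Suc.prems])
      show "continuous_on ({0..\<rho>1} \<times> {0..\<rho>2}) (\<lambda>(y, z). - fs (Suc k) y z)"
        using continuous_on_minus[OF fs_continuous_box[OF \<rho>(2,4)]] by (simp add: split_beta)
      fix y z assume yz: "y \<in> {0..\<rho>1}" "z \<in> {0..\<rho>2}"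
      then have q: "0 \<le> y" "y < 1" "0 \<le> z" "z < 1" using \<rho> by auto
      then show "((\<lambda>t. - fs (Suc k) t z) has_real_derivative - fsy (Suc k) y z) (at y)"
        "((\<lambda>t. - fs (Suc k) y t) has_real_derivative - fsz (Suc k) y z) (at z)" by (auto intro!: DERIV_minus fs_deriv)
      show "0 \<le> (real k + 1) * qfun y z" using qfun_bounds[OF q] by simp
      show "(real k + 1) * (real k + 2 * \<beta>) \<le> (real k + 1) * (real k + 2 * \<beta> + \<beta> * qfun y z)"
        using qfun_bounds(1)[OF q] beta by (intro mult_left_mono) auto
      show "(real k + 1) * (real k + 2 * \<beta> + \<beta> * qfun y z) * - fs (Suc k) y z
        + (real k + 1) * qfun y z * (y * - fsy (Suc k) y z + z * - fsz (Suc k) y z) = - (ec k * fs k y z)"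
        using fs_transport[OF q, of k] by (simp add: algebra_simps)
      show "- (ec k * fs k y z) \<le> 0" using ec Suc.IH[OF yz] by (simp add: mult_nonneg_nonneg del: mult_nonneg_nonneg) (metis ec mult_nonneg_nonneg)
    qed simp
    then show ?case by simp
  qed (use M in simp)
  have ge: "S \<ge> c 0" if "\<And>k. c k \<ge> 0" "0 \<le> t" "(\<lambda>k. c k * t ^ k) sums S" for c :: "nat \<Rightarrow> real" and t S
    using sum_le_suminf[OF sums_summable[OF that(3)], of "{0}"] that sums_unique[OF that(3)] by auto
  have e0: "fs 0 0 z \<ge> 1" if "0 \<le> z" "z < 1" for z
    using ge[of "hcoef \<beta> (3 * \<beta>)" z "hf z"] hfun_summable[of "3 * \<beta>" z \<beta>] hc that beta
    by (auto simp: fs_0 F_axis hfun_def summable_sums)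
  have f0: "F 0 y z \<ge> 1" if "0 \<le> y" "y < 1" "0 \<le> z" "z < 1" for y z
  proof -
    have "fs k 0 z \<ge> 0" for k
      by (rule box[of 0 z]) (use that e0 in \<open>auto intro: order_trans[OF zero_le_one]\<close>)
    then have "F y 0 z \<ge> fs 0 0 z" using ge[OF _ that(1) F_sums[of y 0 z]] that by auto
    then show ?thesis using e0[of z] that F_sym(1)[of 0 y z] by simp
  qed
  have "fs k y z \<ge> 0" for k
    by (rule box[of y z]) (use q f0 in \<open>auto simp: fs_0 intro: order_trans[OF zero_le_one]\<close>)
  then have "F x y z \<ge> fs 0 y z" using ge[OF _ q(1) F_sums[of x y z]] q by auto
  then show ?thesis using f0[of y z] q by (simp add: fs_0)
qed

end

section \<open>The BPZ operator in cross-ratios\<close>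

text \<open>The cross-ratio without absolute values and minimum, hence a rational function of the
  points.\<close>

definition crs :: "real \<Rightarrow> real \<Rightarrow> real \<Rightarrow> real \<Rightarrow> real" where
  "crs p1 q1 p2 q2 = (p1 - p2) * (q1 - q2) / ((p1 - q2) * (q1 - p2))"

lemma one_minus_crs:
  assumes "p1 \<noteq> q2" "q1 \<noteq> p2"
  shows "1 - crs p1 q1 p2 q2 = (p1 - q1) * (q2 - p2) / ((p1 - q2) * (q1 - p2))"
  using assms by (simp add: crs_def divide_simps) (simp add: algebra_simps)

lemma crs_swap: "crs p2 q2 p1 q1 = crs p1 q1 p2 q2" "crs q1 p1 q2 p2 = crs p1 q1 p2 q2"
proof -
  have "(p2 - p1) * (q2 - q1) = (p1 - p2) * (q1 - q2)" "(p2 - q1) * (q2 - p1) = (p1 - q2) * (q1 - p2)"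
    "(q1 - q2) * (p1 - p2) = (p1 - p2) * (q1 - q2)" "(q1 - p2) * (p1 - q2) = (p1 - q2) * (q1 - p2)"
    by (simp_all add: algebra_simps)
  then show "crs p2 q2 p1 q1 = crs p1 q1 p2 q2" "crs q1 p1 q2 p2 = crs p1 q1 p2 q2" by (simp_all only: crs_def)
qed

text \<open>Division by zero yields 0, so a value in \<open>(0, 1)\<close> by itself certifies that
  no denominator vanishes and that all four points are distinct.\<close>

lemma crs_distinct:
  assumes "crs p1 q1 p2 q2 \<in> {0<..<1}"
  shows "p1 \<noteq> p2" "q1 \<noteq> q2" "p1 \<noteq> q2" "q1 \<noteq> p2" "p1 \<noteq> q1" "p2 \<noteq> q2"
proof -
  show d: "p1 \<noteq> p2" "q1 \<noteq> q2" "p1 \<noteq> q2" "q1 \<noteq> p2" using assms by (auto simp: crs_def)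
  show "p1 \<noteq> q1" "p2 \<noteq> q2" using assms one_minus_crs[OF d(3,4)] by auto
qed

text \<open>The prefactor of \<open>F\<close> in the partition function for \<kappa> = 4 / \<beta>:
  then - 2 h = 1 - 3 \<beta> / 2 and 2 / \<kappa> = \<beta> / 2.\<close>

definition Lam :: "real \<Rightarrow> real \<Rightarrow> real \<Rightarrow> real \<Rightarrow> real \<Rightarrow> real \<Rightarrow> real \<Rightarrow> real" where
  "Lam \<beta> p1 p2 p3 q1 q2 q3 =
     \<bar>p1 - q1\<bar> powr (1 - 3 * \<beta> / 2) * \<bar>p2 - q2\<bar> powr (1 - 3 * \<beta> / 2) * \<bar>p3 - q3\<bar> powr (1 - 3 * \<beta> / 2) *
     (crs p1 q1 p2 q2 * crs p2 q2 p3 q3 * crs p3 q3 p1 q1) powr (\<beta> / 2)"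

text \<open>The function \<open>E\<close> of the cross-ratios is left open because the operator is
  applied both to \<open>F\<close> and to a comparison function.\<close>

definition Wf :: "real \<Rightarrow> (real \<Rightarrow> real \<Rightarrow> real \<Rightarrow> real) \<Rightarrow> real \<Rightarrow> real \<Rightarrow> real \<Rightarrow> real \<Rightarrow> real \<Rightarrow> real \<Rightarrow> real" where
  "Wf \<beta> E p1 p2 p3 q1 q2 q3 = Lam \<beta> p1 p2 p3 q1 q2 q3 *
     E (crs p1 q1 p2 q2) (crs p2 q2 p3 q3) (crs p3 q3 p1 q1)"

text \<open>\<open>rlog\<close> is the logarithmic derivative of a cross-ratio when its four points move with
  velocities \<open>v1, w1, v2, w2\<close>.\<close>

definition rlog :: "real \<Rightarrow> real \<Rightarrow> real \<Rightarrow> real \<Rightarrow> real \<Rightarrow> real \<Rightarrow> real \<Rightarrow> real \<Rightarrow> real" where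
  "rlog p1 q1 p2 q2 v1 w1 v2 w2 =
     (v1 - v2) / (p1 - p2) + (w1 - w2) / (q1 - q2) - (v1 - w2) / (p1 - q2) - (w1 - v2) / (q1 - p2)"

text \<open>Writing the power of \<open>\<bar>x\<bar>\<close> as the power \<open>c / 2\<close> of
  \<open>x\<^sup>2\<close> avoids a case distinction on the sign.\<close>

lemma abs_powr_deriv:
  fixes u :: "real \<Rightarrow> real"
  assumes "(u has_real_derivative u') (at t)" "u t \<noteq> 0"
  shows "((\<lambda>s. \<bar>u s\<bar> powr c) has_real_derivative (c * (u' / u t)) * \<bar>u t\<bar> powr c) (at t)"
proof -
  have e: "\<bar>x\<bar> powr c = x\<^sup>2 powr (c / 2)" for x :: real
  proof -
    have "x\<^sup>2 = \<bar>x\<bar> powr 2" by simp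
    then have "x\<^sup>2 powr (c / 2) = \<bar>x\<bar> powr (2 * (c / 2))" by (simp only: powr_powr)
    then show ?thesis by simp
  qed
  have "((\<lambda>s. (u s)\<^sup>2 powr (c / 2)) has_real_derivative c / 2 * (u t)\<^sup>2 powr (c / 2 - 1) * (2 * u t * u')) (at t)"
    by (rule DERIV_chain2[OF has_real_derivative_powr]) (use assms in \<open>auto intro!: derivative_eq_intros\<close>)
  moreover have "c / 2 * (u t)\<^sup>2 powr (c / 2 - 1) * (2 * u t * u') = (c * (u' / u t)) * (u t)\<^sup>2 powr (c / 2)"
    using assms(2) by (simp add: powr_diff power2_eq_square)
  ultimately show ?thesis unfolding e by simp
qed

lemma crs_deriv:
  assumes "(P1 has_real_derivative v1) (at t)" "(Q1 has_real_derivative w1) (at t)"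
    "(P2 has_real_derivative v2) (at t)" "(Q2 has_real_derivative w2) (at t)"
    and r: "crs (P1 t) (Q1 t) (P2 t) (Q2 t) \<in> {0<..<1}"
  shows "((\<lambda>s. crs (P1 s) (Q1 s) (P2 s) (Q2 s)) has_real_derivative
     crs (P1 t) (Q1 t) (P2 t) (Q2 t) * rlog (P1 t) (Q1 t) (P2 t) (Q2 t) v1 w1 v2 w2) (at t)"
proof -
  have n: "P1 t - P2 t \<noteq> 0" "Q1 t - Q2 t \<noteq> 0" "P1 t - Q2 t \<noteq> 0" "Q1 t - P2 t \<noteq> 0"
    using crs_distinct[OF r] by auto
  have key: "((\<lambda>s. A s * B s / (C s * D s)) has_real_derivative
      A t * B t / (C t * D t) * (a / A t + b / B t - c / C t - d / D t)) (at t)"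
    if "(A has_real_derivative a) (at t)" "(B has_real_derivative b) (at t)" "(C has_real_derivative c) (at t)"
      "(D has_real_derivative d) (at t)" "A t \<noteq> 0" "B t \<noteq> 0" "C t \<noteq> 0" "D t \<noteq> 0" for A B C D :: "real \<Rightarrow> real" and a b c d
    using that by (auto intro!: derivative_eq_intros simp: field_simps)
  show ?thesis
    unfolding crs_def rlog_def
    by (rule key) (use n assms in \<open>auto intro!: DERIV_diff\<close>)
qed

text \<open>Derivative of \<open>Wf\<close> when \<open>p1, p2, p3, q1, q2, q3\<close> move with
  velocities \<open>v1, v2, v3, w1, w2, w3\<close>; one formula serves for all six partial
  derivatives.\<close>

definition Wdot where
  "Wdot \<beta> E E1 E2 E3 p1 p2 p3 q1 q2 q3 v1 v2 v3 w1 w2 w3 =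
     (let r1 = crs p1 q1 p2 q2; r2 = crs p2 q2 p3 q3; r3 = crs p3 q3 p1 q1;
          R1 = rlog p1 q1 p2 q2 v1 w1 v2 w2; R2 = rlog p2 q2 p3 q3 v2 w2 v3 w3; R3 = rlog p3 q3 p1 q1 v3 w3 v1 w1
      in Lam \<beta> p1 p2 p3 q1 q2 q3 *
        (((1 - 3 * \<beta> / 2) * ((v1 - w1) / (p1 - q1) + (v2 - w2) / (p2 - q2) + (v3 - w3) / (p3 - q3)) + \<beta> / 2 * (R1 + R2 + R3)) * E r1 r2 r3
          + E1 r1 r2 r3 * (r1 * R1) + E2 r1 r2 r3 * (r2 * R2) + E3 r1 r2 r3 * (r3 * R3)))"

lemma Lam_has_derivative:
  assumes d: "(P1 has_real_derivative v1) (at t)" "(P2 has_real_derivative v2) (at t)" "(P3 has_real_derivative v3) (at t)"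
    "(Q1 has_real_derivative w1) (at t)" "(Q2 has_real_derivative w2) (at t)" "(Q3 has_real_derivative w3) (at t)"
    and r: "crs (P1 t) (Q1 t) (P2 t) (Q2 t) \<in> {0<..<1}" "crs (P2 t) (Q2 t) (P3 t) (Q3 t) \<in> {0<..<1}" "crs (P3 t) (Q3 t) (P1 t) (Q1 t) \<in> {0<..<1}"
  shows "((\<lambda>s. Lam \<beta> (P1 s) (P2 s) (P3 s) (Q1 s) (Q2 s) (Q3 s)) has_real_derivative
    Lam \<beta> (P1 t) (P2 t) (P3 t) (Q1 t) (Q2 t) (Q3 t) *
     ((1 - 3 * \<beta> / 2) * ((v1 - w1) / (P1 t - Q1 t) + (v2 - w2) / (P2 t - Q2 t) + (v3 - w3) / (P3 t - Q3 t))
       + \<beta> / 2 * (rlog (P1 t) (Q1 t) (P2 t) (Q2 t) v1 w1 v2 w2 + rlog (P2 t) (Q2 t) (P3 t) (Q3 t) v2 w2 v3 w3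
          + rlog (P3 t) (Q3 t) (P1 t) (Q1 t) v3 w3 v1 w1))) (at t)"
proof -
  note n = crs_distinct[OF r(1)] crs_distinct[OF r(2)] crs_distinct[OF r(3)]
  have l: "((\<lambda>s. \<bar>P s - Q s\<bar> powr c) has_real_derivative (c * ((v - w) / (P t - Q t))) * \<bar>P t - Q t\<bar> powr c) (at t)"
    if "(P has_real_derivative v) (at t)" "(Q has_real_derivative w) (at t)" "P t \<noteq> Q t" for P Q :: "real \<Rightarrow> real" and v w c
    by (rule abs_powr_deriv) (use that in \<open>auto intro!: DERIV_diff\<close>)
  note l1 = l[OF d(1,4) n(5)] and l2 = l[OF d(2,5) n(6)] and l3 = l[OF d(3,6) n(12)]
  let ?r1 = "\<lambda>t. crs (P1 t) (Q1 t) (P2 t) (Q2 t)" and ?r2 = "\<lambda>t. crs (P2 t) (Q2 t) (P3 t) (Q3 t)" and ?r3 = "\<lambda>t. crs (P3 t) (Q3 t) (P1 t) (Q1 t)"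
  let ?R1 = "rlog (P1 t) (Q1 t) (P2 t) (Q2 t) v1 w1 v2 w2" and ?R2 = "rlog (P2 t) (Q2 t) (P3 t) (Q3 t) v2 w2 v3 w3"
    and ?R3 = "rlog (P3 t) (Q3 t) (P1 t) (Q1 t) v3 w3 v1 w1"
  have pos: "?r1 t * ?r2 t * ?r3 t > 0" using r by simp
  have "((\<lambda>s. ?r1 s * ?r2 s * ?r3 s) has_real_derivative (?r1 t * ?r2 t * ?r3 t) * (?R1 + ?R2 + ?R3)) (at t)"
    by (rule DERIV_cong[OF DERIV_mult[OF DERIV_mult[OF crs_deriv[OF d(1,4,2,5) r(1)] crs_deriv[OF d(2,5,3,6) r(2)]] crs_deriv[OF d(3,6,1,4) r(3)]]])
      (simp add: algebra_simps)
  from DERIV_chain2[OF has_real_derivative_powr[OF pos, of "\<beta> / 2"] this]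
  have "((\<lambda>s. (?r1 s * ?r2 s * ?r3 s) powr (\<beta> / 2)) has_real_derivative
      \<beta> / 2 * (?r1 t * ?r2 t * ?r3 t) powr (\<beta> / 2 - 1) * ((?r1 t * ?r2 t * ?r3 t) * (?R1 + ?R2 + ?R3))) (at t)" .
  moreover have "\<beta> / 2 * (?r1 t * ?r2 t * ?r3 t) powr (\<beta> / 2 - 1) * ((?r1 t * ?r2 t * ?r3 t) * (?R1 + ?R2 + ?R3))
     = (\<beta> / 2 * (?R1 + ?R2 + ?R3)) * (?r1 t * ?r2 t * ?r3 t) powr (\<beta> / 2)"
    using pos powr_add[of "?r1 t * ?r2 t * ?r3 t" "\<beta> / 2 - 1" 1] by simp
  ultimately have c: "((\<lambda>s. (?r1 s * ?r2 s * ?r3 s) powr (\<beta> / 2)) has_real_derivative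
      (\<beta> / 2 * (?R1 + ?R2 + ?R3)) * (?r1 t * ?r2 t * ?r3 t) powr (\<beta> / 2)) (at t)" by (rule DERIV_cong)
  have key: "u1 * a1 * a2 + u2 * a2 * a1 = a1 * a2 * (u1 + u2)" for u1 u2 a1 a2 :: real by (simp add: algebra_simps)
  have mult: "((\<lambda>s. f s * g s) has_real_derivative (u + v) * (f t * g t)) (at t)"
    if "(f has_real_derivative u * f t) (at t)" "(g has_real_derivative v * g t) (at t)" for f g :: "real \<Rightarrow> real" and u v
    by (rule DERIV_cong[OF DERIV_mult[OF that]]) (simp add: algebra_simps)
  show ?thesis
    unfolding Lam_def
    by (rule DERIV_cong[OF mult[OF mult[OF mult[OF l1 l2] l3] c]]) (simp add: algebra_simps)
qed

lemma Wf_has_derivative: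
  assumes E: "has_partials E E1 E2 E3"
    and d: "(P1 has_real_derivative v1) (at t)" "(P2 has_real_derivative v2) (at t)" "(P3 has_real_derivative v3) (at t)"
    "(Q1 has_real_derivative w1) (at t)" "(Q2 has_real_derivative w2) (at t)" "(Q3 has_real_derivative w3) (at t)"
    and r: "crs (P1 t) (Q1 t) (P2 t) (Q2 t) \<in> {0<..<1}" "crs (P2 t) (Q2 t) (P3 t) (Q3 t) \<in> {0<..<1}" "crs (P3 t) (Q3 t) (P1 t) (Q1 t) \<in> {0<..<1}"
  shows "((\<lambda>s. Wf \<beta> E (P1 s) (P2 s) (P3 s) (Q1 s) (Q2 s) (Q3 s)) has_real_derivative
    Wdot \<beta> E E1 E2 E3 (P1 t) (P2 t) (P3 t) (Q1 t) (Q2 t) (Q3 t) v1 v2 v3 w1 w2 w3) (at t)"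
  unfolding Wf_def
  by (rule DERIV_cong[OF DERIV_mult[OF Lam_has_derivative[OF d r]
        E[unfolded has_partials_def, rule_format, OF crs_deriv[OF d(1,4,2,5) r(1)] crs_deriv[OF d(2,5,3,6) r(2)] crs_deriv[OF d(3,6,1,4) r(3)] r]]])
    (simp add: Wdot_def Let_def algebra_simps)

text \<open>The point \<open>p1\<close> moves. Here \<open>\<rho>1, \<rho>3\<close> are the logarithmic derivatives of the two cross-ratios
  that depend on \<open>p1\<close>.\<close>

lemma Wf_second_derivative:
  fixes \<beta> :: real
  assumes E: "has_partials E E1 E2 E3" "has_partials E1 E11 E12 E13" "has_partials E3 E13 E32 E33"
    and r: "crs p1 q1 p2 q2 \<in> {0<..<1}" "crs p2 q2 p3 q3 \<in> {0<..<1}" "crs p3 q3 p1 q1 \<in> {0<..<1}"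
  defines "r1 \<equiv> crs p1 q1 p2 q2" and "r2 \<equiv> crs p2 q2 p3 q3" and "r3 \<equiv> crs p3 q3 p1 q1"
    and "\<rho>1 \<equiv> 1 / (p1 - p2) - 1 / (p1 - q2)" and "\<rho>3 \<equiv> 1 / (p1 - p3) - 1 / (p1 - q3)"
    and "\<sigma>1 \<equiv> 1 / (p1 - q2)\<^sup>2 - 1 / (p1 - p2)\<^sup>2" and "\<sigma>3 \<equiv> 1 / (p1 - q3)\<^sup>2 - 1 / (p1 - p3)\<^sup>2"
  defines "L \<equiv> (1 - 3 * \<beta> / 2) / (p1 - q1) + \<beta> / 2 * (\<rho>1 + \<rho>3)"
    and "L' \<equiv> - (1 - 3 * \<beta> / 2) / (p1 - q1)\<^sup>2 + \<beta> / 2 * (\<sigma>1 + \<sigma>3)"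
  shows "((\<lambda>s. Wdot \<beta> E E1 E2 E3 s p2 p3 q1 q2 q3 1 0 0 0 0 0) has_real_derivative
    Lam \<beta> p1 p2 p3 q1 q2 q3 *
      ((L\<^sup>2 + L') * E r1 r2 r3 + 2 * L * (E1 r1 r2 r3 * (r1 * \<rho>1) + E3 r1 r2 r3 * (r3 * \<rho>3))
       + E11 r1 r2 r3 * (r1 * \<rho>1)\<^sup>2 + 2 * E13 r1 r2 r3 * (r1 * \<rho>1) * (r3 * \<rho>3) + E33 r1 r2 r3 * (r3 * \<rho>3)\<^sup>2
       + E1 r1 r2 r3 * (r1 * (\<rho>1\<^sup>2 + \<sigma>1)) + E3 r1 r2 r3 * (r3 * (\<rho>3\<^sup>2 + \<sigma>3)))) (at p1)"
proof -
  note n = crs_distinct[OF r(1)] crs_distinct[OF r(2)] crs_distinct[OF r(3)]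
  let ?r1 = "\<lambda>s. crs s q1 p2 q2" and ?r3 = "\<lambda>s. crs p3 q3 s q1"
  let ?R1 = "\<lambda>s. 1 / (s - p2) - 1 / (s - q2)" and ?R3 = "\<lambda>s. 1 / (s - p3) - 1 / (s - q3)"
  let ?Lam = "\<lambda>s. Lam \<beta> s p2 p3 q1 q2 q3"
  let ?L = "\<lambda>s. (1 - 3 * \<beta> / 2) / (s - q1) + \<beta> / 2 * (?R1 s + ?R3 s)"
  have R3: "rlog p3 q3 s q1 0 0 1 0 = ?R3 s" for s
  proof -
    have "(0 - 1) / (p3 - s) = 1 / (s - p3)" "(0 - 1) / (q3 - s) = 1 / (s - q3)"
      by (metis diff_0 minus_diff_eq minus_divide_divide minus_minus)+
    then show ?thesis by (simp only: rlog_def) simp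
  qed
  have eq: "Wdot \<beta> E E1 E2 E3 s p2 p3 q1 q2 q3 1 0 0 0 0 0 =
    ?Lam s * (?L s * E (?r1 s) r2 (?r3 s) + E1 (?r1 s) r2 (?r3 s) * (?r1 s * ?R1 s) + E3 (?r1 s) r2 (?r3 s) * (?r3 s * ?R3 s))" for s
    unfolding Wdot_def Let_def R3 r2_def by (simp add: rlog_def)
  have id: "((\<lambda>s. s) has_real_derivative 1) (at p1)" by (rule DERIV_ident)
  have c: "((\<lambda>s. k) has_real_derivative 0) (at p1)" for k :: real by (rule DERIV_const)
  have dr1: "(?r1 has_real_derivative r1 * \<rho>1) (at p1)"
    using crs_deriv[OF id c c c r(1)] by (simp add: rlog_def r1_def \<rho>1_def)
  have dr3: "(?r3 has_real_derivative r3 * \<rho>3) (at p1)"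
    using crs_deriv[OF c c id c r(3)] unfolding R3 by (simp add: r3_def \<rho>3_def)
  have dL: "(?Lam has_real_derivative ?Lam p1 * L) (at p1)"
    using Lam_has_derivative[OF id c c c c c r, of \<beta>] unfolding R3 by (simp add: rlog_def L_def \<rho>1_def \<rho>3_def)
  have dR1: "(?R1 has_real_derivative \<sigma>1) (at p1)" and dR3: "(?R3 has_real_derivative \<sigma>3) (at p1)"
    using n by (auto intro!: derivative_eq_intros simp: \<sigma>1_def \<sigma>3_def power2_eq_square)
  have dl: "(?L has_real_derivative L') (at p1)"
  proof -
    have "((\<lambda>s. (1 - 3 * \<beta> / 2) / (s - q1)) has_real_derivative - (1 - 3 * \<beta> / 2) / (p1 - q1)\<^sup>2) (at p1)"
      using n by (auto intro!: derivative_eq_intros simp: power2_eq_square)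
    from DERIV_add[OF this DERIV_cmult[OF DERIV_add[OF dR1 dR3]]] show ?thesis unfolding L'_def .
  qed
  have r': "?r1 p1 \<in> {0<..<1}" "r2 \<in> {0<..<1}" "?r3 p1 \<in> {0<..<1}" using r by (simp_all add: r2_def)
  note ch = E(1)[unfolded has_partials_def, rule_format, OF dr1 c dr3 r']
    E(2)[unfolded has_partials_def, rule_format, OF dr1 c dr3 r']
    E(3)[unfolded has_partials_def, rule_format, OF dr1 c dr3 r']
  show ?thesis
    unfolding eq
    by (rule DERIV_cong[OF DERIV_mult[OF dL DERIV_add[OF DERIV_add[OF DERIV_mult[OF dl ch(1)]
      DERIV_mult[OF ch(2) DERIV_mult[OF dr1 dR1]]] DERIV_mult[OF ch(3) DERIV_mult[OF dr3 dR3]]]]])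
      (simp only: r1_def[symmetric] r3_def[symmetric] \<rho>1_def[symmetric] \<rho>3_def[symmetric] L_def[symmetric],
       simp add: power2_eq_square algebra_simps)
qed

section \<open>Algebra of the BPZ operator\<close>

text \<open>Partial fractions: reciprocals of differences without \<open>p1\<close> are tied to
  those containing \<open>p1\<close>, which clears the denominators in the first order part of the
  operator.\<close>

lemma inverse_difference:
  fixes x y z :: real
  assumes "x \<noteq> y" "x \<noteq> z" "y \<noteq> z"
  shows "1 / (y - z) * (1 / (x - y) - 1 / (x - z)) = 1 / (x - y) * (1 / (x - z))"
  using assms by (simp add: divide_simps)

text \<open>The BPZ operator at \<open>p1\<close> in the variables \<open>y = 1 / (p1 - x)\<close>, in which the coefficients of the
  operator become polynomials. The \<open>r\<close>-hypotheses encode the cross-ratios.\<close>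

lemma bpz_polynomial:
  fixes \<beta> y2 Y2 y3 Y3 Y1 r1 r2 r3 e e1 e2 e3 e11 e13 e33 :: real
  assumes r1: "r1 * (y2 - Y1) = Y2 - Y1" and r3: "r3 * (y3 - Y1) = Y3 - Y1"
  defines "\<rho>1 \<equiv> y2 - Y2" and "\<rho>3 \<equiv> y3 - Y3" and "\<sigma>1 \<equiv> Y2\<^sup>2 - y2\<^sup>2" and "\<sigma>3 \<equiv> Y3\<^sup>2 - y3\<^sup>2"
    and "w1 \<equiv> (y2 - Y2) * (Y2 - Y1)" and "w3 \<equiv> (y3 - Y3) * (Y3 - Y1)"
    and "S0 \<equiv> Y1\<^sup>2 - y2 * Y2 - y3 * Y3" and "S1 \<equiv> (y2 - Y2) * (y2 + Y2 + Y1)"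
    and "S2 \<equiv> - ((y2 - Y2) * (y3 - Y3))" and "S3 \<equiv> (y3 - Y3) * (y3 + Y3 + Y1)"
  defines "L \<equiv> (1 - 3 * \<beta> / 2) * Y1 + \<beta> / 2 * (\<rho>1 + \<rho>3)"
    and "L' \<equiv> - (1 - 3 * \<beta> / 2) * Y1\<^sup>2 + \<beta> / 2 * (\<sigma>1 + \<sigma>3)"
  shows "((L\<^sup>2 + L') * e + 2 * L * (e1 * (r1 * \<rho>1) + e3 * (r3 * \<rho>3))
       + e11 * (r1 * \<rho>1)\<^sup>2 + 2 * e13 * (r1 * \<rho>1) * (r3 * \<rho>3) + e33 * (r3 * \<rho>3)\<^sup>2
       + e1 * (r1 * (\<rho>1\<^sup>2 + \<sigma>1)) + e3 * (r3 * (\<rho>3\<^sup>2 + \<sigma>3)))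
     + \<beta> * (((1 - 3 * \<beta> / 2) * S0 + \<beta> / 2 * (S1 + S2 + S3)) * e + e1 * (r1 * S1) + e2 * (r2 * S2) + e3 * (r3 * S3))
     + \<beta> / 2 * (1 - 3 * \<beta> / 2) * (y2\<^sup>2 + Y2\<^sup>2 + y3\<^sup>2 + Y3\<^sup>2 + Y1\<^sup>2) * e
    = w1 * (r1 * (1 - r1) * e11 + (2 * \<beta> - 2 * r1) * e1 - \<beta> * (1 - \<beta>) * e)
     + w3 * (r3 * (1 - r3) * e33 + (2 * \<beta> - 2 * r3) * e3 - \<beta> * (1 - \<beta>) * e)
     + \<rho>1 * \<rho>3 * (2 * r1 * r3 * e13 + \<beta> * (r1 * e1 + r3 * e3 - r2 * e2))"
proof -
  \<comment> \<open>\<open>w1 = r1 * T1\<close> and \<open>\<rho>1\<^sup>2 = T1 * (1 - r1)\<close>: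
    the second order coefficient \<open>(r1 * \<rho>1)\<^sup>2\<close> thus equals
    \<open>w1 * (r1 * (1 - r1))\<close>, that of the hypergeometric operator. \<open>T3\<close>
    plays this role for \<open>r3\<close>.\<close>
  define T1 where "T1 = (y2 - Y2) * (y2 - Y1)"
  define T3 where "T3 = (y3 - Y3) * (y3 - Y1)"
  have w1: "w1 = r1 * T1" and w3: "w3 = r3 * T3"
    unfolding w1_def w3_def T1_def T3_def using r1 r3 by algebra+
  have t1: "T1 * (1 - r1) = \<rho>1\<^sup>2" and t3: "T3 * (1 - r3) = \<rho>3\<^sup>2"
    unfolding T1_def T3_def \<rho>1_def \<rho>3_def using r1 r3 by algebra+
  have id0: "L\<^sup>2 + L' + \<beta> * ((1 - 3 * \<beta> / 2) * S0 + \<beta> / 2 * (S1 + S2 + S3)) + \<beta> / 2 * (1 - 3 * \<beta> / 2) * (y2\<^sup>2 + Y2\<^sup>2 + y3\<^sup>2 + Y3\<^sup>2 + Y1\<^sup>2)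
     = - \<beta> * (1 - \<beta>) * (w1 + w3)"
    unfolding L_def L'_def S0_def S1_def S2_def S3_def w1_def w3_def \<rho>1_def \<rho>3_def \<sigma>1_def \<sigma>3_def
    by (simp add: field_simps power2_eq_square)
  have id1: "2 * L * \<rho>1 + \<rho>1\<^sup>2 + \<sigma>1 + \<beta> * S1 = 2 * \<beta> * T1 - 2 * w1 + \<beta> * (\<rho>1 * \<rho>3)"
    unfolding L_def S1_def w1_def T1_def \<rho>1_def \<rho>3_def \<sigma>1_def by (simp add: field_simps power2_eq_square)
  have id3: "2 * L * \<rho>3 + \<rho>3\<^sup>2 + \<sigma>3 + \<beta> * S3 = 2 * \<beta> * T3 - 2 * w3 + \<beta> * (\<rho>1 * \<rho>3)"
    unfolding L_def S3_def w3_def T3_def \<rho>1_def \<rho>3_def \<sigma>3_def by (simp add: field_simps power2_eq_square)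
  have c11: "w1 * (r1 * (1 - r1) * e11) = e11 * (r1 * \<rho>1)\<^sup>2" "w3 * (r3 * (1 - r3) * e33) = e33 * (r3 * \<rho>3)\<^sup>2"
    unfolding w1 w3 using t1 t3 by algebra+
  have c1: "w1 * ((2 * \<beta> - 2 * r1) * e1) = e1 * r1 * (2 * \<beta> * T1 - 2 * w1)" "w3 * ((2 * \<beta> - 2 * r3) * e3) = e3 * r3 * (2 * \<beta> * T3 - 2 * w3)"
    using w1 w3 by algebra+
  have d1: "e1 * r1 * (2 * \<beta> * T1 - 2 * w1) = e1 * r1 * (2 * L * \<rho>1 + \<rho>1\<^sup>2 + \<sigma>1 + \<beta> * S1 - \<beta> * (\<rho>1 * \<rho>3))"
    and d3: "e3 * r3 * (2 * \<beta> * T3 - 2 * w3) = e3 * r3 * (2 * L * \<rho>3 + \<rho>3\<^sup>2 + \<sigma>3 + \<beta> * S3 - \<beta> * (\<rho>1 * \<rho>3))"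
    using id1 id3 by algebra+
  have d0: "w1 * (- \<beta> * (1 - \<beta>) * e) + w3 * (- \<beta> * (1 - \<beta>) * e) = (L\<^sup>2 + L' + \<beta> * ((1 - 3 * \<beta> / 2) * S0 + \<beta> / 2 * (S1 + S2 + S3)) + \<beta> / 2 * (1 - 3 * \<beta> / 2) * (y2\<^sup>2 + Y2\<^sup>2 + y3\<^sup>2 + Y3\<^sup>2 + Y1\<^sup>2)) * e"
    unfolding id0 by algebra
  have rhs: "w1 * (r1 * (1 - r1) * e11 + (2 * \<beta> - 2 * r1) * e1 - \<beta> * (1 - \<beta>) * e)
     + w3 * (r3 * (1 - r3) * e33 + (2 * \<beta> - 2 * r3) * e3 - \<beta> * (1 - \<beta>) * e)
     = w1 * (r1 * (1 - r1) * e11) + w1 * ((2 * \<beta> - 2 * r1) * e1) + w3 * (r3 * (1 - r3) * e33) + w3 * ((2 * \<beta> - 2 * r3) * e3)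
      + (w1 * (- \<beta> * (1 - \<beta>) * e) + w3 * (- \<beta> * (1 - \<beta>) * e))"
    by (simp add: algebra_simps)
  have S2: "S2 = - (\<rho>1 * \<rho>3)" unfolding S2_def \<rho>1_def \<rho>3_def ..
  show ?thesis
    unfolding rhs c11 c1 d1 d3 d0 S2 by (simp add: algebra_simps)
qed

text \<open>In \<open>A\<close> and \<open>C\<close> the formula for \<open>r2\<close> is a
  homogeneous quadratic equation, and the left-hand side is that quadratic times
  \<open>(1 - r1) * (1 - r3)\<close>. So the factor of \<open>G\<close> vanishes precisely because
  the three cross-ratios come from actual points.\<close>

lemma G_coefficient:
  fixes y2 Y2 y3 Y3 Y1 r1 r2 r3 :: real
  assumes r1: "r1 * (y2 - Y1) = Y2 - Y1" and r3: "r3 * (y3 - Y1) = Y3 - Y1"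
    and r2: "r2 * ((y2 - Y3) * (Y2 - y3)) = (y2 - y3) * (Y2 - Y3)"
  shows "(y2 - Y2) * (Y2 - Y1) * ((1 - r2) * (1 - r3)) + (y3 - Y3) * (Y3 - Y1) * ((1 - r1) * (1 - r2))
    + (y2 - Y2) * (y3 - Y3) * (r2 + r1 * r2 * r3 - r1 - r3) = 0"
proof -
  define A where "A = y2 - Y1"
  define C where "C = y3 - Y1"
  have e: "y2 = A + Y1" "y3 = C + Y1" "Y2 = r1 * A + Y1" "Y3 = r3 * C + Y1"
    using r1 r3 by (auto simp: A_def C_def)
  have "r2 * ((A - r3 * C) * (r1 * A - C)) = (A - C) * (r1 * A - r3 * C)" using r2 unfolding e by simp
  then have "(1 - r1) * (1 - r3) * (A\<^sup>2 * r1 * (1 - r2) + C\<^sup>2 * r3 * (1 - r2) + A * C * (r2 + r1 * r2 * r3 - r1 - r3)) = 0"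
    by algebra
  moreover have "(y2 - Y2) * (Y2 - Y1) * ((1 - r2) * (1 - r3)) + (y3 - Y3) * (Y3 - Y1) * ((1 - r1) * (1 - r2))
    + (y2 - Y2) * (y3 - Y3) * (r2 + r1 * r2 * r3 - r1 - r3)
    = (1 - r1) * (1 - r3) * (A\<^sup>2 * r1 * (1 - r2) + C\<^sup>2 * r3 * (1 - r2) + A * C * (r2 + r1 * r2 * r3 - r1 - r3))"
    unfolding e by algebra
  ultimately show ?thesis by simp
qed

lemma crs_inverse_coordinates:
  assumes r: "crs p1 q1 p2 q2 \<in> {0<..<1}" "crs p2 q2 p3 q3 \<in> {0<..<1}" "crs p3 q3 p1 q1 \<in> {0<..<1}"
  shows "crs p1 q1 p2 q2 * (1 / (p1 - p2) - 1 / (p1 - q1)) = 1 / (p1 - q2) - 1 / (p1 - q1)"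
    "crs p3 q3 p1 q1 * (1 / (p1 - p3) - 1 / (p1 - q1)) = 1 / (p1 - q3) - 1 / (p1 - q1)"
    "crs p2 q2 p3 q3 * ((1 / (p1 - p2) - 1 / (p1 - q3)) * (1 / (p1 - q2) - 1 / (p1 - p3)))
      = (1 / (p1 - p2) - 1 / (p1 - p3)) * (1 / (p1 - q2) - 1 / (p1 - q3))"
proof -
  note n = crs_distinct[OF r(1)] crs_distinct[OF r(2)] crs_distinct[OF r(3)]
  have d: "1 / (p1 - u) - 1 / (p1 - v) = (u - v) / ((p1 - u) * (p1 - v))" if "p1 \<noteq> u" "p1 \<noteq> v" for u v
    using that by (simp add: divide_simps)
  have one: "crs p q u v * (1 / (p - u) - 1 / (p - q)) = 1 / (p - v) - 1 / (p - q)"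
    if "p \<noteq> u" "p \<noteq> q" "p \<noteq> v" "q \<noteq> u" for p q u v
    using that unfolding crs_def by (simp add: divide_simps) (simp add: algebra_simps)
  show "crs p1 q1 p2 q2 * (1 / (p1 - p2) - 1 / (p1 - q1)) = 1 / (p1 - q2) - 1 / (p1 - q1)"
    by (rule one) (use n in auto)
  show "crs p3 q3 p1 q1 * (1 / (p1 - p3) - 1 / (p1 - q1)) = 1 / (p1 - q3) - 1 / (p1 - q1)"
    unfolding crs_swap(1)[of p3 q3 p1 q1] by (rule one) (use n in auto)
  show "crs p2 q2 p3 q3 * ((1 / (p1 - p2) - 1 / (p1 - q3)) * (1 / (p1 - q2) - 1 / (p1 - p3)))
      = (1 / (p1 - p2) - 1 / (p1 - p3)) * (1 / (p1 - q2) - 1 / (p1 - q3))"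
    using n by (simp add: d crs_def mult_ac)
qed

text \<open>The BPZ operator at \<open>p1\<close>, times \<beta> / 2 and with \<open>Lam\<close>
  divided out. The three groups are the left-hand sides of \<open>eq_D1\<close>,
  \<open>eq_D3\<close> and of \<open>x * M1 + z * M3 - y * M2\<close> in terms of the equations
  \<open>eq_M1\<close>, \<open>eq_M2\<close>, \<open>eq_M3\<close>; in the last one the other mixed
  second derivatives cancel.\<close>

definition bpz_op where
  "bpz_op \<beta> E E1 E2 E3 E11 E13 E33 p1 p2 p3 q1 q2 q3 =
    (let r1 = crs p1 q1 p2 q2; r2 = crs p2 q2 p3 q3; r3 = crs p3 q3 p1 q1;
         \<rho>1 = 1 / (p1 - p2) - 1 / (p1 - q2); \<rho>3 = 1 / (p1 - p3) - 1 / (p1 - q3)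
     in \<rho>1 * (1 / (p1 - q2) - 1 / (p1 - q1)) *
          (r1 * (1 - r1) * E11 r1 r2 r3 + (2 * \<beta> - 2 * r1) * E1 r1 r2 r3 - \<beta> * (1 - \<beta>) * E r1 r2 r3)
      + \<rho>3 * (1 / (p1 - q3) - 1 / (p1 - q1)) *
          (r3 * (1 - r3) * E33 r1 r2 r3 + (2 * \<beta> - 2 * r3) * E3 r1 r2 r3 - \<beta> * (1 - \<beta>) * E r1 r2 r3)
      + \<rho>1 * \<rho>3 * (2 * r1 * r3 * E13 r1 r2 r3 + \<beta> * (r1 * E1 r1 r2 r3 + r3 * E3 r1 r2 r3 - r2 * E2 r1 r2 r3)))"

text \<open>The factor \<beta> / 2 gives the second derivative the coefficient 1, since \<kappa> / 2
  = 2 / \<beta>, and turns - 2 h into \<beta> / 2 times 1 - 3 \<beta> / 2.\<close>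

lemma bpz_identity:
  fixes \<beta> :: real
  assumes E: "has_partials E E1 E2 E3" "has_partials E1 E11 E12 E13" "has_partials E3 E13 E32 E33"
    and r: "crs p1 q1 p2 q2 \<in> {0<..<1}" "crs p2 q2 p3 q3 \<in> {0<..<1}" "crs p3 q3 p1 q1 \<in> {0<..<1}"
  defines "W \<equiv> Wdot \<beta> E E1 E2 E3 p1 p2 p3 q1 q2 q3"
  shows "\<exists>W2. ((\<lambda>s. Wdot \<beta> E E1 E2 E3 s p2 p3 q1 q2 q3 1 0 0 0 0 0) has_real_derivative W2) (at p1) \<and>
    W2 + \<beta> * (1 / (p2 - p1) * W 0 1 0 0 0 0 + 1 / (p3 - p1) * W 0 0 1 0 0 0
       + 1 / (q1 - p1) * W 0 0 0 1 0 0 + 1 / (q2 - p1) * W 0 0 0 0 1 0 + 1 / (q3 - p1) * W 0 0 0 0 0 1)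
     + \<beta> / 2 * (1 - 3 * \<beta> / 2) * (1 / (p2 - p1)\<^sup>2 + 1 / (p3 - p1)\<^sup>2 + 1 / (q1 - p1)\<^sup>2 + 1 / (q2 - p1)\<^sup>2 + 1 / (q3 - p1)\<^sup>2)
        * Wf \<beta> E p1 p2 p3 q1 q2 q3
     = Lam \<beta> p1 p2 p3 q1 q2 q3 * bpz_op \<beta> E E1 E2 E3 E11 E13 E33 p1 p2 p3 q1 q2 q3"
proof -
  note n = crs_distinct[OF r(1)] crs_distinct[OF r(2)] crs_distinct[OF r(3)]
  define y2 where "y2 = 1 / (p1 - p2)"
  define Y2 where "Y2 = 1 / (p1 - q2)"
  define y3 where "y3 = 1 / (p1 - p3)"
  define Y3 where "Y3 = 1 / (p1 - q3)"
  define Y1 where "Y1 = 1 / (p1 - q1)"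
  define r1 where "r1 = crs p1 q1 p2 q2"
  define r2 where "r2 = crs p2 q2 p3 q3"
  define r3 where "r3 = crs p3 q3 p1 q1"
  define La where "La = Lam \<beta> p1 p2 p3 q1 q2 q3"
  define e where "e = E r1 r2 r3"
  define e1 where "e1 = E1 r1 r2 r3"
  define e2 where "e2 = E2 r1 r2 r3"
  define e3 where "e3 = E3 r1 r2 r3"
  define e11 where "e11 = E11 r1 r2 r3"
  define e13 where "e13 = E13 r1 r2 r3"
  define e33 where "e33 = E33 r1 r2 r3"
  note cd = crs_inverse_coordinates[OF r, folded y2_def Y2_def y3_def Y3_def Y1_def r1_def r2_def r3_def]
  define a b c d f g k2 k3 l m where "a = 1 / (q1 - p2)" and "b = 1 / (q1 - q2)" and "c = 1 / (p2 - p3)"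
    and "d = 1 / (q2 - q3)" and "f = 1 / (p2 - q3)" and "g = 1 / (q2 - p3)" and "k2 = 1 / (p2 - q2)"
    and "k3 = 1 / (p3 - q3)" and "l = 1 / (q1 - p3)" and "m = 1 / (q1 - q3)"
  note defs = a_def b_def c_def d_def f_def g_def k2_def k3_def l_def m_def
  have rel: "a * (Y1 - y2) = Y1 * y2" "b * (Y1 - Y2) = Y1 * Y2" "c * (y2 - y3) = y2 * y3" "d * (Y2 - Y3) = Y2 * Y3"
    "f * (y2 - Y3) = y2 * Y3" "g * (Y2 - y3) = Y2 * y3" "k2 * (y2 - Y2) = y2 * Y2" "k3 * (y3 - Y3) = y3 * Y3"
    "l * (Y1 - y3) = Y1 * y3" "m * (Y1 - Y3) = Y1 * Y3"
    unfolding defs y2_def Y2_def y3_def Y3_def Y1_def by (rule inverse_difference; use n in auto)+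
  have neg: "1 / (v - u) = - (1 / (u - v))" for u v :: real
    by (metis minus_diff_eq minus_divide_right)
  have R1: "rlog p1 q1 p2 q2 v1 w1 v2 w2 = (v1 - v2) * y2 + (w1 - w2) * b - (v1 - w2) * Y2 - (w1 - v2) * a" for v1 w1 v2 w2
    by (simp add: rlog_def y2_def Y2_def b_def a_def)
  have R2: "rlog p2 q2 p3 q3 v2 w2 v3 w3 = (v2 - v3) * c + (w2 - w3) * d - (v2 - w3) * f - (w2 - v3) * g" for v2 w2 v3 w3
    by (simp add: rlog_def c_def d_def f_def g_def)
  have R3: "rlog p3 q3 p1 q1 v3 w3 v1 w1 = (v1 - v3) * y3 + (w1 - w3) * m - (w1 - v3) * l - (v1 - w3) * Y3" for v3 w3 v1 w1
  proof -
    have t: "u / v = u * (1 / v)" for u v :: real by simp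
    have "rlog p3 q3 p1 q1 v3 w3 v1 w1 = (v3 - v1) * (1 / (p3 - p1)) + (w3 - w1) * (1 / (q3 - q1)) - (v3 - w1) * (1 / (p3 - q1)) - (w3 - v1) * (1 / (q3 - p1))"
      by (simp add: rlog_def)
    then show ?thesis
      unfolding neg[of p3 p1] neg[of q3 q1] neg[of p3 q1] neg[of q3 p1] y3_def[symmetric] Y3_def[symmetric] m_def[symmetric] l_def[symmetric]
      by (simp add: algebra_simps)
  qed
  have Wd: "W v1 v2 v3 w1 w2 w3 = La * (((1 - 3 * \<beta> / 2) * ((v1 - w1) * Y1 + (v2 - w2) * k2 + (v3 - w3) * k3)
       + \<beta> / 2 * (rlog p1 q1 p2 q2 v1 w1 v2 w2 + rlog p2 q2 p3 q3 v2 w2 v3 w3 + rlog p3 q3 p1 q1 v3 w3 v1 w1)) * e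
       + e1 * (r1 * rlog p1 q1 p2 q2 v1 w1 v2 w2) + e2 * (r2 * rlog p2 q2 p3 q3 v2 w2 v3 w3) + e3 * (r3 * rlog p3 q3 p1 q1 v3 w3 v1 w1))"
    for v1 v2 v3 w1 w2 w3
    by (simp add: W_def Wdot_def Let_def La_def r1_def r2_def r3_def e_def e1_def e2_def e3_def Y1_def k2_def k3_def)
  have S: "1 / (p2 - p1) * W 0 1 0 0 0 0 + 1 / (p3 - p1) * W 0 0 1 0 0 0
       + 1 / (q1 - p1) * W 0 0 0 1 0 0 + 1 / (q2 - p1) * W 0 0 0 0 1 0 + 1 / (q3 - p1) * W 0 0 0 0 0 1
    = La * (((1 - 3 * \<beta> / 2) * (Y1\<^sup>2 - y2 * Y2 - y3 * Y3) + \<beta> / 2 * ((y2 - Y2) * (y2 + Y2 + Y1) + - ((y2 - Y2) * (y3 - Y3)) + (y3 - Y3) * (y3 + Y3 + Y1))) * e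
       + e1 * (r1 * ((y2 - Y2) * (y2 + Y2 + Y1))) + e2 * (r2 * (- ((y2 - Y2) * (y3 - Y3)))) + e3 * (r3 * ((y3 - Y3) * (y3 + Y3 + Y1))))"
  proof -
    \<comment> \<open>The first order part, summed over the five other points, applied to the
      logarithms of the link lengths (\<open>S0\<close>) and of the three cross-ratios
      (\<open>S1\<close>, \<open>S2\<close>, \<open>S3\<close>).\<close>
    have S0: "- y2 * k2 - y3 * k3 + Y1 * Y1 + Y2 * k2 + Y3 * k3 = Y1\<^sup>2 - y2 * Y2 - y3 * Y3" using rel(7,8) by algebra
    have S1: "- y2 * (a - y2) - Y1 * (b - a) - Y2 * (Y2 - b) = (y2 - Y2) * (y2 + Y2 + Y1)" using rel(1,2) by algebra
    have S2: "- y2 * (c - f) - y3 * (g - c) - Y2 * (d - g) - Y3 * (f - d) = - ((y2 - Y2) * (y3 - Y3))" using rel(3-6) by algebra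
    have S3: "- y3 * (l - y3) - Y1 * (m - l) - Y3 * (Y3 - m) = (y3 - Y3) * (y3 + Y3 + Y1)" using rel(9,10) by algebra
    have n': "1 / (p2 - p1) = - y2" "1 / (p3 - p1) = - y3" "1 / (q1 - p1) = - Y1" "1 / (q2 - p1) = - Y2" "1 / (q3 - p1) = - Y3"
      unfolding y2_def Y2_def y3_def Y3_def Y1_def by (rule neg)+
    define la mu where "la = 1 - 3 * \<beta> / 2" and "mu = \<beta> / 2"
    show ?thesis
      unfolding n' Wd R1 R2 R3 S0[symmetric] S1[symmetric] S2[symmetric] S3[symmetric] la_def[symmetric] mu_def[symmetric]
      by (simp add: algebra_simps)
  qed
  have sq: "1 / (p2 - p1)\<^sup>2 = y2\<^sup>2" "1 / (p3 - p1)\<^sup>2 = y3\<^sup>2" "1 / (q1 - p1)\<^sup>2 = Y1\<^sup>2" "1 / (q2 - p1)\<^sup>2 = Y2\<^sup>2" "1 / (q3 - p1)\<^sup>2 = Y3\<^sup>2"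
    unfolding y2_def Y2_def y3_def Y3_def Y1_def by (simp_all add: power_divide power2_commute)
  have sq': "1 / (p1 - q2)\<^sup>2 - 1 / (p1 - p2)\<^sup>2 = Y2\<^sup>2 - y2\<^sup>2" "1 / (p1 - q3)\<^sup>2 - 1 / (p1 - p3)\<^sup>2 = Y3\<^sup>2 - y3\<^sup>2"
    "- (1 - 3 * \<beta> / 2) / (p1 - q1)\<^sup>2 = - (1 - 3 * \<beta> / 2) * Y1\<^sup>2" "(1 - 3 * \<beta> / 2) / (p1 - q1) = (1 - 3 * \<beta> / 2) * Y1"
    unfolding y2_def Y2_def y3_def Y3_def Y1_def by (simp_all add: power_divide)
  note D = Wf_second_derivative[OF E r, of \<beta>, folded y2_def Y2_def y3_def Y3_def, unfolded sq',
      folded r1_def r2_def r3_def La_def, folded e_def e1_def e3_def e11_def e13_def e33_def]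
  have Wf: "Wf \<beta> E p1 p2 p3 q1 q2 q3 = La * e" by (simp add: Wf_def La_def e_def r1_def r2_def r3_def)
  have op: "bpz_op \<beta> E E1 E2 E3 E11 E13 E33 p1 p2 p3 q1 q2 q3 =
      (y2 - Y2) * (Y2 - Y1) * (r1 * (1 - r1) * e11 + (2 * \<beta> - 2 * r1) * e1 - \<beta> * (1 - \<beta>) * e)
     + (y3 - Y3) * (Y3 - Y1) * (r3 * (1 - r3) * e33 + (2 * \<beta> - 2 * r3) * e3 - \<beta> * (1 - \<beta>) * e)
     + (y2 - Y2) * (y3 - Y3) * (2 * r1 * r3 * e13 + \<beta> * (r1 * e1 + r3 * e3 - r2 * e2))"
    by (simp add: bpz_op_def Let_def y2_def Y2_def y3_def Y3_def Y1_def r1_def r2_def r3_def e_def e1_def e2_def e3_def e11_def e13_def e33_def)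
  show ?thesis
    unfolding S sq Wf op La_def[symmetric] bpz_polynomial[OF cd(1,2), symmetric]
    by (rule exI, rule conjI, rule D) (simp add: algebra_simps)
qed

section \<open>Positivity\<close>

lemma pderiv_comm13: "pderiv1 (pderiv3 a) = pderiv3 (pderiv1 a)"
  by (intro ext) (simp add: pderiv1_def pderiv3_def)

lemma has_partials_combine:
  assumes "has_partials E E1 E2 E3" "has_partials D D1 D2 D3"
  shows "has_partials (\<lambda>x y z. E x y z - c + m * D x y z) (\<lambda>x y z. E1 x y z + m * D1 x y z)
    (\<lambda>x y z. E2 x y z + m * D2 x y z) (\<lambda>x y z. E3 x y z + m * D3 x y z)"
  unfolding has_partials_def
proof (intro allI impI)
  fix X Y Z :: "real \<Rightarrow> real" and X' Y' Z' t
  assume h: "(X has_real_derivative X') (at t)" "(Y has_real_derivative Y') (at t)" "(Z has_real_derivative Z') (at t)"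
    "X t \<in> {0<..<1}" "Y t \<in> {0<..<1}" "Z t \<in> {0<..<1}"
  have c: "((\<lambda>s. c) has_real_derivative 0) (at t)" by (rule DERIV_const)
  show "((\<lambda>s. E (X s) (Y s) (Z s) - c + m * D (X s) (Y s) (Z s)) has_real_derivative
      (E1 (X t) (Y t) (Z t) + m * D1 (X t) (Y t) (Z t)) * X' + (E2 (X t) (Y t) (Z t) + m * D2 (X t) (Y t) (Z t)) * Y'
      + (E3 (X t) (Y t) (Z t) + m * D3 (X t) (Y t) (Z t)) * Z') (at t)"
    by (rule DERIV_cong[OF DERIV_add[OF DERIV_diff[OF assms(1)[unfolded has_partials_def, rule_format, OF h] c]
      DERIV_cmult[OF assms(2)[unfolded has_partials_def, rule_format, OF h]]]]) (simp add: algebra_simps)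
qed

lemma has_partials_product:
  assumes "\<And>x. x \<in> {0<..<1} \<Longrightarrow> (f has_real_derivative f' x) (at x)" "\<And>x. x \<in> {0<..<1} \<Longrightarrow> (g has_real_derivative g' x) (at x)"
    "\<And>x. x \<in> {0<..<1} \<Longrightarrow> (h has_real_derivative h' x) (at x)"
  shows "has_partials (\<lambda>x y z. f x * g y * h z) (\<lambda>x y z. f' x * g y * h z) (\<lambda>x y z. f x * g' y * h z) (\<lambda>x y z. f x * g y * h' z)"
  unfolding has_partials_def
proof (intro allI impI)
  fix X Y Z :: "real \<Rightarrow> real" and X' Y' Z' t
  assume h: "(X has_real_derivative X') (at t)" "(Y has_real_derivative Y') (at t)" "(Z has_real_derivative Z') (at t)"
    "X t \<in> {0<..<1}" "Y t \<in> {0<..<1}" "Z t \<in> {0<..<1}"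
  show "((\<lambda>s. f (X s) * g (Y s) * h (Z s)) has_real_derivative
      f' (X t) * g (Y t) * h (Z t) * X' + f (X t) * g' (Y t) * h (Z t) * Y' + f (X t) * g (Y t) * h' (Z t) * Z') (at t)"
    by (rule DERIV_cong[OF DERIV_mult[OF DERIV_mult[OF DERIV_chain2[OF assms(1)[OF h(4)] h(1)] DERIV_chain2[OF assms(2)[OF h(5)] h(2)]]
      DERIV_chain2[OF assms(3)[OF h(6)] h(3)]]]) (simp add: algebra_simps)
qed

text \<open>The operator is linear and sees a constant only through its zero order part, so for
  \<open>c > 0\<close> the last line has the sign of 1 - \<beta> as soon as the bracket is
  positive.\<close>

lemma bpz_op_combine:
  "bpz_op \<beta> (\<lambda>x y z. E x y z - c + m * D x y z) (\<lambda>x y z. E1 x y z + m * D1 x y z)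
    (\<lambda>x y z. E2 x y z + m * D2 x y z) (\<lambda>x y z. E3 x y z + m * D3 x y z)
    (\<lambda>x y z. E11 x y z + m * D11 x y z) (\<lambda>x y z. E13 x y z + m * D13 x y z) (\<lambda>x y z. E33 x y z + m * D33 x y z) p1 p2 p3 q1 q2 q3
   = bpz_op \<beta> E E1 E2 E3 E11 E13 E33 p1 p2 p3 q1 q2 q3
     + m * bpz_op \<beta> D D1 D2 D3 D11 D13 D33 p1 p2 p3 q1 q2 q3
     + c * \<beta> * (1 - \<beta>) * ((1 / (p1 - p2) - 1 / (p1 - q2)) * (1 / (p1 - q2) - 1 / (p1 - q1)) + (1 / (p1 - p3) - 1 / (p1 - q3)) * (1 / (p1 - q3) - 1 / (p1 - q1)))"
  unfolding bpz_op_def Let_def by (simp only: algebra_simps)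

text \<open>The three cross-ratios of six ordered real points do not fill the cube: given two of them, \<open>u\<close> and
  \<open>v\<close>, the third has the form \<open>Kf u v t\<close> with \<open>t > 0\<close>.\<close>

definition Kf :: "real \<Rightarrow> real \<Rightarrow> real \<Rightarrow> real" where
  "Kf u v t = (u + v * t) * (1 + t) / ((u + t) * (1 + v * t))"

lemma one_minus_Kf:
  assumes "u > 0" "v > 0" "t > 0"
  shows "1 - Kf u v t = (1 - u) * (1 - v) * t / ((u + t) * (1 + v * t))"
proof -
  have "u + t > 0" "1 + v * t > 0" using assms by (auto intro: add_pos_pos)
  then show ?thesis unfolding Kf_def by (simp add: divide_simps) (simp add: algebra_simps)
qed

text \<open>By the last two bounds, \<open>Kf\<close> tends to 1 as \<open>t\<close> tends to 0 or
  to infinity while \<open>u\<close> and \<open>v\<close> stay away from 0; this confines minima to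
  a compact set of \<open>t\<close>.\<close>

lemma Kf_range:
  assumes "0 < u" "u < 1" "0 < v" "v < 1" "t > 0"
  shows "0 < Kf u v t" "Kf u v t < 1" "1 - Kf u v t < t / u" "1 - Kf u v t < 1 / (v * t)"
proof -
  have vt: "v * t > 0" using assms by simp
  have p: "u + t > 0" "1 + v * t > 0" "u + v * t > 0" "v * t > 0" using assms vt by linarith+
  show "0 < Kf u v t" unfolding Kf_def by (intro divide_pos_pos mult_pos_pos; use p assms in linarith)
  have k: "1 - Kf u v t = (1 - u) * (1 - v) * t / ((u + t) * (1 + v * t))" using assms by (intro one_minus_Kf)
  have "(1 - u) * (1 - v) * t / ((u + t) * (1 + v * t)) > 0" by (intro divide_pos_pos mult_pos_pos; use p assms in linarith)
  then show "Kf u v t < 1" using k by simp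
  have l: "(1 - u) * (1 - v) < 1 * 1" using assms by (intro mult_strict_mono) auto
  have "(1 - u) * (1 - v) * t < t" using l assms by simp
  moreover have "(u + t) * (1 + v * t) > u * 1" using p assms by (intro mult_strict_mono) auto
  ultimately show "1 - Kf u v t < t / u" unfolding k
    using assms by (intro frac_less) auto
  have "(1 - u) * (1 - v) * t < t" using l assms by simp
  moreover have "(u + t) * (1 + v * t) > t * (v * t)" using p assms by (intro mult_strict_mono) auto
  ultimately have "(1 - u) * (1 - v) * t / ((u + t) * (1 + v * t)) < t / (t * (v * t))"
    using assms by (intro frac_less) auto
  then show "1 - Kf u v t < 1 / (v * t)" unfolding k using assms by simp
qed

text \<open>The Moebius map \<open>w\<close> sends \<open>q1\<close> to 0 and \<open>p1\<close> to
  infinity; then \<open>q2\<close> and \<open>q3\<close> become the multiples \<open>v\<close> and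
  \<open>u\<close> of \<open>p2\<close> and \<open>p3\<close>. The sign hypothesis says that the
  link of \<open>p1\<close> and \<open>q1\<close> separates the other two, which makes
  \<open>t = - w p2 / w p3\<close> positive.\<close>

lemma crs_Kf:
  assumes r: "crs p1 q1 p2 q2 \<in> {0<..<1}" "crs p2 q2 p3 q3 \<in> {0<..<1}" "crs p3 q3 p1 q1 \<in> {0<..<1}"
    and s: "(p2 - q1) / (p2 - p1) * ((p3 - q1) / (p3 - p1)) < 0"
  obtains t where "t > 0" "crs p2 q2 p3 q3 = Kf (crs p3 q3 p1 q1) (crs p1 q1 p2 q2) t"
proof -
  note n = crs_distinct[OF r(1)] crs_distinct[OF r(2)] crs_distinct[OF r(3)]
  define w where "w x = (x - q1) / (x - p1)" for x
  define t where "t = - w p2 / w p3"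
  define u where "u = crs p3 q3 p1 q1"
  define v where "v = crs p1 q1 p2 q2"
  have s': "w p2 * w p3 < 0" using s by (simp add: w_def)
  then have t: "t > 0" and w3: "w p3 \<noteq> 0" by (auto simp: t_def divide_less_0_iff mult_less_0_iff)
  have uv: "u \<in> {0<..<1}" "v \<in> {0<..<1}" using r by (simp_all add: u_def v_def)
  have e2: "w p2 = - t * w p3" using w3 by (simp add: t_def)
  have one: "w b = crs p1 q1 a b * w a" if "a \<noteq> p1" "b \<noteq> p1" "a \<noteq> q1" "b \<noteq> q1" for a b
    using that unfolding crs_def w_def by (simp add: divide_simps) (simp add: algebra_simps)
  have q2: "w q2 = v * w p2" unfolding v_def by (rule one) (use n in auto)
  have q3: "w q3 = u * w p3" unfolding u_def crs_swap(1)[of p3 q3 p1 q1] by (rule one) (use n in auto)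
  have d: "w a - w b = (q1 - p1) * (a - b) / ((a - p1) * (b - p1))" if "a \<noteq> p1" "b \<noteq> p1" for a b
    using that unfolding w_def by (simp add: divide_simps) (simp add: algebra_simps)
  have inv: "crs p2 q2 p3 q3 = (w p2 - w p3) * (w q2 - w q3) / ((w p2 - w q3) * (w q2 - w p3))"
  proof -
    have e: "w p2 - w p3 = (q1 - p1) * (p2 - p3) / ((p2 - p1) * (p3 - p1))" "w q2 - w q3 = (q1 - p1) * (q2 - q3) / ((q2 - p1) * (q3 - p1))"
      "w p2 - w q3 = (q1 - p1) * (p2 - q3) / ((p2 - p1) * (q3 - p1))" "w q2 - w p3 = (q1 - p1) * (q2 - p3) / ((q2 - p1) * (p3 - p1))"
      using n by (auto intro!: d)
    show ?thesis unfolding e crs_def using n by (simp add: divide_simps)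
  qed
  have "crs p2 q2 p3 q3 = (- t * w p3 - w p3) * (v * (- t * w p3) - u * w p3) / ((- t * w p3 - u * w p3) * (v * (- t * w p3) - w p3))"
    unfolding inv q2 q3 e2 ..
  also have "\<dots> = ((w p3)\<^sup>2 * ((u + v * t) * (1 + t))) / ((w p3)\<^sup>2 * ((u + t) * (1 + v * t)))"
    by (rule arg_cong2[of _ _ _ _ "(/)"]) (simp_all add: power2_eq_square algebra_simps)
  also have "\<dots> = Kf u v t" unfolding Kf_def using w3 by simp
  finally show ?thesis using that[OF t] by (simp add: u_def v_def)
qed

lemma crs_unit:
  assumes "(p1 - p2) * (q1 - q2) / ((p1 - q2) * (q1 - p2)) > 0" "(p1 - q1) * (q2 - p2) / ((p1 - q2) * (q1 - p2)) > 0"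
  shows "crs p1 q1 p2 q2 \<in> {0<..<1}"
proof -
  have n: "p1 \<noteq> q2" "q1 \<noteq> p2" using assms by auto
  have "1 - crs p1 q1 p2 q2 > 0" unfolding one_minus_crs[OF n] by (rule assms(2))
  then show ?thesis using assms(1) by (simp add: crs_def)
qed

lemma crs_chamber:
  assumes "x1 < x2" "x2 < x3" "x3 < x4" "x4 < x5" "x5 < (x6::real)"
  shows "crs x1 x4 x2 x3 \<in> {0<..<1}" "crs x2 x3 x6 x5 \<in> {0<..<1}" "crs x6 x5 x1 x4 \<in> {0<..<1}"
    "(x2 - x4) / (x2 - x1) * ((x6 - x4) / (x6 - x1)) < 0"
proof -
  show "crs x1 x4 x2 x3 \<in> {0<..<1}" by (rule crs_unit) (use assms in \<open>auto simp: zero_less_divide_iff zero_less_mult_iff mult_less_0_iff\<close>)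
  show "crs x2 x3 x6 x5 \<in> {0<..<1}" by (rule crs_unit) (use assms in \<open>auto simp: zero_less_divide_iff zero_less_mult_iff mult_less_0_iff\<close>)
  show "crs x6 x5 x1 x4 \<in> {0<..<1}" by (rule crs_unit) (use assms in \<open>auto simp: zero_less_divide_iff zero_less_mult_iff mult_less_0_iff\<close>)
  show "(x2 - x4) / (x2 - x1) * ((x6 - x4) / (x6 - x1)) < 0"
    by (rule mult_neg_pos) (use assms in \<open>auto simp: zero_less_divide_iff divide_less_0_iff\<close>)
qed

text \<open>The normal form of \<open>crs_Kf\<close> read backwards: with the separating link at 0
  and 1/2, the map \<open>(x - 1/2) / x\<close> takes \<open>x2, x3, x5, 1\<close> to
  \<open>- t / 2, - v * t / 2, u / 2, 1/2\<close>.\<close>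

lemma crs_realisation:
  assumes "0 < u" "u < 1" "0 < v" "v < 1" "t > 0"
  defines "x2 \<equiv> 1 / (2 + t)" and "x3 \<equiv> 1 / (2 + v * t)" and "x5 \<equiv> 1 / (2 - u)"
  shows "0 < x2" "x2 < x3" "x3 < 1/2" "1/2 < x5" "x5 < 1"
    "crs 0 (1/2) x2 x3 = v" "crs x2 x3 1 x5 = Kf u v t" "crs 1 x5 0 (1/2) = u"
proof -
  have vt: "v * t > 0" using assms by simp
  have p: "2 + t > 0" "2 + v * t > 0" "2 - u > 0" "v * t < t" "v * t > 0" "\<not> 2 + v * t < 0" "2 + v * t \<noteq> 0"
  proof -
    show "v * t < t" using assms(1-5) by simp
    show "2 + t > 0" "2 + v * t > 0" "2 - u > 0" "v * t > 0" "\<not> 2 + v * t < 0" "2 + v * t \<noteq> 0"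
      using assms(1-5) vt by linarith+
  qed
  show o: "0 < x2" "x2 < x3" "x3 < 1/2" "1/2 < x5" "x5 < 1"
    unfolding x2_def x3_def x5_def using p assms by (auto simp: divide_simps)
  have d: "1/2 - x2 = t / (2 * (2 + t))" "1/2 - x3 = v * t / (2 * (2 + v * t))" "1 - x5 = (1 - u) / (2 - u)" "1/2 - x5 = - u / (2 * (2 - u))"
    "x2 - x3 = - ((1 - v) * t) / ((2 + t) * (2 + v * t))"  "x2 - 1 = - (1 + t) / (2 + t)" "x3 - x5 = - (u + v * t) / ((2 + v * t) * (2 - u))"
    "x2 - x5 = - (u + t) / ((2 + t) * (2 - u))" "x3 - 1 = - (1 + v * t) / (2 + v * t)" "x5 - 1/2 = u / (2 * (2 - u))"
    unfolding x2_def x3_def x5_def using p by (simp_all add: divide_simps) (simp_all add: algebra_simps)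
  have pp: "u + t > 0" "1 + v * t > 0" using assms p by auto
  show "crs 0 (1/2) x2 x3 = v" unfolding crs_def d using assms p by (simp add: x2_def x3_def divide_simps) (simp add: algebra_simps)
  show "crs x2 x3 1 x5 = Kf u v t" unfolding crs_def d Kf_def using assms p pp by (simp add: divide_simps mult_ac) (simp add: algebra_simps)
  show "crs 1 x5 0 (1/2) = u" unfolding crs_def d using assms p by (simp add: x5_def divide_simps)
qed

section \<open>The supersolution in the BPZ operator\<close>

lemma powr_one_minus_deriv2:
  fixes x :: real
  assumes "x < 1"
  shows "((\<lambda>t. - \<gamma> / (1 - t) * (1 - t) powr \<gamma>) has_real_derivative \<gamma> * (\<gamma> - 1) / (1 - x)\<^sup>2 * (1 - x) powr \<gamma>) (at x)"
proof -
  have "((\<lambda>t. - \<gamma> / (1 - t)) has_real_derivative - \<gamma> / (1 - x)\<^sup>2) (at x)"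
    using assms by (auto intro!: derivative_eq_intros simp: power2_eq_square)
  from DERIV_mult[OF this powr_one_minus_deriv[OF assms]] show ?thesis
    by (rule DERIV_cong) (use assms in \<open>simp add: power2_eq_square divide_simps\<close>, simp add: algebra_simps)
qed

text \<open>The operator on the product of the powers \<open>(1 - r) powr \<gamma>\<close>, divided
  by that product. The relation \<open>rel\<close> removes \<open>r2 / (1 - r2)\<close>; what
  remains is a quadratic form in \<open>r1 * A\<close> and \<open>r3 * C\<close> and a multiple of
  the zero order weight.\<close>

lemma bpz_power_form:
  fixes A C r1 r2 r3 \<gamma> \<beta> :: real
  assumes n: "r1 \<noteq> 1" "r2 \<noteq> 1" "r3 \<noteq> 1"
    and rel: "r2 * ((A - r3 * C) * (r1 * A - C)) = (A - C) * (r1 * A - r3 * C)"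
  shows "A * (1 - r1) * (r1 * A) * (r1 * (1 - r1) * (\<gamma> * (\<gamma> - 1) / (1 - r1)\<^sup>2) + (2 * \<beta> - 2 * r1) * (- \<gamma> / (1 - r1)) - \<beta> * (1 - \<beta>))
    + C * (1 - r3) * (r3 * C) * (r3 * (1 - r3) * (\<gamma> * (\<gamma> - 1) / (1 - r3)\<^sup>2) + (2 * \<beta> - 2 * r3) * (- \<gamma> / (1 - r3)) - \<beta> * (1 - \<beta>))
    + A * (1 - r1) * (C * (1 - r3)) * (2 * r1 * r3 * (\<gamma> / (1 - r1) * (\<gamma> / (1 - r3)))
        + \<beta> * (r1 * (- \<gamma> / (1 - r1)) + r3 * (- \<gamma> / (1 - r3)) - r2 * (- \<gamma> / (1 - r2))))
   = \<gamma> * (\<gamma> + 1 - 3 * \<beta>) * ((r1 * A)\<^sup>2 + (r3 * C)\<^sup>2) + 2 * \<gamma> * (\<gamma> + \<beta>) * (r1 * A * (r3 * C))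
     - \<beta> * (3 * \<gamma> + 1 - \<beta>) * (A\<^sup>2 * r1 * (1 - r1) + C\<^sup>2 * r3 * (1 - r3))"
proof -
  define i1 i2 i3 where "i1 = 1 / (1 - r1)" and "i2 = 1 / (1 - r2)" and "i3 = 1 / (1 - r3)"
  have i: "i1 * (1 - r1) = 1" "i2 * (1 - r2) = 1" "i3 * (1 - r3) = 1" using n by (simp_all add: i1_def i2_def i3_def)
  have q: "\<gamma> * (\<gamma> - 1) / (1 - r1)\<^sup>2 = \<gamma> * (\<gamma> - 1) * i1\<^sup>2" "- \<gamma> / (1 - r1) = - \<gamma> * i1" "\<gamma> / (1 - r1) = \<gamma> * i1"
    "\<gamma> * (\<gamma> - 1) / (1 - r3)\<^sup>2 = \<gamma> * (\<gamma> - 1) * i3\<^sup>2" "- \<gamma> / (1 - r3) = - \<gamma> * i3" "\<gamma> / (1 - r3) = \<gamma> * i3" "- \<gamma> / (1 - r2) = - \<gamma> * i2"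
    by (simp_all add: i1_def i2_def i3_def power_divide)
  have "(1 - r2) * (A * C * (1 - r1) * (1 - r3) * r2 * i2) = (1 - r2) * (- (A\<^sup>2 * r1 - (r1 + r3) * A * C + r3 * C\<^sup>2))"
    using i(2) rel by algebra
  then have k2: "A * C * (1 - r1) * (1 - r3) * r2 * i2 = - (A\<^sup>2 * r1 - (r1 + r3) * A * C + r3 * C\<^sup>2)" using n(2) by simp
  have c1: "A * (1 - r1) * (r1 * A) * (r1 * (1 - r1) * (\<gamma> * (\<gamma> - 1) * i1\<^sup>2) + (2 * \<beta> - 2 * r1) * (- \<gamma> * i1) - \<beta> * (1 - \<beta>))
    = A\<^sup>2 * r1 * (\<gamma> * (\<gamma> + 1) * r1 - 2 * \<gamma> * \<beta>) - \<beta> * (1 - \<beta>) * (A\<^sup>2 * r1 * (1 - r1))" using i(1) by algebra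
  have c3: "C * (1 - r3) * (r3 * C) * (r3 * (1 - r3) * (\<gamma> * (\<gamma> - 1) * i3\<^sup>2) + (2 * \<beta> - 2 * r3) * (- \<gamma> * i3) - \<beta> * (1 - \<beta>))
    = C\<^sup>2 * r3 * (\<gamma> * (\<gamma> + 1) * r3 - 2 * \<gamma> * \<beta>) - \<beta> * (1 - \<beta>) * (C\<^sup>2 * r3 * (1 - r3))" using i(3) by algebra
  have c2: "A * (1 - r1) * (C * (1 - r3)) * (2 * r1 * r3 * (\<gamma> * i1 * (\<gamma> * i3)) + \<beta> * (r1 * (- \<gamma> * i1) + r3 * (- \<gamma> * i3) - r2 * (- \<gamma> * i2)))
    = 2 * \<gamma>\<^sup>2 * r1 * r3 * A * C - \<beta> * \<gamma> * A * C * (r1 * (1 - r3) + r3 * (1 - r1)) + \<beta> * \<gamma> * (A * C * (1 - r1) * (1 - r3) * r2 * i2)"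
    using i(1,3) by algebra
  show ?thesis unfolding q c1 c2 c3 k2 by (simp add: algebra_simps power2_eq_square)
qed

lemma bpz_quadratic_form_neg:
  fixes \<gamma> \<beta> U V :: real
  assumes "\<gamma> > 0" "\<beta> > 1/2" "2 * \<gamma> + 1 - 2 * \<beta> < 0"
  shows "\<gamma> * (\<gamma> + 1 - 3 * \<beta>) * (U\<^sup>2 + V\<^sup>2) + 2 * \<gamma> * (\<gamma> + \<beta>) * (U * V) \<le> 0"
proof -
  have "\<gamma> * (\<gamma> + 1 - 3 * \<beta>) * (U\<^sup>2 + V\<^sup>2) + 2 * \<gamma> * (\<gamma> + \<beta>) * (U * V)
    = \<gamma> * (2 * \<gamma> + 1 - 2 * \<beta>) * (U\<^sup>2 + V\<^sup>2) - \<gamma> * (\<gamma> + \<beta>) * (U - V)\<^sup>2"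
    by (simp add: power2_eq_square algebra_simps)
  moreover have "\<gamma> * (2 * \<gamma> + 1 - 2 * \<beta>) * (U\<^sup>2 + V\<^sup>2) \<le> 0" using assms by (intro mult_nonpos_nonneg mult_nonneg_nonpos) auto
  moreover have "\<gamma> * (\<gamma> + \<beta>) * (U - V)\<^sup>2 \<ge> 0" using assms by (intro mult_nonneg_nonneg) auto
  ultimately show ?thesis by linarith
qed

lemma Lam_pos:
  assumes r: "crs p1 q1 p2 q2 \<in> {0<..<1}" "crs p2 q2 p3 q3 \<in> {0<..<1}" "crs p3 q3 p1 q1 \<in> {0<..<1}"
  shows "Lam \<beta> p1 p2 p3 q1 q2 q3 > 0"
proof -
  note n = crs_distinct[OF r(1)] crs_distinct[OF r(2)] crs_distinct[OF r(3)]
  have "crs p1 q1 p2 q2 * crs p2 q2 p3 q3 * crs p3 q3 p1 q1 > 0" using r by simp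
  then show ?thesis unfolding Lam_def using n by (intro mult_pos_pos) auto
qed

context rainbow
begin

lemma bpz_op_F:
  assumes r: "crs p1 q1 p2 q2 \<in> {0<..<1}" "crs p2 q2 p3 q3 \<in> {0<..<1}" "crs p3 q3 p1 q1 \<in> {0<..<1}"
  shows "bpz_op \<beta> F (psum (pderiv1 a)) (psum (pderiv2 a)) (psum (pderiv3 a)) (psum (pderiv1 (pderiv1 a)))
    (psum (pderiv3 (pderiv1 a))) (psum (pderiv3 (pderiv3 a))) p1 p2 p3 q1 q2 q3 = 0"
proof -
  define x y z where "x = crs p1 q1 p2 q2" and "y = crs p2 q2 p3 q3" and "z = crs p3 q3 p1 q1"
  have q: "\<bar>x\<bar> < 1" "\<bar>y\<bar> < 1" "\<bar>z\<bar> < 1" using r by (auto simp: x_def y_def z_def)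
  have M: "2 * x * z * psum (pderiv3 (pderiv1 a)) x y z + \<beta> * (x * psum (pderiv1 a) x y z + z * psum (pderiv3 a) x y z - y * psum (pderiv2 a) x y z)
     = (y + x * y * z - x - z) * G x y z"
    using eq_M1[OF q] eq_M2[OF q] eq_M3[OF q] by algebra
  note g = G_coefficient[OF crs_inverse_coordinates[OF r], folded x_def y_def z_def]
  show ?thesis
    unfolding bpz_op_def Let_def x_def[symmetric] y_def[symmetric] z_def[symmetric] eq_D1[OF q] eq_D3[OF q] M
    using g by algebra
qed

definition psi :: "real \<Rightarrow> real \<Rightarrow> real \<Rightarrow> real" where
  "psi x y z = (1 - x) powr \<gamma> * (1 - y) powr \<gamma> * (1 - z) powr \<gamma>"

abbreviation "psf x \<equiv> (1 - x) powr \<gamma>"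
abbreviation "psf' x \<equiv> - \<gamma> / (1 - x) * (1 - x) powr \<gamma>"
abbreviation "psf'' x \<equiv> \<gamma> * (\<gamma> - 1) / (1 - x)\<^sup>2 * (1 - x) powr \<gamma>"

text \<open>The second claim is the positivity of the weight that multiplies a constant in
  \<open>bpz_op_combine\<close>: in terms of \<open>A\<close> and \<open>C\<close> it is a
  combination of squares with positive coefficients.\<close>

lemma bpz_op_psi_neg:
  assumes r: "crs p1 q1 p2 q2 \<in> {0<..<1}" "crs p2 q2 p3 q3 \<in> {0<..<1}" "crs p3 q3 p1 q1 \<in> {0<..<1}"
  shows "bpz_op \<beta> psi (\<lambda>x y z. psf' x * psf y * psf z) (\<lambda>x y z. psf x * psf' y * psf z) (\<lambda>x y z. psf x * psf y * psf' z)
    (\<lambda>x y z. psf'' x * psf y * psf z) (\<lambda>x y z. psf' x * psf y * psf' z) (\<lambda>x y z. psf x * psf y * psf'' z) p1 p2 p3 q1 q2 q3 < 0"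
    (is "?op < 0")
    and "(1 / (p1 - p2) - 1 / (p1 - q2)) * (1 / (p1 - q2) - 1 / (p1 - q1)) + (1 / (p1 - p3) - 1 / (p1 - q3)) * (1 / (p1 - q3) - 1 / (p1 - q1)) > 0"
    (is "?w > 0")
proof -
  note n = crs_distinct[OF r(1)] crs_distinct[OF r(2)] crs_distinct[OF r(3)]
  define x y z where "x = crs p1 q1 p2 q2" and "y = crs p2 q2 p3 q3" and "z = crs p3 q3 p1 q1"
  have q: "0 < x" "x < 1" "0 < y" "y < 1" "0 < z" "z < 1" using r by (auto simp: x_def y_def z_def)
  define A C where "A = 1 / (p1 - p2) - 1 / (p1 - q1)" and "C = 1 / (p1 - p3) - 1 / (p1 - q1)"
  note cd = crs_inverse_coordinates[OF r, folded x_def y_def z_def A_def C_def]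
  have A: "A \<noteq> 0" using n by (simp add: A_def divide_simps)
  have e: "1 / (p1 - q2) - 1 / (p1 - q1) = x * A" "1 / (p1 - q3) - 1 / (p1 - q1) = z * C"
    "1 / (p1 - p2) - 1 / (p1 - q2) = A * (1 - x)" "1 / (p1 - p3) - 1 / (p1 - q3) = C * (1 - z)"
    using cd(1,2) unfolding A_def C_def by algebra+
  have rel: "y * ((A - z * C) * (x * A - C)) = (A - C) * (x * A - z * C)"
  proof -
    have d: "1 / (p1 - p2) - 1 / (p1 - q3) = A - z * C" "1 / (p1 - q2) - 1 / (p1 - p3) = x * A - C"
      "1 / (p1 - p2) - 1 / (p1 - p3) = A - C" "1 / (p1 - q2) - 1 / (p1 - q3) = x * A - z * C"
      using e(1,2) unfolding A_def C_def by linarith+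
    show ?thesis using crs_inverse_coordinates(3)[OF r] unfolding d y_def .
  qed
  have w: "A\<^sup>2 * x * (1 - x) + C\<^sup>2 * z * (1 - z) > 0" using q A by (intro add_pos_nonneg) auto
  have "?w = A\<^sup>2 * x * (1 - x) + C\<^sup>2 * z * (1 - z)" unfolding e by (simp add: power2_eq_square algebra_simps)
  then show "?w > 0" using w by simp
  have "?op = psi x y z * (A * (1 - x) * (x * A) * (x * (1 - x) * (\<gamma> * (\<gamma> - 1) / (1 - x)\<^sup>2) + (2 * \<beta> - 2 * x) * (- \<gamma> / (1 - x)) - \<beta> * (1 - \<beta>))
    + C * (1 - z) * (z * C) * (z * (1 - z) * (\<gamma> * (\<gamma> - 1) / (1 - z)\<^sup>2) + (2 * \<beta> - 2 * z) * (- \<gamma> / (1 - z)) - \<beta> * (1 - \<beta>))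
    + A * (1 - x) * (C * (1 - z)) * (2 * x * z * (\<gamma> / (1 - x) * (\<gamma> / (1 - z)))
        + \<beta> * (x * (- \<gamma> / (1 - x)) + z * (- \<gamma> / (1 - z)) - y * (- \<gamma> / (1 - y)))))"
  proof -
    define c1 c2 c3 d1 d3 where c: "c1 = - \<gamma> / (1 - x)" "c2 = - \<gamma> / (1 - y)" "c3 = - \<gamma> / (1 - z)"
      "d1 = \<gamma> * (\<gamma> - 1) / (1 - x)\<^sup>2" "d3 = \<gamma> * (\<gamma> - 1) / (1 - z)\<^sup>2"
    have m: "\<gamma> / (1 - x) * (\<gamma> / (1 - z)) = c1 * c3" by (simp add: c)
    show ?thesis
      unfolding bpz_op_def Let_def psi_def x_def[symmetric] y_def[symmetric] z_def[symmetric] e m c[symmetric] by algebra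
  qed
  also have "\<dots> = psi x y z * (\<gamma> * (\<gamma> + 1 - 3 * \<beta>) * ((x * A)\<^sup>2 + (z * C)\<^sup>2) + 2 * \<gamma> * (\<gamma> + \<beta>) * (x * A * (z * C))
     - \<beta> * (3 * \<gamma> + 1 - \<beta>) * (A\<^sup>2 * x * (1 - x) + C\<^sup>2 * z * (1 - z)))"
    by (subst bpz_power_form) (use q rel in auto)
  also have "\<dots> < 0"
  proof (rule mult_pos_neg)
    show "psi x y z > 0" using q by (simp add: psi_def)
    have "\<beta> * (3 * \<gamma> + 1 - \<beta>) * (A\<^sup>2 * x * (1 - x) + C\<^sup>2 * z * (1 - z)) > 0" using w gam beta by simp
    then show "\<gamma> * (\<gamma> + 1 - 3 * \<beta>) * ((x * A)\<^sup>2 + (z * C)\<^sup>2) + 2 * \<gamma> * (\<gamma> + \<beta>) * (x * A * (z * C))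
     - \<beta> * (3 * \<gamma> + 1 - \<beta>) * (A\<^sup>2 * x * (1 - x) + C\<^sup>2 * z * (1 - z)) < 0"
      using bpz_quadratic_form_neg[OF gam(1) beta gam(2), of "x * A" "z * C"] by linarith
  qed
  finally show "?op < 0" .
qed


text \<open>Maximum principle for \<open>(F - \<delta>) / psi\<close>. It has to be run in the six points rather than in the cube
  of cross-ratios, because the BPZ operator has real coefficients in the image of the chamber only.\<close>

lemma F_pos_large:
  assumes b1: "\<beta> > 1" and q: "0 < u" "u < 1" "0 < v" "v < 1" "t > 0"
  shows "F v (Kf u v t) u > 0"
proof (rule ccontr)
  assume neg: "\<not> F v (Kf u v t) u > 0"
  obtain \<delta> \<eta> where de: "\<delta> > 0" "\<eta> > 0" and faces: "\<And>x y z. 0 < x \<Longrightarrow> x < 1 \<Longrightarrow> 0 < y \<Longrightarrow> y < 1 \<Longrightarrow> 0 < z \<Longrightarrow> z < 1 \<Longrightarrow>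
    min x (min y z) < \<eta> \<or> 1 - \<eta> < max x (max y z) \<Longrightarrow> F x y z > \<delta>"
    using F_faces[OF b1] by blast
  \<comment> \<open>Outside \<open>S\<close> some cross-ratio is within \<eta> of 0 or 1: if
    \<open>u, v \<ge> \<eta>\<close>, then \<open>t < \<eta>\<^sup>2\<close> or
    \<open>t > 1 / \<eta>\<^sup>2\<close> forces \<open>Kf u v t > 1 - \<eta>\<close>.\<close>
  define S where "S = {\<eta>..1 - \<eta>} \<times> {\<eta>..1 - \<eta>} \<times> {\<eta>\<^sup>2..1 / \<eta>\<^sup>2}"
  have out: "F v (Kf u v t) u > \<delta>" if "0 < u" "u < 1" "0 < v" "v < 1" "t > 0" "(u, v, t) \<notin> S" for u v t
  proof (rule faces)
    note k = Kf_range[OF that(1-5)]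
    show "0 < Kf u v t" "Kf u v t < 1" using k by auto
    have "Kf u v t > 1 - \<eta>" if uv: "u \<ge> \<eta>" "v \<ge> \<eta>" "t < \<eta>\<^sup>2 \<or> t > 1 / \<eta>\<^sup>2"
      using uv(3)
    proof
      assume "t < \<eta>\<^sup>2"
      then have "t / u < \<eta>\<^sup>2 / \<eta>" using uv de \<open>t > 0\<close> by (intro frac_less) auto
      then show ?thesis using k(3) de by (simp add: power2_eq_square)
    next
      assume t: "t > 1 / \<eta>\<^sup>2"
      have "1 / \<eta> = \<eta> * (1 / \<eta>\<^sup>2)" using de by (simp add: power2_eq_square)
      also have "\<dots> < v * t" using t uv de by (intro mult_le_less_imp_less) auto
      finally have "1 / \<eta> < v * t" .
      moreover have "1 / \<eta> > 0" using de by simp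
      ultimately have "1 / (v * t) < 1 / (1 / \<eta>)" by (intro frac_less2) auto
      then show ?thesis using k(4) by simp
    qed
    then show "min v (min (Kf u v t) u) < \<eta> \<or> 1 - \<eta> < max v (max (Kf u v t) u)"
      using that(6) unfolding S_def by (auto simp: not_le min_less_iff_disj less_max_iff_disj)
  qed (use that in auto)
  have S: "0 < u" "u < 1" "0 < v" "v < 1" "t > 0" if "(u, v, t) \<in> S" for u v t
    using that de by (auto simp: S_def intro: less_le_trans[of 0 "\<eta>\<^sup>2"])
  define f where "f = (\<lambda>(u, v, t). (F v (Kf u v t) u - \<delta>) / psi v (Kf u v t) u)"
  have psi: "psi v (Kf u v t) u > 0" if "0 < u" "u < 1" "0 < v" "v < 1" "t > 0" for u v t
    using Kf_range[OF that] that by (simp add: psi_def)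
  have inS: "(u, v, t) \<in> S" using out[OF q] neg de by linarith
  have "continuous_on S f"
    unfolding continuous_on_eq_continuous_within
  proof
    fix p assume p: "p \<in> S"
    obtain u v t where e: "p = (u, v, t)" by (cases p)
    note s = S[OF p[unfolded e]]
    note k = Kf_range[OF s]
    have lim: "(fst \<longlongrightarrow> u) (at p within S)" "((\<lambda>p. fst (snd p)) \<longlongrightarrow> v) (at p within S)" "((\<lambda>p. snd (snd p)) \<longlongrightarrow> t) (at p within S)"
      using tendsto_fst[OF tendsto_ident_at, of p S] tendsto_fst[OF tendsto_snd[OF tendsto_ident_at], of p S] tendsto_snd[OF tendsto_snd[OF tendsto_ident_at], of p S]
      unfolding e by auto
    have "v * t > 0" using s by simp
    then have vt: "1 + v * t \<noteq> 0" by linarith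
    have kl: "((\<lambda>p. Kf (fst p) (fst (snd p)) (snd (snd p))) \<longlongrightarrow> Kf u v t) (at p within S)"
      unfolding Kf_def by (intro tendsto_intros lim) (use s vt in auto)
    have Fl: "((\<lambda>p. F (fst (snd p)) (Kf (fst p) (fst (snd p)) (snd (snd p))) (fst p)) \<longlongrightarrow> F v (Kf u v t) u) (at p within S)"
      by (rule psum_tendsto[OF regular_a _ _ _ lim(2) kl lim(1)]) (use s k in auto)
    have "((\<lambda>p. (F (fst (snd p)) (Kf (fst p) (fst (snd p)) (snd (snd p))) (fst p) - \<delta>) / psi (fst (snd p)) (Kf (fst p) (fst (snd p)) (snd (snd p))) (fst p))
        \<longlongrightarrow> (F v (Kf u v t) u - \<delta>) / psi v (Kf u v t) u) (at p within S)"
      unfolding psi_def by (intro tendsto_intros lim Fl kl) (use s k in auto)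
    then show "continuous (at p within S) f"
      unfolding continuous_within f_def by (simp add: e case_prod_unfold)
  qed
  moreover have "compact S" unfolding S_def by (intro compact_Times compact_Icc)
  moreover have "S \<noteq> {}" using inS by auto
  ultimately obtain p where p: "p \<in> S" "\<And>x. x \<in> S \<Longrightarrow> f p \<le> f x" using continuous_attains_inf by metis
  obtain u0 v0 t0 where e: "p = (u0, v0, t0)" by (cases p)
  note s0 = S[OF p(1)[unfolded e]]
  define \<mu> where "\<mu> = - f p"
  have "f p \<le> f (u, v, t)" using p(2) inS by blast
  also have "f (u, v, t) < 0" using neg de psi[OF q] by (simp add: f_def divide_neg_pos)
  finally have mu: "\<mu> > 0" by (simp add: \<mu>_def)
  define E where "E = (\<lambda>x y z. F x y z - \<delta> + \<mu> * psi x y z)"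
  have E0: "E v0 (Kf u0 v0 t0) u0 = 0" using psi[OF s0] by (simp add: E_def \<mu>_def f_def e)
  have Eimg: "E v (Kf u v t) u \<ge> 0" if "0 < u" "u < 1" "0 < v" "v < 1" "t > 0" for u v t
  proof (cases "(u, v, t) \<in> S")
    case True
    have "- \<mu> \<le> (F v (Kf u v t) u - \<delta>) / psi v (Kf u v t) u" using p(2)[OF True] by (simp add: \<mu>_def f_def)
    then show ?thesis using psi[OF that] by (simp add: E_def pos_le_divide_eq)
  next
    case False
    have "\<mu> * psi v (Kf u v t) u > 0" using mu psi[OF that] by simp
    then show ?thesis using out[OF that False] by (simp add: E_def)
  qed
  have Ecrs: "E (crs x1 x4 x2 x3) (crs x2 x3 x6 x5) (crs x6 x5 x1 x4) \<ge> 0"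
    if o: "x1 < x2" "x2 < x3" "x3 < x4" "x4 < x5" "x5 < x6" for x1 x2 x3 x4 x5 x6
  proof -
    note c = crs_chamber[OF o]
    obtain t where t: "t > 0" "crs x2 x3 x6 x5 = Kf (crs x6 x5 x1 x4) (crs x1 x4 x2 x3) t"
      using crs_Kf[OF c] by blast
    show ?thesis unfolding t(2) by (rule Eimg) (use c t in auto)
  qed
  \<comment> \<open>Six ordered points that realise the minimum; \<open>Ecrs\<close> gives the
    inequality for every ordered configuration, hence for the displaced ones.\<close>
  note re = crs_realisation[OF s0]
  define x2 x3 x5 where "x2 = 1 / (2 + t0)" and "x3 = 1 / (2 + v0 * t0)" and "x5 = 1 / (2 - u0)"
  note re = re[folded x2_def x3_def x5_def]
  have W0: "Wf \<beta> E 0 x2 1 (1/2) x3 x5 = 0" unfolding Wf_def re(6-8) E0 by simp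
  have Wnn: "Wf \<beta> E x1 x2 x6 x4 x3 x5 \<ge> 0" if o: "x1 < x2" "x2 < x3" "x3 < x4" "x4 < x5" "x5 < x6" for x1 x2 x3 x4 x5 x6
    unfolding Wf_def using Ecrs[OF o] Lam_pos[OF crs_chamber(1-3)[OF o], of \<beta>] by simp
  define E1 E2 E3 where "E1 = (\<lambda>x y z. psum (pderiv1 a) x y z + \<mu> * (psf' x * psf y * psf z))"
    and "E2 = (\<lambda>x y z. psum (pderiv2 a) x y z + \<mu> * (psf x * psf' y * psf z))"
    and "E3 = (\<lambda>x y z. psum (pderiv3 a) x y z + \<mu> * (psf x * psf y * psf' z))"
  have d1: "x \<in> {0<..<1} \<Longrightarrow> (psf has_real_derivative psf' x) (at x)"
    and d2: "x \<in> {0<..<1} \<Longrightarrow> (psf' has_real_derivative psf'' x) (at x)" for x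
    using powr_one_minus_deriv[of x] powr_one_minus_deriv2[of x] by simp_all
  have P: "has_partials E E1 E2 E3"
    unfolding E_def E1_def E2_def E3_def psi_def
    by (rule has_partials_combine[OF psum_has_partials[OF regular_a] has_partials_product[OF d1 d1 d1]])
  have P1: "has_partials E1 (\<lambda>x y z. psum (pderiv1 (pderiv1 a)) x y z + \<mu> * (psf'' x * psf y * psf z))
     (\<lambda>x y z. psum (pderiv2 (pderiv1 a)) x y z + \<mu> * (psf' x * psf' y * psf z)) (\<lambda>x y z. psum (pderiv3 (pderiv1 a)) x y z + \<mu> * (psf' x * psf y * psf' z))"
    using has_partials_combine[OF psum_has_partials[OF reg(3)[OF regular_a]] has_partials_product[OF d2 d1 d1], of 0 \<mu>]
    unfolding E1_def diff_0_right .
  have P3: "has_partials E3 (\<lambda>x y z. psum (pderiv1 (pderiv3 a)) x y z + \<mu> * (psf' x * psf y * psf' z))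
     (\<lambda>x y z. psum (pderiv2 (pderiv3 a)) x y z + \<mu> * (psf x * psf' y * psf' z)) (\<lambda>x y z. psum (pderiv3 (pderiv3 a)) x y z + \<mu> * (psf x * psf y * psf'' z))"
    using has_partials_combine[OF psum_has_partials[OF reg(5)[OF regular_a]] has_partials_product[OF d1 d1 d2], of 0 \<mu>]
    unfolding E3_def diff_0_right .
  have P3: "has_partials E3 (\<lambda>x y z. psum (pderiv3 (pderiv1 a)) x y z + \<mu> * (psf' x * psf y * psf' z))
     (\<lambda>x y z. psum (pderiv2 (pderiv3 a)) x y z + \<mu> * (psf x * psf' y * psf' z)) (\<lambda>x y z. psum (pderiv3 (pderiv3 a)) x y z + \<mu> * (psf x * psf y * psf'' z))"
    using P3 unfolding pderiv_comm13 .
  note r = crs_chamber(1-3)[OF re(1-5)]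
  obtain d where d: "d > 0" "d < x2" "d < x3 - x2" "d < 1/2 - x3" "d < x5 - 1/2" "d < 1 - x5"
  proof -
    define m where "m = min (min x2 (x3 - x2)) (min (1/2 - x3) (min (x5 - 1/2) (1 - x5)))"
    have "m > 0" using re by (auto simp: m_def)
    moreover have "m \<le> x2" "m \<le> x3 - x2" "m \<le> 1/2 - x3" "m \<le> x5 - 1/2" "m \<le> 1 - x5" unfolding m_def by linarith+
    ultimately show ?thesis by (intro that[of "m / 2"]) linarith+
  qed
  define W where "W = Wdot \<beta> E E1 E2 E3"
  have D1: "((\<lambda>s. Wf \<beta> E s x2 1 (1/2) x3 x5) has_real_derivative W s x2 1 (1/2) x3 x5 1 0 0 0 0 0) (at s)"
    if "\<bar>s - 0\<bar> < d" for s
  proof -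
    have "s < x2" using d that by auto
    from Wf_has_derivative[OF P DERIV_ident DERIV_const DERIV_const DERIV_const DERIV_const DERIV_const crs_chamber(1-3)[OF this re(2-5)]]
    show ?thesis unfolding W_def .
  qed
  have z: "D = 0" if "(f has_real_derivative D) (at s)" "f s = 0" "\<And>y. \<bar>s - y\<bar> < d \<Longrightarrow> f y \<ge> 0" for f s D
    using DERIV_local_min[OF that(1) d(1)] that(2,3) by simp
  have fd1: "((\<lambda>s. Wf \<beta> E 0 s 1 (1/2) x3 x5) has_real_derivative W 0 x2 1 (1/2) x3 x5 0 1 0 0 0 0) (at x2)"
    unfolding W_def by (rule Wf_has_derivative[OF P DERIV_const DERIV_ident DERIV_const DERIV_const DERIV_const DERIV_const]) (fact r)+
  have fd2: "((\<lambda>s. Wf \<beta> E 0 x2 s (1/2) x3 x5) has_real_derivative W 0 x2 1 (1/2) x3 x5 0 0 1 0 0 0) (at 1)"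
    unfolding W_def by (rule Wf_has_derivative[OF P DERIV_const DERIV_const DERIV_ident DERIV_const DERIV_const DERIV_const]) (fact r)+
  have fd3: "((\<lambda>s. Wf \<beta> E 0 x2 1 s x3 x5) has_real_derivative W 0 x2 1 (1/2) x3 x5 0 0 0 1 0 0) (at (1/2))"
    unfolding W_def by (rule Wf_has_derivative[OF P DERIV_const DERIV_const DERIV_const DERIV_ident DERIV_const DERIV_const]) (fact r)+
  have fd4: "((\<lambda>s. Wf \<beta> E 0 x2 1 (1/2) s x5) has_real_derivative W 0 x2 1 (1/2) x3 x5 0 0 0 0 1 0) (at x3)"
    unfolding W_def by (rule Wf_has_derivative[OF P DERIV_const DERIV_const DERIV_const DERIV_const DERIV_ident DERIV_const]) (fact r)+
  have fd5: "((\<lambda>s. Wf \<beta> E 0 x2 1 (1/2) x3 s) has_real_derivative W 0 x2 1 (1/2) x3 x5 0 0 0 0 0 1) (at x5)"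
    unfolding W_def by (rule Wf_has_derivative[OF P DERIV_const DERIV_const DERIV_const DERIV_const DERIV_const DERIV_ident]) (fact r)+
  \<comment> \<open>\<open>Wf\<close> vanishes at this configuration and is nonnegative nearby, so
    the derivatives in the other five points vanish, and of the whole operator only the second
    derivative in the first point is left.\<close>
  have Z: "W 0 x2 1 (1/2) x3 x5 0 1 0 0 0 0 = 0" "W 0 x2 1 (1/2) x3 x5 0 0 1 0 0 0 = 0" "W 0 x2 1 (1/2) x3 x5 0 0 0 1 0 0 = 0"
    "W 0 x2 1 (1/2) x3 x5 0 0 0 0 1 0 = 0" "W 0 x2 1 (1/2) x3 x5 0 0 0 0 0 1 = 0"
    subgoal by (rule z[OF fd1 W0], rule Wnn) (use re(1-5) d in linarith)+
    subgoal by (rule z[OF fd2 W0], rule Wnn) (use re(1-5) d in linarith)+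
    subgoal by (rule z[OF fd3 W0], rule Wnn) (use re(1-5) d in linarith)+
    subgoal by (rule z[OF fd4 W0], rule Wnn) (use re(1-5) d in linarith)+
    subgoal by (rule z[OF fd5 W0], rule Wnn) (use re(1-5) d in linarith)+
    done
  obtain W2 where W2: "((\<lambda>s. W s x2 1 (1/2) x3 x5 1 0 0 0 0 0) has_real_derivative W2) (at 0)"
    and id: "W2 = Lam \<beta> 0 x2 1 (1/2) x3 x5 * bpz_op \<beta> E E1 E2 E3 (\<lambda>x y z. psum (pderiv1 (pderiv1 a)) x y z + \<mu> * (psf'' x * psf y * psf z))
       (\<lambda>x y z. psum (pderiv3 (pderiv1 a)) x y z + \<mu> * (psf' x * psf y * psf' z)) (\<lambda>x y z. psum (pderiv3 (pderiv3 a)) x y z + \<mu> * (psf x * psf y * psf'' z))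
       0 x2 1 (1/2) x3 x5"
    using bpz_identity[OF P P1 P3 r, of \<beta>, folded W_def] unfolding Z W0 mult_zero_right add_0_right by blast
  have "W2 \<ge> 0"
    by (rule second_derivative_nonneg(2)[OF d(1) D1 W2]) (assumption, unfold W0, rule Wnn, (use re(1-5) d in linarith)+)
  moreover have "W2 < 0"
  proof -
    have "bpz_op \<beta> E E1 E2 E3 (\<lambda>x y z. psum (pderiv1 (pderiv1 a)) x y z + \<mu> * (psf'' x * psf y * psf z))
       (\<lambda>x y z. psum (pderiv3 (pderiv1 a)) x y z + \<mu> * (psf' x * psf y * psf' z)) (\<lambda>x y z. psum (pderiv3 (pderiv3 a)) x y z + \<mu> * (psf x * psf y * psf'' z))
       0 x2 1 (1/2) x3 x5 < 0"
      unfolding E_def E1_def E2_def E3_def bpz_op_combine bpz_op_F[OF r]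
    proof (simp only: add_0, rule add_neg_neg)
      show "\<mu> * bpz_op \<beta> psi (\<lambda>x y z. psf' x * psf y * psf z) (\<lambda>x y z. psf x * psf' y * psf z) (\<lambda>x y z. psf x * psf y * psf' z)
        (\<lambda>x y z. psf'' x * psf y * psf z) (\<lambda>x y z. psf' x * psf y * psf' z) (\<lambda>x y z. psf x * psf y * psf'' z) 0 x2 1 (1/2) x3 x5 < 0"
        using mu bpz_op_psi_neg(1)[OF r] by (rule mult_pos_neg)
      \<comment> \<open>Here \<beta> > 1 enters: subtracting \<delta> contributes with the same sign
        as the supersolution.\<close>
      have c: "\<delta> * \<beta> * (1 - \<beta>) < 0" using de b1 by (intro mult_pos_neg) auto
      show "\<delta> * \<beta> * (1 - \<beta>) * ((1 / (0 - x2) - 1 / (0 - x3)) * (1 / (0 - x3) - 1 / (0 - 1/2)) + (1 / (0 - 1) - 1 / (0 - x5)) * (1 / (0 - x5) - 1 / (0 - 1/2))) < 0"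
        using c bpz_op_psi_neg(2)[OF r] by (rule mult_neg_pos)
    qed
    then show ?thesis unfolding id using Lam_pos[OF r] by (intro mult_pos_neg)
  qed
  ultimately show False by simp
qed

lemma F_pos:
  assumes r: "crs p1 q1 p2 q2 \<in> {0<..<1}" "crs p2 q2 p3 q3 \<in> {0<..<1}" "crs p3 q3 p1 q1 \<in> {0<..<1}"
    and s: "(p2 - q1) / (p2 - p1) * ((p3 - q1) / (p3 - p1)) < 0"
  shows "F (crs p1 q1 p2 q2) (crs p2 q2 p3 q3) (crs p3 q3 p1 q1) > 0"
proof (cases "\<beta> \<le> 1")
  case True
  have "F (crs p1 q1 p2 q2) (crs p2 q2 p3 q3) (crs p3 q3 p1 q1) \<ge> 1" by (rule F_ge_1[OF True]) (use r in auto)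
  then show ?thesis by simp
next
  case False
  obtain t where t: "t > 0" "crs p2 q2 p3 q3 = Kf (crs p3 q3 p1 q1) (crs p1 q1 p2 q2) t" using crs_Kf[OF r s] by blast
  show ?thesis unfolding t(2) by (rule F_pos_large) (use r t False in auto)
qed

end

section \<open>Smoothness, BPZ equations and Moebius covariance\<close>

lemma eventually_chamber:
  assumes "x \<in> chamber N"
  shows "\<forall>\<^sub>F t in nhds (x i). x(i := t) \<in> chamber N"
proof -
  have c: "((\<lambda>t. (x(i := t)) j) \<longlongrightarrow> x j) (nhds (x i))" for j
    by (cases "j = i") (auto simp: filterlim_ident)
  have "\<forall>\<^sub>F t in nhds (x i). (x(i := t)) j < (x(i := t)) k" if "x j < x k" for j k
    using order_tendstoD(1)[OF tendsto_diff[OF c[of k] c[of j]], of 0] that by simp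
  then have "\<forall>\<^sub>F t in nhds (x i). \<forall>j\<in>{1..2*N}. \<forall>k\<in>{1..2*N}. j < k \<longrightarrow> (x(i := t)) j < (x(i := t)) k"
    using assms by (intro eventually_ball_finite ballI) (auto simp: chamber_def)
  then show ?thesis by (simp add: chamber_def)
qed

lemma has_derivative_chamber_cong:
  assumes "x \<in> chamber N" "\<And>y. y \<in> chamber N \<Longrightarrow> f y = g y"
    and "((\<lambda>t. g (x(i := t))) has_real_derivative D) (at (x i))"
  shows "((\<lambda>t. f (x(i := t))) has_real_derivative D) (at (x i))"
proof -
  have "\<forall>\<^sub>F t in nhds (x i). f (x(i := t)) = g (x(i := t))"
    using eventually_chamber[OF assms(1), of i] by eventually_elim (rule assms(2))
  then show ?thesis by (rule iffD2[OF DERIV_cong_ev[OF refl _ refl] assms(3)])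
qed

lemma partial_chamber:
  assumes "x \<in> chamber N" "\<And>y. y \<in> chamber N \<Longrightarrow> f y = g y"
    and "((\<lambda>t. g (x(i := t))) has_real_derivative D) (at (x i))"
  shows "partial i f x = D"
  unfolding partial_def by (rule DERIV_imp_deriv[OF has_derivative_chamber_cong[OF assms]])

text \<open>The links are \<open>{p\<^sub>l, q\<^sub>l}\<close>, oriented so that \<open>crs\<close> is the unoriented cross-ratio, i.e. the one of the
  two candidates that is less than \<open>1\<close>.\<close>

definition frame :: "nat \<Rightarrow> nat \<Rightarrow> nat \<Rightarrow> nat \<Rightarrow> nat \<Rightarrow> nat \<Rightarrow> bool" where
  "frame p1 p2 p3 q1 q2 q3 \<longleftrightarrow> {p1, p2, p3, q1, q2, q3} = {1..6} \<and>
     (\<forall>x\<in>chamber 3. crs (x p1) (x q1) (x p2) (x q2) \<in> {0<..<1} \<and> crs (x p2) (x q2) (x p3) (x q3) \<in> {0<..<1} \<and>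
        crs (x p3) (x q3) (x p1) (x q1) \<in> {0<..<1})"

definition Wx :: "real \<Rightarrow> (real \<Rightarrow> real \<Rightarrow> real \<Rightarrow> real) \<Rightarrow> nat \<Rightarrow> nat \<Rightarrow> nat \<Rightarrow> nat \<Rightarrow> nat \<Rightarrow> nat \<Rightarrow> (nat \<Rightarrow> real) \<Rightarrow> real" where
  "Wx \<beta> E p1 p2 p3 q1 q2 q3 x = Wf \<beta> E (x p1) (x p2) (x p3) (x q1) (x q2) (x q3)"

lemma frame_rotate: "frame p1 p2 p3 q1 q2 q3 \<Longrightarrow> frame p2 p3 p1 q2 q3 q1"
  unfolding frame_def by (auto simp: insert_commute)

lemma frame_swap:
  assumes "frame p1 p2 p3 q1 q2 q3"
  shows "frame q1 q2 q3 p1 p2 p3"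
proof -
  have e: "crs (x q1) (x p1) (x q2) (x p2) = crs (x p1) (x q1) (x p2) (x q2)" "crs (x q2) (x p2) (x q3) (x p3) = crs (x p2) (x q2) (x p3) (x q3)"
    "crs (x q3) (x p3) (x q1) (x p1) = crs (x p3) (x q3) (x p1) (x q1)" for x :: "nat \<Rightarrow> real" by (rule crs_swap(2))+
  have "{q1, q2, q3, p1, p2, p3} = {p1, p2, p3, q1, q2, q3}" by blast
  then show ?thesis using assms unfolding frame_def e by simp
qed

lemma frame_transpose:
  assumes "frame p1 p2 p3 q1 q2 q3"
  shows "frame p2 p1 p3 q2 q1 q3"
proof -
  have e: "crs (x p2) (x q2) (x p1) (x q1) = crs (x p1) (x q1) (x p2) (x q2)" "crs (x p1) (x q1) (x p3) (x q3) = crs (x p3) (x q3) (x p1) (x q1)"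
    "crs (x p3) (x q3) (x p2) (x q2) = crs (x p2) (x q2) (x p3) (x q3)" for x :: "nat \<Rightarrow> real" by (rule crs_swap(1))+
  have "{p2, p1, p3, q2, q1, q3} = {p1, p2, p3, q1, q2, q3}" by blast
  then show ?thesis using assms unfolding frame_def e by simp
qed

lemma frame_crs:
  assumes "frame p1 p2 p3 q1 q2 q3" "x \<in> chamber 3"
  shows "crs (x p1) (x q1) (x p2) (x q2) \<in> {0<..<1}" "crs (x p2) (x q2) (x p3) (x q3) \<in> {0<..<1}"
    "crs (x p3) (x q3) (x p1) (x q1) \<in> {0<..<1}"
  using assms by (simp_all add: frame_def)

lemma frame_distinct:
  assumes "frame p1 p2 p3 q1 q2 q3"
  shows "distinct [p1, p2, p3, q1, q2, q3]"
proof -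
  have "card (set [p1, p2, p3, q1, q2, q3]) = card {1..6::nat}" using assms by (simp add: frame_def)
  then show ?thesis by (intro card_distinct) simp
qed

lemma frame_index:
  assumes "frame p1 p2 p3 q1 q2 q3"
  shows "p1 \<in> {1..6}" "p2 \<in> {1..6}" "p3 \<in> {1..6}" "q1 \<in> {1..6}" "q2 \<in> {1..6}" "q3 \<in> {1..6}"
proof -
  have "{p1, p2, p3, q1, q2, q3} = {1..6}" using assms by (simp add: frame_def)
  then show "p1 \<in> {1..6}" "p2 \<in> {1..6}" "p3 \<in> {1..6}" "q1 \<in> {1..6}" "q2 \<in> {1..6}" "q3 \<in> {1..6}" by blast+
qed

lemma chamber_neq:
  assumes "x \<in> chamber N" "p \<in> {1..2*N}" "q \<in> {1..2*N}" "p \<noteq> q"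
  shows "x p \<noteq> x q"
  using assms unfolding chamber_def by (metis (mono_tags, lifting) less_irrefl linorder_neqE_nat mem_Collect_eq)

lemma coord_deriv: "((\<lambda>t. (x(i := t)) p) has_real_derivative (if p = i then 1 else 0)) (at (x i))"
  by (cases "p = i") (auto simp: DERIV_ident)

lemma continuous_on_coordinate: "continuous_on S (\<lambda>x. x i :: real)"
  by (rule continuous_on_subset[OF continuous_on_product_coordinates subset_UNIV])

text \<open>A family of functions that contains the partition function and is closed under partial
  derivatives on the chamber; this gives all orders of differentiability at once.\<close>

inductive smooth6 :: "nat \<Rightarrow> nat \<Rightarrow> nat \<Rightarrow> nat \<Rightarrow> nat \<Rightarrow> nat \<Rightarrow> ((nat \<Rightarrow> real) \<Rightarrow> real) \<Rightarrow> bool" for p1 p2 p3 q1 q2 q3 where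
  const: "smooth6 p1 p2 p3 q1 q2 q3 (\<lambda>x. c)"
| coord: "smooth6 p1 p2 p3 q1 q2 q3 (\<lambda>x. x i)"
| add: "smooth6 p1 p2 p3 q1 q2 q3 f \<Longrightarrow> smooth6 p1 p2 p3 q1 q2 q3 g \<Longrightarrow> smooth6 p1 p2 p3 q1 q2 q3 (\<lambda>x. f x + g x)"
| mult: "smooth6 p1 p2 p3 q1 q2 q3 f \<Longrightarrow> smooth6 p1 p2 p3 q1 q2 q3 g \<Longrightarrow> smooth6 p1 p2 p3 q1 q2 q3 (\<lambda>x. f x * g x)"
| inv: "p \<in> {1..6} \<Longrightarrow> q \<in> {1..6} \<Longrightarrow> p \<noteq> q \<Longrightarrow> smooth6 p1 p2 p3 q1 q2 q3 (\<lambda>x. 1 / (x p - x q))"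
| powr: "p \<in> {1..6} \<Longrightarrow> q \<in> {1..6} \<Longrightarrow> p \<noteq> q \<Longrightarrow> smooth6 p1 p2 p3 q1 q2 q3 (\<lambda>x. \<bar>x p - x q\<bar> powr c)"
| psum: "regular a \<Longrightarrow> smooth6 p1 p2 p3 q1 q2 q3
    (\<lambda>x. psum a (crs (x p1) (x q1) (x p2) (x q2)) (crs (x p2) (x q2) (x p3) (x q3)) (crs (x p3) (x q3) (x p1) (x q1)))"

context
  fixes p1 p2 p3 q1 q2 q3 :: nat
  assumes fr: "frame p1 p2 p3 q1 q2 q3"
begin

abbreviation "sm \<equiv> smooth6 p1 p2 p3 q1 q2 q3"

lemma sm_diff: "sm f \<Longrightarrow> sm g \<Longrightarrow> sm (\<lambda>x. f x - g x)"
  using smooth6.add[OF _ smooth6.mult[OF smooth6.const[of p1 p2 p3 q1 q2 q3 "-1"]], of f g] by simp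

lemma sm_crs:
  assumes "a \<in> {1..6}" "b \<in> {1..6}" "c \<in> {1..6}" "d \<in> {1..6}" "a \<noteq> d" "b \<noteq> c"
  shows "sm (\<lambda>x. crs (x a) (x b) (x c) (x d))"
proof -
  have "sm (\<lambda>x. (x a - x c) * (x b - x d) * (1 / (x a - x d) * (1 / (x b - x c))))"
    using assms by (intro smooth6.mult sm_diff smooth6.coord smooth6.inv) auto
  then show ?thesis by (simp add: crs_def)
qed

lemma sm_rlog:
  assumes "a \<in> {1..6}" "b \<in> {1..6}" "c \<in> {1..6}" "d \<in> {1..6}" "distinct [a, b, c, d]"
  shows "sm (\<lambda>x. rlog (x a) (x b) (x c) (x d) v1 w1 v2 w2)"
proof -
  have d: "sm (\<lambda>x. u / (x p - x q))" if "p \<in> {1..6}" "q \<in> {1..6}" "p \<noteq> q" for u p q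
    using smooth6.mult[OF smooth6.const smooth6.inv[OF that], of p1 p2 p3 q1 q2 q3 u] by simp
  from assms show ?thesis unfolding rlog_def by (intro sm_diff smooth6.add d) auto
qed

lemma sm_has_partial:
  assumes "sm f"
  shows "\<exists>g. sm g \<and> (\<forall>x\<in>chamber 3. ((\<lambda>t. f (x(i := t))) has_real_derivative g x) (at (x i)))"
  using assms
proof induction
  case (const c)
  show ?case by (rule exI[of _ "\<lambda>x. 0"]) (auto intro: smooth6.const)
next
  case (coord j)
  show ?case by (rule exI[of _ "\<lambda>x. if j = i then 1 else 0"]) (auto intro: smooth6.const coord_deriv)
next
  case (add f g)
  then obtain f' g' where "sm f'" "sm g'"
    "\<forall>x\<in>chamber 3. ((\<lambda>t. f (x(i := t))) has_real_derivative f' x) (at (x i))"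
    "\<forall>x\<in>chamber 3. ((\<lambda>t. g (x(i := t))) has_real_derivative g' x) (at (x i))" by blast
  then show ?case by (intro exI[of _ "\<lambda>x. f' x + g' x"] conjI ballI smooth6.add DERIV_add; blast)
next
  case (mult f g)
  then obtain f' g' where h: "sm f'" "sm g'"
    "\<forall>x\<in>chamber 3. ((\<lambda>t. f (x(i := t))) has_real_derivative f' x) (at (x i))"
    "\<forall>x\<in>chamber 3. ((\<lambda>t. g (x(i := t))) has_real_derivative g' x) (at (x i))" by blast
  show ?case
  proof (intro exI[of _ "\<lambda>x. f' x * g x + g' x * f x"] conjI ballI)
    show "sm (\<lambda>x. f' x * g x + g' x * f x)" using h mult by (intro smooth6.add smooth6.mult) auto
    fix x :: "nat \<Rightarrow> real" assume x: "x \<in> chamber 3"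
    show "((\<lambda>t. f (x(i := t)) * g (x(i := t))) has_real_derivative f' x * g x + g' x * f x) (at (x i))"
      using DERIV_mult[OF h(3)[rule_format, OF x] h(4)[rule_format, OF x]] by simp
  qed
next
  case (inv p q)
  define v :: real where "v = (if p = i then 1 else 0) - (if q = i then 1 else 0)"
  show ?case
  proof (intro exI[of _ "\<lambda>x. - v * (1 / (x p - x q) * (1 / (x p - x q)))"] conjI ballI)
    show "sm (\<lambda>x. - v * (1 / (x p - x q) * (1 / (x p - x q))))" using inv by (intro smooth6.mult smooth6.const smooth6.inv)
    fix x :: "nat \<Rightarrow> real" assume x: "x \<in> chamber 3"
    have n: "x p - x q \<noteq> 0" using chamber_neq[OF x, of p q] inv by auto
    have "((\<lambda>t. (x(i := t)) p - (x(i := t)) q) has_real_derivative v) (at (x i))"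
      unfolding v_def by (intro DERIV_diff coord_deriv)
    from DERIV_inverse_fun[OF this] show "((\<lambda>t. 1 / ((x(i := t)) p - (x(i := t)) q)) has_real_derivative - v * (1 / (x p - x q) * (1 / (x p - x q)))) (at (x i))"
      using n by (simp add: inverse_eq_divide)
  qed
next
  case (powr p q c)
  define v :: real where "v = (if p = i then 1 else 0) - (if q = i then 1 else 0)"
  show ?case
  proof (intro exI[of _ "\<lambda>x. c * v * (1 / (x p - x q)) * \<bar>x p - x q\<bar> powr c"] conjI ballI)
    show "sm (\<lambda>x. c * v * (1 / (x p - x q)) * \<bar>x p - x q\<bar> powr c)"
      using powr by (intro smooth6.mult smooth6.const smooth6.inv smooth6.powr)
    fix x :: "nat \<Rightarrow> real" assume x: "x \<in> chamber 3"
    have n: "x p - x q \<noteq> 0" using chamber_neq[OF x, of p q] powr by auto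
    have "((\<lambda>t. (x(i := t)) p - (x(i := t)) q) has_real_derivative v) (at (x i))"
      unfolding v_def by (intro DERIV_diff coord_deriv)
    from abs_powr_deriv[OF this, of c] n
    show "((\<lambda>t. \<bar>(x(i := t)) p - (x(i := t)) q\<bar> powr c) has_real_derivative c * v * (1 / (x p - x q)) * \<bar>x p - x q\<bar> powr c) (at (x i))"
      by simp
  qed
next
  case (psum a)
  define v :: "nat \<Rightarrow> real" where "v p = (if p = i then 1 else 0)" for p
  note fi = frame_index[OF fr] and fd = frame_distinct[OF fr]
  let ?r1 = "\<lambda>x. crs (x p1) (x q1) (x p2) (x q2)" and ?r2 = "\<lambda>x. crs (x p2) (x q2) (x p3) (x q3)" and ?r3 = "\<lambda>x. crs (x p3) (x q3) (x p1) (x q1)"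
  let ?g = "\<lambda>x. psum (pderiv1 a) (?r1 x) (?r2 x) (?r3 x) * (?r1 x * rlog (x p1) (x q1) (x p2) (x q2) (v p1) (v q1) (v p2) (v q2))
     + psum (pderiv2 a) (?r1 x) (?r2 x) (?r3 x) * (?r2 x * rlog (x p2) (x q2) (x p3) (x q3) (v p2) (v q2) (v p3) (v q3))
     + psum (pderiv3 a) (?r1 x) (?r2 x) (?r3 x) * (?r3 x * rlog (x p3) (x q3) (x p1) (x q1) (v p3) (v q3) (v p1) (v q1))"
  show ?case
  proof (intro exI[of _ ?g] conjI ballI)
    show "sm ?g"
      using fi fd by (intro smooth6.add smooth6.mult smooth6.psum sm_crs sm_rlog regular_pderiv1 regular_pderiv2 regular_pderiv3 psum) auto
    fix x :: "nat \<Rightarrow> real" assume x: "x \<in> chamber 3"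
    note r = frame_crs[OF fr x]
    have d: "((\<lambda>t. (x(i := t)) p) has_real_derivative v p) (at (x i))" for p unfolding v_def by (rule coord_deriv)
    have c: "((\<lambda>t. crs ((x(i := t)) a) ((x(i := t)) b) ((x(i := t)) c) ((x(i := t)) d)) has_real_derivative
       crs (x a) (x b) (x c) (x d) * rlog (x a) (x b) (x c) (x d) (v a) (v b) (v c) (v d)) (at (x i))"
      if "crs (x a) (x b) (x c) (x d) \<in> {0<..<1}" for a b c d
      using crs_deriv[OF d[of a] d[of b] d[of c] d[of d]] that unfolding fun_upd_triv .
    have c1: "((\<lambda>t. ?r1 (x(i := t))) has_real_derivative ?r1 x * rlog (x p1) (x q1) (x p2) (x q2) (v p1) (v q1) (v p2) (v q2)) (at (x i))"
      by (rule c[OF r(1)])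
    have c2: "((\<lambda>t. ?r2 (x(i := t))) has_real_derivative ?r2 x * rlog (x p2) (x q2) (x p3) (x q3) (v p2) (v q2) (v p3) (v q3)) (at (x i))"
      by (rule c[OF r(2)])
    have c3: "((\<lambda>t. ?r3 (x(i := t))) has_real_derivative ?r3 x * rlog (x p3) (x q3) (x p1) (x q1) (v p3) (v q3) (v p1) (v q1)) (at (x i))"
      by (rule c[OF r(3)])
    have u: "\<bar>(?r1 (x(i := x i)))\<bar> < 1" "\<bar>?r2 (x(i := x i))\<bar> < 1" "\<bar>?r3 (x(i := x i))\<bar> < 1" using r by simp_all
    from psum_chain[OF psum c1 c2 c3 u, unfolded fun_upd_triv]
    show "((\<lambda>t. psum a (?r1 (x(i := t))) (?r2 (x(i := t))) (?r3 (x(i := t)))) has_real_derivative ?g x) (at (x i))" .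
  qed
qed

lemma sm_continuous: "sm f \<Longrightarrow> continuous_on (chamber 3) f"
proof (induction rule: smooth6.induct)
  case (psum a)
  have cr: "continuous_on (chamber 3) (\<lambda>x. crs (x u) (x b) (x c) (x d))"
    if "u \<in> {1..6}" "b \<in> {1..6}" "c \<in> {1..6}" "d \<in> {1..6}" "u \<noteq> d" "b \<noteq> c" for u b c d
    unfolding crs_def using that chamber_neq[of _ 3 u d] chamber_neq[of _ 3 b c]
    by (intro continuous_intros continuous_on_coordinate) auto
  note fi = frame_index[OF fr] and fd = frame_distinct[OF fr]
  have c: "continuous_on (chamber 3) (\<lambda>x. crs (x p1) (x q1) (x p2) (x q2))" "continuous_on (chamber 3) (\<lambda>x. crs (x p2) (x q2) (x p3) (x q3))"
    "continuous_on (chamber 3) (\<lambda>x. crs (x p3) (x q3) (x p1) (x q1))"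
    by (rule cr; use fi fd in auto)+
  have u: "\<bar>r\<bar> < 1" if "r \<in> {0<..<1}" for r :: real using that by simp
  show ?case
    unfolding continuous_on_def
  proof
    fix x :: "nat \<Rightarrow> real" assume x: "x \<in> chamber 3"
    note r = frame_crs[OF fr x]
    show "((\<lambda>x. psum a (crs (x p1) (x q1) (x p2) (x q2)) (crs (x p2) (x q2) (x p3) (x q3)) (crs (x p3) (x q3) (x p1) (x q1))) \<longlongrightarrow>
      psum a (crs (x p1) (x q1) (x p2) (x q2)) (crs (x p2) (x q2) (x p3) (x q3)) (crs (x p3) (x q3) (x p1) (x q1))) (at x within chamber 3)"
      by (rule psum_tendsto[OF psum u[OF r(1)] u[OF r(2)] u[OF r(3)]]) (use c x in \<open>auto simp: continuous_on_def\<close>)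
  qed
next
  case (inv p q)
  then show ?case using chamber_neq[of _ 3 p q]
    by (intro continuous_intros continuous_on_coordinate) auto
next
  case (powr p q c)
  then show ?case using chamber_neq[of _ 3 p q]
    by (intro continuous_intros continuous_on_coordinate) auto
qed (auto intro!: continuous_intros continuous_on_coordinate)

lemma sm_Ck_on:
  assumes "sm g" "\<And>x. x \<in> chamber 3 \<Longrightarrow> f x = g x"
  shows "Ck_on k {1..6} (chamber 3) f"
  using assms
proof (induction k arbitrary: f g)
  case 0
  then show ?case using sm_continuous continuous_on_cong[of "chamber 3" "chamber 3" f g] by simp
next
  case (Suc k)
  have c: "continuous_on (chamber 3) f" using Suc.prems sm_continuous continuous_on_cong[of "chamber 3" "chamber 3" f g] by simp
  have "(\<forall>x\<in>chamber 3. (\<lambda>t. f (x(i := t))) field_differentiable at (x i)) \<and> Ck_on k {1..6} (chamber 3) (partial i f)" for i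
  proof -
    obtain g' where g': "sm g'" "\<And>x. x \<in> chamber 3 \<Longrightarrow> ((\<lambda>t. g (x(i := t))) has_real_derivative g' x) (at (x i))"
      using sm_has_partial[OF Suc.prems(1), of i] by blast
    have "Ck_on k {1..6} (chamber 3) (partial i f)"
      by (rule Suc.IH[OF g'(1)]) (rule partial_chamber[OF _ Suc.prems(2) g'(2)])
    moreover have "(\<lambda>t. f (x(i := t))) field_differentiable at (x i)" if "x \<in> chamber 3" for x
      unfolding field_differentiable_def by (rule exI, rule has_derivative_chamber_cong[OF that Suc.prems(2) g'(2)[OF that]])
    ultimately show ?thesis by blast
  qed
  then show ?case using c by simp
qed

text \<open>In absolute value a cross-ratio is a quotient of distances, so its power \<beta> / 2 is
  a product of generators of the family.\<close>

lemma sm_Wx: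
  assumes "regular a"
  shows "\<exists>g. sm g \<and> (\<forall>x\<in>chamber 3. Wx \<beta> (psum a) p1 p2 p3 q1 q2 q3 x = g x)"
proof -
  note fi = frame_index[OF fr] and fd = frame_distinct[OF fr]
  define P :: "nat \<Rightarrow> nat \<Rightarrow> nat \<Rightarrow> nat \<Rightarrow> (nat \<Rightarrow> real) \<Rightarrow> real" where "P = (\<lambda>a b c d x. (\<bar>x a - x c\<bar> powr (\<beta> / 2) * \<bar>x b - x d\<bar> powr (\<beta> / 2)) * (\<bar>x a - x d\<bar> powr (- (\<beta> / 2)) * \<bar>x b - x c\<bar> powr (- (\<beta> / 2))))"
  have P: "crs (x a) (x b) (x c) (x d) powr (\<beta> / 2) = P a b c d x" if "crs (x a) (x b) (x c) (x d) \<in> {0<..<1}" for a b c d and x :: "nat \<Rightarrow> real"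
  proof -
    have "crs (x a) (x b) (x c) (x d) = \<bar>crs (x a) (x b) (x c) (x d)\<bar>" using that by simp
    also have "\<dots> = (\<bar>x a - x c\<bar> * \<bar>x b - x d\<bar>) / (\<bar>x a - x d\<bar> * \<bar>x b - x c\<bar>)" by (simp add: crs_def abs_mult)
    finally show ?thesis by (simp add: P_def powr_mult powr_divide powr_minus_divide)
  qed
  have sP: "sm (P a b c d)" if "a \<in> {1..6}" "b \<in> {1..6}" "c \<in> {1..6}" "d \<in> {1..6}" "distinct [a, b, c, d]" for a b c d
    unfolding P_def using that by (intro smooth6.mult smooth6.powr) auto
  let ?g = "\<lambda>x. \<bar>x p1 - x q1\<bar> powr (1 - 3 * \<beta> / 2) * \<bar>x p2 - x q2\<bar> powr (1 - 3 * \<beta> / 2) * \<bar>x p3 - x q3\<bar> powr (1 - 3 * \<beta> / 2)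
     * (P p1 q1 p2 q2 x * P p2 q2 p3 q3 x * P p3 q3 p1 q1 x)
     * psum a (crs (x p1) (x q1) (x p2) (x q2)) (crs (x p2) (x q2) (x p3) (x q3)) (crs (x p3) (x q3) (x p1) (x q1))"
  show ?thesis
  proof (intro exI[of _ ?g] conjI ballI)
    show "sm ?g" using fi fd by (intro smooth6.mult smooth6.powr sP smooth6.psum[OF assms]) auto
    fix x :: "nat \<Rightarrow> real" assume x: "x \<in> chamber 3"
    note r = frame_crs[OF fr x]
    show "Wx \<beta> (psum a) p1 p2 p3 q1 q2 q3 x = ?g x"
      using r by (simp add: Wx_def Wf_def Lam_def P[OF r(1), symmetric] P[OF r(2), symmetric] P[OF r(3), symmetric] powr_mult)
  qed
qed

end

section \<open>Symmetries of frames and the equations at every point\<close>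

lemma Lam_rotate: "Lam \<beta> p2 p3 p1 q2 q3 q1 = Lam \<beta> p1 p2 p3 q1 q2 q3"
  unfolding Lam_def by (simp only: mult_ac)

lemma Lam_swap: "Lam \<beta> q1 q2 q3 p1 p2 p3 = Lam \<beta> p1 p2 p3 q1 q2 q3"
proof -
  have "\<bar>q1 - p1\<bar> = \<bar>p1 - q1\<bar>" "\<bar>q2 - p2\<bar> = \<bar>p2 - q2\<bar>" "\<bar>q3 - p3\<bar> = \<bar>p3 - q3\<bar>" by simp_all
  moreover have "crs q1 p1 q2 p2 = crs p1 q1 p2 q2" "crs q2 p2 q3 p3 = crs p2 q2 p3 q3" "crs q3 p3 q1 p1 = crs p3 q3 p1 q1" by (rule crs_swap(2))+
  ultimately show ?thesis unfolding Lam_def by presburger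
qed

lemma Lam_transpose: "Lam \<beta> p2 p1 p3 q2 q1 q3 = Lam \<beta> p1 p2 p3 q1 q2 q3"
proof -
  have "crs p2 q2 p1 q1 = crs p1 q1 p2 q2" "crs p1 q1 p3 q3 = crs p3 q3 p1 q1" "crs p3 q3 p2 q2 = crs p2 q2 p3 q3" by (rule crs_swap(1))+
  then show ?thesis unfolding Lam_def by (simp only: mult_ac)
qed

lemma frame_sum:
  assumes "frame p1 p2 p3 q1 q2 q3"
  shows "(\<Sum>j\<in>{1..6} - {p1}. f j) = f p2 + f p3 + f q1 + f q2 + (f q3 :: real)"
    and "(\<Prod>j=1..6. f j) = f p1 * f p2 * f p3 * f q1 * f q2 * f q3"
proof -
  have e: "{1..6} = {p1, p2, p3, q1, q2, q3}" using assms by (simp add: frame_def)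
  note d = frame_distinct[OF assms]
  have "{p1, p2, p3, q1, q2, q3} - {p1} = {p2, p3, q1, q2, q3}" using d by auto
  then show "(\<Sum>j\<in>{1..6} - {p1}. f j) = f p2 + f p3 + f q1 + f q2 + f q3" unfolding e using d by simp
  show "(\<Prod>j=1..6. f j) = f p1 * f p2 * f p3 * f q1 * f q2 * f q3" unfolding e using d by (simp add: mult_ac)
qed

context rainbow
begin

lemma F_rotate: "F y z x = F x y z" and F_reverse: "F x z y = F x y z"
proof -
  show "F x z y = F x y z" by (rule F_sym(2))
  have "F y z x = F y x z" by (rule F_sym(2))
  also have "\<dots> = F x y z" by (rule F_sym(1))
  finally show "F y z x = F x y z" .
qed

lemma Wx_rotate: "Wx \<beta> F p2 p3 p1 q2 q3 q1 = Wx \<beta> F p1 p2 p3 q1 q2 q3"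
proof
  fix x
  show "Wx \<beta> F p2 p3 p1 q2 q3 q1 x = Wx \<beta> F p1 p2 p3 q1 q2 q3 x"
    unfolding Wx_def Wf_def Lam_rotate[of \<beta> "x p2" "x p3" "x p1"] by (rule arg_cong[OF F_rotate])
qed

lemma Wx_swap: "Wx \<beta> F q1 q2 q3 p1 p2 p3 = Wx \<beta> F p1 p2 p3 q1 q2 q3"
proof
  fix x
  have "crs (x q1) (x p1) (x q2) (x p2) = crs (x p1) (x q1) (x p2) (x q2)" "crs (x q2) (x p2) (x q3) (x p3) = crs (x p2) (x q2) (x p3) (x q3)"
    "crs (x q3) (x p3) (x q1) (x p1) = crs (x p3) (x q3) (x p1) (x q1)" by (rule crs_swap(2))+
  then show "Wx \<beta> F q1 q2 q3 p1 p2 p3 x = Wx \<beta> F p1 p2 p3 q1 q2 q3 x"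
    unfolding Wx_def Wf_def Lam_swap[of \<beta> "x q1"] by simp
qed

lemma Wx_transpose: "Wx \<beta> F p2 p1 p3 q2 q1 q3 = Wx \<beta> F p1 p2 p3 q1 q2 q3"
proof
  fix x
  have "crs (x p2) (x q2) (x p1) (x q1) = crs (x p1) (x q1) (x p2) (x q2)" "crs (x p1) (x q1) (x p3) (x q3) = crs (x p3) (x q3) (x p1) (x q1)"
    "crs (x p3) (x q3) (x p2) (x q2) = crs (x p2) (x q2) (x p3) (x q3)" by (rule crs_swap(1))+
  then show "Wx \<beta> F p2 p1 p3 q2 q1 q3 x = Wx \<beta> F p1 p2 p3 q1 q2 q3 x"
    unfolding Wx_def Wf_def Lam_transpose[of \<beta> "x p2"] by (simp only: F_reverse)
qed

text \<open>Cyclic rotation and the exchange of all \<open>p\<close> with all \<open>q\<close> bring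
  any of the six points to the first place without changing the function, so the BPZ equation at
  \<open>p1\<close> suffices.\<close>

lemma frame_first:
  assumes "frame p1 p2 p3 q1 q2 q3" "i \<in> {1..6}"
  obtains p2' p3' q1' q2' q3' where "frame i p2' p3' q1' q2' q3'"
    "Wx \<beta> F i p2' p3' q1' q2' q3' = Wx \<beta> F p1 p2 p3 q1 q2 q3"
proof -
  have "i \<in> {p1, p2, p3, q1, q2, q3}" using assms by (simp add: frame_def)
  moreover note f = assms(1) frame_rotate[OF assms(1)] frame_rotate[OF frame_rotate[OF assms(1)]]
  moreover note frame_swap[OF f(1)] frame_swap[OF f(2)] frame_swap[OF f(3)]
  moreover have "Wx \<beta> F p2 p3 p1 q2 q3 q1 = Wx \<beta> F p1 p2 p3 q1 q2 q3" "Wx \<beta> F p3 p1 p2 q3 q1 q2 = Wx \<beta> F p1 p2 p3 q1 q2 q3"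
    "Wx \<beta> F q1 q2 q3 p1 p2 p3 = Wx \<beta> F p1 p2 p3 q1 q2 q3" "Wx \<beta> F q2 q3 q1 p2 p3 p1 = Wx \<beta> F p1 p2 p3 q1 q2 q3"
    "Wx \<beta> F q3 q1 q2 p3 p1 p2 = Wx \<beta> F p1 p2 p3 q1 q2 q3"
    using Wx_rotate Wx_swap by metis+
  ultimately show ?thesis using that by blast
qed

lemma frame_PDE_at_first:
  assumes fr: "frame p1 p2 p3 q1 q2 q3" and k: "\<kappa> = 4 / \<beta>"
    and Z: "\<And>x. x \<in> chamber 3 \<Longrightarrow> Z x = c * Wx \<beta> F p1 p2 p3 q1 q2 q3 x" and x: "x \<in> chamber 3"
  shows "\<kappa> / 2 * partial p1 (partial p1 Z) x
     + (\<Sum>j\<in>{1..6} - {p1}. 2 / (x j - x p1) * partial j Z x - 2 * h_exp \<kappa> / (x j - x p1)\<^sup>2 * Z x) = 0"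
proof -
  let ?F1 = "psum (pderiv1 a)" and ?F2 = "psum (pderiv2 a)" and ?F3 = "psum (pderiv3 a)"
  have P: "has_partials F ?F1 ?F2 ?F3" by (rule psum_has_partials[OF regular_a])
  have P1: "has_partials ?F1 (psum (pderiv1 (pderiv1 a))) (psum (pderiv2 (pderiv1 a))) (psum (pderiv3 (pderiv1 a)))"
    by (rule psum_has_partials[OF regular_pderiv1[OF regular_a]])
  have P3: "has_partials ?F3 (psum (pderiv3 (pderiv1 a))) (psum (pderiv2 (pderiv3 a))) (psum (pderiv3 (pderiv3 a)))"
    using psum_has_partials[OF regular_pderiv3[OF regular_a]] unfolding pderiv_comm13 .
  define W where "W = (\<lambda>y. Wdot \<beta> F ?F1 ?F2 ?F3 (y p1) (y p2) (y p3) (y q1) (y q2) (y q3))"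
  define v :: "nat \<Rightarrow> nat \<Rightarrow> real" where "v i p = (if p = i then 1 else 0)" for i p
  have first: "partial i Z y = c * W y (v i p1) (v i p2) (v i p3) (v i q1) (v i q2) (v i q3)" if y: "y \<in> chamber 3" for i y
  proof (rule partial_chamber[OF y Z])
    have d: "((\<lambda>t. (y(i := t)) p) has_real_derivative v i p) (at (y i))" for p unfolding v_def by (rule coord_deriv)
    note r = frame_crs[OF fr y]
    have r': "crs ((y(i := y i)) p1) ((y(i := y i)) q1) ((y(i := y i)) p2) ((y(i := y i)) q2) \<in> {0<..<1}"
      "crs ((y(i := y i)) p2) ((y(i := y i)) q2) ((y(i := y i)) p3) ((y(i := y i)) q3) \<in> {0<..<1}"
      "crs ((y(i := y i)) p3) ((y(i := y i)) q3) ((y(i := y i)) p1) ((y(i := y i)) q1) \<in> {0<..<1}"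
      using r by simp_all
    show "((\<lambda>t. c * Wx \<beta> F p1 p2 p3 q1 q2 q3 (y(i := t))) has_real_derivative
        c * W y (v i p1) (v i p2) (v i p3) (v i q1) (v i q2) (v i q3)) (at (y i))"
      unfolding Wx_def W_def
      by (rule DERIV_cmult) (rule Wf_has_derivative[OF P d[of p1] d[of p2] d[of p3] d[of q1] d[of q2] d[of q3] r', unfolded fun_upd_triv])
  qed
  note d = frame_distinct[OF fr]
  note r = frame_crs[OF fr x]
  obtain W2 where W2: "((\<lambda>s. Wdot \<beta> F ?F1 ?F2 ?F3 s (x p2) (x p3) (x q1) (x q2) (x q3) 1 0 0 0 0 0) has_real_derivative W2) (at (x p1))"
    and id: "W2 + \<beta> * (1 / (x p2 - x p1) * W x 0 1 0 0 0 0 + 1 / (x p3 - x p1) * W x 0 0 1 0 0 0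
       + 1 / (x q1 - x p1) * W x 0 0 0 1 0 0 + 1 / (x q2 - x p1) * W x 0 0 0 0 1 0 + 1 / (x q3 - x p1) * W x 0 0 0 0 0 1)
     + \<beta> / 2 * (1 - 3 * \<beta> / 2) * (1 / (x p2 - x p1)\<^sup>2 + 1 / (x p3 - x p1)\<^sup>2 + 1 / (x q1 - x p1)\<^sup>2 + 1 / (x q2 - x p1)\<^sup>2 + 1 / (x q3 - x p1)\<^sup>2)
        * Wx \<beta> F p1 p2 p3 q1 q2 q3 x = 0"
    using bpz_identity[OF P P1 P3 r, of \<beta>] unfolding bpz_op_F[OF r] mult_zero_right W_def Wx_def by blast
  have second: "partial p1 (partial p1 Z) x = c * W2"
  proof (rule partial_chamber[OF x first])
    have e: "c * W (x(p1 := t)) (v p1 p1) (v p1 p2) (v p1 p3) (v p1 q1) (v p1 q2) (v p1 q3)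
       = c * Wdot \<beta> F ?F1 ?F2 ?F3 t (x p2) (x p3) (x q1) (x q2) (x q3) 1 0 0 0 0 0" for t
      unfolding W_def v_def using d by auto
    show "((\<lambda>t. c * W (x(p1 := t)) (v p1 p1) (v p1 p2) (v p1 p3) (v p1 q1) (v p1 q2) (v p1 q3)) has_real_derivative c * W2) (at (x p1))"
      unfolding e by (rule DERIV_cmult[OF W2])
  qed
  have f: "partial p2 Z x = c * W x 0 1 0 0 0 0" "partial p3 Z x = c * W x 0 0 1 0 0 0" "partial q1 Z x = c * W x 0 0 0 1 0 0"
    "partial q2 Z x = c * W x 0 0 0 0 1 0" "partial q3 Z x = c * W x 0 0 0 0 0 1"
    unfolding first[OF x] v_def using d by auto
  have kap: "\<kappa> / 2 = 2 / \<beta>" "2 * h_exp \<kappa> = 3 * \<beta> / 2 - 1" using beta by (simp_all add: k h_exp_def field_simps)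
  define u where "u p = 1 / (x p - x p1)" for p
  have u: "1 / (x p - x p1) = u p" "2 / (x p - x p1) = 2 * u p" "1 / (x p - x p1)\<^sup>2 = (u p)\<^sup>2" "(3 * \<beta> / 2 - 1) / (x p - x p1)\<^sup>2 = (3 * \<beta> / 2 - 1) * (u p)\<^sup>2" for p
    by (simp_all add: u_def power_divide)
  have key: "2 / \<beta> * (c * W2) + ((2 * u p2 * (c * A2) - (3 * \<beta> / 2 - 1) * (u p2)\<^sup>2 * (c * w)) + (2 * u p3 * (c * A3) - (3 * \<beta> / 2 - 1) * (u p3)\<^sup>2 * (c * w))
       + (2 * u q1 * (c * B1) - (3 * \<beta> / 2 - 1) * (u q1)\<^sup>2 * (c * w)) + (2 * u q2 * (c * B2) - (3 * \<beta> / 2 - 1) * (u q2)\<^sup>2 * (c * w))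
       + (2 * u q3 * (c * B3) - (3 * \<beta> / 2 - 1) * (u q3)\<^sup>2 * (c * w))) =
    2 / \<beta> * c * (W2 + \<beta> * (u p2 * A2 + u p3 * A3 + u q1 * B1 + u q2 * B2 + u q3 * B3)
      + \<beta> / 2 * (1 - 3 * \<beta> / 2) * ((u p2)\<^sup>2 + (u p3)\<^sup>2 + (u q1)\<^sup>2 + (u q2)\<^sup>2 + (u q3)\<^sup>2) * w)" for A2 A3 B1 B2 B3 w
    using beta by (simp add: field_simps)
  show ?thesis
    unfolding frame_sum(1)[OF fr] second f kap Z[OF x] u key using id unfolding u by simp
qed

lemma frame_PDE:
  assumes fr: "frame p1 p2 p3 q1 q2 q3" and k: "\<kappa> = 4 / \<beta>"
    and Z: "\<And>x. x \<in> chamber 3 \<Longrightarrow> Z x = c * Wx \<beta> F p1 p2 p3 q1 q2 q3 x"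
  shows "PDE \<kappa> 3 Z"
  unfolding PDE_def
proof (intro conjI allI ballI)
  obtain g where g: "smooth6 p1 p2 p3 q1 q2 q3 g" "\<And>x. x \<in> chamber 3 \<Longrightarrow> Wx \<beta> F p1 p2 p3 q1 q2 q3 x = g x"
    using sm_Wx[OF fr regular_a] by blast
  show "Ck_on n {1..2 * 3} (chamber 3) Z" for n
    using sm_Ck_on[OF fr smooth6.mult[OF smooth6.const[of _ _ _ _ _ _ c] g(1)], of Z n] Z g(2) by simp
  fix x :: "nat \<Rightarrow> real" and i :: nat assume x: "x \<in> chamber 3" and i: "i \<in> {1..2 * 3}"
  from i have i': "i \<in> {1..6}" by simp
  obtain p2' p3' q1' q2' q3' where f: "frame i p2' p3' q1' q2' q3'"
    "Wx \<beta> F i p2' p3' q1' q2' q3' = Wx \<beta> F p1 p2 p3 q1 q2 q3"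
    by (rule frame_first[OF fr i'])
  show "\<kappa> / 2 * partial i (partial i Z) x
     + (\<Sum>j\<in>{1..2 * 3} - {i}. 2 / (x j - x i) * partial j Z x - 2 * h_exp \<kappa> / (x j - x i)\<^sup>2 * Z x) = 0"
    using frame_PDE_at_first[OF f(1) k _ x, of Z c] Z f(2) by simp
qed

text \<open>Cross-ratios are invariant, and a difference \<open>u - w\<close> is scaled by
  \<open>de / (m u * m w)\<close>, whose square is the product of the derivatives at
  \<open>u\<close> and \<open>w\<close>. Each link length thus yields the factors at its two ends,
  and every point is the end of exactly one link.\<close>

lemma frame_COV:
  assumes fr: "frame p1 p2 p3 q1 q2 q3" and k: "\<kappa> = 4 / \<beta>"
    and Z: "\<And>x. x \<in> chamber 3 \<Longrightarrow> Z x = c * Wx \<beta> F p1 p2 p3 q1 q2 q3 x"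
  shows "COV \<kappa> 3 Z"
  unfolding COV_def
proof (intro ballI allI impI)
  fix x :: "nat \<Rightarrow> real" and A B C D :: real and \<phi>
  assume x: "x \<in> chamber 3" and det: "A * D - B * C > 0" and phi: "\<phi> = moebius A B C D"
    and n: "\<forall>i\<in>{1..2 * 3}. C * x i + D \<noteq> 0" and y: "\<phi> \<circ> x \<in> chamber 3"
  define de where "de = A * D - B * C"
  define m where "m u = C * u + D" for u
  define h where "h = h_exp \<kappa>"
  have de: "de > 0" using det by (simp add: de_def)
  have e: "1 - 3 * \<beta> / 2 = - (2 * h)" using beta by (simp add: h_def k h_exp_def field_simps)
  have m: "m (x i) \<noteq> 0" if "i \<in> {1..6}" for i using n that by (simp add: m_def)
  have diff: "\<phi> u - \<phi> w = de * (u - w) / (m u * m w)" if "m u \<noteq> 0" "m w \<noteq> 0" for u w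
    using that by (simp add: phi moebius_def m_def de_def divide_simps) (simp add: algebra_simps)
  have dphi: "deriv \<phi> u = de / (m u)\<^sup>2" if "m u \<noteq> 0" for u
    unfolding phi moebius_def using that
    by (intro DERIV_imp_deriv) (auto intro!: derivative_eq_intros simp: m_def de_def power2_eq_square algebra_simps)
  have cr: "crs (\<phi> u) (\<phi> v) (\<phi> w) (\<phi> z) = crs u v w z" if "m u \<noteq> 0" "m v \<noteq> 0" "m w \<noteq> 0" "m z \<noteq> 0" for u v w z
    unfolding crs_def using that de by (simp add: diff divide_simps mult_ac)
  have ab: "\<bar>u - w\<bar> powr (- (2 * h)) = (deriv \<phi> u powr h * deriv \<phi> w powr h) * \<bar>\<phi> u - \<phi> w\<bar> powr (- (2 * h))"
    if "m u \<noteq> 0" "m w \<noteq> 0" "u \<noteq> w" for u w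
  proof -
    have p: "deriv \<phi> u powr h * deriv \<phi> w powr h = (de / (\<bar>m u\<bar> * \<bar>m w\<bar>)) powr (2 * h)"
    proof -
      have "deriv \<phi> u * deriv \<phi> w = (de / (\<bar>m u\<bar> * \<bar>m w\<bar>))\<^sup>2"
        using that by (simp add: dphi power_divide power_mult_distrib) (simp add: power2_eq_square)
      moreover have "deriv \<phi> u \<ge> 0" "deriv \<phi> w \<ge> 0" using that de by (simp_all add: dphi)
      moreover have q: "de / (\<bar>m u\<bar> * \<bar>m w\<bar>) > 0" using that de by simp
      ultimately have "deriv \<phi> u powr h * deriv \<phi> w powr h = ((de / (\<bar>m u\<bar> * \<bar>m w\<bar>))\<^sup>2) powr h"
        by (metis powr_mult)
      also have "\<dots> = (de / (\<bar>m u\<bar> * \<bar>m w\<bar>)) powr (2 * h)"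
        unfolding powr_realpow[OF q, of 2, symmetric, simplified] powr_powr by simp
      finally show ?thesis .
    qed
    have q: "\<bar>\<phi> u - \<phi> w\<bar> = (de / (\<bar>m u\<bar> * \<bar>m w\<bar>)) * \<bar>u - w\<bar>" using that de by (simp add: diff abs_mult)
    define K where "K = de / (\<bar>m u\<bar> * \<bar>m w\<bar>)"
    have "K > 0" using that de by (simp add: K_def)
    then show ?thesis unfolding p q K_def[symmetric] by (simp add: powr_mult powr_minus)
  qed
  note fi = frame_index[OF fr] and d = frame_distinct[OF fr]
  have ne: "x p1 \<noteq> x q1" "x p2 \<noteq> x q2" "x p3 \<noteq> x q3" using chamber_neq[OF x] fi d by auto
  note mi = m[OF fi(1)] m[OF fi(2)] m[OF fi(3)] m[OF fi(4)] m[OF fi(5)] m[OF fi(6)]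
  have "Wx \<beta> F p1 p2 p3 q1 q2 q3 x = (\<Prod>i=1..6. deriv \<phi> (x i) powr h) * Wx \<beta> F p1 p2 p3 q1 q2 q3 (\<phi> \<circ> x)"
    unfolding Wx_def Wf_def Lam_def o_def cr[OF mi(1) mi(4) mi(2) mi(5)] cr[OF mi(2) mi(5) mi(3) mi(6)] cr[OF mi(3) mi(6) mi(1) mi(4)] e
      ab[OF mi(1,4) ne(1)] ab[OF mi(2,5) ne(2)] ab[OF mi(3,6) ne(3)] frame_sum(2)[OF fr] by (simp only: mult_ac)
  then show "Z x = (\<Prod>i=1..2 * 3. deriv \<phi> (x i) powr h_exp \<kappa>) * Z (\<phi> \<circ> x)"
    unfolding Z[OF x] Z[OF y] h_def by simp
qed

end

section \<open>Asymptotics\<close>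

lemma crs_tendsto:
  assumes "(P \<longlongrightarrow> p) A" "(Q \<longlongrightarrow> q) A" "(R \<longlongrightarrow> r) A" "(S \<longlongrightarrow> s) A" "p \<noteq> s" "q \<noteq> r"
  shows "((\<lambda>\<omega>. crs (P \<omega>) (Q \<omega>) (R \<omega>) (S \<omega>)) \<longlongrightarrow> crs p q r s) A"
  unfolding crs_def by (intro tendsto_intros assms) (use assms in auto)

context rainbow
begin

text \<open>The cross-ratio of the two links whose ends \<open>p1\<close>, \<open>p2\<close> merge
  is proportional to their distance and \<open>F\<close> is bounded. The exponent left over is
  \<beta> / 2 - (1 - 3 \<beta> / 2) = 2 \<beta> - 1 > 0.\<close>

lemma Wx_unlinked_limit:
  assumes fr: "frame p1 p2 p3 q1 q2 q3"
    and ev: "\<forall>\<^sub>F \<omega> in A. Y \<omega> \<in> chamber 3" and lim: "\<And>i. ((\<lambda>\<omega>. Y \<omega> i) \<longlongrightarrow> X i) A"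
    and X: "X p1 = X p2" "X p1 \<noteq> X q1" "X p2 \<noteq> X q2" "X p3 \<noteq> X q3" "X q1 \<noteq> X q2"
  shows "((\<lambda>\<omega>. Wx \<beta> F p1 p2 p3 q1 q2 q3 (Y \<omega>) / \<bar>Y \<omega> p1 - Y \<omega> p2\<bar> powr (1 - 3 * \<beta> / 2)) \<longlongrightarrow> 0) A"
proof (rule Lim_null_comparison)
  define L where "L \<omega> = \<bar>Y \<omega> p1 - Y \<omega> q1\<bar> powr (1 - 3 * \<beta> / 2) * \<bar>Y \<omega> p2 - Y \<omega> q2\<bar> powr (1 - 3 * \<beta> / 2) * \<bar>Y \<omega> p3 - Y \<omega> q3\<bar> powr (1 - 3 * \<beta> / 2)" for \<omega>
  define R where "R \<omega> = (\<bar>Y \<omega> q1 - Y \<omega> q2\<bar> / (\<bar>Y \<omega> p1 - Y \<omega> q2\<bar> * \<bar>Y \<omega> q1 - Y \<omega> p2\<bar>)) powr (\<beta> / 2)" for \<omega>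
  let ?B = "\<lambda>\<omega>. L \<omega> * R \<omega> * (gsum * M0) * \<bar>Y \<omega> p1 - Y \<omega> p2\<bar> powr (2 * \<beta> - 1)"
  have "(?B \<longlongrightarrow> (\<bar>X p1 - X q1\<bar> powr (1 - 3 * \<beta> / 2) * \<bar>X p2 - X q2\<bar> powr (1 - 3 * \<beta> / 2) * \<bar>X p3 - X q3\<bar> powr (1 - 3 * \<beta> / 2))
     * (\<bar>X q1 - X q2\<bar> / (\<bar>X p1 - X q2\<bar> * \<bar>X q1 - X p2\<bar>)) powr (\<beta> / 2) * (gsum * M0) * 0) A"
  proof (rule tendsto_mult)
    show "((\<lambda>\<omega>. L \<omega> * R \<omega> * (gsum * M0)) \<longlongrightarrow> (\<bar>X p1 - X q1\<bar> powr (1 - 3 * \<beta> / 2) * \<bar>X p2 - X q2\<bar> powr (1 - 3 * \<beta> / 2) * \<bar>X p3 - X q3\<bar> powr (1 - 3 * \<beta> / 2))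
     * (\<bar>X q1 - X q2\<bar> / (\<bar>X p1 - X q2\<bar> * \<bar>X q1 - X p2\<bar>)) powr (\<beta> / 2) * (gsum * M0)) A"
      unfolding L_def R_def by (intro tendsto_intros lim) (use X in auto)
    have "((\<lambda>\<omega>. \<bar>Y \<omega> p1 - Y \<omega> p2\<bar>) \<longlongrightarrow> \<bar>X p1 - X p2\<bar>) A" by (intro tendsto_intros lim)
    then have "((\<lambda>\<omega>. \<bar>Y \<omega> p1 - Y \<omega> p2\<bar>) \<longlongrightarrow> 0) A" using X(1) by simp
    from tendsto_powr'[OF this tendsto_const[of "2 * \<beta> - 1"]] show "((\<lambda>\<omega>. \<bar>Y \<omega> p1 - Y \<omega> p2\<bar> powr (2 * \<beta> - 1)) \<longlongrightarrow> 0) A"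
      using beta by simp
  qed
  then show "(?B \<longlongrightarrow> 0) A" by simp
  show "\<forall>\<^sub>F \<omega> in A. norm (Wx \<beta> F p1 p2 p3 q1 q2 q3 (Y \<omega>) / \<bar>Y \<omega> p1 - Y \<omega> p2\<bar> powr (1 - 3 * \<beta> / 2)) \<le> ?B \<omega>"
    using ev
  proof eventually_elim
    fix \<omega> assume y: "Y \<omega> \<in> chamber 3"
    let ?y = "Y \<omega>"
    note r = frame_crs[OF fr y]
    let ?r1 = "crs (?y p1) (?y q1) (?y p2) (?y q2)" and ?r2 = "crs (?y p2) (?y q2) (?y p3) (?y q3)" and ?r3 = "crs (?y p3) (?y q3) (?y p1) (?y q1)"
    define d where "d = \<bar>?y p1 - ?y p2\<bar>"
    have d: "d > 0" using crs_distinct(1)[OF r(1)] by (simp add: d_def)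
    have R0: "R \<omega> \<ge> 0" "L \<omega> \<ge> 0" by (simp_all add: R_def L_def)
    have "(?r1 * ?r2 * ?r3) powr (\<beta> / 2) \<le> ?r1 powr (\<beta> / 2)"
    proof (rule powr_mono2)
      have "?r2 * ?r3 \<le> 1" using r by (intro mult_le_one) auto
      then have "?r1 * (?r2 * ?r3) \<le> ?r1 * 1" using r by (intro mult_left_mono) auto
      then show "?r1 * ?r2 * ?r3 \<le> ?r1" by (simp add: mult.assoc)
    qed (use r beta in auto)
    also have "?r1 powr (\<beta> / 2) = d powr (\<beta> / 2) * R \<omega>"
    proof -
      have "?r1 = \<bar>?r1\<bar>" using r by simp
      also have "\<dots> = d * (\<bar>?y q1 - ?y q2\<bar> / (\<bar>?y p1 - ?y q2\<bar> * \<bar>?y q1 - ?y p2\<bar>))" by (simp add: crs_def d_def abs_mult)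
      finally show ?thesis unfolding R_def by (simp only: powr_mult)
    qed
    finally have c: "(?r1 * ?r2 * ?r3) powr (\<beta> / 2) \<le> d powr (\<beta> / 2) * R \<omega>" .
    have Fb: "\<bar>F ?r1 ?r2 ?r3\<bar> \<le> gsum * M0" by (rule F_bound) (use r in auto)
    have "norm (Wx \<beta> F p1 p2 p3 q1 q2 q3 ?y / d powr (1 - 3 * \<beta> / 2)) =
       L \<omega> * ((?r1 * ?r2 * ?r3) powr (\<beta> / 2) * \<bar>F ?r1 ?r2 ?r3\<bar>) / d powr (1 - 3 * \<beta> / 2)"
      by (simp add: Wx_def Wf_def Lam_def L_def abs_mult)
    also have "\<dots> \<le> L \<omega> * ((d powr (\<beta> / 2) * R \<omega>) * (gsum * M0)) / d powr (1 - 3 * \<beta> / 2)"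
      using c Fb R0 by (intro divide_right_mono mult_left_mono mult_mono) auto
    also have "\<dots> = L \<omega> * R \<omega> * (gsum * M0) * (d powr (\<beta> / 2) / d powr (1 - 3 * \<beta> / 2))" by simp
    also have "d powr (\<beta> / 2) / d powr (1 - 3 * \<beta> / 2) = d powr (2 * \<beta> - 1)"
      using d by (simp add: powr_diff[symmetric])
    finally show "norm (Wx \<beta> F p1 p2 p3 q1 q2 q3 ?y / \<bar>?y p1 - ?y p2\<bar> powr (1 - 3 * \<beta> / 2)) \<le> ?B \<omega>"
      unfolding d_def .
  qed
qed

text \<open>Both cross-ratios that involve the collapsing link tend to 1. \<open>F_boundary\<close>,
  with the first of them as its middle argument, yields \<open>hf 1 * gf r2 * gf r3\<close>; by its
  uniformity the second may tend to 1 at the same time, and \<open>gf\<close> is continuous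
  there.\<close>

lemma Wx_linked_limit:
  assumes fr: "frame p1 p2 p3 q1 q2 q3"
    and ev: "\<forall>\<^sub>F \<omega> in A. Y \<omega> \<in> chamber 3" and lim: "\<And>i. ((\<lambda>\<omega>. Y \<omega> i) \<longlongrightarrow> X i) A"
    and X: "X p1 = X q1" "distinct [X p1, X p2, X q2, X p3, X q3]"
    and C: "crs (X p2) (X q2) (X p3) (X q3) \<in> {0<..<1}"
  shows "((\<lambda>\<omega>. Wx \<beta> F p1 p2 p3 q1 q2 q3 (Y \<omega>) / \<bar>Y \<omega> p1 - Y \<omega> q1\<bar> powr (1 - 3 * \<beta> / 2)) \<longlongrightarrow>
    \<bar>X p2 - X q2\<bar> powr (1 - 3 * \<beta> / 2) * \<bar>X p3 - X q3\<bar> powr (1 - 3 * \<beta> / 2) * crs (X p2) (X q2) (X p3) (X q3) powr (\<beta> / 2)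
      * (hf 1 * gf (crs (X p2) (X q2) (X p3) (X q3)) * gf 1)) A"
proof -
  define C where "C = crs (X p2) (X q2) (X p3) (X q3)"
  let ?r1 = "\<lambda>\<omega>. crs (Y \<omega> p1) (Y \<omega> q1) (Y \<omega> p2) (Y \<omega> q2)" and ?r2 = "\<lambda>\<omega>. crs (Y \<omega> p2) (Y \<omega> q2) (Y \<omega> p3) (Y \<omega> q3)"
    and ?r3 = "\<lambda>\<omega>. crs (Y \<omega> p3) (Y \<omega> q3) (Y \<omega> p1) (Y \<omega> q1)"
  have r1: "(?r1 \<longlongrightarrow> 1) A"
  proof -
    have "(?r1 \<longlongrightarrow> crs (X p1) (X q1) (X p2) (X q2)) A" by (rule crs_tendsto[OF lim lim lim lim]) (use X in auto)
    also have "crs (X p1) (X q1) (X p2) (X q2) = 1" using X(2) unfolding X(1) crs_def by auto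
    finally show ?thesis .
  qed
  have r3: "(?r3 \<longlongrightarrow> 1) A"
  proof -
    have "(?r3 \<longlongrightarrow> crs (X p3) (X q3) (X p1) (X q1)) A" by (rule crs_tendsto[OF lim lim lim lim]) (use X in auto)
    also have "crs (X p3) (X q3) (X p1) (X q1) = 1" using X(2) unfolding X(1) crs_def by auto
    finally show ?thesis .
  qed
  have r2: "(?r2 \<longlongrightarrow> C) A" unfolding C_def by (rule crs_tendsto[OF lim lim lim lim]) (use X in auto)
  have in01: "\<forall>\<^sub>F \<omega> in A. ?r1 \<omega> \<in> {0<..<1} \<and> ?r2 \<omega> \<in> {0<..<1} \<and> ?r3 \<omega> \<in> {0<..<1}"
    using ev by eventually_elim (use frame_crs[OF fr] in blast)
  have gl: "((\<lambda>\<omega>. gf (R \<omega>)) \<longlongrightarrow> gf r) A" if "(R \<longlongrightarrow> r) A" "\<forall>\<^sub>F \<omega> in A. R \<omega> \<in> {0<..<1}" "r \<in> {-1..1}" for R r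
  proof (rule continuous_on_tendsto_compose[OF hfun_continuous that(1)])
    show "\<forall>\<^sub>F \<omega> in A. R \<omega> \<in> {- 1..1}" using that(2) by eventually_elim auto
  qed (use beta that in auto)
  have P: "((\<lambda>\<omega>. hf 1 * gf (?r2 \<omega>) * gf (?r3 \<omega>)) \<longlongrightarrow> hf 1 * gf C * gf 1) A"
    using C in01 by (intro tendsto_mult tendsto_const gl r2 r3) (auto simp: C_def elim: eventually_mono)
  have D: "((\<lambda>\<omega>. F (?r1 \<omega>) (?r2 \<omega>) (?r3 \<omega>) - hf 1 * gf (?r2 \<omega>) * gf (?r3 \<omega>)) \<longlongrightarrow> 0) A"
    unfolding tendsto_iff
  proof (intro allI impI)
    fix e :: real assume "e > 0"
    then obtain \<delta> where d: "\<delta> > 0" "\<And>x y z. 0 \<le> x \<Longrightarrow> x < 1 \<Longrightarrow> 0 \<le> y \<Longrightarrow> y < 1 \<Longrightarrow> 0 \<le> z \<Longrightarrow> z < 1 \<Longrightarrow>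
      1 - y < \<delta> \<Longrightarrow> \<bar>F x y z - hf 1 * gf x * gf z\<bar> < e" using F_boundary by blast
    have "\<forall>\<^sub>F \<omega> in A. 1 - \<delta> < ?r1 \<omega>" using order_tendstoD(1)[OF r1, of "1 - \<delta>"] d(1) by simp
    then show "\<forall>\<^sub>F \<omega> in A. dist (F (?r1 \<omega>) (?r2 \<omega>) (?r3 \<omega>) - hf 1 * gf (?r2 \<omega>) * gf (?r3 \<omega>)) 0 < e"
      using in01
    proof eventually_elim
      case (elim \<omega>)
      then have "\<bar>F (?r2 \<omega>) (?r1 \<omega>) (?r3 \<omega>) - hf 1 * gf (?r2 \<omega>) * gf (?r3 \<omega>)\<bar> < e" by (intro d(2)) auto
      then show ?case unfolding F_sym(1)[of "?r2 \<omega>"] by simp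
    qed
  qed
  have Fl: "((\<lambda>\<omega>. F (?r1 \<omega>) (?r2 \<omega>) (?r3 \<omega>)) \<longlongrightarrow> hf 1 * gf C * gf 1) A"
    using tendsto_add[OF D P] by simp
  have pl: "((\<lambda>\<omega>. (?r1 \<omega> * ?r2 \<omega> * ?r3 \<omega>) powr (\<beta> / 2)) \<longlongrightarrow> (1 * C * 1) powr (\<beta> / 2)) A"
    by (intro tendsto_powr tendsto_mult r1 r2 r3 tendsto_const) (use C in \<open>auto simp: C_def\<close>)
  have "((\<lambda>\<omega>. \<bar>Y \<omega> p2 - Y \<omega> q2\<bar> powr (1 - 3 * \<beta> / 2) * \<bar>Y \<omega> p3 - Y \<omega> q3\<bar> powr (1 - 3 * \<beta> / 2) * (?r1 \<omega> * ?r2 \<omega> * ?r3 \<omega>) powr (\<beta> / 2)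
      * F (?r1 \<omega>) (?r2 \<omega>) (?r3 \<omega>)) \<longlongrightarrow>
     \<bar>X p2 - X q2\<bar> powr (1 - 3 * \<beta> / 2) * \<bar>X p3 - X q3\<bar> powr (1 - 3 * \<beta> / 2) * (1 * C * 1) powr (\<beta> / 2) * (hf 1 * gf C * gf 1)) A"
    by (intro tendsto_mult pl Fl tendsto_powr tendsto_const tendsto_rabs tendsto_diff lim) (use X in auto)
  moreover have "\<forall>\<^sub>F \<omega> in A. \<bar>Y \<omega> p2 - Y \<omega> q2\<bar> powr (1 - 3 * \<beta> / 2) * \<bar>Y \<omega> p3 - Y \<omega> q3\<bar> powr (1 - 3 * \<beta> / 2) * (?r1 \<omega> * ?r2 \<omega> * ?r3 \<omega>) powr (\<beta> / 2)
      * F (?r1 \<omega>) (?r2 \<omega>) (?r3 \<omega>) = Wx \<beta> F p1 p2 p3 q1 q2 q3 (Y \<omega>) / \<bar>Y \<omega> p1 - Y \<omega> q1\<bar> powr (1 - 3 * \<beta> / 2)"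
    using ev
  proof eventually_elim
    case (elim \<omega>)
    then have "\<bar>Y \<omega> p1 - Y \<omega> q1\<bar> > 0" using crs_distinct(5)[OF frame_crs(1)[OF fr elim]] by simp
    then show ?case by (simp add: Wx_def Wf_def Lam_def)
  qed
  ultimately show ?thesis unfolding C_def[symmetric] using Lim_transform_eventually by fastforce
qed

end

section \<open>Passage from the given arrays and cross-ratios\<close>

lemma rainbow_arrays_locale:
  assumes "\<beta> > 1/2" "rainbow_arrays \<beta> A B"
  shows "rainbow \<beta> (\<lambda>k m n. ext0 A (vector [k, m, n])) (\<lambda>k m n. ext0 B (vector [k, m, n]))"
proof -
  have zero: "ext0 C (vector [k, m, n]) = 0" if "k < 0 \<or> m < 0 \<or> n < 0" for C and k m n :: int
    using that by (auto simp: ext0_def forall_3)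
  have u: "vector [k, m, n] + unit3 1 = vector [k + 1, m, n]" "vector [k, m, n] + unit3 2 = vector [k, m + 1, n]"
    "vector [k, m, n] + unit3 3 = vector [k, m, n + 1]" "vector [k, m, n] - unit3 1 = vector [k - 1, m, n]"
    "vector [k, m, n] - unit3 2 = vector [k, m - 1, n]" "vector [k, m, n] - unit3 3 = vector [k, m, n - 1]" for k m n :: int
    by (simp_all add: vec_eq_iff forall_3 axis_def)
  have 0: "A 0 = 1" using assms(2) by (simp add: rainbow_arrays_def)
  have R: "(of_int (v $ l) + 1) * (of_int (v $ l) + 2 * \<beta>) * ext0 A (v + unit3 l)
          - (of_int (v $ l) + \<beta>) * (of_int (v $ l) + 1 - \<beta>) * ext0 A v
        = ext0 B v - ext0 B (v - unit3 j) - ext0 B (v - unit3 k) + ext0 B (v - unit3 j - unit3 k)"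
     "(2 * of_int (v $ j) * of_int (v $ k)
           + \<beta> * of_int (v $ j) + \<beta> * of_int (v $ k) - \<beta> * of_int (v $ l)) * ext0 A v
        = ext0 B (v - unit3 l) + ext0 B (v - unit3 l - unit3 j - unit3 k)
          - ext0 B (v - unit3 j) - ext0 B (v - unit3 k)" if "{j, k, l} = {1, 2, 3}" for v j k l
    using assms(2) that unfolding rainbow_arrays_def by blast+
  have s: "{2, 3, 1} = {1, 2, 3 :: 3}" "{1, 3, 2} = {1, 2, 3 :: 3}" "{1, 2, 3} = {1, 2, 3 :: 3}" by auto
  show ?thesis
  proof
    show "1/2 < \<beta>" by fact
    show "ext0 A (vector [k, m, n]) = 0 \<and> ext0 B (vector [k, m, n]) = 0" if "k < 0 \<or> m < 0 \<or> n < 0" for k m n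
      using zero[OF that] by simp
    have "(\<chi> i. nat (vector [0, 0, 0] $ i)) = (0 :: nat^3)" by (simp add: vec_eq_iff forall_3)
    then show "ext0 A (vector [0, 0, 0]) = 1" using 0 by (simp add: ext0_def forall_3)
    fix k m n :: int
    let ?v = "vector [k, m, n] :: int^3"
    show "(of_int k + 1) * (of_int k + 2 * \<beta>) * ext0 A (vector [k + 1, m, n]) - (of_int k + \<beta>) * (of_int k + 1 - \<beta>) * ext0 A ?v
      = ext0 B ?v - ext0 B (vector [k, m - 1, n]) - ext0 B (vector [k, m, n - 1]) + ext0 B (vector [k, m - 1, n - 1])"
      using R(1)[OF s(1), of ?v] by (simp add: u)
    show "(of_int m + 1) * (of_int m + 2 * \<beta>) * ext0 A (vector [k, m + 1, n]) - (of_int m + \<beta>) * (of_int m + 1 - \<beta>) * ext0 A ?v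
      = ext0 B ?v - ext0 B (vector [k - 1, m, n]) - ext0 B (vector [k, m, n - 1]) + ext0 B (vector [k - 1, m, n - 1])"
      using R(1)[OF s(2), of ?v] by (simp add: u)
    show "(of_int n + 1) * (of_int n + 2 * \<beta>) * ext0 A (vector [k, m, n + 1]) - (of_int n + \<beta>) * (of_int n + 1 - \<beta>) * ext0 A ?v
      = ext0 B ?v - ext0 B (vector [k - 1, m, n]) - ext0 B (vector [k, m - 1, n]) + ext0 B (vector [k - 1, m - 1, n])"
      using R(1)[OF s(3), of ?v] by (simp add: u)
    note R2 = R(2)[OF s(1), of ?v] R(2)[OF s(2), of ?v] R(2)[OF s(3), of ?v]
    define K M N where "K = real_of_int k" "M = real_of_int m" "N = real_of_int n"
    define c b0 b1 b2 b3 where "c = ext0 A ?v" "b0 = ext0 B (vector [k - 1, m - 1, n - 1])" "b1 = ext0 B (vector [k - 1, m, n])"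
      "b2 = ext0 B (vector [k, m - 1, n])" "b3 = ext0 B (vector [k, m, n - 1])"
    note defs = K_M_N_def c_b0_b1_b2_b3_def
    have S: "(2 * M * N + \<beta> * M + \<beta> * N - \<beta> * K) * c = b1 + b0 - b2 - b3"
      "(2 * K * N + \<beta> * K + \<beta> * N - \<beta> * M) * c = b2 + b0 - b1 - b3"
      "(2 * K * M + \<beta> * K + \<beta> * M - \<beta> * N) * c = b3 + b0 - b1 - b2"
      using R2 by (simp_all add: u defs)
    show "of_int k * (of_int m + of_int n + \<beta>) * ext0 A ?v = ext0 B (vector [k - 1, m - 1, n - 1]) - ext0 B (vector [k - 1, m, n])"
      using S(2,3) unfolding defs[symmetric] by (simp add: algebra_simps)
    show "of_int m * (of_int k + of_int n + \<beta>) * ext0 A ?v = ext0 B (vector [k - 1, m - 1, n - 1]) - ext0 B (vector [k, m - 1, n])"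
      using S(1,3) unfolding defs[symmetric] by (simp add: algebra_simps)
    show "of_int n * (of_int k + of_int m + \<beta>) * ext0 A ?v = ext0 B (vector [k - 1, m - 1, n - 1]) - ext0 B (vector [k, m, n - 1])"
      using S(1,2) unfolding defs[symmetric] by (simp add: algebra_simps)
  qed
qed

lemma rainbow_F_psum:
  "rainbow_F A (vector [x, y, z]) = psum (\<lambda>k m n. ext0 A (vector [k, m, n])) x y z"
proof -
  let ?g = "\<lambda>(k, m, n). vector [k, m, n] :: nat^3"
  have b: "bij_betw ?g UNIV UNIV"
    by (rule bij_betw_byWitness[of _ "\<lambda>v. (v $ 1, v $ 2, v $ 3)"]) (auto simp: vec_eq_iff forall_3)
  have P3: "(\<Prod>i\<in>UNIV. f i) = f 1 * f 2 * f 3" for f :: "3 \<Rightarrow> real" unfolding UNIV_3 by (simp add: mult_ac)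
  have "rainbow_F A (vector [x, y, z]) = (\<Sum>\<^sub>\<infinity>p\<in>UNIV. A (?g p) * (\<Prod>i\<in>UNIV. (vector [x, y, z] $ i) ^ (?g p $ i)))"
    unfolding rainbow_F_def by (rule infsum_reindex_bij_betw[OF b, symmetric])
  also have "\<dots> = psum (\<lambda>k m n. ext0 A (vector [k, m, n])) x y z"
    unfolding psum_def pterm_def
  proof (rule infsum_cong)
    fix p :: "nat \<times> nat \<times> nat"
    obtain k m n where p: "p = (k, m, n)" by (cases p)
    have "(\<chi> i. nat (vector [int k, int m, int n] $ i)) = (vector [k, m, n] :: nat^3)" by (simp add: vec_eq_iff forall_3)
    then show "A (?g p) * (\<Prod>i\<in>UNIV. (vector [x, y, z] $ i) ^ (?g p $ i))
       = (\<lambda>(k, m, n). ext0 A (vector [int k, int m, int n]) * x ^ k * y ^ m * z ^ n) p"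
      by (simp add: p ext0_def forall_3 P3 mult_ac)
  qed
  finally show ?thesis .
qed

lemma cross_ratio_swap:
  "cross_ratio q1 p1 p2 q2 = cross_ratio p1 q1 p2 q2" "cross_ratio p1 q1 q2 p2 = cross_ratio p1 q1 p2 q2"
  unfolding cross_ratio_def by (simp_all add: min.commute mult.commute)

lemma cross_ratio_commute: "cross_ratio p2 q2 p1 q1 = cross_ratio p1 q1 p2 q2"
  unfolding cross_ratio_def by (simp add: abs_minus_commute mult.commute)

lemma cross_ratio_links:
  assumes "{a, b} = {a', b'}" "{c, d} = {c', d'}"
  shows "cross_ratio (x a) (x b) (x c) (x d) = cross_ratio (x a') (x b') (x c') (x d')"
  using assms by (auto simp: doubleton_eq_iff cross_ratio_swap)

lemma length_links:
  fixes x :: "nat \<Rightarrow> real"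
  assumes "{a, b} = {a', b'}"
  shows "\<bar>x a - x b\<bar> = \<bar>x a' - x b'\<bar>"
  using assms by (auto simp: doubleton_eq_iff abs_minus_commute)

text \<open>The two candidates for the minimum are \<open>c\<close> and
  \<open>1 / c\<close>.\<close>

lemma cross_ratio_crs:
  assumes "crs p1 q1 p2 q2 \<in> {0<..<1}"
  shows "cross_ratio p1 q1 p2 q2 = crs p1 q1 p2 q2"
proof -
  define c where "c = crs p1 q1 p2 q2"
  have c: "0 < c" "c < 1" using assms by (simp_all add: c_def)
  have "(\<bar>p1 - p2\<bar> * \<bar>q1 - q2\<bar>) / (\<bar>p1 - q2\<bar> * \<bar>q1 - p2\<bar>) = \<bar>c\<bar>" by (simp add: c_def crs_def abs_mult)
  then have 1: "(\<bar>p1 - p2\<bar> * \<bar>q1 - q2\<bar>) / (\<bar>p1 - q2\<bar> * \<bar>q1 - p2\<bar>) = c" using c by simp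
  have "(\<bar>p1 - q2\<bar> * \<bar>q1 - p2\<bar>) / (\<bar>p1 - p2\<bar> * \<bar>q1 - q2\<bar>) = 1 / c" unfolding 1[symmetric] by simp
  moreover have "c \<le> 1 / c" using c mult_le_one[of c c] by (simp add: pos_le_divide_eq)
  ultimately show ?thesis unfolding cross_ratio_def 1 c_def[symmetric] by simp
qed

lemma merge_limits:
  fixes x :: "nat \<Rightarrow> real" and j :: nat and \<xi> :: real
  defines "Y \<equiv> (\<lambda>(s, t). x(j := s, j + 1 := t))"
  defines "A \<equiv> at (\<xi>, \<xi>) within {p. Y p \<in> chamber 3}"
  shows "\<forall>\<^sub>F p in A. Y p \<in> chamber 3"
    and "((\<lambda>p. Y p i) \<longlongrightarrow> (if i = j \<or> i = j + 1 then \<xi> else x i)) A"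
proof -
  show "\<forall>\<^sub>F p in A. Y p \<in> chamber 3" by (auto simp: A_def eventually_at_filter)
  have f: "(fst \<longlongrightarrow> \<xi>) A" "(snd \<longlongrightarrow> \<xi>) A"
    using tendsto_fst[OF tendsto_ident_at, of "(\<xi>, \<xi>)"] tendsto_snd[OF tendsto_ident_at, of "(\<xi>, \<xi>)"] by (simp_all add: A_def)
  consider "i = j" | "i = j + 1" | "i \<noteq> j" "i \<noteq> j + 1" by blast
  then show "((\<lambda>p. Y p i) \<longlongrightarrow> (if i = j \<or> i = j + 1 then \<xi> else x i)) A"
  proof cases
    case 1
    then have "(\<lambda>p. Y p i) = fst" by (auto simp: Y_def)
    then show ?thesis using f 1 by simp
  next
    case 2
    then have "(\<lambda>p. Y p i) = snd" by (auto simp: Y_def)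
    then show ?thesis using f 2 by simp
  next
    case 3
    then have "(\<lambda>p. Y p i) = (\<lambda>p. x i)" by (auto simp: Y_def)
    then show ?thesis using 3 by simp
  qed
qed

lemma merge_less:
  assumes y: "x(j := s, j + 1 := t) \<in> chamber N" and j: "j \<in> {1..2*N}" "j + 1 \<in> {1..2*N}"
  shows "s < t"
proof -
  have "(x(j := s, j + 1 := t)) j < (x(j := s, j + 1 := t)) (j + 1)"
    using y j by (simp only: chamber_def mem_Collect_eq)
  then show ?thesis by simp
qed

lemma merge_distinct:
  fixes x :: "nat \<Rightarrow> real"
  assumes o: "\<forall>i\<in>{1..6} - {j, j + 1}. \<forall>k\<in>{1..6} - {j, j + 1}. i < k \<longrightarrow> x i < x k"
    "\<forall>i\<in>{1..<j}. x i < \<xi>" "\<forall>i\<in>{j + 2..6}. \<xi> < x i"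
    and i: "i \<in> {1..6}" "k \<in> {1..6}" "i \<noteq> k" "\<not> {i, k} \<subseteq> {j, j + 1}"
  shows "(if i = j \<or> i = j + 1 then \<xi> else x i) \<noteq> (if k = j \<or> k = j + 1 then \<xi> else x k)"
proof -
  have m: "x m \<noteq> \<xi>" if "m \<in> {1..6} - {j, j + 1}" for m
  proof (cases "m < j")
    case True then show ?thesis using o(2) that by force
  next
    case False
    then have "m \<in> {j + 2..6}" using that by auto
    then show ?thesis using o(3) by force
  qed
  have "x i \<noteq> x k" if "i \<in> {1..6} - {j, j + 1}" "k \<in> {1..6} - {j, j + 1}"
    using o(1) that i(3) by (metis less_irrefl linorder_neqE_nat)
  then show ?thesis using m[of i] m[of k] i by auto
qed

context rainbow
begin

lemma frame_ASY_unlinked: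
  assumes fr: "frame p1 p2 p3 q1 q2 q3"
    and Z: "\<And>x. x \<in> chamber 3 \<Longrightarrow> Z x = c * Wx \<beta> F p1 p2 p3 q1 q2 q3 x"
    and j: "{j, j + 1} = {p1, p2}"
    and o: "\<forall>i\<in>{1..6} - {j, j + 1}. \<forall>k\<in>{1..6} - {j, j + 1}. i < k \<longrightarrow> x i < x k"
      "\<forall>i\<in>{1..<j}. x i < \<xi>" "\<forall>i\<in>{j + 2..6}. \<xi> < x i"
  shows "((\<lambda>(s, t). Z (x(j := s, j + 1 := t)) / (t - s) powr (1 - 3 * \<beta> / 2)) \<longlongrightarrow> 0)
    (at (\<xi>, \<xi>) within {p. (case p of (s, t) \<Rightarrow> x(j := s, j + 1 := t)) \<in> chamber 3})"
proof -
  let ?Y = "\<lambda>(s, t). x(j := s, j + 1 := t)" and ?A = "at (\<xi>, \<xi>) within {p. (case p of (s, t) \<Rightarrow> x(j := s, j + 1 := t)) \<in> chamber 3}"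
  let ?X = "\<lambda>i. if i = j \<or> i = j + 1 then \<xi> else x i"
  note fi = frame_index[OF fr] and d = frame_distinct[OF fr]
  have jp: "(j = p1 \<and> j + 1 = p2) \<or> (j = p2 \<and> j + 1 = p1)" using j by (auto simp: doubleton_eq_iff)
  note ne = merge_distinct[OF o]
  have "((\<lambda>\<omega>. Wx \<beta> F p1 p2 p3 q1 q2 q3 (?Y \<omega>) / \<bar>?Y \<omega> p1 - ?Y \<omega> p2\<bar> powr (1 - 3 * \<beta> / 2)) \<longlongrightarrow> 0) ?A"
  proof (rule Wx_unlinked_limit[OF fr merge_limits])
    show "?X p1 = ?X p2" using jp by auto
    show "?X p1 \<noteq> ?X q1" "?X p2 \<noteq> ?X q2" "?X p3 \<noteq> ?X q3" "?X q1 \<noteq> ?X q2"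
      by (rule ne; use fi d jp in auto)+
  qed
  from tendsto_mult_left_zero[OF this, of c]
  show ?thesis
  proof (rule Lim_transform_eventually)
    show "\<forall>\<^sub>F \<omega> in ?A. Wx \<beta> F p1 p2 p3 q1 q2 q3 (?Y \<omega>) / \<bar>?Y \<omega> p1 - ?Y \<omega> p2\<bar> powr (1 - 3 * \<beta> / 2) * c
      = (case \<omega> of (s, t) \<Rightarrow> Z (x(j := s, j + 1 := t)) / (t - s) powr (1 - 3 * \<beta> / 2))"
      using merge_limits(1)
    proof eventually_elim
      case (elim \<omega>)
      obtain s t where w: "\<omega> = (s, t)" by (cases \<omega>)
      have y: "x(j := s, j + 1 := t) \<in> chamber 3" using elim by (simp add: w)
      have "j \<in> {1..6}" "j + 1 \<in> {1..6}" using jp fi by auto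
      then have "s < t" using merge_less[OF y] by simp
      then have "\<bar>(x(j := s, j + 1 := t)) p1 - (x(j := s, j + 1 := t)) p2\<bar> = t - s" using jp by auto
      then show ?case using Z[OF y] by (simp only: w prod.case) simp
    qed
  qed
qed

text \<open>The constant is \<open>1 / (hf 1 * (gf 1)\<^sup>2)\<close> by Gauss' theorem, which
  turns the limit \<open>hf 1 * gf C * gf 1\<close> into the normalised value
  \<open>gf C / gf 1\<close> for two links.\<close>

lemma rainbow_const_eq: "rainbow_const \<beta> * (hf 1 * gf 1) = 1 / gf 1" "rainbow_const \<beta> > 0"
proof -
  have "rainbow_const \<beta> = 1 / hf 1 * (1 / gf 1)\<^sup>2" by (simp add: rainbow_const_def hf_1 gf_1)
  then show "rainbow_const \<beta> * (hf 1 * gf 1) = 1 / gf 1" "rainbow_const \<beta> > 0"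
    using gf_1_pos hf_1_pos by (simp_all add: power2_eq_square)
qed

lemma frame_ASY_linked:
  assumes fr: "frame p1 p2 p3 q1 q2 q3" and k: "\<kappa> = 4 / \<beta>"
    and Z: "\<And>x. x \<in> chamber 3 \<Longrightarrow> Z x = rainbow_const \<beta> * Wx \<beta> F p1 p2 p3 q1 q2 q3 x"
    and j: "{j, j + 1} = {p1, q1}"
    and o: "\<forall>i\<in>{1..6} - {j, j + 1}. \<forall>k\<in>{1..6} - {j, j + 1}. i < k \<longrightarrow> x i < x k"
      "\<forall>i\<in>{1..<j}. x i < \<xi>" "\<forall>i\<in>{j + 2..6}. \<xi> < x i"
    and ab: "remove_link j {{p1, q1}, {p2, q2}, {p3, q3}} = {{a' 1, b' 1}, {a' 2, b' 2}}"
  shows "((\<lambda>(s, t). Z (x(j := s, j + 1 := t)) / (t - s) powr (1 - 3 * \<beta> / 2)) \<longlongrightarrow> pure_Z2 \<kappa> a' b' (remove_points j x))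
    (at (\<xi>, \<xi>) within {p. (case p of (s, t) \<Rightarrow> x(j := s, j + 1 := t)) \<in> chamber 3})"
proof (cases "at (\<xi>, \<xi>) within {p. (case p of (s, t) \<Rightarrow> x(j := s, j + 1 := t)) \<in> chamber 3} = bot")
  \<comment> \<open>A trivial filter satisfies every limit. Otherwise the chamber contains an
    admissible point, which certifies that the cross-ratio of the two remaining links lies in
    \<open>(0, 1)\<close>.\<close>
  case True
  then show ?thesis by simp
next
  case False
  let ?Y = "\<lambda>(s, t). x(j := s, j + 1 := t)" and ?A = "at (\<xi>, \<xi>) within {p. (case p of (s, t) \<Rightarrow> x(j := s, j + 1 := t)) \<in> chamber 3}"
  let ?X = "\<lambda>i. if i = j \<or> i = j + 1 then \<xi> else x i"
  note fi = frame_index[OF fr] and d = frame_distinct[OF fr]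
  have jp: "(j = p1 \<and> j + 1 = q1) \<or> (j = q1 \<and> j + 1 = p1)" using j by (auto simp: doubleton_eq_iff)
  have nj: "p2 \<noteq> j" "p2 \<noteq> j + 1" "q2 \<noteq> j" "q2 \<noteq> j + 1" "p3 \<noteq> j" "p3 \<noteq> j + 1" "q3 \<noteq> j" "q3 \<noteq> j + 1" using jp d by auto
  note ne = merge_distinct[OF o]
  have X: "?X p2 = x p2" "?X q2 = x q2" "?X p3 = x p3" "?X q3 = x q3" using nj by auto
  define C where "C = crs (x p2) (x q2) (x p3) (x q3)"
  obtain s0 t0 where "x(j := s0, j + 1 := t0) \<in> chamber 3"
    using eventually_happens[OF merge_limits(1)[where j = j and x = x and \<xi> = \<xi>]] False by auto
  from frame_crs(2)[OF fr this] have C: "C \<in> {0<..<1}" using nj by (simp add: C_def)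
  define lim where "lim = \<bar>x p2 - x q2\<bar> powr (1 - 3 * \<beta> / 2) * \<bar>x p3 - x q3\<bar> powr (1 - 3 * \<beta> / 2) * C powr (\<beta> / 2)"
  have "((\<lambda>\<omega>. Wx \<beta> F p1 p2 p3 q1 q2 q3 (?Y \<omega>) / \<bar>?Y \<omega> p1 - ?Y \<omega> q1\<bar> powr (1 - 3 * \<beta> / 2)) \<longlongrightarrow>
    \<bar>?X p2 - ?X q2\<bar> powr (1 - 3 * \<beta> / 2) * \<bar>?X p3 - ?X q3\<bar> powr (1 - 3 * \<beta> / 2) * crs (?X p2) (?X q2) (?X p3) (?X q3) powr (\<beta> / 2)
      * (hf 1 * gf (crs (?X p2) (?X q2) (?X p3) (?X q3)) * gf 1)) ?A"
  proof (rule Wx_linked_limit[OF fr merge_limits])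
    show "?X p1 = ?X q1" using jp by auto
    have "?X p1 \<noteq> ?X p2" "?X p1 \<noteq> ?X q2" "?X p1 \<noteq> ?X p3" "?X p1 \<noteq> ?X q3" "?X p2 \<noteq> ?X q2" "?X p2 \<noteq> ?X p3" "?X p2 \<noteq> ?X q3"
      "?X q2 \<noteq> ?X p3" "?X q2 \<noteq> ?X q3" "?X p3 \<noteq> ?X q3"
      by (rule ne; use fi d jp in auto)+
    then show "distinct [?X p1, ?X p2, ?X q2, ?X p3, ?X q3]" by simp
    show "crs (?X p2) (?X q2) (?X p3) (?X q3) \<in> {0<..<1}" using C unfolding X C_def .
  qed
  from tendsto_mult[OF tendsto_const[of "rainbow_const \<beta>"] this[unfolded X, folded C_def, folded lim_def]]
  have main: "((\<lambda>(s, t). Z (x(j := s, j + 1 := t)) / (t - s) powr (1 - 3 * \<beta> / 2)) \<longlongrightarrow> rainbow_const \<beta> * (lim * (hf 1 * gf C * gf 1))) ?A"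
  proof (rule Lim_transform_eventually)
    show "\<forall>\<^sub>F \<omega> in ?A. rainbow_const \<beta> * (Wx \<beta> F p1 p2 p3 q1 q2 q3 (?Y \<omega>) / \<bar>?Y \<omega> p1 - ?Y \<omega> q1\<bar> powr (1 - 3 * \<beta> / 2))
      = (case \<omega> of (s, t) \<Rightarrow> Z (x(j := s, j + 1 := t)) / (t - s) powr (1 - 3 * \<beta> / 2))"
      using merge_limits(1)
    proof eventually_elim
      case (elim \<omega>)
      obtain s t where w: "\<omega> = (s, t)" by (cases \<omega>)
      have y: "x(j := s, j + 1 := t) \<in> chamber 3" using elim by (simp add: w)
      have "j \<in> {1..6}" "j + 1 \<in> {1..6}" using jp fi by auto
      then have "s < t" using merge_less[OF y] by simp
      then have "\<bar>(x(j := s, j + 1 := t)) p1 - (x(j := s, j + 1 := t)) q1\<bar> = t - s" using jp by auto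
      then show ?case using Z[OF y] by (simp only: w prod.case) simp
    qed
  qed
  have "rainbow_const \<beta> * (lim * (hf 1 * gf C * gf 1)) = lim * gf C * (rainbow_const \<beta> * (hf 1 * gf 1))" by (simp only: mult_ac)
  then have val: "rainbow_const \<beta> * (lim * (hf 1 * gf C * gf 1)) = lim * (gf C / gf 1)" unfolding rainbow_const_eq by simp
  let ?red = "\<lambda>i. if i < j then i else i - 2 :: nat"
  have "{{p1, q1}, {p2, q2}, {p3, q3}} - {{j, j + 1}} = {{p2, q2}, {p3, q3}}"
    unfolding j using d by (auto simp: doubleton_eq_iff)
  then have rl: "{{a' 1, b' 1}, {a' 2, b' 2}} = {{?red p2, ?red q2}, {?red p3, ?red q3}}"
    unfolding ab[symmetric] remove_link_def by simp
  \<comment> \<open>Relabelling indices and dropping coordinates cancel on the surviving indices;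
    subtraction on \<open>nat\<close> is harmless since these are at least \<open>j + 2\<close> or
    below \<open>j\<close>.\<close>
  have rp: "remove_points j x (?red i) = x i" if "i \<noteq> j" "i \<noteq> j + 1" for i
  proof (cases "i < j")
    case False
    then have "i - 2 + 2 = i" "\<not> i - 2 < j" using that by arith+
    then show ?thesis using False by (simp add: remove_points_def)
  qed (simp add: remove_points_def)
  have links: "({a' 1, b' 1} = {?red p2, ?red q2} \<and> {a' 2, b' 2} = {?red p3, ?red q3}) \<or> ({a' 1, b' 1} = {?red p3, ?red q3} \<and> {a' 2, b' 2} = {?red p2, ?red q2})"
    using rl by (simp only: doubleton_eq_iff[of "{a' 1, b' 1}"])
  have par: "4 / \<kappa> = \<beta>" "2 / \<kappa> = \<beta> / 2" "- 2 * h_exp \<kappa> = 1 - 3 * \<beta> / 2"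
    using beta by (simp_all add: k h_exp_def field_simps)
  define x' where "x' = remove_points j x"
  have x': "x' (?red p2) = x p2" "x' (?red q2) = x q2" "x' (?red p3) = x p3" "x' (?red q3) = x q3"
    unfolding x'_def by (rule rp; use nj in auto)+
  have cc: "cross_ratio (x p2) (x q2) (x p3) (x q3) = C" using cross_ratio_crs C by (simp add: C_def)
  have prod2: "(\<Prod>j=1..2. f j) = f 1 * f (2 :: nat)" for f :: "nat \<Rightarrow> real" by (simp add: numeral_2_eq_2)
  from links have "pure_Z2 \<kappa> a' b' x' = lim * (gf C / gf 1)"
  proof (elim disjE conjE)
    assume l: "{a' 1, b' 1} = {?red p2, ?red q2}" "{a' 2, b' 2} = {?red p3, ?red q3}"
    have "cross_ratio (x' (a' 1)) (x' (b' 1)) (x' (a' 2)) (x' (b' 2)) = C" unfolding cross_ratio_links[OF l] x' cc ..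
    moreover have "\<bar>x' (a' 1) - x' (b' 1)\<bar> = \<bar>x p2 - x q2\<bar>" unfolding length_links[OF l(1)] x' ..
    moreover have "\<bar>x' (a' 2) - x' (b' 2)\<bar> = \<bar>x p3 - x q3\<bar>" unfolding length_links[OF l(2)] x' ..
    ultimately show ?thesis unfolding pure_Z2_def Let_def par hyp2F1_hfun prod2 lim_def by simp
  next
    assume l: "{a' 1, b' 1} = {?red p3, ?red q3}" "{a' 2, b' 2} = {?red p2, ?red q2}"
    have "cross_ratio (x' (a' 1)) (x' (b' 1)) (x' (a' 2)) (x' (b' 2)) = C"
      unfolding cross_ratio_links[OF l] x' cross_ratio_commute[of "x p3"] cc ..
    moreover have "\<bar>x' (a' 1) - x' (b' 1)\<bar> = \<bar>x p3 - x q3\<bar>" unfolding length_links[OF l(1)] x' ..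
    moreover have "\<bar>x' (a' 2) - x' (b' 2)\<bar> = \<bar>x p2 - x q2\<bar>" unfolding length_links[OF l(2)] x' ..
    ultimately show ?thesis unfolding pure_Z2_def Let_def par hyp2F1_hfun prod2 lim_def by simp
  qed
  then show ?thesis using main unfolding val x'_def by simp
qed


text \<open>By \<open>nb\<close>, neighbouring points are linked or lie on the same side, both among
  the \<open>p\<close> or both among the \<open>q\<close>; in the second case their merging sends a
  cross-ratio to 0. Rotation and exchange bring every case to the first places of a frame.\<close>

lemma frame_ASY:
  assumes fr: "frame p1 p2 p3 q1 q2 q3" and k: "\<kappa> = 4 / \<beta>"
    and Z: "\<And>x. x \<in> chamber 3 \<Longrightarrow> Z x = rainbow_const \<beta> * Wx \<beta> F p1 p2 p3 q1 q2 q3 x"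
    and al: "\<alpha> = {{p1, q1}, {p2, q2}, {p3, q3}}"
    and nb: "\<And>j. j \<in> {1..5} \<Longrightarrow> {j, j + 1} \<in> \<alpha> \<or> {j, j + 1} \<subseteq> {p1, p2, p3} \<or> {j, j + 1} \<subseteq> {q1, q2, q3}"
  shows "ASY3 \<kappa> \<alpha> Z"
  unfolding ASY3_def Let_def prod.case
proof (intro ballI allI impI conjI)
  fix j :: nat and \<xi> :: real and x :: "nat \<Rightarrow> real"
  assume j: "j \<in> {1..5}" and o: "\<forall>i\<in>{1..6} - {j, j + 1}. \<forall>k\<in>{1..6} - {j, j + 1}. i < k \<longrightarrow> x i < x k"
      "\<forall>i\<in>{1..<j}. x i < \<xi>" "\<forall>i\<in>{j + 2..6}. \<xi> < x i"
  have e: "- 2 * h_exp \<kappa> = 1 - 3 * \<beta> / 2" using beta by (simp add: k h_exp_def field_simps)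
  note fr2 = frame_rotate[OF fr] and fr3 = frame_rotate[OF frame_rotate[OF fr]]
  have Wx: "Wx \<beta> F p2 p3 p1 q2 q3 q1 = Wx \<beta> F p1 p2 p3 q1 q2 q3" "Wx \<beta> F p3 p1 p2 q3 q1 q2 = Wx \<beta> F p1 p2 p3 q1 q2 q3"
    "Wx \<beta> F q1 q2 q3 p1 p2 p3 = Wx \<beta> F p1 p2 p3 q1 q2 q3" "Wx \<beta> F q2 q3 q1 p2 p3 p1 = Wx \<beta> F p1 p2 p3 q1 q2 q3"
    "Wx \<beta> F q3 q1 q2 p3 p1 p2 = Wx \<beta> F p1 p2 p3 q1 q2 q3"
    using Wx_rotate Wx_swap by metis+
  have Z': "x \<in> chamber 3 \<Longrightarrow> Z x = rainbow_const \<beta> * Wx \<beta> F p2 p3 p1 q2 q3 q1 x" "x \<in> chamber 3 \<Longrightarrow> Z x = rainbow_const \<beta> * Wx \<beta> F p3 p1 p2 q3 q1 q2 x"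
    "x \<in> chamber 3 \<Longrightarrow> Z x = rainbow_const \<beta> * Wx \<beta> F q1 q2 q3 p1 p2 p3 x" "x \<in> chamber 3 \<Longrightarrow> Z x = rainbow_const \<beta> * Wx \<beta> F q2 q3 q1 p2 p3 p1 x"
    "x \<in> chamber 3 \<Longrightarrow> Z x = rainbow_const \<beta> * Wx \<beta> F q3 q1 q2 p3 p1 p2 x" for x
    unfolding Wx by (rule Z; assumption)+
  let ?A = "at (\<xi>, \<xi>) within {p. (case p of (s, t) \<Rightarrow> x(j := s, j + 1 := t)) \<in> chamber 3}"
  {
    assume "{j, j + 1} \<notin> \<alpha>"
    then have sub: "{j, j + 1} \<subseteq> {p1, p2, p3} \<or> {j, j + 1} \<subseteq> {q1, q2, q3}" using nb[OF j] by blast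
    have two: "{j, j + 1} = {u, v} \<or> {j, j + 1} = {v, w} \<or> {j, j + 1} = {w, u}" if "{j, j + 1} \<subseteq> {u, v, w}" for u v w
      using that by auto
    from sub consider "{j, j + 1} = {p1, p2}" | "{j, j + 1} = {p2, p3}" | "{j, j + 1} = {p3, p1}" | "{j, j + 1} = {q1, q2}" | "{j, j + 1} = {q2, q3}" | "{j, j + 1} = {q3, q1}"
      using two[of p1 p2 p3] two[of q1 q2 q3] by satx
    then show "((\<lambda>(s, t). Z (x(j := s, j + 1 := t)) / (t - s) powr (- 2 * h_exp \<kappa>)) \<longlongrightarrow> 0) ?A"
    proof cases
      case 1 show ?thesis unfolding e by (rule frame_ASY_unlinked[OF fr Z 1 o])
    next
      case 2 show ?thesis unfolding e by (rule frame_ASY_unlinked[OF fr2 Z'(1) 2 o])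
    next
      case 3 show ?thesis unfolding e by (rule frame_ASY_unlinked[OF fr3 Z'(2) 3 o])
    next
      case 4 show ?thesis unfolding e by (rule frame_ASY_unlinked[OF frame_swap[OF fr] Z'(3) 4 o])
    next
      case 5 show ?thesis unfolding e by (rule frame_ASY_unlinked[OF frame_swap[OF fr2] Z'(4) 5 o])
    next
      case 6 show ?thesis unfolding e by (rule frame_ASY_unlinked[OF frame_swap[OF fr3] Z'(5) 6 o])
    qed
  }
  fix a' b' :: "nat \<Rightarrow> nat"
  assume m: "{j, j + 1} \<in> \<alpha>" and ab: "remove_link j \<alpha> = {{a' 1, b' 1}, {a' 2, b' 2}}"
  have al2: "\<alpha> = {{p2, q2}, {p3, q3}, {p1, q1}}" "\<alpha> = {{p3, q3}, {p1, q1}, {p2, q2}}" unfolding al by blast+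
  from m consider "{j, j + 1} = {p1, q1}" | "{j, j + 1} = {p2, q2}" | "{j, j + 1} = {p3, q3}" unfolding al by (elim insertE emptyE)
  then show "((\<lambda>(s, t). Z (x(j := s, j + 1 := t)) / (t - s) powr (- 2 * h_exp \<kappa>)) \<longlongrightarrow> pure_Z2 \<kappa> a' b' (remove_points j x)) ?A"
  proof cases
    case 1 show ?thesis unfolding e by (rule frame_ASY_linked[OF fr k Z 1 o ab[unfolded al]])
  next
    case 2 show ?thesis unfolding e by (rule frame_ASY_linked[OF fr2 k Z'(1) 2 o ab[unfolded al2(1)]])
  next
    case 3 show ?thesis unfolding e by (rule frame_ASY_linked[OF fr3 k Z'(2) 3 o ab[unfolded al2(2)]])
  qed
qed

lemma rainbow_Z_frame:
  assumes fr: "frame p1 p2 p3 q1 q2 q3" and k: "\<kappa> = 4 / \<beta>"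
    and F: "\<And>x y z. rainbow_F A (vector [x, y, z]) = F x y z"
    and l: "{a' 1, b' 1} = {p1, q1}" "{a' 2, b' 2} = {p2, q2}" "{a' 3, b' 3} = {p3, q3}"
    and x: "x \<in> chamber 3"
  shows "rainbow_Z \<kappa> A a' b' x = rainbow_const \<beta> * Wx \<beta> F p1 p2 p3 q1 q2 q3 x"
proof -
  note r = frame_crs[OF fr x]
  have par: "4 / \<kappa> = \<beta>" "2 / \<kappa> = \<beta> / 2" "- 2 * h_exp \<kappa> = 1 - 3 * \<beta> / 2"
    using beta by (simp_all add: k h_exp_def field_simps)
  have c: "cross_ratio (x (a' 1)) (x (b' 1)) (x (a' 2)) (x (b' 2)) = crs (x p1) (x q1) (x p2) (x q2)"
    "cross_ratio (x (a' 2)) (x (b' 2)) (x (a' 3)) (x (b' 3)) = crs (x p2) (x q2) (x p3) (x q3)"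
    "cross_ratio (x (a' 3)) (x (b' 3)) (x (a' 1)) (x (b' 1)) = crs (x p3) (x q3) (x p1) (x q1)"
    unfolding cross_ratio_links[OF l(1,2)] cross_ratio_links[OF l(2,3)] cross_ratio_links[OF l(3,1)] using cross_ratio_crs r by blast+
  have p: "(\<Prod>j=1..3. f j) = f 1 * f 2 * f (3 :: nat)" for f :: "nat \<Rightarrow> real" by (simp add: numeral_3_eq_3 numeral_2_eq_2 mult.assoc)
  show ?thesis
    unfolding rainbow_Z_def Let_def rainbow_H_def p par c F length_links[OF l(1)] length_links[OF l(2)] length_links[OF l(3)] Wx_def Wf_def Lam_def
    by simp
qed

end

lemma chamber3_order:
  assumes "x \<in> chamber 3"
  shows "x 1 < x 2" "x 2 < x 3" "x 3 < x 4" "x 4 < x 5" "x 5 < x 6"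
  using assms unfolding chamber_def by auto

text \<open>In each frame the first link separates the other two, which is the sign condition of
  \<open>crs_Kf\<close>. The ends are named so that all three oriented cross-ratios lie in
  \<open>(0, 1)\<close>.\<close>

lemma rainbow_frames:
  assumes "\<alpha> \<in> rainbow_patterns"
  obtains p1 p2 p3 q1 q2 q3 where "frame p1 p2 p3 q1 q2 q3" "\<alpha> = {{p1, q1}, {p2, q2}, {p3, q3}}"
    "\<And>x. x \<in> chamber 3 \<Longrightarrow> (x p2 - x q1) / (x p2 - x p1) * ((x p3 - x q1) / (x p3 - x p1)) < 0"
    "\<And>j. j \<in> {1..5} \<Longrightarrow> {j, j + 1} \<in> \<alpha> \<or> {j, j + 1} \<subseteq> {p1, p2, p3} \<or> {j, j + 1} \<subseteq> {q1, q2, q3}"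
proof -
  have six: "{1..6::nat} = {1, 2, 3, 4, 5, 6}" by auto
  have five: "j \<in> {1..5} \<Longrightarrow> j = 1 \<or> j = 2 \<or> j = 3 \<or> j = 4 \<or> j = 5" for j :: nat by auto
  have fr1: "frame 2 1 3 5 6 4"
    unfolding frame_def six
  proof (intro conjI ballI)
    show "{2, 1, 3, 5, 6, 4} = {1, 2, 3, 4, 5, 6 :: nat}" by auto
    fix x :: "nat \<Rightarrow> real" assume "x \<in> chamber 3"
    note o = chamber3_order[OF this]
    show "crs (x 2) (x 5) (x 1) (x 6) \<in> {0<..<1}"
      by (rule crs_unit) (use o in \<open>auto simp: zero_less_divide_iff zero_less_mult_iff mult_less_0_iff\<close>)
    show "crs (x 1) (x 6) (x 3) (x 4) \<in> {0<..<1}"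
      by (rule crs_unit) (use o in \<open>auto simp: zero_less_divide_iff zero_less_mult_iff mult_less_0_iff\<close>)
    show "crs (x 3) (x 4) (x 2) (x 5) \<in> {0<..<1}"
      by (rule crs_unit) (use o in \<open>auto simp: zero_less_divide_iff zero_less_mult_iff mult_less_0_iff\<close>)
  qed
  have fr2: "frame 1 2 6 4 3 5"
    unfolding frame_def six
  proof (intro conjI ballI)
    show "{1, 2, 6, 4, 3, 5} = {1, 2, 3, 4, 5, 6 :: nat}" by auto
    fix x :: "nat \<Rightarrow> real" assume "x \<in> chamber 3"
    note o = chamber3_order[OF this]
    show "crs (x 1) (x 4) (x 2) (x 3) \<in> {0<..<1}"
      by (rule crs_unit) (use o in \<open>auto simp: zero_less_divide_iff zero_less_mult_iff mult_less_0_iff\<close>)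
    show "crs (x 2) (x 3) (x 6) (x 5) \<in> {0<..<1}"
      by (rule crs_unit) (use o in \<open>auto simp: zero_less_divide_iff zero_less_mult_iff mult_less_0_iff\<close>)
    show "crs (x 6) (x 5) (x 1) (x 4) \<in> {0<..<1}"
      by (rule crs_unit) (use o in \<open>auto simp: zero_less_divide_iff zero_less_mult_iff mult_less_0_iff\<close>)
  qed
  have fr3: "frame 3 2 4 6 1 5"
    unfolding frame_def six
  proof (intro conjI ballI)
    show "{3, 2, 4, 6, 1, 5} = {1, 2, 3, 4, 5, 6 :: nat}" by auto
    fix x :: "nat \<Rightarrow> real" assume "x \<in> chamber 3"
    note o = chamber3_order[OF this]
    show "crs (x 3) (x 6) (x 2) (x 1) \<in> {0<..<1}"
      by (rule crs_unit) (use o in \<open>auto simp: zero_less_divide_iff zero_less_mult_iff mult_less_0_iff\<close>)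
    show "crs (x 2) (x 1) (x 4) (x 5) \<in> {0<..<1}"
      by (rule crs_unit) (use o in \<open>auto simp: zero_less_divide_iff zero_less_mult_iff mult_less_0_iff\<close>)
    show "crs (x 4) (x 5) (x 3) (x 6) \<in> {0<..<1}"
      by (rule crs_unit) (use o in \<open>auto simp: zero_less_divide_iff zero_less_mult_iff mult_less_0_iff\<close>)
  qed
  have sg: "(x 1 - x 5) / (x 1 - x 2) * ((x 3 - x 5) / (x 3 - x 2)) < 0" "(x 2 - x 4) / (x 2 - x 1) * ((x 6 - x 4) / (x 6 - x 1)) < 0"
    "(x 2 - x 6) / (x 2 - x 3) * ((x 4 - x 6) / (x 4 - x 3)) < 0" if "x \<in> chamber 3" for x
    using chamber3_order[OF that] by (auto simp: mult_less_0_iff zero_less_mult_iff zero_less_divide_iff divide_less_0_iff)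
  from assms consider "\<alpha> = {{1, 6}, {2, 5}, {3, 4}}" | "\<alpha> = {{1, 4}, {2, 3}, {5, 6}}" | "\<alpha> = {{1, 2}, {3, 6}, {4, 5}}"
    unfolding rainbow_patterns_def by (elim insertE emptyE)
  then show ?thesis
  proof cases
    case 1
    have "\<alpha> = {{2, 5}, {1, 6}, {3, 4}}" unfolding 1 by (rule insert_commute)
    moreover have "{j, j + 1} \<in> \<alpha> \<or> {j, j + 1} \<subseteq> {2, 1, 3} \<or> {j, j + 1} \<subseteq> {5, 6, 4}" if "j \<in> {1..5}" for j
      using five[OF that] unfolding 1 by (elim disjE) simp_all
    ultimately show ?thesis using that[OF fr1 _ sg(1)] by metis
  next
    case 2
    have "\<alpha> = {{1, 4}, {2, 3}, {6, 5}}" unfolding 2 by (simp add: insert_commute[of 5])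
    moreover have "{j, j + 1} \<in> \<alpha> \<or> {j, j + 1} \<subseteq> {1, 2, 6} \<or> {j, j + 1} \<subseteq> {4, 3, 5}" if "j \<in> {1..5}" for j
      using five[OF that] unfolding 2 by (elim disjE) simp_all
    ultimately show ?thesis using that[OF fr2 _ sg(2)] by metis
  next
    case 3
    have "\<alpha> = {{3, 6}, {2, 1}, {4, 5}}" unfolding 3 by (simp only: insert_commute[of 1 2] insert_commute[of "{2, 1}"])
    moreover have "{j, j + 1} \<in> \<alpha> \<or> {j, j + 1} \<subseteq> {3, 2, 4} \<or> {j, j + 1} \<subseteq> {6, 1, 5}" if "j \<in> {1..5}" for j
      using five[OF that] unfolding 3 by (elim disjE) (simp_all add: numeral_2_eq_2)
    ultimately show ?thesis using that[OF fr3 _ sg(3)] by metis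
  qed
qed

text \<open>The labelling of the links is arbitrary; these six cases are absorbed by the symmetry of
  \<open>Wx\<close> under permuting the links.\<close>

lemma three_set_eq:
  assumes "{A, B, C} = {D, E, G}" "D \<noteq> E" "D \<noteq> G" "E \<noteq> G"
  shows "(A = D \<and> B = E \<and> C = G) \<or> (A = E \<and> B = G \<and> C = D) \<or> (A = G \<and> B = D \<and> C = E)
    \<or> (A = E \<and> B = D \<and> C = G) \<or> (A = D \<and> B = G \<and> C = E) \<or> (A = G \<and> B = E \<and> C = D)"
proof -
  have "A \<in> {D, E, G}" "B \<in> {D, E, G}" "C \<in> {D, E, G}" "D \<in> {A, B, C}" "E \<in> {A, B, C}" "G \<in> {A, B, C}" using assms(1) by blast+
  then show ?thesis using assms(2-4) by auto
qed

theorem corollary5p4: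
  fixes \<beta> \<kappa> :: real and A B :: "nat^3 \<Rightarrow> real"
    and \<alpha> :: "nat set set" and a b :: "nat \<Rightarrow> nat"
  assumes "\<beta> > 1/2" and "\<kappa> = 4 / \<beta>"
    and "rainbow_arrays \<beta> A B"
    and "\<alpha> \<in> link_patterns 3" and "\<alpha> \<in> rainbow_patterns"
    and "\<alpha> = {{a 1, b 1}, {a 2, b 2}, {a 3, b 3}}"
  shows "(\<forall>x\<in>chamber 3. rainbow_Z \<kappa> A a b x > 0)
    \<and> PDE \<kappa> 3 (rainbow_Z \<kappa> A a b)
    \<and> COV \<kappa> 3 (rainbow_Z \<kappa> A a b)
    \<and> ASY3 \<kappa> \<alpha> (rainbow_Z \<kappa> A a b)
    \<and> pure_partition_function3 \<kappa> \<alpha> (rainbow_Z \<kappa> A a b)"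
proof -
  interpret rainbow \<beta> "\<lambda>k m n. ext0 A (vector [k, m, n])" "\<lambda>k m n. ext0 B (vector [k, m, n])"
    by (rule rainbow_arrays_locale[OF assms(1,3)])
  let ?Z = "rainbow_Z \<kappa> A a b"
  obtain p1 p2 p3 q1 q2 q3 where fr: "frame p1 p2 p3 q1 q2 q3" and al: "\<alpha> = {{p1, q1}, {p2, q2}, {p3, q3}}"
    and sg: "\<And>x. x \<in> chamber 3 \<Longrightarrow> (x p2 - x q1) / (x p2 - x p1) * ((x p3 - x q1) / (x p3 - x p1)) < 0"
    and nb: "\<And>j. j \<in> {1..5} \<Longrightarrow> {j, j + 1} \<in> \<alpha> \<or> {j, j + 1} \<subseteq> {p1, p2, p3} \<or> {j, j + 1} \<subseteq> {q1, q2, q3}"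
    using rainbow_frames[OF assms(5)] by blast
  note d = frame_distinct[OF fr]
  have Z: "?Z x = rainbow_const \<beta> * Wx \<beta> F p1 p2 p3 q1 q2 q3 x" if x: "x \<in> chamber 3" for x
  proof -
    note z = rainbow_Z_frame[OF _ assms(2) rainbow_F_psum _ _ _ x, of _ _ _ _ _ _ a b]
    note fr2 = frame_rotate[OF fr] and fr3 = frame_rotate[OF frame_rotate[OF fr]]
    have w: "Wx \<beta> F p2 p3 p1 q2 q3 q1 x = Wx \<beta> F p1 p2 p3 q1 q2 q3 x" "Wx \<beta> F p3 p1 p2 q3 q1 q2 x = Wx \<beta> F p1 p2 p3 q1 q2 q3 x"
      "Wx \<beta> F p2 p1 p3 q2 q1 q3 x = Wx \<beta> F p1 p2 p3 q1 q2 q3 x" "Wx \<beta> F p1 p3 p2 q1 q3 q2 x = Wx \<beta> F p1 p2 p3 q1 q2 q3 x"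
      "Wx \<beta> F p3 p2 p1 q3 q2 q1 x = Wx \<beta> F p1 p2 p3 q1 q2 q3 x"
      using Wx_rotate Wx_transpose by metis+
    have "{p1, q1} \<noteq> {p2, q2}" "{p1, q1} \<noteq> {p3, q3}" "{p2, q2} \<noteq> {p3, q3}" using d by (auto simp: doubleton_eq_iff)
    from three_set_eq[OF assms(6)[unfolded al, symmetric] this] show ?thesis
      using z[OF fr] z[OF fr2] z[OF fr3] z[OF frame_transpose[OF fr]] z[OF frame_transpose[OF fr3]] z[OF frame_transpose[OF fr2]]
      unfolding w by metis
  qed
  have pos: "\<forall>x\<in>chamber 3. ?Z x > 0"
  proof
    fix x :: "nat \<Rightarrow> real" assume x: "x \<in> chamber 3"
    note r = frame_crs[OF fr x]
    show "?Z x > 0"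
      unfolding Z[OF x] Wx_def Wf_def by (intro mult_pos_pos rainbow_const_eq Lam_pos F_pos r sg x)
  qed
  have P: "PDE \<kappa> 3 ?Z" by (rule frame_PDE[OF fr assms(2) Z])
  have C: "COV \<kappa> 3 ?Z" by (rule frame_COV[OF fr assms(2) Z])
  have S: "ASY3 \<kappa> \<alpha> ?Z" by (rule frame_ASY[OF fr assms(2) Z al nb])
  show ?thesis using pos P C S by (simp add: pure_partition_function3_def)
qed

end
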